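(* Let $k$ be a perfect field, and let $R$, $R'$, $\bar R$, $I$ be as defined in the context. Equip $R'\otimes_{\mathbb{Z}}\bar R\oplus I$ with the ring structure described in the context, for which $(a\otimes b)w=\dim(a)\dim(b)\,w$ for all $a\in R'$, $b\in\bar R$, $w\in I$. Then the $\mathbb{Z}$-linear map \[ \phi: R'\otimes_{\mathbb{Z}}\bar R\oplus I\rightarrow R,\qquad \phi(a\otimes b+w)=ab+w, \] is a ring isomorphism.
   Context: The polynomial algebra $k[x]$ is a bialgebra with comultiplication $x\mapsto x\otimes x$; thus for finite-dimensional $k[x]$-modules $V,W$ the tensor product $V\otimes W=V\otimes_k W$ is a $k[x]$-module with $x(v\otimes w)=xv\otimes xw$. The representation ring $R$ of $k[x]$ is the free abelian group on the isomorphism classes $[V]$ of indecomposable finite-dimensional $k[x]$-modules, with multiplication $[V][W]=\sum_{i\in I_0}[U_i]$, where $V\otimes W\cong\bigoplus_{i\in I_0}U_i$ is the decomposition into indecomposables. For any finite-dimensional module $V$, $[V]$ denotes the sum of the classes of its indecomposable summands. $R$ is commutative with identity $[k[x]/(x-1)]$. The ring morphism $\dim:R\to\mathbb{Z}$ is given by $\dim([V])=\dim_k V$. $R'$ is the $\mathbb{Z}$-span in $R$ of all $[k[x]/(x-1)^s]$, $s\ge1$. $\bar R$ is the $\mathbb{Z}$-span in $R$ of all $[k[x]/f(x)]$ with $f(x)\in k[x]$ irreducible and $f(0)\neq0$. Both are subrings of $R$. $I$ is the $\mathbb{Z}$-span in $R$ of all $[k[x]/x^s]$, $s\ge1$; it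 is an ideal of $R$. The (commutative) ring structure on $R'\otimes_{\mathbb{Z}}\bar R\oplus I$ is given as follows: $R'\otimes_{\mathbb{Z}}\bar R$ has its usual tensor product ring structure, elements of $I$ are multiplied as in $R$, and products of elements of $R'\otimes_{\mathbb{Z}}\bar R$ with elements of $I$ are determined by $(a\otimes b)w=\dim(a)\dim(b)w$. *)

theory Defs
  imports
    "HOL-Computational_Algebra.Computational_Algebra"
    "HOL-Library.Poly_Mapping"
    "HOL-Algebra.Algebraic_Closure_Type"
    "HOL-Algebra.Algebra"
begin

definition perfect_field :: "'k::field itself \<Rightarrow> bool" where
  "perfect_field (_ :: 'k itself) \<longleftrightarrow>
     CHAR('k) = 0 \<or> surj (\<lambda>a::'k. a ^ CHAR('k))"


section \<open>Modules\<close>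

text \<open>Scalars form a type \<^typ>\<open>'r\<close>, seen as the ring record \<^const>\<open>ring_of_type_algebra\<close>.
  In a module record only the carrier, addition, zero and scalar multiplication matter;
  the fields \<^const>\<open>monoid.mult\<close> and \<^const>\<open>one\<close> are meaningful only for algebras.\<close>

abbreviation is_module :: "('r::comm_ring_1, 'v, 'm) module_scheme \<Rightarrow> bool" where
  "is_module M \<equiv> Module.module (ring_of_type_algebra :: 'r ring) M"

abbreviation is_submodule :: "'v set \<Rightarrow> ('r::comm_ring_1, 'v, 'm) module_scheme \<Rightarrow> bool" where
  "is_submodule N M \<equiv> submodule N (ring_of_type_algebra :: 'r ring) M"

definition module_iso ::
    "('r, 'v, 'm) module_scheme \<Rightarrow> ('r, 'w, 'n) module_scheme \<Rightarrow> bool" where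
  "module_iso M N \<longleftrightarrow>
     (\<exists>h \<in> iso (add_monoid M) (add_monoid N).
        \<forall>r. \<forall>v \<in> carrier M. h (r \<odot>\<^bsub>M\<^esub> v) = r \<odot>\<^bsub>N\<^esub> h v)"

definition quotient_module ::
    "('r, 'v, 'm) module_scheme \<Rightarrow> 'v set \<Rightarrow> ('r, 'v set) module" where
  "quotient_module M N =
     ring.extend (M Quot N) (module.fields (\<lambda>r C. \<Union>c\<in>C. N +>\<^bsub>M\<^esub> (r \<odot>\<^bsub>M\<^esub> c)))"

definition indecomposable :: "('r::comm_ring_1, 'v, 'm) module_scheme \<Rightarrow> bool" where
  "indecomposable M \<longleftrightarrow>
     carrier M \<noteq> {\<zero>\<^bsub>M\<^esub>} \<and>
     (\<forall>N N'. is_submodule N M \<and> is_submodule N' M \<and>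
             carrier M = N <+>\<^bsub>M\<^esub> N' \<and> N \<inter> N' = {\<zero>\<^bsub>M\<^esub>} \<longrightarrow>
             N = {\<zero>\<^bsub>M\<^esub>} \<or> N' = {\<zero>\<^bsub>M\<^esub>})"

definition indecomposable_decomposition ::
    "('r::comm_ring_1, 'v, 'm) module_scheme \<Rightarrow> nat \<Rightarrow> (nat \<Rightarrow> 'v set) \<Rightarrow> bool" where
  "indecomposable_decomposition M n U \<longleftrightarrow>
     (\<forall>i<n. is_submodule (U i) M \<and> indecomposable (M\<lparr>carrier := U i\<rparr>)) \<and>
     (\<forall>v \<in> carrier M. \<exists>!u. u \<in> PiE {..<n} U \<and> v = finsum M u {..<n})"


section \<open>Tensor products over a commutative ring\<close>

text \<open>The free module on \<open>carrier V \<times> carrier W\<close>; its product extends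
  \<open>(v, w) (v', w') = (v v', w w')\<close>, which is of interest when \<open>V\<close> and \<open>W\<close> are algebras.\<close>

definition free_on_product ::
    "('r::comm_ring_1, 'v, 'm) module_scheme \<Rightarrow> ('r, 'w, 'n) module_scheme \<Rightarrow>
     ('r, ('v \<times> 'w) \<Rightarrow>\<^sub>0 'r) module" where
  "free_on_product V W =
     \<lparr>carrier = {c. Poly_Mapping.keys c \<subseteq> carrier V \<times> carrier W},
      monoid.mult = (\<lambda>c d. \<Sum>p\<in>Poly_Mapping.keys c. \<Sum>q\<in>Poly_Mapping.keys d.
        Poly_Mapping.single (fst p \<otimes>\<^bsub>V\<^esub> fst q, snd p \<otimes>\<^bsub>W\<^esub> snd q)
          (Poly_Mapping.lookup c p * Poly_Mapping.lookup d q)),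
      one = Poly_Mapping.single (\<one>\<^bsub>V\<^esub>, \<one>\<^bsub>W\<^esub>) 1,
      ring.zero = 0,
      add = (+),
      module.smult = (\<lambda>r. Poly_Mapping.map ((*) r))\<rparr>"

definition bilinear_relations ::
    "('r::comm_ring_1, 'v, 'm) module_scheme \<Rightarrow> ('r, 'w, 'n) module_scheme \<Rightarrow>
     (('v \<times> 'w) \<Rightarrow>\<^sub>0 'r) set" where
  "bilinear_relations V W =
     {Poly_Mapping.single (v \<oplus>\<^bsub>V\<^esub> v', w) 1 - Poly_Mapping.single (v, w) 1
        - Poly_Mapping.single (v', w) 1
      | v v' w. v \<in> carrier V \<and> v' \<in> carrier V \<and> w \<in> carrier W}
   \<union> {Poly_Mapping.single (v, w \<oplus>\<^bsub>W\<^esub> w') 1 - Poly_Mapping.single (v, w) 1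
        - Poly_Mapping.single (v, w') 1
      | v w w'. v \<in> carrier V \<and> w \<in> carrier W \<and> w' \<in> carrier W}
   \<union> {Poly_Mapping.single (r \<odot>\<^bsub>V\<^esub> v, w) 1 - Poly_Mapping.single (v, w) r
      | r v w. v \<in> carrier V \<and> w \<in> carrier W}
   \<union> {Poly_Mapping.single (v, r \<odot>\<^bsub>W\<^esub> w) 1 - Poly_Mapping.single (v, w) r
      | r v w. v \<in> carrier V \<and> w \<in> carrier W}"

definition tensor_kernel ::
    "('r::comm_ring_1, 'v, 'm) module_scheme \<Rightarrow> ('r, 'w, 'n) module_scheme \<Rightarrow>
     (('v \<times> 'w) \<Rightarrow>\<^sub>0 'r) set" where
  "tensor_kernel V W =
     (\<lambda>N. is_submodule N (free_on_product V W)) hull bilinear_relations V W"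

definition tensor_product ::
    "('r::comm_ring_1, 'v, 'm) module_scheme \<Rightarrow> ('r, 'w, 'n) module_scheme \<Rightarrow>
     ('r, (('v \<times> 'w) \<Rightarrow>\<^sub>0 'r) set) module" where
  "tensor_product V W = quotient_module (free_on_product V W) (tensor_kernel V W)"

definition pure_tensor ::
    "('r::comm_ring_1, 'v, 'm) module_scheme \<Rightarrow> ('r, 'w, 'n) module_scheme \<Rightarrow>
     'v \<Rightarrow> 'w \<Rightarrow> (('v \<times> 'w) \<Rightarrow>\<^sub>0 'r) set" where
  "pure_tensor V W v w =
     tensor_kernel V W +>\<^bsub>free_on_product V W\<^esub> Poly_Mapping.single (v, w) 1"


section \<open>Finite-dimensional modules over \<open>k[x]\<close>\<close>

definition restrict_to_field ::
    "('k::field poly, 'v, 'm) module_scheme \<Rightarrow> ('k, 'v) module" where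
  "restrict_to_field M =
     ring.extend (ring.truncate M) (module.fields (\<lambda>a v. [:a:] \<odot>\<^bsub>M\<^esub> v))"

definition finite_basis :: "('k::field, 'v, 'm) module_scheme \<Rightarrow> 'v set \<Rightarrow> bool" where
  "finite_basis V B \<longleftrightarrow>
     finite B \<and> B \<subseteq> carrier V \<and>
     (\<forall>v \<in> carrier V. \<exists>!a. a \<in> extensional B \<and> v = (\<Oplus>\<^bsub>V\<^esub>b\<in>B. a b \<odot>\<^bsub>V\<^esub> b))"

definition fd_module :: "('k::field poly, 'v, 'm) module_scheme \<Rightarrow> bool" where
  "fd_module M \<longleftrightarrow> is_module M \<and> (\<exists>B. finite_basis (restrict_to_field M) B)"

definition dim_over_field :: "('k::field poly, 'v, 'm) module_scheme \<Rightarrow> nat" where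
  "dim_over_field M = (THE n. \<exists>B. finite_basis (restrict_to_field M) B \<and> card B = n)"

definition poly_module :: "('k::field poly, 'k poly) module" where
  "poly_module = ring.extend ring_of_type_algebra (module.fields (*))"

definition cyclic_module :: "'k::field poly \<Rightarrow> ('k poly, 'k poly set) module" where
  "cyclic_module f = quotient_module poly_module (PIdl\<^bsub>ring_of_type_algebra\<^esub> f)"

definition tensor_shift ::
    "('k::field poly, 'v, 'm) module_scheme \<Rightarrow> ('k poly, 'w, 'n) module_scheme \<Rightarrow>
     (('v \<times> 'w) \<Rightarrow>\<^sub>0 'k) set \<Rightarrow> (('v \<times> 'w) \<Rightarrow>\<^sub>0 'k) set" where
  "tensor_shift V W C =
     (\<Union>c\<in>C. tensor_kernel (restrict_to_field V) (restrict_to_field W)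
        +>\<^bsub>free_on_product (restrict_to_field V) (restrict_to_field W)\<^esub>
        (\<Sum>p\<in>Poly_Mapping.keys c.
           Poly_Mapping.single ([:0, 1:] \<odot>\<^bsub>V\<^esub> fst p, [:0, 1:] \<odot>\<^bsub>W\<^esub> snd p)
             (Poly_Mapping.lookup c p)))"

text \<open>\<^const>\<open>tensor_shift\<close> is the \<open>k\<close>-linear map \<open>v \<otimes> w \<mapsto> x v \<otimes> x w\<close> on
  \<open>V \<otimes>\<^sub>k W\<close>; a polynomial acts by being evaluated at it.\<close>

definition kx_tensor ::
    "('k::field poly, 'v, 'm) module_scheme \<Rightarrow> ('k poly, 'w, 'n) module_scheme \<Rightarrow>
     ('k poly, (('v \<times> 'w) \<Rightarrow>\<^sub>0 'k) set) module" where
  "kx_tensor V W =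
     (let T = tensor_product (restrict_to_field V) (restrict_to_field W)
      in ring.extend (ring.truncate T) (module.fields (\<lambda>f C.
           \<Oplus>\<^bsub>T\<^esub>i\<in>{..Polynomial.degree f}.
             Polynomial.coeff f i \<odot>\<^bsub>T\<^esub> (tensor_shift V W ^^ i) C)))"


section \<open>The representation ring\<close>

text \<open>Isomorphism classes are taken among modules with elements in \<^typ>\<open>'k list\<close>. This type
  contains a copy of \<open>k\<^sup>n\<close> for every \<open>n\<close>, so every finite-dimensional module, whatever the type
  of its elements, is isomorphic to such a module.\<close>

type_synonym 'k kx_class = "('k poly, 'k list) module set"

definition iso_class :: "('k::field poly, 'v, 'm) module_scheme \<Rightarrow> 'k kx_class" where
  "iso_class M = {N. fd_module N \<and> module_iso M N}"

definition indecomposable_classes :: "'k::field kx_class set" where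
  "indecomposable_classes =
     iso_class ` {M :: ('k poly, 'k list) module. fd_module M \<and> indecomposable M}"

definition representative :: "'k::field kx_class \<Rightarrow> ('k poly, 'k list) module" where
  "representative C = (SOME M. M \<in> C)"

text \<open>The element \<open>[V]\<close> of the representation ring, for any finite-dimensional \<open>V\<close>.\<close>

definition rep_class ::
    "('k::field poly, 'v, 'm) module_scheme \<Rightarrow> 'k kx_class \<Rightarrow>\<^sub>0 int" where
  "rep_class V =
     (THE r. \<exists>n U. indecomposable_decomposition V n U \<and>
        r = (\<Sum>i<n. frag_of (iso_class (V\<lparr>carrier := U i\<rparr>))))"

definition rep_ring :: "'k::field itself \<Rightarrow> (int, 'k kx_class \<Rightarrow>\<^sub>0 int) module" where
  "rep_ring (_ :: 'k itself) =
     \<lparr>carrier = {c. Poly_Mapping.keys c \<subseteq> (indecomposable_classes :: 'k kx_class set)},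
      monoid.mult = (\<lambda>c d. frag_extend (\<lambda>C. frag_extend (\<lambda>D.
        rep_class (kx_tensor (representative C) (representative D))) d) c),
      one = rep_class (cyclic_module [:-1, 1:]),
      ring.zero = 0,
      add = (+),
      module.smult = frag_cmul\<rparr>"

definition rep_dim :: "('k::field kx_class \<Rightarrow>\<^sub>0 int) \<Rightarrow> int" where
  "rep_dim c = (\<Sum>C\<in>Poly_Mapping.keys c.
     Poly_Mapping.lookup c C * int (dim_over_field (representative C)))"

definition int_span ::
    "'k::field itself \<Rightarrow> ('k kx_class \<Rightarrow>\<^sub>0 int) set \<Rightarrow> ('k kx_class \<Rightarrow>\<^sub>0 int) set" where
  "int_span k S = generate (add_monoid (rep_ring k)) S"

definition unipotent_ring :: "'k::field itself \<Rightarrow> (int, 'k kx_class \<Rightarrow>\<^sub>0 int) module" where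
  "unipotent_ring k = (rep_ring k)\<lparr>carrier :=
     int_span k {rep_class (cyclic_module ([:-1, 1:] ^ s)) | s. s \<ge> 1}\<rparr>"

definition semisimple_ring :: "'k::field itself \<Rightarrow> (int, 'k kx_class \<Rightarrow>\<^sub>0 int) module" where
  "semisimple_ring k = (rep_ring k)\<lparr>carrier :=
     int_span k {rep_class (cyclic_module f) | f.
       Factorial_Ring.irreducible f \<and> poly f 0 \<noteq> 0}\<rparr>"

definition nilpotent_ideal :: "'k::field itself \<Rightarrow> ('k kx_class \<Rightarrow>\<^sub>0 int) set" where
  "nilpotent_ideal k = int_span k {rep_class (cyclic_module ([:0, 1:] ^ s)) | s. s \<ge> 1}"


section \<open>The direct sum ring and the comparison map\<close>

text \<open>Additive maps out of a tensor product are given on a coset of the free abelian group by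
  their common value on its elements.\<close>

type_synonym 'k rep_tensor =
  "((('k kx_class \<Rightarrow>\<^sub>0 int) \<times> ('k kx_class \<Rightarrow>\<^sub>0 int)) \<Rightarrow>\<^sub>0 int) set"

abbreviation unip_ss_tensor :: "'k::field itself \<Rightarrow> (int, 'k rep_tensor) module" where
  "unip_ss_tensor k \<equiv> tensor_product (unipotent_ring k) (semisimple_ring k)"

definition tensor_dim :: "'k::field rep_tensor \<Rightarrow> int" where
  "tensor_dim C = the_elem ((\<lambda>c. \<Sum>p\<in>Poly_Mapping.keys c.
     Poly_Mapping.lookup c p * (rep_dim (fst p) * rep_dim (snd p))) ` C)"

definition split_ring ::
    "'k::field itself \<Rightarrow> ('k rep_tensor \<times> ('k kx_class \<Rightarrow>\<^sub>0 int)) ring" where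
  "split_ring k =
     \<lparr>carrier = carrier (unip_ss_tensor k) \<times> nilpotent_ideal k,
      monoid.mult = (\<lambda>(t, w) (t', w').
        (t \<otimes>\<^bsub>unip_ss_tensor k\<^esub> t',
         frag_cmul (tensor_dim t) w' + frag_cmul (tensor_dim t') w + w \<otimes>\<^bsub>rep_ring k\<^esub> w')),
      one = (\<one>\<^bsub>unip_ss_tensor k\<^esub>, 0),
      ring.zero = (\<zero>\<^bsub>unip_ss_tensor k\<^esub>, 0),
      add = (\<lambda>(t, w) (t', w'). (t \<oplus>\<^bsub>unip_ss_tensor k\<^esub> t', w + w'))\<rparr>"

definition phi ::
    "'k::field itself \<Rightarrow> 'k rep_tensor \<times> ('k kx_class \<Rightarrow>\<^sub>0 int) \<Rightarrow> 'k kx_class \<Rightarrow>\<^sub>0 int" where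
  "phi k = (\<lambda>(t, w).
     the_elem (frag_extend (\<lambda>(a, b). a \<otimes>\<^bsub>rep_ring k\<^esub> b) ` t) + w)"

end

theory Submission
  imports Defs "HOL-Library.Function_Algebras"
begin

text \<open>By the Krull-Schmidt theorem the representation ring is free on the classes of the modules
  \<open>k[x]/p\<^sup>s\<close> with \<open>p\<close> monic and irreducible, so additively it splits into the part with \<open>p \<noteq> x\<close> and the
  part with \<open>p = x\<close>. In coordinates a tensor product of modules is a Kronecker product of matrices.
  The main point is \<open>k[x]/(x-1)\<^sup>s \<otimes> k[x]/f \<cong> k[x]/f\<^sup>s\<close> for irreducible \<open>f \<noteq> x\<close>: writing \<open>x = (1 + n) \<otimes> z\<close>, a
  Taylor expansion shows that \<open>f(x)\<close> is an invertible multiple of \<open>n\<close> up to higher powers of \<open>n\<close>, because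
  \<open>f\<close> is separable. Hence the products of the basis elements of \<open>R'\<close> and of the semisimple subring are
  exactly the basis elements with \<open>p \<noteq> x\<close>. The semisimple subring is closed under multiplication because
  over an algebraic closure both factors, and therefore their Kronecker product, become diagonalisable.
  Finally, if \<open>x\<close> acts invertibly on \<open>W\<close>, then \<open>e\<^sub>i \<otimes> w \<mapsto> e\<^sub>i \<otimes> x\<^sup>-\<^sup>i w\<close> identifies \<open>k[x]/x\<^sup>s \<otimes> W\<close> with a sum of
  \<open>dim W\<close> copies of \<open>k[x]/x\<^sup>s\<close>.\<close>


section \<open>Polynomials over a field\<close>

text \<open>Modules, cyclic modules and tensor products are records on varying carrier types, and
  quotients consist of cosets. Each is therefore compared with a submodule of a fixed type by a
  structure-preserving bijection (\<open>kx_rec\<close>), usually with \<open>k^I\<close> on which x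
  acts through a matrix. For a quotient the comparison needs the exact kernel of a map out of a free
  module. For both tensor products this kernel is found in one way: modulo the bilinear relations a
  formal sum reduces to tensors of basis elements, and these have linearly independent images. Over
  the integers this is already the injectivity of \<open>phi\<close> on the tensor part. Uniqueness
  in the Krull-Schmidt theorem comes from counting: the dimension of the p-torsion in
  \<open>p^j V\<close> is the degree of p times the number of summands \<open>k[x]/p^s\<close> with
  s > j. Perfectness enters through one fact: an irreducible f does not divide its derivative. This
  makes f' invertible modulo f in the Taylor expansion, and the roots of f distinct in the algebraic
  closure. The ring axioms of the direct sum are pulled back along the bijection
  \<open>phi\<close>.\<close>

lemma poly_ideal_principal:
  fixes S :: "'k::field poly set"
  assumes "0 \<in> S" and "\<And>a b. a \<in> S \<Longrightarrow> b \<in> S \<Longrightarrow> a - b \<in> S" and "\<And>a r. a \<in> S \<Longrightarrow> r * a \<in> S"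
  obtains g where "S = {r. g dvd r}"
proof (cases "S = {0}")
  case True
  then show ?thesis using that[of 0] by auto
next
  case False
  then have ex: "\<exists>n g. g \<in> S \<and> g \<noteq> 0 \<and> degree g = n" using assms(1) by blast
  define n where "n = (LEAST n. \<exists>g. g \<in> S \<and> g \<noteq> 0 \<and> degree g = n)"
  obtain g where g: "g \<in> S" "g \<noteq> 0" "degree g = n"
    using LeastI_ex[OF ex] unfolding n_def by blast
  have least: "n \<le> degree h" if "h \<in> S" "h \<noteq> 0" for h
    unfolding n_def by (rule Least_le) (use that in blast)
  have "g dvd r" if "r \<in> S" for r
  proof -
    have "r mod g = r - (r div g) * g" by (simp add: minus_div_mult_eq_mod)
    then have "r mod g \<in> S" using assms that g by metis
    then have "r mod g = 0" using least[of "r mod g"] degree_mod_less[of g r] g by linarith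
    then show ?thesis by blast
  qed
  moreover have "r \<in> S" if "g dvd r" for r
    using that assms(3)[OF g(1)] by (auto simp: dvd_def mult.commute)
  ultimately show ?thesis using that[of g] by blast
qed

text \<open>The combinations of \<open>p\<close> and \<open>h\<close> form a principal ideal. Its
  generator divides \<open>p\<close>, so it is a unit or an associate of \<open>p\<close>, and an
  associate of \<open>p\<close> cannot divide \<open>h\<close>.\<close>

lemma irreducible_poly_bezout:
  fixes p h :: "'k::field poly"
  assumes "irreducible p" "\<not> p dvd h"
  obtains a b where "a * p + b * h = 1"
proof -
  define S where "S = {a * p + b * h | a b. True}"
  have "0 \<in> S" unfolding S_def by (auto intro!: exI[of _ 0])
  moreover have "a - b \<in> S" if ab: "a \<in> S" "b \<in> S" for a b
  proof -
    obtain c d c' d' where "a = c * p + d * h" "b = c' * p + d' * h" using ab unfolding S_def by blast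
    then have "a - b = (c - c') * p + (d - d') * h" by (simp add: algebra_simps)
    then show ?thesis unfolding S_def by blast
  qed
  moreover have "r * a \<in> S" if a: "a \<in> S" for a r
  proof -
    obtain c d where "a = c * p + d * h" using a unfolding S_def by blast
    then have "r * a = (r * c) * p + (r * d) * h" by (simp add: algebra_simps)
    then show ?thesis unfolding S_def by blast
  qed
  ultimately obtain g where g: "S = {r. g dvd r}" using poly_ideal_principal by blast
  have "p \<in> S" "h \<in> S" unfolding S_def
    by (rule CollectI, rule exI[of _ 1], rule exI[of _ 0], simp)
      (rule CollectI, rule exI[of _ 0], rule exI[of _ 1], simp)
  then have gd: "g dvd p" "g dvd h" using g by auto
  then obtain c where c: "p = g * c" by (auto elim: dvdE)
  with assms(1) have "g dvd 1 \<or> c dvd 1" by (metis irreducible_def)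
  moreover have "\<not> c dvd 1"
  proof
    assume "c dvd 1"
    then obtain d where "1 = c * d" by (auto elim: dvdE)
    then have "g = p * d" using c by (metis mult.assoc mult.right_neutral)
    then show False using gd assms(2) by (metis dvd_trans dvd_triv_left)
  qed
  ultimately have "1 \<in> S" using g by auto
  then show ?thesis using that unfolding S_def by (smt (verit, del_insts) mem_Collect_eq)
qed

lemma irreducible_degree_pos: "irreducible (p :: 'k::field poly) \<Longrightarrow> degree p > 0"
  using is_unit_iff_degree[of p] by (auto simp: irreducible_def)

lemma irreducible_poly_dvd_mult:
  fixes p :: "'k::field poly"
  assumes "irreducible p" "p dvd a * b"
  shows "p dvd a \<or> p dvd b"
proof (rule ccontr)
  assume "\<not> ?thesis"
  then obtain c d where "c * p + d * a = 1" and nb: "\<not> p dvd b"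
    using irreducible_poly_bezout[OF assms(1)] by metis
  then have "b = c * b * p + d * (a * b)"
    by (metis (no_types, lifting) distrib_right mult.assoc mult.commute mult.right_neutral)
  then show False using nb assms(2) by (metis dvd_add dvd_mult dvd_triv_right)
qed

text \<open>Factors \<open>p\<close> are stripped from \<open>b\<close> one at a time:
  \<open>p\<close> divides \<open>b\<close> because it does not divide \<open>a\<close>, and then it
  cancels.\<close>

lemma irreducible_poly_power_dvd_mult:
  fixes p :: "'k::field poly"
  assumes p: "irreducible p" and "\<not> p dvd a" "p ^ n dvd a * b"
  shows "p ^ n dvd b"
  using assms(3)
proof (induction n arbitrary: b)
  case (Suc n)
  have "p dvd a * b" using Suc.prems by (auto intro: dvd_trans)
  then obtain c where c: "b = p * c" using irreducible_poly_dvd_mult[OF p] assms(2) by (metis dvdE)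
  have "p \<noteq> 0" using p by auto
  then have "p ^ n dvd a * c" using Suc.prems unfolding c by (metis dvd_mult_cancel_left mult.left_commute power_Suc)
  then show ?case using Suc.IH[of c] c by (simp add: mult_dvd_mono)
qed simp

text \<open>Multiplying the identity for \<open>p ^ n\<close> by the one for \<open>p\<close> leaves
  one multiple of \<open>p ^ Suc n\<close>; every other term contains \<open>h\<close>.\<close>

lemma irreducible_poly_power_bezout:
  fixes p h :: "'k::field poly"
  assumes p: "irreducible p" "\<not> p dvd h"
  obtains a b where "a * p ^ n + b * h = 1"
proof -
  have "\<exists>a b. a * p ^ n + b * h = 1"
  proof (induction n)
    case 0
    show ?case by (rule exI[of _ 1], rule exI[of _ 0]) simp
  next
    case (Suc n)
    then obtain a b where ab: "a * p ^ n + b * h = 1" by blast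
    obtain c d where cd: "c * p + d * h = 1" using irreducible_poly_bezout[OF p] by blast
    have "(a * p ^ n + b * h) * (c * p + d * h) = (a * c) * p ^ Suc n + (a * p ^ n * d + b * c * p + b * h * d) * h"
      by (simp add: algebra_simps)
    then show ?case using ab cd by (metis mult_1)
  qed
  then show ?thesis using that by blast
qed

lemma irreducible_dvd_power_poly:
  fixes p :: "'k::field poly"
  assumes "irreducible p" "p dvd a ^ n"
  shows "p dvd a"
  using assms(2)
proof (induction n)
  case 0
  then show ?case using assms(1) by (auto simp: irreducible_def)
next
  case (Suc n)
  then show ?case using irreducible_poly_dvd_mult[OF assms(1)] by auto
qed

text \<open>The cofactor is a unit, hence a constant, and comparing leading coefficients makes it 1.
  Monic irreducible polynomials therefore label primes without ambiguity.\<close>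

lemma monic_irreducible_dvd_eq:
  fixes p q :: "'k::field poly"
  assumes "irreducible p" "irreducible q" "lead_coeff p = 1" "lead_coeff q = 1" "p dvd q"
  shows "p = q"
proof -
  obtain c where c: "q = p * c" using assms(5) by (auto elim: dvdE)
  then have "c dvd 1" using assms(1,2) by (metis irreducible_def)
  then obtain a where a: "c = [:a:]" by (auto simp: is_unit_poly_iff)
  have "lead_coeff q = lead_coeff p * a" unfolding c a by (simp add: lead_coeff_mult)
  then have "a = 1" using assms(3,4) by simp
  then show ?thesis using c a by simp
qed

lemma poly_irreducible_divisor:
  fixes m :: "'k::field poly"
  assumes "degree m > 0"
  obtains p where "irreducible p" "lead_coeff p = 1" "p dvd m"
proof -
  have "\<exists>p. irreducible p \<and> p dvd m" using assms
  proof (induction "degree m" arbitrary: m rule: less_induct)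
    case less
    show ?case
    proof (cases "irreducible m")
      case False
      have "m \<noteq> 0" "\<not> m dvd 1" using less.prems is_unit_iff_degree[of m] by force+
      then obtain a b where ab: "m = a * b" "\<not> a dvd 1" "\<not> b dvd 1"
        using False by (auto simp: irreducible_def)
      then have "a \<noteq> 0" "b \<noteq> 0" using \<open>m \<noteq> 0\<close> by auto
      then have "degree a > 0" "degree b > 0" using ab by (auto simp: is_unit_iff_degree)
      then have "degree a < degree m" using ab \<open>a \<noteq> 0\<close> \<open>b \<noteq> 0\<close> by (simp add: degree_mult_eq)
      then obtain p where "irreducible p" "p dvd a" using less.hyps \<open>degree a > 0\<close> by blast
      then show ?thesis using ab by auto
    qed auto
  qed
  then obtain p where p: "irreducible p" "p dvd m" by blast
  \<comment> \<open>Scaling makes \<open>p\<close> monic; irreducibility carries over because the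
    two polynomials divide each other.\<close>
  define q where "q = smult (inverse (lead_coeff p)) p"
  have "lead_coeff p \<noteq> 0" using p by auto
  then have "p = q * [:lead_coeff p:]" "q = p * [:inverse (lead_coeff p):]" unfolding q_def by auto
  then have pq: "p dvd q" "q dvd p" by (metis dvd_triv_left)+
  have "irreducible q"
  proof (rule irreducibleI)
    show "q \<noteq> 0" using pq(2) p(1) by (auto simp: irreducible_def)
    show "\<not> q dvd 1" using p(1) pq(1) dvd_trans[of p q 1] by (auto simp: irreducible_def)
    fix a b assume "q = a * b"
    then have "p = (a * [:lead_coeff p:]) * b" using \<open>p = q * _\<close> by (metis mult.assoc mult.commute)
    then have "a * [:lead_coeff p:] dvd 1 \<or> b dvd 1" using p(1) by (metis irreducible_def)
    then show "a dvd 1 \<or> b dvd 1" by (meson dvd_mult_left)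
  qed
  moreover have "lead_coeff q = 1" unfolding q_def using \<open>lead_coeff p \<noteq> 0\<close> by simp
  moreover have "q dvd m" using pq p dvd_trans by blast
  ultimately show ?thesis using that by blast
qed

lemma linear_poly_irreducible: "irreducible [:a, 1::'k::field:]"
proof (rule irreducibleI)
  fix b c assume bc: "[:a, 1:] = b * c"
  then have nz: "b \<noteq> 0" "c \<noteq> 0" by auto
  have "degree (b * c) = 1" using bc by (metis degree_pCons_eq_if degree_1 One_nat_def one_neq_zero one_pCons pCons_0_0 pCons_eq_0_iff degree_linear_power power_one_right)
  then have "degree b + degree c = 1" using nz by (simp add: degree_mult_eq)
  then show "b dvd 1 \<or> c dvd 1" using nz by (auto simp: is_unit_iff_degree)
qed (auto simp: is_unit_iff_degree)

lemma sum_monom_lt: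
  fixes c :: "nat \<Rightarrow> 'r::comm_ring_1"
  shows "coeff (\<Sum>i<n. monom (c i) i) j = (if j < n then c j else 0)"
  by (simp add: coeff_sum)

section \<open>Polynomials acting through an endomorphism\<close>

text \<open>Horner's scheme. The scalars form an arbitrary commutative ring, so the construction can
  be iterated to let polynomials in two variables act.\<close>

definition poly_act :: "('r::comm_ring_1 \<Rightarrow> 'v::ab_group_add \<Rightarrow> 'v) \<Rightarrow> ('v \<Rightarrow> 'v) \<Rightarrow> 'r poly \<Rightarrow> 'v \<Rightarrow> 'v" where
  "poly_act s T p v = fold_coeffs (\<lambda>c w. s c v + T w) p 0"

locale module_endo = Modules.module s for s :: "'r::comm_ring_1 \<Rightarrow> 'v::ab_group_add \<Rightarrow> 'v" +
  fixes T :: "'v \<Rightarrow> 'v"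
  assumes T_add: "T (v + w) = T v + T w" and T_scale: "T (s c v) = s c (T v)"
begin

lemma T_zero [simp]: "T 0 = 0"
  using T_scale[of 0 0] by simp

lemma T_sum: "T (sum f A) = (\<Sum>a\<in>A. T (f a))"
  by (induction A rule: infinite_finite_induct) (auto simp: T_add)

lemma poly_act_0 [simp]: "poly_act s T 0 v = 0"
  by (simp add: poly_act_def)

lemma poly_act_pCons [simp]: "poly_act s T (pCons c p) v = s c v + T (poly_act s T p v)"
  unfolding poly_act_def
  by (cases "p = 0"; cases "c = 0") auto

lemma poly_act_module: "Modules.module (poly_act s T)"
proof
  fix a b :: "'r poly" and x y :: 'v
  show "poly_act s T a (x + y) = poly_act s T a x + poly_act s T a y"
    by (induction a) (simp_all add: scale_right_distrib T_add algebra_simps)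
  show plus: "poly_act s T (a + b) x = poly_act s T a x + poly_act s T b x" for a b
    by (induction a b rule: poly_induct2) (simp_all add: scale_left_distrib T_add algebra_simps)
  have sm: "poly_act s T (smult c b) x = s c (poly_act s T b x)" for c
    by (induction b) (simp_all add: scale_right_distrib T_scale)
  show "poly_act s T a (poly_act s T b x) = poly_act s T (a * b) x"
    by (induction a) (simp_all add: plus sm)
  show "poly_act s T 1 x = x"
    by (simp add: one_pCons)
qed

text \<open>Connects Horner's scheme with the power sum through which \<open>kx_tensor\<close> lets
  a polynomial act.\<close>

lemma poly_act_eq_sum:
  assumes "degree p \<le> n"
  shows "poly_act s T p v = (\<Sum>i\<le>n. s (coeff p i) ((T ^^ i) v))"
  using assms
proof (induction p arbitrary: n)
  case (pCons c p)
  show ?case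
  proof (cases n)
    case 0
    then have "p = 0" using pCons.prems by (auto split: if_splits)
    then show ?thesis using 0 by simp
  next
    case (Suc m)
    then have "degree p \<le> m" using pCons.prems by (auto split: if_splits)
    then have "poly_act s T p v = (\<Sum>i\<le>m. s (coeff p i) ((T ^^ i) v))" by (rule pCons.IH)
    then show ?thesis unfolding Suc by (subst sum.atMost_Suc_shift) (simp add: T_sum T_scale)
  qed
qed simp

end


section \<open>Submodules of a \<open>k[x]\<close>-module on a type\<close>

locale kx_space =
  fixes act :: "'k::field poly \<Rightarrow> 'v::ab_group_add \<Rightarrow> 'v"
  assumes act_module: "Modules.module act"
begin

sublocale m: Modules.module act
  by (rule act_module)

definition scal :: "'k \<Rightarrow> 'v \<Rightarrow> 'v" where
  "scal c v = act [:c:] v"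

sublocale vs: vector_space scal
  by standard (simp_all add: scal_def m.scale_right_distrib mult.commute flip: m.scale_left_distrib one_pCons)

lemma scal_act: "scal c (act r v) = act r (scal c v)"
  by (simp add: scal_def mult.commute)

lemma subspace_scal: "m.subspace V \<Longrightarrow> vs.subspace V"
  by (auto simp: m.subspace_def vs.subspace_def scal_def)

text \<open>Containment in a finite span, rather than equality with it, makes the property pass to
  subsets at once; \<open>fd_basis\<close> still finds a basis inside \<open>V\<close>.\<close>

definition fd :: "'v set \<Rightarrow> bool" where
  "fd V \<longleftrightarrow> (\<exists>B. finite B \<and> V \<subseteq> vs.span B)"

lemma fd_mono: "fd W \<Longrightarrow> V \<subseteq> W \<Longrightarrow> fd V"
  unfolding fd_def by blast

lemma fd_basis:
  assumes "fd V"
  obtains B where "finite B" "B \<subseteq> V" "vs.independent B" "V \<subseteq> vs.span B" "card B = vs.dim V"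
  using assms unfolding fd_def
  by (metis vs.basis_exists vs.independent_span_bound subset_trans)

lemma dim_mono: "fd W \<Longrightarrow> V \<subseteq> W \<Longrightarrow> vs.dim V \<le> vs.dim W"
  by (metis fd_basis vs.dim_le_card subset_trans)

lemma subspace_eq_of_dim_le:
  assumes "vs.subspace V" "V \<subseteq> W" "fd W" "vs.dim W \<le> vs.dim V"
  shows "V = W"
proof (rule ccontr)
  assume "V \<noteq> W"
  then obtain w where w: "w \<in> W" "w \<notin> V" using assms by blast
  obtain B where B: "finite B" "B \<subseteq> V" "vs.independent B" "V \<subseteq> vs.span B" "card B = vs.dim V"
    using fd_basis[OF fd_mono[OF assms(3,2)]] .
  obtain C where C: "finite C" "C \<subseteq> W" "W \<subseteq> vs.span C" "card C = vs.dim W"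
    using fd_basis[OF assms(3)] by metis
  have "vs.span B = V" using B assms(1) by (simp add: vs.span_subspace)
  then have "vs.independent (insert w B)" using B w by (simp add: vs.independent_insert)
  moreover have "insert w B \<subseteq> vs.span C" using B C w assms by blast
  ultimately have "card (insert w B) \<le> card C" using vs.independent_span_bound[OF C(1)] by blast
  moreover have "w \<notin> B" using w B by blast
  ultimately show False using assms(4) B C by simp
qed

lemma dim_zero_iff: "fd V \<Longrightarrow> vs.dim V = 0 \<longleftrightarrow> V \<subseteq> {0}"
proof
  assume "fd V" "vs.dim V = 0"
  then obtain B where "finite B" "V \<subseteq> vs.span B" "card B = 0" by (metis fd_basis)
  then show "V \<subseteq> {0}" by simp
next
  assume "V \<subseteq> {0}"
  then show "vs.dim V = 0" using vs.dim_le_card[of V "{}"] by simp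
qed

section \<open>Sums of two submodules and their dimension\<close>

definition ssum :: "'v set \<Rightarrow> 'v set \<Rightarrow> 'v set" where
  "ssum U W = {u + w | u w. u \<in> U \<and> w \<in> W}"

lemma ssum_subspace: "m.subspace U \<Longrightarrow> m.subspace W \<Longrightarrow> m.subspace (ssum U W)"
  unfolding ssum_def m.subspace_def
  apply safe
    apply (metis add.right_neutral)
   apply (metis (no_types, opaque_lifting) add.assoc add.left_commute)
  apply (metis m.scale_right_distrib)
  done

lemma fd_ssum: "fd U \<Longrightarrow> fd W \<Longrightarrow> fd (ssum U W)"
proof -
  assume "fd U" "fd W"
  then obtain B C where B: "finite B" "U \<subseteq> vs.span B" and C: "finite C" "W \<subseteq> vs.span C"
    unfolding fd_def by blast
  have "vs.span B \<subseteq> vs.span (B \<union> C)" "vs.span C \<subseteq> vs.span (B \<union> C)" by (auto intro: vs.span_mono[THEN subsetD])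
  then have "ssum U W \<subseteq> vs.span (B \<union> C)" using B C unfolding ssum_def by (auto intro!: vs.span_add)
  then show ?thesis unfolding fd_def using B C by (intro exI[of _ "B \<union> C"]) auto
qed

lemma dim_direct_sum:
  assumes U: "vs.subspace U" "fd U" and W: "vs.subspace W" "fd W" and int: "U \<inter> W \<subseteq> {0}"
  shows "vs.dim (ssum U W) = vs.dim U + vs.dim W"
proof -
  obtain B where B: "finite B" "B \<subseteq> U" "vs.independent B" "U \<subseteq> vs.span B" "card B = vs.dim U"
    using fd_basis[OF U(2)] .
  obtain C where C: "finite C" "C \<subseteq> W" "vs.independent C" "W \<subseteq> vs.span C" "card C = vs.dim W"
    using fd_basis[OF W(2)] .
  have disj: "B \<inter> C = {}"
  proof -
    have "0 \<notin> B" using B(3) vs.dependent_zero by blast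
    then show ?thesis using int B C by blast
  qed
  have sB: "(\<Sum>v\<in>B. scal (f v) v) \<in> U" and sC: "(\<Sum>v\<in>C. scal (f v) v) \<in> W" for f
    using B C U W by (auto intro!: vs.subspace_sum vs.subspace_scale)
  have ind: "vs.independent (B \<union> C)"
  proof (rule vs.independent_if_scalars_zero)
    fix f x assume 0: "(\<Sum>v\<in>B \<union> C. scal (f v) v) = 0" and x: "x \<in> B \<union> C"
    have eq: "(\<Sum>v\<in>B. scal (f v) v) + (\<Sum>v\<in>C. scal (f v) v) = 0"
      using 0 B C disj by (simp add: sum.union_disjoint)
    then have "(\<Sum>v\<in>B. scal (f v) v) = - (\<Sum>v\<in>C. scal (f v) v)" by (simp add: eq_neg_iff_add_eq_0)
    then have "(\<Sum>v\<in>B. scal (f v) v) \<in> W" using sC W by (metis vs.subspace_neg)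
    then have "(\<Sum>v\<in>B. scal (f v) v) = 0" using sB int by blast
    moreover from this eq have "(\<Sum>v\<in>C. scal (f v) v) = 0" by simp
    ultimately show "f x = 0" using x vs.independentD[OF B(3,1) subset_refl] vs.independentD[OF C(3,1) subset_refl]
      by blast
  qed (use B C in auto)
  have "B \<union> C \<subseteq> ssum U W"
  proof -
    have "b + 0 \<in> ssum U W" if "b \<in> B" for b unfolding ssum_def using that B vs.subspace_0[OF W(1)] by blast
    moreover have "0 + c \<in> ssum U W" if "c \<in> C" for c unfolding ssum_def using that C vs.subspace_0[OF U(1)] by blast
    ultimately show ?thesis by auto
  qed
  moreover have "ssum U W \<subseteq> vs.span (B \<union> C)"
  proof -
    have "vs.span B \<subseteq> vs.span (B \<union> C)" "vs.span C \<subseteq> vs.span (B \<union> C)" by (auto intro: vs.span_mono[THEN subsetD])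
    then show ?thesis using B C unfolding ssum_def by (auto intro!: vs.span_add)
  qed
  moreover have "card (B \<union> C) = vs.dim U + vs.dim W" using B C disj by (simp add: card_Un_disjoint)
  ultimately show ?thesis using ind by (intro vs.dim_unique)
qed

section \<open>Cyclic submodules and annihilating polynomials\<close>

definition cyc :: "'v \<Rightarrow> 'v set" where
  "cyc u = range (\<lambda>r. act r u)"

text \<open>\<open>f\<close> generates the annihilator ideal of \<open>u\<close>, so
  \<open>cyc u\<close> is a copy of \<open>k[x]/f\<close>.\<close>

definition exact :: "'k poly \<Rightarrow> 'v \<Rightarrow> bool" where
  "exact f u \<longleftrightarrow> (\<forall>r. act r u = 0 \<longleftrightarrow> f dvd r)"

lemma act_in_cyc [simp]: "act r u \<in> cyc u"
  by (simp add: cyc_def)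

lemma self_in_cyc [simp]: "u \<in> cyc u"
  using act_in_cyc[of 1 u] by simp

lemma cycE: "v \<in> cyc u \<Longrightarrow> (\<And>r. v = act r u \<Longrightarrow> P) \<Longrightarrow> P"
  by (auto simp: cyc_def)

lemma cyc_subspace: "m.subspace (cyc u)"
  unfolding m.subspace_def cyc_def
proof (safe)
  show "0 \<in> range (\<lambda>r. act r u)" by (rule range_eqI[of _ _ 0]) simp
  fix r s show "act r u + act s u \<in> range (\<lambda>r. act r u)"
    by (rule range_eqI[of _ _ "r + s"]) (simp add: m.scale_left_distrib)
  show "act r (act s u) \<in> range (\<lambda>r. act r u)" by (rule range_eqI[of _ _ "r * s"]) simp
qed

lemma cyc_minimal: "m.subspace V \<Longrightarrow> u \<in> V \<Longrightarrow> cyc u \<subseteq> V"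
  by (auto simp: cyc_def m.subspace_scale)

lemma act_mod: "act f u = 0 \<Longrightarrow> act (r mod f) u = act r u"
proof -
  assume "act f u = 0"
  have "act r u = act (r div f * f + r mod f) u" by simp
  also have "\<dots> = act (r div f) (act f u) + act (r mod f) u" by (simp only: m.scale_left_distrib m.scale_scale)
  finally show ?thesis using \<open>act f u = 0\<close> by simp
qed

lemma act_as_sum: "act p v = (\<Sum>i\<le>degree p. scal (coeff p i) (act (monom 1 i) v))"
proof -
  have "act p v = act (\<Sum>i\<le>degree p. monom (coeff p i) i) v" by (simp add: poly_as_sum_of_monoms)
  also have "\<dots> = (\<Sum>i\<le>degree p. act (monom (coeff p i) i) v)" by (rule m.scale_sum_left)
  finally show ?thesis by (simp add: scal_def smult_monom)
qed

lemma act_sum_monom: "act (\<Sum>i<n. monom (c i) i) v = (\<Sum>i<n. scal (c i) (act (monom 1 i) v))"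
  by (simp add: m.scale_sum_left scal_def smult_monom)

lemma degree_sum_monom_less: "(0::nat) < n \<Longrightarrow> degree (\<Sum>i<n. monom (c i :: 'k) i) < n"
  by (rule degree_lessI) (auto simp: sum_monom_lt)

text \<open>A linear relation between u, x u, ..., x^(n-1) u is the same as a polynomial of degree
  below \<open>n\<close> that kills \<open>u\<close>. Injectivity of the orbit is the case of a
  relation with two terms.\<close>

lemma monom_orbit_independent:
  assumes "\<And>r. degree r < n \<Longrightarrow> act r u = 0 \<Longrightarrow> r = 0"
  shows "vs.independent ((\<lambda>i. act (monom 1 i) u) ` {..<n})" "card ((\<lambda>i. act (monom 1 i) u) ` {..<n}) = n"
proof -
  define g where "g i = act (monom (1::'k) i) u" for i
  have zero: "c i = 0" if "(\<Sum>i<n. scal (c i) (g i)) = 0" "i < n" for c i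
  proof -
    have "act (\<Sum>i<n. monom (c i) i) u = 0" using that by (simp add: act_sum_monom g_def)
    then have "(\<Sum>i<n. monom (c i) i) = 0" using that degree_sum_monom_less[of n c] by (intro assms) auto
    then show ?thesis using sum_monom_lt[of c n i] that by simp
  qed
  have inj: "inj_on g {..<n}"
  proof (rule inj_onI, rule ccontr)
    fix i j assume ij: "i \<in> {..<n}" "j \<in> {..<n}" "g i = g j" "i \<noteq> j"
    \<comment> \<open>The relation saying that the i-th and the j-th orbit vector agree.\<close>
    define c where "c l = (if l = i then 1 else if l = j then -1 else (0::'k))" for l
    have "(\<Sum>l<n. scal (c l) (g l)) = (\<Sum>l\<in>{i,j}. scal (c l) (g l))"
      by (rule sum.mono_neutral_right) (use ij in \<open>auto simp: c_def\<close>)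
    also have "\<dots> = 0" using ij by (simp add: c_def)
    finally have "c i = 0" by (rule zero) (use ij in auto)
    then show False by (simp add: c_def)
  qed
  have "vs.independent (g ` {..<n})"
  proof (rule vs.independent_if_scalars_zero)
    fix f x assume "(\<Sum>x\<in>g ` {..<n}. scal (f x) x) = 0" and x: "x \<in> g ` {..<n}"
    then have "(\<Sum>i<n. scal (f (g i)) (g i)) = 0" by (simp add: sum.reindex[OF inj])
    from zero[OF this] show "f x = 0" using x by blast
  qed simp
  then show "vs.independent ((\<lambda>i. act (monom 1 i) u) ` {..<n})" unfolding g_def .
  show "card ((\<lambda>i. act (monom 1 i) u) ` {..<n}) = n" using card_image[OF inj] unfolding g_def by simp
qed

lemma cyc_in_span:
  assumes "act f u = 0" "f \<noteq> 0"
  shows "cyc u \<subseteq> vs.span ((\<lambda>i. act (monom 1 i) u) ` {..<degree f})"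
proof
  fix v assume "v \<in> cyc u"
  then obtain r where r: "v = act (r mod f) u" using act_mod[OF assms(1)] by (metis cycE)
  show "v \<in> vs.span ((\<lambda>i. act (monom 1 i) u) ` {..<degree f})"
  proof (cases "r mod f = 0")
    case False
    then have "degree (r mod f) < degree f" using degree_mod_less[OF assms(2)] by blast
    then show ?thesis unfolding r by (subst act_as_sum) (auto intro!: vs.span_sum vs.span_scale intro: vs.span_base)
  qed (simp add: r vs.span_zero)
qed

lemma fd_cyc: "act f u = 0 \<Longrightarrow> f \<noteq> 0 \<Longrightarrow> fd (cyc u)"
  unfolding fd_def using cyc_in_span[of f u]
  by (intro exI[of _ "(\<lambda>i. act (monom 1 i) u) ` {..<degree f}"] conjI) simp_all

lemma dim_cyc:
  assumes "exact f u" "f \<noteq> 0"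
  shows "vs.dim (cyc u) = degree f"
proof -
  have "r = 0" if "degree r < degree f" "act r u = 0" for r
  proof (rule ccontr)
    assume "r \<noteq> 0"
    moreover have "f dvd r" using that assms by (simp add: exact_def)
    ultimately show False using that(1) dvd_imp_degree_le[of f r] by simp
  qed
  note ind = monom_orbit_independent[OF this]
  show ?thesis
    by (rule vs.dim_unique[OF _ cyc_in_span ind]) (use assms in \<open>auto simp: exact_def\<close>)
qed

text \<open>One orbit vector more than \<open>card B\<close> cannot be independent inside the span
  of \<open>B\<close>, so some nonzero polynomial kills \<open>u\<close>.\<close>

lemma vector_annihilator:
  assumes "m.subspace V" "fd V" "u \<in> V"
  obtains f where "f \<noteq> 0" "act f u = 0"
proof -
  obtain B where B: "finite B" "V \<subseteq> vs.span B" using assms unfolding fd_def by blast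
  have "\<exists>f. f \<noteq> 0 \<and> act f u = 0"
  proof (rule ccontr)
    assume "\<not> ?thesis"
    then have "\<And>r. degree r < Suc (card B) \<Longrightarrow> act r u = 0 \<Longrightarrow> r = 0" by blast
    note ind = monom_orbit_independent[OF this]
    have "(\<lambda>i. act (monom 1 i) u) ` {..<Suc (card B)} \<subseteq> vs.span B"
      using assms B by (auto simp: m.subspace_scale)
    from vs.independent_span_bound[OF B(1) ind(1) this] ind(2) show False by simp
  qed
  then show ?thesis using that by blast
qed

definition kills :: "'k poly \<Rightarrow> 'v set \<Rightarrow> bool" where
  "kills f V \<longleftrightarrow> (\<forall>v\<in>V. act f v = 0)"

lemma kernel_subspace: "m.subspace V \<Longrightarrow> m.subspace {v \<in> V. act f v = 0}"
  by (auto simp: m.subspace_def m.scale_right_distrib mult.commute[of f] simp flip: m.scale_scale)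
    (metis m.scale_left_commute m.scale_zero_right)

text \<open>The product of annihilators of the basis vectors kills the basis, hence its
  span.\<close>

lemma fd_annihilator:
  assumes V: "m.subspace V" "fd V"
  obtains f where "f \<noteq> 0" "kills f V"
proof -
  obtain B where B: "finite B" "B \<subseteq> V" "V \<subseteq> vs.span B" using fd_basis[OF V(2)] by metis
  have "\<exists>f. f \<noteq> 0 \<and> kills f C" if "C \<subseteq> V" "finite C" for C
    using that(2,1)
  proof (induction C)
    case (insert b C)
    then obtain f where f: "f \<noteq> 0" "kills f C" by auto
    obtain g where g: "g \<noteq> 0" "act g b = 0" using vector_annihilator[OF V] insert.prems by blast
    have "kills (f * g) (insert b C)" using f g unfolding kills_def
      by (metis insert_iff m.scale_scale m.scale_zero_right mult.commute)
    then show ?case using f g by (metis mult_eq_0_iff)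
  qed (auto simp: kills_def intro: exI[of _ 1])
  from this[OF B(2,1)] obtain f where f: "f \<noteq> 0" "kills f B" by blast
  have "vs.subspace {v. act f v = 0}" using subspace_scal[OF kernel_subspace[of UNIV f]] by simp
  then have "vs.span B \<subseteq> {v. act f v = 0}" using f(2) by (intro vs.span_minimal) (auto simp: kills_def)
  then show ?thesis using that[OF f(1)] B unfolding kills_def by blast
qed

section \<open>Indecomposable submodules are cyclic of prime power order\<close>

definition indec :: "'v set \<Rightarrow> bool" where
  "indec V \<longleftrightarrow> V \<noteq> {0} \<and> (\<forall>U W. m.subspace U \<and> m.subspace W \<and> V = ssum U W \<and> U \<inter> W = {0} \<longrightarrow> U = {0} \<or> W = {0})"

text \<open>The submodules isomorphic to \<open>k[x]/p^s\<close>. Requiring \<open>p\<close> to be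
  monic and \<open>s\<close> positive makes the pair of \<open>p\<close> and \<open>s\<close> an
  invariant of \<open>V\<close>.\<close>

definition primary_cyc :: "'v set \<Rightarrow> 'k poly \<Rightarrow> nat \<Rightarrow> bool" where
  "primary_cyc V p s \<longleftrightarrow> irreducible p \<and> lead_coeff p = 1 \<and> s \<ge> 1 \<and> (\<exists>u. V = cyc u \<and> exact (p ^ s) u)"

lemma ssum_memI: "u \<in> U \<Longrightarrow> w \<in> W \<Longrightarrow> u + w \<in> ssum U W"
  unfolding ssum_def by blast

lemma subset_ssum: "m.subspace U \<Longrightarrow> m.subspace W \<Longrightarrow> U \<subseteq> ssum U W" "m.subspace U \<Longrightarrow> m.subspace W \<Longrightarrow> W \<subseteq> ssum U W"
  using ssum_memI[of _ U 0 W] ssum_memI[of 0 U _ W] by (auto simp: m.subspace_0)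

text \<open>Write a polynomial killing \<open>u\<close> as \<open>p ^ j * h\<close> with
  \<open>h\<close> prime to \<open>p\<close>. If j <= s, inverting \<open>h\<close> modulo
  \<open>p ^ Suc s\<close> would show that \<open>p ^ j\<close>, and hence \<open>p ^ s\<close>,
  kills \<open>u\<close>.\<close>

lemma exact_prime_power:
  assumes p: "irreducible p" and "act (p ^ Suc s) u = 0" "act (p ^ s) u \<noteq> 0"
  shows "exact (p ^ Suc s) u"
  unfolding exact_def
proof safe
  fix r assume r: "act r u = 0"
  show "p ^ Suc s dvd r"
  proof (rule ccontr)
    assume nd: "\<not> p ^ Suc s dvd r"
    \<comment> \<open>The exponent of \<open>p\<close> in \<open>r\<close>. The cap at
      \<open>s\<close> loses nothing, since \<open>p ^ Suc s\<close> does not divide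
      \<open>r\<close>.\<close>
    define j where "j = (GREATEST j. j \<le> s \<and> p ^ j dvd r)"
    have j: "j \<le> s \<and> p ^ j dvd r" unfolding j_def
      by (rule GreatestI_nat[of "\<lambda>j. j \<le> s \<and> p ^ j dvd r" 0 s]) auto
    then obtain h where h: "r = p ^ j * h" by (auto elim: dvdE)
    have "\<not> p dvd h"
    proof
      assume "p dvd h"
      then have d: "p ^ Suc j dvd r" unfolding h by (metis dvd_refl mult.commute mult_dvd_mono power_Suc)
      then have "Suc j \<le> s" using nd j by (metis le_SucE Suc_le_mono)
      then have "Suc j \<le> j" unfolding j_def using d
        by (intro Greatest_le_nat[of "\<lambda>j. j \<le> s \<and> p ^ j dvd r" _ s]) (auto simp: j_def)
      then show False by simp
    qed
    then obtain a b where ab: "a * p ^ Suc s + b * h = 1" using irreducible_poly_power_bezout[OF p] by blast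
    \<comment> \<open>Bezout's identity multiplied by \<open>p ^ s\<close>; the factor
      \<open>p ^ (s - j)\<close> completes \<open>h\<close> to a multiple of
      \<open>r\<close>.\<close>
    have "p ^ s = a * p ^ s * p ^ Suc s + (b * p ^ (s - j)) * r"
    proof -
      have "p ^ s = p ^ s * (a * p ^ Suc s + b * h)" using ab by simp
      moreover have "p ^ s = p ^ (s - j) * p ^ j" using j by (simp flip: power_add)
      ultimately show ?thesis unfolding h by (simp add: algebra_simps)
    qed
    then have "act (p ^ s) u = act (a * p ^ s) (act (p ^ Suc s) u) + act (b * p ^ (s - j)) (act r u)"
      by (metis m.scale_left_distrib m.scale_scale)
    then show False using r assms(3) unfolding assms(2) by simp
  qed
next
  fix r assume "p ^ Suc s dvd r"
  then obtain h where h: "r = h * p ^ Suc s" by (metis dvdE mult.commute)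
  have "act r u = act h (act (p ^ Suc s) u)" unfolding h by simp
  then show "act r u = 0" unfolding assms(2) by simp
qed

text \<open>Splitting a minimal polynomial into \<open>p ^ s\<close> and a cofactor \<open>h\<close>
  prime to \<open>p\<close> splits \<open>V\<close> into the kernels of the two factors, and one of
  them must vanish.\<close>

lemma indec_killed_by_prime_power:
  assumes V: "m.subspace V" "fd V" "indec V"
  obtains p s where "irreducible p" "lead_coeff p = 1" "kills (p ^ s) V"
proof -
  have "\<exists>n f. f \<noteq> 0 \<and> kills f V \<and> degree f = n" using fd_annihilator[OF V(1,2)] by metis
  \<comment> \<open>The degree of a minimal polynomial of \<open>V\<close>. Its minimality later
    shows that \<open>h\<close> alone does not kill \<open>V\<close>, so the kernel of
    \<open>p ^ s\<close> is not zero.\<close>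
  define n where "n = (LEAST n. \<exists>f. f \<noteq> 0 \<and> kills f V \<and> degree f = n)"
  obtain m where m: "m \<noteq> 0" "kills m V" "degree m = n"
    using LeastI_ex[OF \<open>\<exists>n f. _ n f\<close>] unfolding n_def by blast
  have least: "n \<le> degree f" if "f \<noteq> 0" "kills f V" for f
    unfolding n_def by (rule Least_le) (use that in blast)
  have "degree m > 0"
  proof (rule ccontr)
    assume "\<not> ?thesis"
    then obtain a where a: "m = [:a:]" "a \<noteq> 0" using m by (metis degree_eq_zeroE neq0_conv pCons_0_0)
    have "v = 0" if "v \<in> V" for v using m(2) that a vs.scale_eq_0_iff unfolding kills_def scal_def by auto
    then show False using V m.subspace_0[OF V(1)] unfolding indec_def by blast
  qed
  then obtain p where p: "irreducible p" "lead_coeff p = 1" "p dvd m" using poly_irreducible_divisor by blast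
  define s where "s = (GREATEST s. p ^ s dvd m)"
  have dp: "degree p > 0" using irreducible_degree_pos p by blast
  have bound: "i \<le> degree m" if "p ^ i dvd m" for i
  proof -
    have "i \<le> i * degree p" using dp by simp
    also have "\<dots> = degree (p ^ i)" using p(1) by (subst degree_power_eq) (auto simp: irreducible_def)
    also have "\<dots> \<le> degree m" using dvd_imp_degree_le[OF that m(1)] .
    finally show ?thesis .
  qed
  have "p ^ s dvd m" unfolding s_def
    by (rule GreatestI_nat[of "\<lambda>s. p ^ s dvd m" 0 "degree m"]) (use bound in auto)
  then obtain h where h: "m = p ^ s * h" by (auto elim: dvdE)
  have s: "\<not> p ^ Suc s dvd m"
  proof
    assume "p ^ Suc s dvd m"
    then have "Suc s \<le> s" unfolding s_def
      by (intro Greatest_le_nat[of "\<lambda>s. p ^ s dvd m" _ "degree m"]) (use bound in auto)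
    then show False by simp
  qed
  then have "\<not> p dvd h" unfolding h by (metis dvd_refl mult.commute mult_dvd_mono power_Suc)
  then obtain a b where ab: "a * p ^ s + b * h = 1" using irreducible_poly_power_bezout[OF p(1)] by blast
  define U where "U = {v \<in> V. act (p ^ s) v = 0}"
  define W where "W = {v \<in> V. act h v = 0}"
  have sub: "m.subspace U" "m.subspace W" unfolding U_def W_def by (intro kernel_subspace V)+
  \<comment> \<open>The first term lies in \<open>U\<close> and the second in \<open>W\<close>:
    applying the missing factor completes each to a multiple of \<open>m\<close>, which kills
    \<open>V\<close>.\<close>
  have split: "v = act (b * h) v + act (a * p ^ s) v" for v
    using ab m.scale_left_distrib m.scale_one by (metis add.commute)
  have "v \<in> ssum U W" if "v \<in> V" for v
  proof -
    have kv: "act m v = 0" using m that unfolding kills_def by blast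
    have "act (b * h) v \<in> U" using V(1) that kv unfolding U_def h
      by (simp add: m.subspace_scale) (metis kv h m.scale_scale m.scale_zero_right mult.left_commute)
    moreover have "act (a * p ^ s) v \<in> W" using V(1) that unfolding W_def
      by (simp add: m.subspace_scale) (metis kv h m.scale_scale m.scale_zero_right mult.left_commute mult.commute)
    ultimately show ?thesis using split[of v] ssum_memI by metis
  qed
  moreover have "ssum U W \<subseteq> V" unfolding ssum_def U_def W_def using V(1) by (auto simp: m.subspace_add)
  moreover have "U \<inter> W = {0}"
  proof -
    have "v = 0" if "v \<in> U \<inter> W" for v using that split[of v] unfolding U_def W_def
      by (simp flip: m.scale_scale)
    then show ?thesis using sub m.subspace_0 by blast
  qed
  ultimately have "U = {0} \<or> W = {0}" using V(3) sub unfolding indec_def by blast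
  moreover have "U \<noteq> {0}"
  proof
    assume "U = {0}"
    then have "V = W" using \<open>ssum U W \<subseteq> V\<close> \<open>\<And>v. v \<in> V \<Longrightarrow> v \<in> ssum U W\<close> unfolding ssum_def by fastforce
    then have "kills h V" unfolding kills_def W_def by blast
    moreover have "h \<noteq> 0" using h m by auto
    moreover have "s > 0"
    proof (rule ccontr)
      assume "\<not> s > 0"
      then show False using s p(3) by simp
    qed
    then have "degree h < degree m" using h m(1) dp p(1) by (auto simp: degree_mult_eq degree_power_eq)
    ultimately show False using least[of h] m by simp
  qed
  ultimately have "W = {0}" by blast
  then have "V = U" using \<open>ssum U W \<subseteq> V\<close> \<open>\<And>v. v \<in> V \<Longrightarrow> v \<in> ssum U W\<close> unfolding ssum_def by fastforce
  then have "kills (p ^ s) V" unfolding kills_def U_def by blast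
  then show ?thesis using that p by blast
qed

text \<open>A cyclic submodule of maximal exponent is complemented: take a maximal submodule \<open>W\<close>
  meeting \<open>cyc u\<close> trivially; if \<open>v\<close> lies outside their sum but \<open>p v\<close> inside, then correcting \<open>v\<close>
  by a multiple of \<open>u\<close> gives \<open>p v \<in> W\<close>, and \<open>W + cyc v\<close> still meets \<open>cyc u\<close> trivially.\<close>

lemma maximal_cyclic_complement:
  assumes V: "m.subspace V" "fd V" and p: "irreducible p" and k: "kills (p ^ Suc s) V"
    and u: "u \<in> V" "act (p ^ s) u \<noteq> 0"
  obtains W where "m.subspace W" "W \<inter> cyc u = {0}" "V = ssum W (cyc u)"
proof -
  have ex: "exact (p ^ Suc s) u" using exact_prime_power[OF p _ u(2)] k u unfolding kills_def by blast
  define Q where "Q W \<longleftrightarrow> m.subspace W \<and> W \<subseteq> V \<and> W \<inter> cyc u = {0}" for W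
  have "Q {0}" unfolding Q_def using V m.subspace_0[OF cyc_subspace] by (auto simp: m.subspace_0)
  moreover have "\<forall>W. Q W \<longrightarrow> vs.dim W < Suc (vs.dim V)" unfolding Q_def using dim_mono[OF V(2)] by (simp add: less_Suc_eq_le)
  ultimately have "\<exists>W. Q W \<and> (\<forall>W'. Q W' \<longrightarrow> vs.dim W' \<le> vs.dim W)"
    by (rule ex_has_greatest_nat)
  then obtain W where W: "Q W" and max: "\<And>W'. Q W' \<Longrightarrow> vs.dim W' \<le> vs.dim W" by metis
  have subW: "m.subspace W" "W \<subseteq> V" "W \<inter> cyc u = {0}" using W unfolding Q_def by auto
  define S where "S = ssum W (cyc u)"
  have S: "m.subspace S" unfolding S_def by (rule ssum_subspace[OF subW(1) cyc_subspace])
  have SV: "S \<subseteq> V" unfolding S_def ssum_def using subW cyc_minimal[OF V(1) u(1)] V(1)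
    by (auto intro!: m.subspace_add)
  have WS: "W \<subseteq> S" "cyc u \<subseteq> S" unfolding S_def by (intro subset_ssum subW cyc_subspace)+
  have "V \<subseteq> S"
  proof (rule ccontr)
    assume "\<not> V \<subseteq> S"
    then obtain v0 where v0: "v0 \<in> V" "v0 \<notin> S" by blast
    \<comment> \<open>The last power of \<open>p\<close> that keeps \<open>v0\<close> outside
      \<open>S\<close> yields a vector \<open>v\<close> outside \<open>S\<close> with
      \<open>p v\<close> inside.\<close>
    define i where "i = (LEAST i. act (p ^ i) v0 \<in> S)"
    have e: "act (p ^ Suc s) v0 \<in> S" using k v0 m.subspace_0[OF S] unfolding kills_def by metis
    have i: "act (p ^ i) v0 \<in> S" unfolding i_def by (rule LeastI[of _ "Suc s"]) (rule e)
    have "i \<noteq> 0" using i v0 by (metis m.scale_one power_0)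
    then obtain i' where i': "i = Suc i'" by (cases i) auto
    define v where "v = act (p ^ i') v0"
    have vS: "v \<notin> S" unfolding v_def using not_less_Least[of i' "\<lambda>i. act (p ^ i) v0 \<in> S"] i' unfolding i_def by auto
    have vV: "v \<in> V" unfolding v_def using V v0 by (simp add: m.subspace_scale)
    have pv: "act p v \<in> S" using i unfolding i' v_def by simp
    then obtain w g where wg: "w \<in> W" "act p v = w + act g u" unfolding S_def ssum_def cyc_def by blast
    \<comment> \<open>Since \<open>p ^ Suc s\<close> kills \<open>v\<close>, applying
      \<open>p ^ s\<close> to the decomposition of \<open>p v\<close> puts \<open>p ^ s w\<close>
      into the zero intersection of \<open>W\<close> and \<open>cyc u\<close>. The remaining
      equation forces \<open>p\<close> to divide \<open>g\<close>.\<close>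
    have "act (p ^ s) w + act (p ^ s * g) u = act (p ^ Suc s) v"
      using wg(2) by (metis m.scale_right_distrib m.scale_scale power_Suc2)
    also have "\<dots> = 0" using k vV unfolding kills_def by blast
    finally have eq: "act (p ^ s) w = - act (p ^ s * g) u" by (simp add: eq_neg_iff_add_eq_0)
    have "act (p ^ s) w \<in> W" using wg subW by (simp add: m.subspace_scale)
    moreover have "act (p ^ s) w \<in> cyc u" unfolding eq by (intro m.subspace_neg cyc_subspace act_in_cyc)
    ultimately have "act (p ^ s) w = 0" using subW(3) by blast
    then have "act (p ^ s * g) u = 0" using eq by simp
    then have "p ^ s * p dvd p ^ s * g" using ex unfolding exact_def by (simp add: mult.commute)
    moreover have "p \<noteq> 0" using p by auto
    ultimately have "p dvd g" by (simp only: dvd_mult_cancel_left) auto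
    then obtain g' where g': "g = p * g'" by (auto elim: dvdE)
    define v' where "v' = v - act g' u"
    have pv': "act p v' = w" unfolding v'_def using wg g' by (simp add: m.scale_right_diff_distrib)
    have v'S: "v' \<notin> S"
    proof
      assume "v' \<in> S"
      then have "v' + act g' u \<in> S" using S WS by (meson act_in_cyc m.subspace_add subsetD)
      then show False using vS unfolding v'_def by simp
    qed
    have v'V: "v' \<in> V" unfolding v'_def using vV V u by (intro m.subspace_diff m.subspace_scale)
    define W' where "W' = ssum W (cyc v')"
    have subW': "m.subspace W'" unfolding W'_def by (rule ssum_subspace[OF subW(1) cyc_subspace])
    have "W' \<subseteq> V" unfolding W'_def ssum_def using subW cyc_minimal[OF V(1) v'V] V(1)
      by (auto intro!: m.subspace_add)
    moreover have "x = 0" if x: "x \<in> W'" "x \<in> cyc u" for x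
    proof -
      obtain w1 h where wh: "w1 \<in> W" "x = w1 + act h v'" using x(1) unfolding W'_def ssum_def cyc_def by blast
      obtain r where r: "x = act r u" using x(2) unfolding cyc_def by blast
      show "x = 0"
      proof (cases "p dvd h")
        case True
        then obtain h' where "h = h' * p" by (metis dvdE mult.commute)
        then have "act h v' = act h' w" using pv' by (metis m.scale_scale)
        then have "x \<in> W" using wh wg subW by (simp add: m.subspace_scale m.subspace_add)
        then show ?thesis using x subW by blast
      next
        case False
        \<comment> \<open>With \<open>p\<close> not dividing \<open>h\<close>, Bezout recovers
          \<open>v'\<close> from \<open>p v' = w\<close> and \<open>h v' = x - w1\<close>. Both lie
          in \<open>S\<close>, but \<open>v'\<close> does not.\<close>
        then obtain a b where ab: "a * p + b * h = 1" using irreducible_poly_bezout[OF p] by blast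
        have "v' = act (a * p) v' + act (b * h) v'" by (metis ab m.scale_left_distrib m.scale_one)
        also have "\<dots> = act a w + act b (x - w1)" using pv' wh by (simp flip: m.scale_scale)
        finally have "v' = act a w + act b (x - w1)" .
        moreover have "act a w \<in> S" using S WS wg by (blast intro: m.subspace_scale)
        moreover have "act b (x - w1) \<in> S" using S WS wh(1) x(2) by (blast intro: m.subspace_scale m.subspace_diff)
        ultimately show ?thesis using v'S S m.subspace_add by metis
      qed
    qed
    then have "W' \<inter> cyc u = {0}" using m.subspace_0[OF subW'] m.subspace_0[OF cyc_subspace] by blast
    ultimately have "Q W'" unfolding Q_def using subW' by blast
    \<comment> \<open>Maximality of the dimension forces \<open>W' = W\<close>, although
      \<open>v'\<close> belongs to \<open>W'\<close> and lies outside \<open>S\<close>.\<close>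
    then have "vs.dim W' \<le> vs.dim W" by (rule max)
    moreover have "W \<subseteq> W'" "v' \<in> W'" unfolding W'_def using subset_ssum[OF subW(1) cyc_subspace[of v']] self_in_cyc by blast+
    ultimately have "W = W'" using \<open>W' \<subseteq> V\<close> fd_mono[OF V(2)] subspace_scal[OF subW(1)]
      by (intro subspace_eq_of_dim_le) auto
    then show False using \<open>v' \<in> W'\<close> v'S WS by blast
  qed
  then show ?thesis using that[OF subW(1,3)] SV unfolding S_def by blast
qed

text \<open>Let \<open>s\<close> be the least exponent for which \<open>p ^ s\<close> kills
  \<open>V\<close>. A vector not killed by the previous power generates a direct summand, which must
  be all of \<open>V\<close>.\<close>

lemma indec_primary_cyc:
  assumes V: "m.subspace V" "fd V" "indec V"
  obtains p s where "primary_cyc V p s"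
proof -
  obtain p n where p: "irreducible p" "lead_coeff p = 1" "kills (p ^ n) V"
    using indec_killed_by_prime_power[OF V] by metis
  define s where "s = (LEAST s. kills (p ^ s) V)"
  have s: "kills (p ^ s) V" unfolding s_def by (rule LeastI[of _ n]) (rule p)
  have "s \<noteq> 0"
  proof
    assume "s = 0"
    then have "V \<subseteq> {0}" using s unfolding kills_def by auto
    then show False using V m.subspace_0[OF V(1)] unfolding indec_def by blast
  qed
  then obtain s' where s': "s = Suc s'" by (cases s) auto
  have "\<not> kills (p ^ s') V" using not_less_Least[of s' "\<lambda>s. kills (p ^ s) V"] s' unfolding s_def by auto
  then obtain u where u: "u \<in> V" "act (p ^ s') u \<noteq> 0" unfolding kills_def by blast
  obtain W where W: "m.subspace W" "W \<inter> cyc u = {0}" "V = ssum W (cyc u)"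
    using maximal_cyclic_complement[OF V(1,2) p(1) _ u] s s' by metis
  have "cyc u \<noteq> {0}" using u(2) act_in_cyc by (metis singletonD)
  then have "W = {0}" using V(3) W cyc_subspace unfolding indec_def by blast
  then have "V = cyc u" using W unfolding ssum_def by auto
  moreover have "exact (p ^ s) u" unfolding s'
    by (rule exact_prime_power[OF p(1) _ u(2)]) (use s s' u in \<open>auto simp: kills_def\<close>)
  ultimately show ?thesis using that p s' unfolding primary_cyc_def by (metis le_add1 plus_1_eq_Suc)
qed

text \<open>A submodule containing a vector not killed by \<open>p ^ (s - 1)\<close> contains the
  generator, because a multiplier prime to \<open>p\<close> is invertible modulo
  \<open>p ^ s\<close>. In a direct sum one of the two components of the generator is such a
  vector.\<close>

lemma primary_cyc_indec:
  assumes "primary_cyc V p s"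
  shows "indec V"
proof -
  obtain u where p: "irreducible p" "s \<ge> 1" and u: "V = cyc u" "exact (p ^ s) u"
    using assms unfolding primary_cyc_def by blast
  obtain t where t: "s = Suc t" using p(2) by (cases s) auto
  have nz: "act (p ^ t) u \<noteq> 0"
  proof
    assume "act (p ^ t) u = 0"
    then have "p ^ t * p dvd p ^ t * 1" using u(2) t unfolding exact_def by (simp add: mult.commute)
    moreover have "p \<noteq> 0" using p by auto
    ultimately have "p dvd 1" by (simp only: dvd_mult_cancel_left) auto
    then show False using p by (simp add: irreducible_def)
  qed
  have nzV: "V \<noteq> {0}" using nz u act_in_cyc by (metis singletonD)
  have big: "u \<in> U" if "m.subspace U" "U \<subseteq> V" "v \<in> U" "act (p ^ t) v \<noteq> 0" for U v
  proof -
    have "v \<in> cyc u" using that u by blast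
    then obtain r where r: "v = act r u" by (rule cycE)
    have "\<not> p dvd r"
    proof
      assume "p dvd r"
      then obtain q where q: "r = p * q" by (metis dvdE)
      have "act (p ^ t) v = act (q * p ^ s) u" unfolding r q t by (simp add: mult_ac)
      also have "\<dots> = 0" using u(2) unfolding exact_def by simp
      finally show False using that by simp
    qed
    then obtain a b where ab: "a * p ^ s + b * r = 1" using irreducible_poly_power_bezout[OF p(1)] by blast
    have "u = act (a * p ^ s) u + act (b * r) u" by (metis ab m.scale_left_distrib m.scale_one)
    also have "act (a * p ^ s) u = 0" using u(2) unfolding exact_def by simp
    also have "act (b * r) u = act b v" using r by simp
    finally show ?thesis using that by (simp add: m.subspace_scale)
  qed
  have "U = {0} \<or> W = {0}" if UW: "m.subspace U" "m.subspace W" "V = ssum U W" "U \<inter> W = {0}" for U W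
  proof -
    have sub: "U \<subseteq> V" "W \<subseteq> V" using subset_ssum UW by auto
    obtain x y where xy: "u = x + y" "x \<in> U" "y \<in> W" using UW u self_in_cyc unfolding ssum_def by blast
    have "act (p ^ t) x \<noteq> 0 \<or> act (p ^ t) y \<noteq> 0" using nz unfolding xy(1) by (auto simp: m.scale_right_distrib)
    then have "u \<in> U \<or> u \<in> W" using big UW sub xy by blast
    then have "V \<subseteq> U \<or> V \<subseteq> W" using UW cyc_minimal u by blast
    then show ?thesis using UW sub by blast
  qed
  then show ?thesis unfolding indec_def using nzV by blast
qed

subsection \<open>Direct sums and multiplicities\<close>

definition dsum :: "'v set \<Rightarrow> nat \<Rightarrow> (nat \<Rightarrow> 'v set) \<Rightarrow> bool" where
  "dsum V n U \<longleftrightarrow> V = {\<Sum>i<n. u i | u. \<forall>i<n. u i \<in> U i} \<and>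
     (\<forall>u. (\<forall>i<n. u i \<in> U i) \<longrightarrow> (\<Sum>i<n. u i) = 0 \<longrightarrow> (\<forall>i<n. u i = 0))"

lemma dsum_0 [simp]: "dsum V 0 U \<longleftrightarrow> V = {0}"
  by (auto simp: dsum_def)

lemma dsum_Suc:
  fixes U :: "nat \<Rightarrow> 'v set" and n
  defines "V' \<equiv> {\<Sum>i<n. u i | u. \<forall>i<n. u i \<in> U i}"
  assumes "dsum V (Suc n) U" "\<forall>i<Suc n. vs.subspace (U i)"
  shows "dsum V' n U" "V = ssum V' (U n)" "V' \<inter> U n = {0}" "vs.subspace V'"
proof -
  note assms = assms(2,3)
  have ind: "\<And>u i. (\<forall>i<Suc n. u i \<in> U i) \<Longrightarrow> (\<Sum>i<Suc n. u i) = 0 \<Longrightarrow> i < Suc n \<Longrightarrow> u i = 0"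
    using assms(1) unfolding dsum_def by blast
  have U0: "0 \<in> U i" if "i < Suc n" for i using assms(2) that vs.subspace_0 by blast
  show "dsum V' n U" unfolding dsum_def V'_def
  proof (intro conjI allI impI refl)
    fix u i assume u: "\<forall>i<n. u i \<in> U i" "(\<Sum>i<n. u i) = 0" "i < n"
    have "(u(n := 0)) i = 0" by (rule ind) (use u U0 in \<open>auto simp: less_Suc_eq\<close>)
    then show "u i = 0" using u by simp
  qed
  show "V = ssum V' (U n)"
  proof (intro equalityI subsetI)
    fix v assume "v \<in> V"
    then obtain u where "v = (\<Sum>i<Suc n. u i)" "\<forall>i<Suc n. u i \<in> U i" using assms(1) unfolding dsum_def by blast
    moreover have "(\<Sum>i<n. u i) \<in> V'" unfolding V'_def using calculation by auto
    ultimately show "v \<in> ssum V' (U n)" using ssum_memI[of "\<Sum>i<n. u i" V' "u n" "U n"] by simp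
  next
    fix v assume "v \<in> ssum V' (U n)"
    then obtain u w where "v = (\<Sum>i<n. u i) + w" "\<forall>i<n. u i \<in> U i" "w \<in> U n" unfolding ssum_def V'_def by blast
    then have "v = (\<Sum>i<Suc n. (u(n := w)) i) \<and> (\<forall>i<Suc n. (u(n := w)) i \<in> U i)" by (auto simp: less_Suc_eq)
    then show "v \<in> V" using assms(1) unfolding dsum_def by blast
  qed
  show "V' \<inter> U n = {0}"
  proof (intro equalityI subsetI)
    fix v assume "v \<in> V' \<inter> U n"
    then obtain u where u: "v = (\<Sum>i<n. u i)" "\<forall>i<n. u i \<in> U i" "v \<in> U n" unfolding V'_def by blast
    have "(u(n := -v)) n = 0"
      by (rule ind) (use u assms(2) in \<open>auto simp: less_Suc_eq vs.subspace_neg\<close>)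
    then show "v \<in> {0}" by simp
  next
    fix v :: 'v assume "v \<in> {0}"
    then show "v \<in> V' \<inter> U n" using U0 unfolding V'_def by (auto intro!: exI[of _ "\<lambda>_. 0"])
  qed
  show "vs.subspace V'"
  proof (rule vs.subspaceI)
    show "0 \<in> V'" using U0 unfolding V'_def by (auto intro!: exI[of _ "\<lambda>_. 0"])
  next
    fix x y assume "x \<in> V'" "y \<in> V'"
    then obtain u w where "x = (\<Sum>i<n. u i)" "y = (\<Sum>i<n. w i)" "\<forall>i<n. u i \<in> U i" "\<forall>i<n. w i \<in> U i" unfolding V'_def by blast
    then show "x + y \<in> V'" using assms(2) unfolding V'_def
      by (auto intro!: exI[of _ "\<lambda>i. u i + w i"] simp: sum.distrib vs.subspace_add)
  next
    fix c x assume "x \<in> V'"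
    then obtain u where "x = (\<Sum>i<n. u i)" "\<forall>i<n. u i \<in> U i" unfolding V'_def by blast
    then show "scal c x \<in> V'" using assms(2) unfolding V'_def
      by (auto intro!: exI[of _ "\<lambda>i. scal c (u i)"] simp: vs.scale_sum_right vs.subspace_scale)
  qed
qed

lemma dsum_piece_subset:
  assumes "dsum V n U" "\<forall>i<n. vs.subspace (U i)" "i < n"
  shows "U i \<subseteq> V"
proof
  fix v assume v: "v \<in> U i"
  have "v = (\<Sum>j<n. if j = i then v else 0)" using assms(3) by simp
  moreover have "\<forall>j<n. (if j = i then v else 0) \<in> U j" using v assms(2) vs.subspace_0 by auto
  ultimately show "v \<in> V" using assms(1) unfolding dsum_def by blast
qed

lemma dsum_dim:
  assumes "dsum V n U" "\<forall>i<n. vs.subspace (U i)" "fd V"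
  shows "vs.dim V = (\<Sum>i<n. vs.dim (U i))"
  using assms
proof (induction n arbitrary: V)
  case 0
  then show ?case using dim_zero_iff[of V] by simp
next
  case (Suc n)
  note S = dsum_Suc[OF Suc.prems(1,2)]
  let ?V' = "{\<Sum>i<n. u i | u. \<forall>i<n. u i \<in> U i}"
  have Un: "U n \<subseteq> V" using dsum_piece_subset[OF Suc.prems(1,2)] by simp
  have "?V' \<subseteq> V"
  proof
    fix v assume "v \<in> ?V'"
    then have "v + 0 \<in> ssum ?V' (U n)" using Suc.prems(2) vs.subspace_0 by (intro ssum_memI) auto
    then show "v \<in> V" unfolding S(2) by simp
  qed
  then have f: "fd ?V'" "fd (U n)" using Un Suc.prems(3) fd_mono by blast+
  have "vs.dim V = vs.dim ?V' + vs.dim (U n)"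
    unfolding S(2) using Suc.prems(2) f S(3,4) by (intro dim_direct_sum) auto
  also have "vs.dim ?V' = (\<Sum>i<n. vs.dim (U i))"
    by (rule Suc.IH[OF S(1)]) (use Suc.prems f in auto)
  finally show ?case by simp
qed

text \<open>The p-torsion inside \<open>p^j V\<close>. It depends on \<open>V\<close> only and is
  compatible with direct sums, so its dimension can count summands without reference to a
  decomposition.\<close>

definition layer :: "'v set \<Rightarrow> 'k poly \<Rightarrow> nat \<Rightarrow> 'v set" where
  "layer V p j = {v \<in> V. act p v = 0 \<and> (\<exists>w\<in>V. v = act (p ^ j) w)}"

lemma layer_subspace: "m.subspace V \<Longrightarrow> m.subspace (layer V p j)"
  unfolding m.subspace_def layer_def
  apply (auto simp: m.scale_right_distrib intro: bexI[of _ 0])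
  apply (metis m.scale_right_distrib)
  apply (metis m.scale_left_commute m.scale_scale m.scale_zero_right)
  apply (metis m.scale_left_commute m.scale_scale)
  done

text \<open>Components in a direct sum are unique, so both conditions on a sum hold summand by
  summand.\<close>

lemma layer_dsum:
  assumes "dsum V n U" "\<forall>i<n. m.subspace (U i)"
  shows "dsum (layer V p j) n (\<lambda>i. layer (U i) p j)"
proof -
  have ind: "\<And>u i. (\<forall>i<n. u i \<in> U i) \<Longrightarrow> (\<Sum>i<n. u i) = 0 \<Longrightarrow> i < n \<Longrightarrow> u i = 0"
    using assms(1) unfolding dsum_def by blast
  have V: "V = {\<Sum>i<n. u i | u. \<forall>i<n. u i \<in> U i}" using assms(1) unfolding dsum_def by blast
  have "layer V p j = {\<Sum>i<n. u i | u. \<forall>i<n. u i \<in> layer (U i) p j}"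
  proof (intro equalityI subsetI)
    fix v assume "v \<in> layer V p j"
    then obtain w where v: "v \<in> V" "act p v = 0" "w \<in> V" "v = act (p ^ j) w" unfolding layer_def by blast
    then obtain u x where u: "v = (\<Sum>i<n. u i)" "\<forall>i<n. u i \<in> U i" and x: "w = (\<Sum>i<n. x i)" "\<forall>i<n. x i \<in> U i"
      unfolding V by blast
    have "u i - act (p ^ j) (x i) = 0" if "i < n" for i
      by (rule ind[of "\<lambda>i. u i - act (p ^ j) (x i)"])
        (use that v u x assms(2) in \<open>auto simp: sum_subtractf m.scale_sum_right m.subspace_diff m.subspace_scale\<close>)
    moreover have "act p (u i) = 0" if "i < n" for i
      by (rule ind[of "\<lambda>i. act p (u i)"])
        (use that v(2) u assms(2) in \<open>auto simp: m.subspace_scale simp flip: m.scale_sum_right\<close>)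
    ultimately have "\<forall>i<n. u i \<in> layer (U i) p j" using u x unfolding layer_def by auto
    then show "v \<in> {\<Sum>i<n. u i | u. \<forall>i<n. u i \<in> layer (U i) p j}" using u by blast
  next
    fix v assume "v \<in> {\<Sum>i<n. u i | u. \<forall>i<n. u i \<in> layer (U i) p j}"
    then obtain u where u: "v = (\<Sum>i<n. u i)" "\<forall>i<n. u i \<in> layer (U i) p j" by blast
    then have "\<forall>i. \<exists>x. i < n \<longrightarrow> x \<in> U i \<and> u i = act (p ^ j) x" unfolding layer_def by blast
    then obtain x where x: "\<forall>i<n. x i \<in> U i \<and> u i = act (p ^ j) (x i)" by metis
    have "v \<in> V" unfolding V using u unfolding layer_def by blast
    moreover have "act p v = 0" using u unfolding layer_def by (simp add: m.scale_sum_right)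
    moreover have "v = act (p ^ j) (\<Sum>i<n. x i)" using u x by (simp add: m.scale_sum_right)
    moreover have "(\<Sum>i<n. x i) \<in> V" unfolding V using x by blast
    ultimately show "v \<in> layer V p j" unfolding layer_def by blast
  qed
  then show ?thesis unfolding dsum_def using ind unfolding layer_def by auto
qed

text \<open>For \<open>q = p\<close> and j < s the layer is generated by
  \<open>p ^ (s - 1) u\<close> and is a copy of \<open>k[x]/p\<close>; in all other cases it is
  zero.\<close>

lemma dim_layer_primary_cyc:
  assumes V: "primary_cyc V p s" and q: "irreducible q" "lead_coeff q = 1"
  shows "vs.dim (layer V q j) = (if q = p \<and> j < s then degree q else 0)"
proof -
  obtain u where p: "irreducible p" "lead_coeff p = 1" "s \<ge> 1" and u: "V = cyc u" "exact (p ^ s) u"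
    using V unfolding primary_cyc_def by blast
  show ?thesis
  proof (cases "q = p \<and> j < s")
    case True
    then obtain t where t: "s = Suc t" by (cases s) auto
    have "p \<noteq> 0" using p by auto
    then have pp: "p ^ Suc t dvd p * r \<longleftrightarrow> p ^ t dvd r" for r by simp
    have ex: "exact p (act (p ^ t) u)" unfolding exact_def
    proof
      fix r
      have "act r (act (p ^ t) u) = 0 \<longleftrightarrow> p ^ t * p dvd p ^ t * r"
        using u(2) t unfolding exact_def by (simp add: mult.commute)
      then show "act r (act (p ^ t) u) = 0 \<longleftrightarrow> p dvd r" using \<open>p \<noteq> 0\<close> by (simp only: dvd_mult_cancel_left) auto
    qed
    have "layer V p j = cyc (act (p ^ t) u)"
    proof (intro equalityI subsetI)
      fix v assume "v \<in> layer V p j"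
      then obtain r where r: "v = act r u" "act p v = 0" unfolding layer_def u by (auto elim: cycE)
      then have "p ^ t dvd r" using u(2) pp t unfolding exact_def by simp
      then obtain h where "r = h * p ^ t" by (metis dvdE mult.commute)
      then show "v \<in> cyc (act (p ^ t) u)" using r by (metis act_in_cyc m.scale_scale)
    next
      fix v assume "v \<in> cyc (act (p ^ t) u)"
      then obtain r where r: "v = act r (act (p ^ t) u)" by (metis cycE)
      have "act p v = act r (act (p ^ s) u)" unfolding r t by (simp add: mult.commute mult.left_commute)
      also have "act (p ^ s) u = 0" using u(2) unfolding exact_def by simp
      finally have "act p v = 0" by simp
      moreover have "v = act (p ^ j) (act (r * p ^ (t - j)) u)" unfolding r using True t
        by (simp add: mult.left_commute flip: power_add)
      moreover have "v \<in> V" unfolding r u by (simp)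
      ultimately show "v \<in> layer V p j" unfolding layer_def u by (metis (mono_tags, lifting) act_in_cyc mem_Collect_eq)
    qed
    then show ?thesis using True dim_cyc[OF ex] \<open>p \<noteq> 0\<close> by simp
  next
    case False
    have "v = 0" if v: "v \<in> layer V q j" for v
    proof (cases "q = p")
      case True
      then have "s \<le> j" using False by simp
      obtain r where "v = act (p ^ j) (act r u)" using v True unfolding layer_def u by (auto elim: cycE)
      then have "v = act (p ^ j * r) u" by simp
      moreover have "p ^ s dvd p ^ j * r" using \<open>s \<le> j\<close> by (simp add: le_imp_power_dvd)
      ultimately show ?thesis using u unfolding exact_def by simp
    next
      case False
      \<comment> \<open>Multiplication by a \<open>q\<close> prime to \<open>p\<close> is injective
        modulo \<open>p ^ s\<close>, so there is no q-torsion.\<close>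
      then have "\<not> p dvd q" using monic_irreducible_dvd_eq[OF p(1) q(1) p(2) q(2)] by blast
      obtain r where r: "v = act r u" "act q v = 0" using v unfolding layer_def u by (auto elim: cycE)
      then have "p ^ s dvd q * r" using u unfolding exact_def by simp
      then have "p ^ s dvd r" using irreducible_poly_power_dvd_mult[OF p(1) \<open>\<not> p dvd q\<close>] by blast
      then show ?thesis using r u unfolding exact_def by simp
    qed
    then have "layer V q j \<subseteq> {0}" by blast
    then have "vs.dim (layer V q j) = 0" using vs.dim_le_card[of _ "{}"] by simp
    then show ?thesis unfolding if_not_P[OF False] .
  qed
qed

lemma primary_cyc_count:
  assumes V: "fd V" and d: "dsum V n U" "\<forall>i<n. m.subspace (U i)" "\<forall>i<n. primary_cyc (U i) (p i) (s i)"
    and q: "irreducible q" "lead_coeff q = 1"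
  shows "card {i. i < n \<and> p i = q \<and> j < s i} * degree q = vs.dim (layer V q j)"
proof -
  have "layer V q j \<subseteq> V" unfolding layer_def by blast
  then have "fd (layer V q j)" using fd_mono V by blast
  then have "vs.dim (layer V q j) = (\<Sum>i<n. vs.dim (layer (U i) q j))"
    by (intro dsum_dim layer_dsum d) (use d in \<open>auto intro: subspace_scal layer_subspace\<close>)
  also have "\<dots> = (\<Sum>i<n. if p i = q \<and> j < s i then degree q else 0)"
  proof (rule sum.cong)
    fix i assume "i \<in> {..<n}"
    then show "vs.dim (layer (U i) q j) = (if p i = q \<and> j < s i then degree q else 0)"
      using dim_layer_primary_cyc[OF _ q] d(3) by auto
  qed simp
  also have "\<dots> = (\<Sum>i\<in>{..<n} \<inter> {i. p i = q \<and> j < s i}. degree q)"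
    by (subst sum.inter_restrict) auto
  also have "\<dots> = card ({..<n} \<inter> {i. p i = q \<and> j < s i}) * degree q" by simp
  also have "{..<n} \<inter> {i. p i = q \<and> j < s i} = {i. i < n \<and> p i = q \<and> j < s i}" by auto
  finally show ?thesis by simp
qed

text \<open>Layers determine, for every \<open>j\<close>, how many summands have prime
  \<open>q\<close> and exponent above \<open>j\<close>. The difference of these numbers for t - 1
  and t is the multiplicity of the label with prime \<open>q\<close> and exponent
  \<open>t\<close>.\<close>

lemma primary_decomposition_unique:
  assumes V: "fd V" and d: "dsum V n U" "\<forall>i<n. m.subspace (U i)" "\<forall>i<n. primary_cyc (U i) (p i) (s i)"
    and d': "dsum V n' U'" "\<forall>i<n'. m.subspace (U' i)" "\<forall>i<n'. primary_cyc (U' i) (p' i) (s' i)"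
  shows "image_mset (\<lambda>i. (p i, s i)) (mset_set {..<n}) = image_mset (\<lambda>i. (p' i, s' i)) (mset_set {..<n'})"
proof (rule multiset_eqI)
  fix x :: "'k poly \<times> nat"
  obtain q t where x: "x = (q, t)" by (cases x)
  have cnt: "count (image_mset (\<lambda>i. (p i, s i)) (mset_set {..<n})) (q, t) = card {i. i < n \<and> p i = q \<and> s i = t}"
    for n and p :: "nat \<Rightarrow> 'k poly" and s
    by (simp add: count_image_mset_eq_card_vimage)
  show "count (image_mset (\<lambda>i. (p i, s i)) (mset_set {..<n})) x = count (image_mset (\<lambda>i. (p' i, s' i)) (mset_set {..<n'})) x"
  proof (cases "irreducible q \<and> lead_coeff q = 1 \<and> t \<ge> 1")
    case True
    then have q: "irreducible q" "lead_coeff q = 1" and t: "t = Suc (t - 1)" by auto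
    have dq: "degree q > 0" using irreducible_degree_pos q by blast
    have eq: "card {i. i < n \<and> p i = q \<and> j < s i} = card {i. i < n' \<and> p' i = q \<and> j < s' i}" for j
    proof -
      have "card {i. i < n \<and> p i = q \<and> j < s i} * degree q = card {i. i < n' \<and> p' i = q \<and> j < s' i} * degree q"
        using primary_cyc_count[OF V d q, of j] primary_cyc_count[OF V d' q, of j] by (rule trans[OF _ sym])
      then show ?thesis using dq by (simp only: mult_cancel2) auto
    qed
    have split: "card {i. i < n \<and> p i = q \<and> t - 1 < s i} = card {i. i < n \<and> p i = q \<and> s i = t} + card {i. i < n \<and> p i = q \<and> t < s i}"
      for n and p :: "nat \<Rightarrow> 'k poly" and s
    proof -
      have "{i. i < n \<and> p i = q \<and> t - 1 < s i} = {i. i < n \<and> p i = q \<and> s i = t} \<union> {i. i < n \<and> p i = q \<and> t < s i}"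
        using t by auto
      then show ?thesis by (simp add: card_Un_disjoint disjoint_iff)
    qed
    show ?thesis unfolding x cnt using split[of n p s] split[of n' p' s'] eq[of t] eq[of "t - 1"] by simp
  next
    case False
    have "{i. i < n \<and> p i = q \<and> s i = t} = {}" "{i. i < n' \<and> p' i = q \<and> s' i = t} = {}"
      using False d(3) d'(3) unfolding primary_cyc_def by auto
    then show ?thesis by (simp only: x cnt)
  qed
qed

lemma dsum_append:
  assumes V: "V = ssum A B" "A \<inter> B = {0}" and A: "m.subspace A" "dsum A n U" and B: "m.subspace B" "dsum B n' U'"
  shows "dsum V (n + n') (\<lambda>i. if i < n then U i else U' (i - n))"
proof -
  let ?W = "\<lambda>i. if i < n then U i else U' (i - n)"
  have sum_split: "(\<Sum>i<n + n'. u i) = (\<Sum>i<n. u i) + (\<Sum>i<n'. u (n + i))" for u :: "nat \<Rightarrow> 'v"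
    by (induction n') (simp_all add: add.assoc)
  have W: "(\<forall>i<n. u i \<in> U i) \<and> (\<forall>i<n'. u (n + i) \<in> U' i)" if u: "\<forall>i<n + n'. u i \<in> ?W i" for u
  proof (intro conjI allI impI)
    show "u i \<in> U i" if "i < n" for i using u[rule_format, of i] that by simp
    show "u (n + i) \<in> U' i" if "i < n'" for i using u[rule_format, of "n + i"] that by simp
  qed
  have A': "A = {\<Sum>i<n. u i | u. \<forall>i<n. u i \<in> U i}" and B': "B = {\<Sum>i<n'. u i | u. \<forall>i<n'. u i \<in> U' i}"
    using A B unfolding dsum_def by blast+
  have "V = {\<Sum>i<n + n'. u i | u. \<forall>i<n + n'. u i \<in> ?W i}"
  proof (intro equalityI subsetI)
    fix v assume "v \<in> V"
    then obtain u w where uw: "v = (\<Sum>i<n. u i) + (\<Sum>i<n'. w i)" "\<forall>i<n. u i \<in> U i" "\<forall>i<n'. w i \<in> U' i"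
      unfolding V(1) ssum_def A' B' by blast
    let ?u = "\<lambda>i. if i < n then u i else w (i - n)"
    have "v = (\<Sum>i<n + n'. ?u i)" unfolding sum_split uw(1) by simp
    moreover have "\<forall>i<n + n'. ?u i \<in> ?W i" using uw by auto
    ultimately show "v \<in> {\<Sum>i<n + n'. u i | u. \<forall>i<n + n'. u i \<in> ?W i}"
      by (intro CollectI exI[of _ ?u] conjI)
  next
    fix v assume "v \<in> {\<Sum>i<n + n'. u i | u. \<forall>i<n + n'. u i \<in> ?W i}"
    then obtain u where u: "v = (\<Sum>i<n + n'. u i)" "\<forall>i<n + n'. u i \<in> ?W i" by blast
    have "(\<Sum>i<n. u i) \<in> A" unfolding A' using W[OF u(2)] by blast
    moreover have "(\<Sum>i<n'. u (n + i)) \<in> B" unfolding B' using W[OF u(2)] by (intro CollectI exI[of _ "\<lambda>i. u (n + i)"]) simp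
    ultimately show "v \<in> V" unfolding V(1) u(1) sum_split by (rule ssum_memI)
  qed
  moreover have "u i = 0" if u: "\<forall>i<n + n'. u i \<in> ?W i" "(\<Sum>i<n + n'. u i) = 0" and i: "i < n + n'" for u i
  proof -
    have a: "(\<Sum>i<n. u i) \<in> A" unfolding A' using W[OF u(1)] by blast
    have b: "(\<Sum>i<n'. u (n + i)) \<in> B" unfolding B' using W[OF u(1)] by (intro CollectI exI[of _ "\<lambda>i. u (n + i)"]) simp
    have "(\<Sum>i<n. u i) = - (\<Sum>i<n'. u (n + i))" using u(2) unfolding sum_split by (simp add: eq_neg_iff_add_eq_0)
    then have "(\<Sum>i<n. u i) \<in> B" using m.subspace_neg[OF B(1) b] by simp
    then have z: "(\<Sum>i<n. u i) = 0" using a V(2) by blast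
    then have z': "(\<Sum>i<n'. u (n + i)) = 0" using u(2) unfolding sum_split by simp
    show "u i = 0"
    proof (cases "i < n")
      case True
      show ?thesis
        by (rule A(2)[unfolded dsum_def, THEN conjunct2, rule_format]) (use W[OF u(1)] z True in auto)
    next
      case False
      then have i': "i - n < n'" "n + (i - n) = i" using i by auto
      have "(\<lambda>i. u (n + i)) (i - n) = 0"
        by (rule B(2)[unfolded dsum_def, THEN conjunct2, rule_format]) (use W[OF u(1)] z' i' in auto)
      then show ?thesis using i' by simp
    qed
  qed
  ultimately show ?thesis unfolding dsum_def by blast
qed

text \<open>Reduces statements compatible with direct sums to indecomposable submodules; it yields
  the existence of decompositions and, later, the formula for the product of two module
  classes.\<close>

lemma fd_induct [consumes 2, case_names zero indec sum]:
  assumes V: "m.subspace V" "fd V" and zero: "P {0}"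
    and ind: "\<And>V. m.subspace V \<Longrightarrow> fd V \<Longrightarrow> indec V \<Longrightarrow> P V"
    and sum: "\<And>A B. m.subspace A \<Longrightarrow> m.subspace B \<Longrightarrow> fd A \<Longrightarrow> fd B \<Longrightarrow> A \<inter> B = {0} \<Longrightarrow> P A \<Longrightarrow> P B \<Longrightarrow> P (ssum A B)"
  shows "P V"
  using V
proof (induction "vs.dim V" arbitrary: V rule: less_induct)
  case less
  show ?case
  proof (cases "V = {0} \<or> indec V")
    case True
    then show ?thesis using zero ind less.prems by blast
  next
    case False
    then obtain A B where AB: "m.subspace A" "m.subspace B" "V = ssum A B" "A \<inter> B = {0}" "A \<noteq> {0}" "B \<noteq> {0}"
      unfolding indec_def by blast
    have sub: "A \<subseteq> V" "B \<subseteq> V" using subset_ssum AB by auto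
    then have f: "fd A" "fd B" using less.prems fd_mono by blast+
    have "vs.dim V = vs.dim A + vs.dim B" unfolding AB(3)
      by (intro dim_direct_sum subspace_scal) (use AB f in auto)
    moreover have "vs.dim A \<noteq> 0" "vs.dim B \<noteq> 0" using dim_zero_iff f AB m.subspace_0 by blast+
    ultimately have "P A" "P B" using less.hyps AB f by auto
    then show ?thesis unfolding AB(3) using sum AB f by blast
  qed
qed

lemma indec_decomposition_exists:
  assumes "m.subspace V" "fd V"
  shows "\<exists>n U. dsum V n U \<and> (\<forall>i<n. m.subspace (U i) \<and> indec (U i))"
  using assms
proof (induction rule: fd_induct)
  case zero
  show ?case by (rule exI[of _ 0]) simp
next
  case (indec V)
  have "dsum V 1 (\<lambda>_. V)" unfolding dsum_def by (auto intro: exI[of _ "\<lambda>_. _"])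
  then show ?case using indec by (intro exI[of _ 1] exI[of _ "\<lambda>_. V"]) auto
next
  case (sum A B)
  then obtain n U n' U' where "dsum A n U" "\<forall>i<n. m.subspace (U i) \<and> indec (U i)"
    and "dsum B n' U'" "\<forall>i<n'. m.subspace (U' i) \<and> indec (U' i)" by blast
  then show ?case using sum(1,2,5)
    by (intro exI[of _ "n + n'"] exI[of _ "\<lambda>i. if i < n then U i else U' (i - n)"] conjI dsum_append[OF refl]) auto
qed

end


section \<open>Module records modelled on submodules of a type\<close>

text \<open>A module record \<open>M\<close> is studied through an isomorphism \<open>h\<close> onto a submodule \<open>V\<close> of a module whose
  elements fill a type.\<close>

locale rec_iso = Modules.module act
  for act :: "'r::comm_ring_1 \<Rightarrow> 'v::ab_group_add \<Rightarrow> 'v" +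
  fixes M :: "('r, 'w, 'm) module_scheme" and V :: "'v set" and h :: "'w \<Rightarrow> 'v"
  assumes V: "subspace V"
    and h_bij: "bij_betw h (carrier M) V"
    and M_zero: "\<zero>\<^bsub>M\<^esub> \<in> carrier M" "h \<zero>\<^bsub>M\<^esub> = 0"
    and M_add: "\<And>x y. x \<in> carrier M \<Longrightarrow> y \<in> carrier M \<Longrightarrow> x \<oplus>\<^bsub>M\<^esub> y \<in> carrier M"
      "\<And>x y. x \<in> carrier M \<Longrightarrow> y \<in> carrier M \<Longrightarrow> h (x \<oplus>\<^bsub>M\<^esub> y) = h x + h y"
    and M_smult: "\<And>r x. x \<in> carrier M \<Longrightarrow> r \<odot>\<^bsub>M\<^esub> x \<in> carrier M"
      "\<And>r x. x \<in> carrier M \<Longrightarrow> h (r \<odot>\<^bsub>M\<^esub> x) = act r (h x)"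
begin

lemma h_inj: "inj_on h (carrier M)" and h_image: "h ` carrier M = V"
  using h_bij by (auto simp: bij_betw_def)

lemma h_in: "x \<in> carrier M \<Longrightarrow> h x \<in> V"
  using h_image by blast

lemma h_eqD: "h x = h y \<Longrightarrow> x \<in> carrier M \<Longrightarrow> y \<in> carrier M \<Longrightarrow> x = y"
  using h_inj by (auto dest: inj_onD)

lemma abelian_group: "abelian_group M"
proof (rule abelian_groupI)
  fix x y z assume xyz: "x \<in> carrier M" "y \<in> carrier M" "z \<in> carrier M"
  show "x \<oplus>\<^bsub>M\<^esub> y \<in> carrier M" using xyz M_add by blast
  show "x \<oplus>\<^bsub>M\<^esub> y \<oplus>\<^bsub>M\<^esub> z = x \<oplus>\<^bsub>M\<^esub> (y \<oplus>\<^bsub>M\<^esub> z)" by (rule h_eqD) (simp_all add: M_add xyz add.assoc)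
  show "x \<oplus>\<^bsub>M\<^esub> y = y \<oplus>\<^bsub>M\<^esub> x" by (rule h_eqD) (simp_all add: M_add xyz add.commute)
next
  fix x assume x: "x \<in> carrier M"
  show "\<zero>\<^bsub>M\<^esub> \<oplus>\<^bsub>M\<^esub> x = x" by (rule h_eqD) (simp_all add: M_add M_zero x)
  \<comment> \<open>The action of -1 supplies additive inverses.\<close>
  show "\<exists>y\<in>carrier M. y \<oplus>\<^bsub>M\<^esub> x = \<zero>\<^bsub>M\<^esub>"
    by (rule bexI[of _ "(-1) \<odot>\<^bsub>M\<^esub> x"], rule h_eqD) (simp_all add: M_add M_zero M_smult x)
qed (rule M_zero)

lemma is_module: "is_module M"
proof (rule moduleI)
  fix a b :: 'r and x y assume x: "x \<in> carrier M" and y: "y \<in> carrier M"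
  show "a \<odot>\<^bsub>M\<^esub> x \<in> carrier M" using x M_smult by blast
  show "(a \<oplus>\<^bsub>ring_of_type_algebra\<^esub> b) \<odot>\<^bsub>M\<^esub> x = a \<odot>\<^bsub>M\<^esub> x \<oplus>\<^bsub>M\<^esub> b \<odot>\<^bsub>M\<^esub> x"
    by (rule h_eqD) (simp_all add: ring_of_type_algebra_def M_add M_smult x scale_left_distrib)
  show "a \<odot>\<^bsub>M\<^esub> (x \<oplus>\<^bsub>M\<^esub> y) = a \<odot>\<^bsub>M\<^esub> x \<oplus>\<^bsub>M\<^esub> a \<odot>\<^bsub>M\<^esub> y"
    by (rule h_eqD) (simp_all add: M_add M_smult x y scale_right_distrib)
  show "(a \<otimes>\<^bsub>ring_of_type_algebra\<^esub> b) \<odot>\<^bsub>M\<^esub> x = a \<odot>\<^bsub>M\<^esub> (b \<odot>\<^bsub>M\<^esub> x)"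
    by (rule h_eqD) (simp_all add: ring_of_type_algebra_def M_smult x)
  show "\<one>\<^bsub>ring_of_type_algebra\<^esub> \<odot>\<^bsub>M\<^esub> x = x"
    by (rule h_eqD) (simp_all add: ring_of_type_algebra_def M_smult x)
qed (use abelian_group in \<open>auto intro: cring_from_type_algebra\<close>)

lemma h_finsum:
  assumes "finite A" "u \<in> A \<rightarrow> carrier M"
  shows "finsum M u A \<in> carrier M" "h (finsum M u A) = (\<Sum>a\<in>A. h (u a))"
proof -
  interpret M: abelian_group M by (rule abelian_group)
  show "finsum M u A \<in> carrier M" using assms by (simp add: M.finsum_closed)
  show "h (finsum M u A) = (\<Sum>a\<in>A. h (u a))" using assms
    by (induction A) (simp_all add: M_zero M_add M.finsum_closed)
qed

lemma is_submodule_iff: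
  assumes "U \<subseteq> carrier M"
  shows "is_submodule U M \<longleftrightarrow> subspace (h ` U)"
proof
  assume U: "is_submodule U M"
  note U' = module.submoduleE[OF is_module U] and z = subgroup.one_closed[OF submodule.axioms(1)[OF U]]
  have "0 \<in> h ` U" using z M_zero by (metis imageI monoid.simps(2))
  moreover have "h x + h y \<in> h ` U" if "x \<in> U" "y \<in> U" for x y
  proof -
    have "h x + h y = h (x \<oplus>\<^bsub>M\<^esub> y)" using that assms M_add by (metis subsetD)
    then show ?thesis using U'(5)[OF that] by simp
  qed
  moreover have "act r (h x) \<in> h ` U" if "x \<in> U" for r x
  proof -
    have "act r (h x) = h (r \<odot>\<^bsub>M\<^esub> x)" using that assms M_smult by (metis subsetD)
    then show ?thesis using U'(4)[OF _ that, of r] by (simp add: ring_of_type_algebra_def)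
  qed
  ultimately show "subspace (h ` U)" unfolding subspace_def by blast
next
  assume S: "subspace (h ` U)"
  have in_U: "x \<in> U" if "x \<in> carrier M" "h x \<in> h ` U" for x using that assms h_eqD by blast
  have sm: "r \<odot>\<^bsub>M\<^esub> x \<in> U" if "x \<in> U" for r x
  proof -
    have x: "x \<in> carrier M" using that assms by blast
    then have "h (r \<odot>\<^bsub>M\<^esub> x) = act r (h x)" by (rule M_smult(2))
    then show ?thesis using in_U[OF M_smult(1)[OF x]] subspace_scale[OF S imageI[OF that]] by simp
  qed
  show "is_submodule U M"
  proof (rule module.submoduleI[OF is_module assms])
    show "\<zero>\<^bsub>M\<^esub> \<in> U" using in_U M_zero subspace_0[OF S] by simp
    show "x \<oplus>\<^bsub>M\<^esub> y \<in> U" if "x \<in> U" "y \<in> U" for x y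
    proof -
      have xy: "x \<in> carrier M" "y \<in> carrier M" using that assms by blast+
      then have "h (x \<oplus>\<^bsub>M\<^esub> y) = h x + h y" by (rule M_add(2))
      then show ?thesis using in_U[OF M_add(1)[OF xy]] subspace_add[OF S imageI[OF that(1)] imageI[OF that(2)]] by simp
    qed
    show "r \<odot>\<^bsub>M\<^esub> x \<in> U" if "x \<in> U" for r x using sm that .
    show "\<ominus>\<^bsub>M\<^esub> x \<in> U" if x: "x \<in> U" for x
    proof -
      interpret M: abelian_group M by (rule abelian_group)
      have xc: "x \<in> carrier M" using x assms by blast
      have "(-1) \<odot>\<^bsub>M\<^esub> x \<oplus>\<^bsub>M\<^esub> x = \<zero>\<^bsub>M\<^esub>" by (rule h_eqD) (simp_all add: M_add M_smult M_zero xc)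
      then have "\<ominus>\<^bsub>M\<^esub> x = (-1) \<odot>\<^bsub>M\<^esub> x" using M.minus_equality xc M_smult by blast
      then show ?thesis using sm x by simp
    qed
  qed
qed

lemma restrict:
  assumes "is_submodule U M"
  shows "rec_iso act (M\<lparr>carrier := U\<rparr>) (h ` U) h"
proof -
  have sub: "U \<subseteq> carrier M" using module.submoduleE[OF is_module assms] by blast
  have S: "subspace (h ` U)" using is_submodule_iff[OF sub] assms by blast
  have in_U: "x \<in> U" if "x \<in> carrier M" "h x \<in> h ` U" for x using that sub h_eqD by blast
  show ?thesis
  proof
    show "bij_betw h (carrier (M\<lparr>carrier := U\<rparr>)) (h ` U)" using h_inj sub by (auto simp: bij_betw_def inj_on_subset)
    show "\<zero>\<^bsub>M\<lparr>carrier := U\<rparr>\<^esub> \<in> carrier (M\<lparr>carrier := U\<rparr>)" using in_U M_zero subspace_0[OF S] by simp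
    show "h \<zero>\<^bsub>M\<lparr>carrier := U\<rparr>\<^esub> = 0" using M_zero by simp
    fix x y r assume x: "x \<in> carrier (M\<lparr>carrier := U\<rparr>)"
    then have x': "x \<in> U" "x \<in> carrier M" using sub by auto
    show "r \<odot>\<^bsub>M\<lparr>carrier := U\<rparr>\<^esub> x \<in> carrier (M\<lparr>carrier := U\<rparr>)"
      using in_U M_smult x' subspace_scale[OF S] by simp
    show "h (r \<odot>\<^bsub>M\<lparr>carrier := U\<rparr>\<^esub> x) = act r (h x)" using M_smult x' by simp
    assume y: "y \<in> carrier (M\<lparr>carrier := U\<rparr>)"
    then have y': "y \<in> U" "y \<in> carrier M" using sub by auto
    show "x \<oplus>\<^bsub>M\<lparr>carrier := U\<rparr>\<^esub> y \<in> carrier (M\<lparr>carrier := U\<rparr>)"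
      using in_U M_add x' y' subspace_add[OF S] by simp
    show "h (x \<oplus>\<^bsub>M\<lparr>carrier := U\<rparr>\<^esub> y) = h x + h y" using M_add x' y' by simp
  qed (rule S)
qed

lemma preimage_submodule:
  assumes "subspace W" "W \<subseteq> V"
  obtains U where "is_submodule U M" "h ` U = W"
proof -
  have "h ` {x \<in> carrier M. h x \<in> W} = W" using assms h_image by blast
  moreover from this have "is_submodule {x \<in> carrier M. h x \<in> W} M" using assms by (subst is_submodule_iff) auto
  ultimately show ?thesis using that by blast
qed

end

lemma module_isoI:
  assumes "bij_betw h (carrier M) (carrier N)"
    and "\<And>x y. x \<in> carrier M \<Longrightarrow> y \<in> carrier M \<Longrightarrow> h (x \<oplus>\<^bsub>M\<^esub> y) = h x \<oplus>\<^bsub>N\<^esub> h y"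
    and "\<And>r x. x \<in> carrier M \<Longrightarrow> h (r \<odot>\<^bsub>M\<^esub> x) = r \<odot>\<^bsub>N\<^esub> h x"
  shows "module_iso M N"
  unfolding module_iso_def
  by (rule bexI[of _ h]) (use assms in \<open>auto simp: iso_def hom_def bij_betw_def\<close>)

lemma module_isoE:
  assumes "module_iso M N"
  obtains h where "bij_betw h (carrier M) (carrier N)"
    "\<And>x y. x \<in> carrier M \<Longrightarrow> y \<in> carrier M \<Longrightarrow> h (x \<oplus>\<^bsub>M\<^esub> y) = h x \<oplus>\<^bsub>N\<^esub> h y"
    "\<And>r x. x \<in> carrier M \<Longrightarrow> h (r \<odot>\<^bsub>M\<^esub> x) = r \<odot>\<^bsub>N\<^esub> h x"
proof -
  obtain h where "h \<in> iso (add_monoid M) (add_monoid N)" "\<forall>r. \<forall>v\<in>carrier M. h (r \<odot>\<^bsub>M\<^esub> v) = r \<odot>\<^bsub>N\<^esub> h v"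
    using assms unfolding module_iso_def by blast
  then show ?thesis using that[of h] unfolding iso_def hom_def by simp
qed

lemma rec_iso_compose:
  assumes M: "is_module M" and iso: "module_iso M N" and N: "rec_iso act N V g"
  obtains h where "rec_iso act M V h"
proof -
  interpret N: rec_iso act N V g by (rule N)
  interpret M: Module.module ring_of_type_algebra M by (rule M)
  obtain f where f: "bij_betw f (carrier M) (carrier N)"
    "\<And>x y. x \<in> carrier M \<Longrightarrow> y \<in> carrier M \<Longrightarrow> f (x \<oplus>\<^bsub>M\<^esub> y) = f x \<oplus>\<^bsub>N\<^esub> f y"
    "\<And>r x. x \<in> carrier M \<Longrightarrow> f (r \<odot>\<^bsub>M\<^esub> x) = r \<odot>\<^bsub>N\<^esub> f x" using module_isoE[OF iso] by blast
  have fin: "f x \<in> carrier N" if "x \<in> carrier M" for x using f(1) that by (auto simp: bij_betw_def)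
  have "rec_iso act M V (g \<circ> f)"
  proof
    show "bij_betw (g \<circ> f) (carrier M) V" using f(1) N.h_bij by (rule bij_betw_trans)
    have "g (f (\<zero>\<^bsub>M\<^esub> \<oplus>\<^bsub>M\<^esub> \<zero>\<^bsub>M\<^esub>)) = g (f \<zero>\<^bsub>M\<^esub>) + g (f \<zero>\<^bsub>M\<^esub>)"
      unfolding f(2)[OF M.M.zero_closed M.M.zero_closed] by (simp add: N.M_add fin)
    then show "(g \<circ> f) \<zero>\<^bsub>M\<^esub> = 0" by simp
  qed (use fin f N.M_add N.M_smult N.V in \<open>auto simp: ring_of_type_algebra_def\<close>)
  then show ?thesis using that by blast
qed

lemma rec_iso_module_iso:
  assumes M: "rec_iso act M V h" and N: "rec_iso act N V g"
  shows "module_iso M N"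
proof -
  interpret M: rec_iso act M V h by (rule M)
  interpret N: rec_iso act N V g by (rule N)
  let ?k = "inv_into (carrier N) g"
  have k: "?k v \<in> carrier N" "g (?k v) = v" if "v \<in> V" for v
    using that N.h_image by (auto intro: inv_into_into f_inv_into_f)
  show ?thesis
  proof (rule module_isoI[of "?k \<circ> h"])
    show "bij_betw (?k \<circ> h) (carrier M) (carrier N)"
      using M.h_bij bij_betw_inv_into[OF N.h_bij] by (rule bij_betw_trans)
    fix x y r assume x: "x \<in> carrier M"
    show "(?k \<circ> h) (r \<odot>\<^bsub>M\<^esub> x) = r \<odot>\<^bsub>N\<^esub> (?k \<circ> h) x"
      by (rule N.h_eqD) (simp_all add: k M.M_smult N.M_smult M.h_in x M.subspace_scale[OF M.V])
    assume y: "y \<in> carrier M"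
    show "(?k \<circ> h) (x \<oplus>\<^bsub>M\<^esub> y) = (?k \<circ> h) x \<oplus>\<^bsub>N\<^esub> (?k \<circ> h) y"
      by (rule N.h_eqD) (simp_all add: k M.M_add N.M_add M.h_in x y M.subspace_add[OF M.V])
  qed
qed

lemma module_iso_trans: "module_iso L M \<Longrightarrow> module_iso M N \<Longrightarrow> module_iso L N"
proof -
  assume "module_iso L M" "module_iso M N"
  obtain f where f: "bij_betw f (carrier L) (carrier M)"
    "\<And>x y. x \<in> carrier L \<Longrightarrow> y \<in> carrier L \<Longrightarrow> f (x \<oplus>\<^bsub>L\<^esub> y) = f x \<oplus>\<^bsub>M\<^esub> f y"
    "\<And>r x. x \<in> carrier L \<Longrightarrow> f (r \<odot>\<^bsub>L\<^esub> x) = r \<odot>\<^bsub>M\<^esub> f x"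
    using module_isoE[OF \<open>module_iso L M\<close>] by blast
  obtain g where g: "bij_betw g (carrier M) (carrier N)"
    "\<And>x y. x \<in> carrier M \<Longrightarrow> y \<in> carrier M \<Longrightarrow> g (x \<oplus>\<^bsub>M\<^esub> y) = g x \<oplus>\<^bsub>N\<^esub> g y"
    "\<And>r x. x \<in> carrier M \<Longrightarrow> g (r \<odot>\<^bsub>M\<^esub> x) = r \<odot>\<^bsub>N\<^esub> g x"
    using module_isoE[OF \<open>module_iso M N\<close>] by blast
  have "f x \<in> carrier M" if "x \<in> carrier L" for x using f(1) that by (auto simp: bij_betw_def)
  then show ?thesis using f g by (intro module_isoI[of "g \<circ> f"]) (auto intro: bij_betw_trans)
qed

text \<open>Transport of structure along a bijection. It produces the modules on lists of which
  isomorphism classes consist.\<close>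

lemma rec_iso_model_exists:
  assumes act: "Modules.module act" and V: "Modules.module.subspace act V" and g: "bij_betw g C V"
  obtains N :: "('r::comm_ring_1, 'w) module" where "rec_iso act N V g"
proof -
  interpret Modules.module act by (rule act)
  let ?k = "inv_into C g"
  have k: "?k v \<in> C" "g (?k v) = v" if "v \<in> V" for v
    using that g by (auto simp: bij_betw_def intro: inv_into_into f_inv_into_f)
  have gin: "g x \<in> V" if "x \<in> C" for x using that g by (auto simp: bij_betw_def)
  define N :: "('r, 'w) module" where
    "N = \<lparr>carrier = C, monoid.mult = (\<lambda>_ _. undefined), one = undefined, ring.zero = ?k 0,
      add = (\<lambda>x y. ?k (g x + g y)), module.smult = (\<lambda>r x. ?k (act r (g x)))\<rparr>"
  have "rec_iso act N V g"
    by standard (use V g k gin subspace_0[OF V] subspace_add[OF V] subspace_scale[OF V] in \<open>auto simp: N_def\<close>)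
  then show ?thesis using that by blast
qed

definition trec :: "('r \<Rightarrow> 'v \<Rightarrow> 'v) \<Rightarrow> 'v::ab_group_add set \<Rightarrow> ('r, 'v) module" where
  "trec act V = \<lparr>carrier = V, monoid.mult = (\<lambda>_ _. 0), one = 0, ring.zero = 0, add = (+), module.smult = act\<rparr>"

lemma trec_simps [simp]:
  "carrier (trec act V) = V" "\<zero>\<^bsub>trec act V\<^esub> = 0" "x \<oplus>\<^bsub>trec act V\<^esub> y = x + y" "r \<odot>\<^bsub>trec act V\<^esub> x = act r x"
  by (simp_all add: trec_def)

lemma trec_rec_iso:
  "Modules.module act \<Longrightarrow> Modules.module.subspace act V \<Longrightarrow> rec_iso act (trec act V) V (\<lambda>x. x)"
  unfolding rec_iso_def rec_iso_axioms_def
  by (auto simp: bij_betw_def Modules.module.subspace_def)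

locale kx_rec = kx_space act + rec_iso act M V h
  for act :: "'k::field poly \<Rightarrow> 'v::ab_group_add \<Rightarrow> 'v"
    and M :: "('k poly, 'w, 'm) module_scheme" and V h
begin

lemma submodule_kx_rec: "is_submodule U M \<Longrightarrow> kx_rec act (M\<lparr>carrier := U\<rparr>) (h ` U) h"
  unfolding kx_rec_def using restrict kx_space_axioms by blast

lemma set_add_image:
  assumes "U \<subseteq> carrier M" "W \<subseteq> carrier M"
  shows "h ` (U <+>\<^bsub>M\<^esub> W) = ssum (h ` U) (h ` W)" "U <+>\<^bsub>M\<^esub> W \<subseteq> carrier M"
proof -
  have e: "U <+>\<^bsub>M\<^esub> W = {u \<oplus>\<^bsub>M\<^esub> w | u w. u \<in> U \<and> w \<in> W}"
    unfolding set_add_def set_mult_def by auto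
  show "U <+>\<^bsub>M\<^esub> W \<subseteq> carrier M" unfolding e using assms M_add by blast
  have "h (u \<oplus>\<^bsub>M\<^esub> w) = h u + h w" if "u \<in> U" "w \<in> W" for u w using that assms M_add by blast
  then show "h ` (U <+>\<^bsub>M\<^esub> W) = ssum (h ` U) (h ` W)" unfolding e ssum_def by (auto; metis (mono_tags, lifting) image_eqI mem_Collect_eq)
qed

lemma image_eq_iff:
  assumes "U \<subseteq> carrier M" "W \<subseteq> carrier M"
  shows "h ` U = h ` W \<longleftrightarrow> U = W"
  by (rule inj_on_image_eq_iff[OF h_inj assms])

lemma image_zero: "h ` {\<zero>\<^bsub>M\<^esub>} = {0}"
  using M_zero by simp

lemma indecomposable_iff: "indecomposable M \<longleftrightarrow> indec V"
proof -
  have zsub: "{\<zero>\<^bsub>M\<^esub>} \<subseteq> carrier M" using M_zero by simp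
  have ne: "carrier M \<noteq> {\<zero>\<^bsub>M\<^esub>} \<longleftrightarrow> V \<noteq> {0}"
    using image_eq_iff[OF subset_refl zsub] unfolding h_image image_zero by simp
  have tr: "(is_submodule U M \<and> is_submodule W M \<and> carrier M = U <+>\<^bsub>M\<^esub> W \<and> U \<inter> W = {\<zero>\<^bsub>M\<^esub>}) \<longleftrightarrow>
      (m.subspace (h ` U) \<and> m.subspace (h ` W) \<and> V = ssum (h ` U) (h ` W) \<and> h ` U \<inter> h ` W = {0})"
    if s: "U \<subseteq> carrier M" "W \<subseteq> carrier M" for U W
  proof -
    have "carrier M = U <+>\<^bsub>M\<^esub> W \<longleftrightarrow> V = ssum (h ` U) (h ` W)"
      using image_eq_iff[OF subset_refl set_add_image(2)[OF s]] unfolding h_image set_add_image(1)[OF s] by simp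
    moreover have "U \<inter> W = {\<zero>\<^bsub>M\<^esub>} \<longleftrightarrow> h ` U \<inter> h ` W = {0}"
    proof -
      have "U \<inter> W \<subseteq> carrier M" using s by blast
      from image_eq_iff[OF this zsub] show ?thesis
        unfolding image_zero inj_on_image_Int[OF h_inj s] by simp
    qed
    ultimately show ?thesis using is_submodule_iff s by simp
  qed
  have z: "U = {\<zero>\<^bsub>M\<^esub>} \<longleftrightarrow> h ` U = {0}" if "U \<subseteq> carrier M" for U
    using image_eq_iff[OF that zsub] unfolding image_zero by simp
  have sub: "U \<subseteq> carrier M" if "is_submodule U M" for U using module.submoduleE[OF is_module that] by blast
  show ?thesis
  proof
    assume I: "indecomposable M"
    have "A = {0} \<or> B = {0}" if AB: "m.subspace A" "m.subspace B" "V = ssum A B" "A \<inter> B = {0}" for A B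
    proof -
      have "A \<subseteq> V" "B \<subseteq> V" using subset_ssum AB by auto
      then obtain U W where UW: "is_submodule U M" "h ` U = A" "is_submodule W M" "h ` W = B"
        using preimage_submodule AB by metis
      have "is_submodule U M \<and> is_submodule W M \<and> carrier M = U <+>\<^bsub>M\<^esub> W \<and> U \<inter> W = {\<zero>\<^bsub>M\<^esub>}"
        by (subst tr[OF sub[OF UW(1)] sub[OF UW(3)]]) (use AB in \<open>simp add: UW(2,4)\<close>)
      then have "U = {\<zero>\<^bsub>M\<^esub>} \<or> W = {\<zero>\<^bsub>M\<^esub>}" using I unfolding indecomposable_def by blast
      then show ?thesis using UW image_zero by metis
    qed
    then show "indec V" using I ne unfolding indecomposable_def indec_def by blast
  next
    assume I: "indec V"
    have "U = {\<zero>\<^bsub>M\<^esub>} \<or> W = {\<zero>\<^bsub>M\<^esub>}" if UW: "is_submodule U M" "is_submodule W M" "carrier M = U <+>\<^bsub>M\<^esub> W" "U \<inter> W = {\<zero>\<^bsub>M\<^esub>}" for U W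
    proof -
      have "m.subspace (h ` U) \<and> m.subspace (h ` W) \<and> V = ssum (h ` U) (h ` W) \<and> h ` U \<inter> h ` W = {0}"
        using tr[OF sub[OF UW(1)] sub[OF UW(2)]] UW by blast
      then have "h ` U = {0} \<or> h ` W = {0}" using I unfolding indec_def by blast
      then show ?thesis using z sub UW by blast
    qed
    moreover have "carrier M \<noteq> {\<zero>\<^bsub>M\<^esub>}" using I ne unfolding indec_def by blast
    ultimately show "indecomposable M" unfolding indecomposable_def by blast
  qed
qed

text \<open>Functions in \<open>PiE\<close> have fixed values off the index set. Unique existence of
  \<open>u\<close> therefore means that every vector is a sum and that only zero components sum to
  zero.\<close>

lemma decomposition_iff:
  assumes U: "\<forall>i<n. is_submodule (U i) M"
  shows "indecomposable_decomposition M n U \<longleftrightarrow> dsum V n (\<lambda>i. h ` U i) \<and> (\<forall>i<n. indec (h ` U i))"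
proof -
  have sub: "U i \<subseteq> carrier M" if "i < n" for i using U module.submoduleE(1)[OF is_module] that by blast
  have S: "m.subspace (h ` U i)" if "i < n" for i using U sub is_submodule_iff that by blast
  have ind: "indecomposable (M\<lparr>carrier := U i\<rparr>) \<longleftrightarrow> indec (h ` U i)" if "i < n" for i
    using kx_rec.indecomposable_iff[OF submodule_kx_rec] U that by blast
  have fs: "finsum M u {..<n} \<in> carrier M" "h (finsum M u {..<n}) = (\<Sum>i<n. h (u i))" if "u \<in> PiE {..<n} U" for u
  proof -
    have "u \<in> {..<n} \<rightarrow> carrier M" using that sub by (auto simp: PiE_def Pi_def)
    then show "finsum M u {..<n} \<in> carrier M" "h (finsum M u {..<n}) = (\<Sum>i<n. h (u i))"
      using h_finsum[OF finite_lessThan] by blast+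
  qed
  have eq: "v = finsum M u {..<n} \<longleftrightarrow> h v = (\<Sum>i<n. h (u i))" if "u \<in> PiE {..<n} U" "v \<in> carrier M" for u v
    using fs[OF that(1)] that(2) h_eqD by metis
  have "(\<forall>v \<in> carrier M. \<exists>!u. u \<in> PiE {..<n} U \<and> v = finsum M u {..<n}) \<longleftrightarrow> dsum V n (\<lambda>i. h ` U i)"
  proof
    assume D: "\<forall>v \<in> carrier M. \<exists>!u. u \<in> PiE {..<n} U \<and> v = finsum M u {..<n}"
    have lift: "\<exists>u'\<in>PiE {..<n} U. \<forall>i<n. u i = h (u' i)" if u: "\<forall>i<n. u i \<in> h ` U i" for u
    proof -
      have "\<forall>i\<in>{..<n}. \<exists>y. y \<in> U i \<and> u i = h y" using u by blast
      from bchoice[OF this] obtain u' where u': "\<forall>i<n. u' i \<in> U i \<and> u i = h (u' i)" by blast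
      then show ?thesis by (intro bexI[of _ "restrict u' {..<n}"]) auto
    qed
    show "dsum V n (\<lambda>i. h ` U i)" unfolding dsum_def
    proof (intro conjI equalityI subsetI)
      fix v assume "v \<in> V"
      then obtain x where x: "x \<in> carrier M" "v = h x" using h_image by blast
      then obtain u where u: "u \<in> PiE {..<n} U" "x = finsum M u {..<n}" using D by blast
      then have "v = (\<Sum>i<n. h (u i))" "\<forall>i<n. h (u i) \<in> h ` U i" using fs[OF u(1)] x by (auto simp: PiE_def Pi_def)
      then show "v \<in> {\<Sum>i<n. u i | u. \<forall>i<n. u i \<in> h ` U i}"
        by (intro CollectI exI[of _ "\<lambda>i. h (u i)"]) simp
    next
      fix v assume "v \<in> {\<Sum>i<n. u i | u. \<forall>i<n. u i \<in> h ` U i}"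
      then obtain u where u: "v = (\<Sum>i<n. u i)" "\<forall>i<n. u i \<in> h ` U i" by blast
      then obtain u' where u': "u'\<in>PiE {..<n} U" "\<forall>i<n. u i = h (u' i)" using lift by blast
      then have "v = h (finsum M u' {..<n})" using fs(2)[OF u'(1)] u by simp
      then show "v \<in> V" using fs(1)[OF u'(1)] h_in by simp
    next
      show "\<forall>u. (\<forall>i<n. u i \<in> h ` U i) \<longrightarrow> (\<Sum>i<n. u i) = 0 \<longrightarrow> (\<forall>i<n. u i = 0)"
      proof (intro allI impI)
        fix u i assume u: "\<forall>i<n. u i \<in> h ` U i" "(\<Sum>i<n. u i) = 0" and i: "i < n"
        obtain u' where u': "u'\<in>PiE {..<n} U" "\<forall>i<n. u i = h (u' i)" using lift u by blast
        have "\<forall>i<n. (\<lambda>_. 0) i \<in> h ` U i" using S m.subspace_0 by blast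
        then obtain z where z: "z\<in>PiE {..<n} U" "\<forall>i<n. 0 = h (z i)" using lift[of "\<lambda>_. 0"] by blast
        have "\<zero>\<^bsub>M\<^esub> = finsum M u' {..<n}" using u u' M_zero by (subst eq) auto
        moreover have "\<zero>\<^bsub>M\<^esub> = finsum M z {..<n}" using z M_zero by (subst eq) auto
        ultimately have "u' = z" using D M_zero(1) u'(1) z(1) by blast
        then show "u i = 0" using u' z i by simp
      qed
    qed
  next
    assume D: "dsum V n (\<lambda>i. h ` U i)"
    show "\<forall>v \<in> carrier M. \<exists>!u. u \<in> PiE {..<n} U \<and> v = finsum M u {..<n}"
    proof (intro ballI ex_ex1I)
      fix v assume v: "v \<in> carrier M"
      then have "h v \<in> V" by (rule h_in)
      then obtain w where w: "h v = (\<Sum>i<n. w i)" "\<forall>i<n. w i \<in> h ` U i" using D unfolding dsum_def by blast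
      have "\<forall>i\<in>{..<n}. \<exists>y. y \<in> U i \<and> w i = h y" using w(2) by blast
      from bchoice[OF this] obtain u where u: "\<forall>i<n. u i \<in> U i \<and> w i = h (u i)" by blast
      have "restrict u {..<n} \<in> PiE {..<n} U" using u by auto
      moreover from this have "v = finsum M (restrict u {..<n}) {..<n}" using w u v by (subst eq) auto
      ultimately show "\<exists>u. u \<in> PiE {..<n} U \<and> v = finsum M u {..<n}" by blast
    next
      fix v u w assume v: "v \<in> carrier M" and u: "u \<in> PiE {..<n} U \<and> v = finsum M u {..<n}"
        and w: "w \<in> PiE {..<n} U \<and> v = finsum M w {..<n}"
      have "(\<Sum>i<n. h (u i)) = (\<Sum>i<n. h (w i))" using u w eq v by metis
      then have s0: "(\<Sum>i<n. h (u i) - h (w i)) = 0" by (simp add: sum_subtractf)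
      have "\<forall>i<n. h (u i) - h (w i) \<in> h ` U i" using u w S by (auto intro!: m.subspace_diff)
      from D[unfolded dsum_def, THEN conjunct2, THEN spec, THEN mp, OF this] s0
      have "\<forall>i<n. h (u i) - h (w i) = 0" by simp
      moreover have "u i \<in> carrier M" "w i \<in> carrier M" if "i < n" for i using u w sub that by (auto simp: PiE_def Pi_def)
      ultimately have "u i = w i" if "i < n" for i using h_eqD that by simp
      then show "u = w" using u w by (auto intro: PiE_ext)
    qed
  qed
  moreover have "(\<forall>i<n. is_submodule (U i) M \<and> indecomposable (M\<lparr>carrier := U i\<rparr>)) \<longleftrightarrow> (\<forall>i<n. indec (h ` U i))"
    using U ind by simp
  ultimately show ?thesis unfolding indecomposable_decomposition_def by (simp add: conj_commute)
qed

lemma restrict_to_field_rec: "rec_iso scal (restrict_to_field M) V h"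
proof
  show "vs.subspace V" using V by (rule subspace_scal)
qed (use h_bij M_zero M_add M_smult in \<open>auto simp: restrict_to_field_def ring.extend_def module.fields_def ring.truncate_def scal_def\<close>)

lemma restrict_to_field_simps: "carrier (restrict_to_field M) = carrier M"
  by (simp add: restrict_to_field_def ring.extend_def module.fields_def ring.truncate_def)

text \<open>Coefficient functions in \<open>extensional B\<close> are determined by their values on
  \<open>B\<close>, so existence of expansions is spanning, and uniqueness for the zero vector is
  already independence.\<close>

lemma finite_basis_iff:
  assumes "finite B" "B \<subseteq> carrier M"
  shows "finite_basis (restrict_to_field M) B \<longleftrightarrow> vs.independent (h ` B) \<and> V \<subseteq> vs.span (h ` B)"
proof -
  interpret F: rec_iso scal "restrict_to_field M" V h by (rule restrict_to_field_rec)
  have inj: "inj_on h B" using h_inj assms inj_on_subset by blast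
  have Bc: "b \<in> carrier (restrict_to_field M)" if "b \<in> B" for b using that assms by (auto simp: restrict_to_field_simps)
  have hs: "v = (\<Oplus>\<^bsub>restrict_to_field M\<^esub>b\<in>B. a b \<odot>\<^bsub>restrict_to_field M\<^esub> b) \<longleftrightarrow> h v = (\<Sum>b\<in>B. scal (a b) (h b))"
    if "v \<in> carrier M" for v a
  proof -
    have c: "(\<lambda>b. a b \<odot>\<^bsub>restrict_to_field M\<^esub> b) \<in> B \<rightarrow> carrier (restrict_to_field M)" using Bc F.M_smult by blast
    have "h (\<Oplus>\<^bsub>restrict_to_field M\<^esub>b\<in>B. a b \<odot>\<^bsub>restrict_to_field M\<^esub> b) = (\<Sum>b\<in>B. scal (a b) (h b))"
      unfolding F.h_finsum(2)[OF assms(1) c] using Bc F.M_smult by (intro sum.cong) auto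
    moreover have "v = w \<longleftrightarrow> h v = h w" if "w \<in> carrier (restrict_to_field M)" for w
      using F.h_eqD[of v w] that \<open>v \<in> carrier M\<close> by (auto simp: restrict_to_field_simps)
    ultimately show ?thesis using F.h_finsum(1)[OF assms(1) c] by simp
  qed
  have fb: "finite_basis (restrict_to_field M) B \<longleftrightarrow>
      (\<forall>v\<in>V. \<exists>!a. a \<in> extensional B \<and> v = (\<Sum>b\<in>B. scal (a b) (h b)))"
    unfolding finite_basis_def restrict_to_field_simps using assms hs h_image[symmetric] by auto
  show ?thesis unfolding fb
  proof (intro iffI conjI)
    assume D: "\<forall>v\<in>V. \<exists>!a. a \<in> extensional B \<and> v = (\<Sum>b\<in>B. scal (a b) (h b))"
    show "V \<subseteq> vs.span (h ` B)"
    proof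
      fix v assume "v \<in> V"
      then obtain a where "v = (\<Sum>b\<in>B. scal (a b) (h b))" using D by blast
      then show "v \<in> vs.span (h ` B)" by (auto intro!: vs.span_sum vs.span_scale intro: vs.span_base)
    qed
    show "vs.independent (h ` B)"
    proof (rule vs.independent_if_scalars_zero)
      fix f x assume z: "(\<Sum>x\<in>h ` B. scal (f x) x) = 0" and x: "x \<in> h ` B"
      have "0 = (\<Sum>b\<in>B. scal (restrict (\<lambda>b. f (h b)) B b) (h b))" using z by (simp add: sum.reindex[OF inj])
      have "0 = (\<Sum>b\<in>B. scal (restrict (\<lambda>b. 0) B b) (h b))" by simp
      have "0 \<in> V" using V by (rule m.subspace_0)
      from D[rule_format, OF this] obtain a where a: "\<And>c. c \<in> extensional B \<Longrightarrow> 0 = (\<Sum>b\<in>B. scal (c b) (h b)) \<Longrightarrow> c = a" by (elim ex1E) metis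
      have "restrict (\<lambda>b. f (h b)) B = a" by (rule a[OF restrict_extensional]) fact
      moreover have "restrict (\<lambda>b. 0) B = a" by (rule a[OF restrict_extensional]) fact
      ultimately have "restrict (\<lambda>b. f (h b)) B = restrict (\<lambda>b. 0) B" by simp
      then show "f x = 0" using x by (metis imageE restrict_apply')
    qed (use assms in auto)
  next
    assume D: "vs.independent (h ` B) \<and> V \<subseteq> vs.span (h ` B)"
    show "\<forall>v\<in>V. \<exists>!a. a \<in> extensional B \<and> v = (\<Sum>b\<in>B. scal (a b) (h b))"
    proof (intro ballI ex_ex1I)
      fix v assume "v \<in> V"
      then obtain c where "v = (\<Sum>x\<in>h ` B. scal (c x) x)" using D assms by (auto simp: vs.span_finite)
      then have "v = (\<Sum>b\<in>B. scal (restrict (\<lambda>b. c (h b)) B b) (h b))" by (simp add: sum.reindex[OF inj])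
      then show "\<exists>a. a \<in> extensional B \<and> v = (\<Sum>b\<in>B. scal (a b) (h b))" using restrict_extensional by blast
    next
      fix v a c assume a: "a \<in> extensional B \<and> v = (\<Sum>b\<in>B. scal (a b) (h b))"
        and c: "c \<in> extensional B \<and> v = (\<Sum>b\<in>B. scal (c b) (h b))"
      define g where "g x = (let b = inv_into B h x in a b - c b)" for x
      have "(\<Sum>x\<in>h ` B. scal (g x) x) = (\<Sum>b\<in>B. scal (a b - c b) (h b))"
        unfolding sum.reindex[OF inj] by (rule sum.cong) (auto simp: g_def inj)
      also have "\<dots> = 0" using a c by (simp add: vs.scale_left_diff_distrib sum_subtractf)
      finally have "\<forall>x\<in>h ` B. g x = 0" using vs.independentD[of "h ` B" "h ` B" g] D assms by blast
      then have "a b = c b" if "b \<in> B" for b using that by (auto simp: g_def inj)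
      then show "a = c" using a c by (meson extensionalityI)
    qed
  qed
qed

lemma fd_module_iff: "fd_module M \<longleftrightarrow> fd V"
proof
  assume "fd_module M"
  then obtain B where B: "finite_basis (restrict_to_field M) B" unfolding fd_module_def by blast
  then have "finite B" "B \<subseteq> carrier M" unfolding finite_basis_def restrict_to_field_simps by auto
  then show "fd V" using finite_basis_iff B unfolding fd_def by blast
next
  assume "fd V"
  then obtain C where C: "finite C" "C \<subseteq> V" "vs.independent C" "V \<subseteq> vs.span C" using fd_basis by metis
  then obtain B where B: "B \<subseteq> carrier M" "finite B" "C = h ` B" using h_image by (metis finite_subset_image)
  then have "finite_basis (restrict_to_field M) B" using finite_basis_iff C by blast
  then show "fd_module M" unfolding fd_module_def using is_module by blast
qed

lemma dim_over_field_eq: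
  assumes "fd V"
  shows "dim_over_field M = vs.dim V"
  unfolding dim_over_field_def
proof (rule the_equality)
  obtain C where C: "finite C" "C \<subseteq> V" "vs.independent C" "V \<subseteq> vs.span C" "card C = vs.dim V" using fd_basis assms by metis
  then obtain B where B: "B \<subseteq> carrier M" "finite B" "C = h ` B" using h_image by (metis finite_subset_image)
  then have "finite_basis (restrict_to_field M) B" using finite_basis_iff C by blast
  moreover have "card B = vs.dim V" using C B h_inj by (metis card_image inj_on_subset)
  ultimately show "\<exists>B. finite_basis (restrict_to_field M) B \<and> card B = vs.dim V" by blast
next
  fix n assume "\<exists>B. finite_basis (restrict_to_field M) B \<and> card B = n"
  then obtain B where B: "finite_basis (restrict_to_field M) B" "card B = n" by blast
  then have f: "finite B" "B \<subseteq> carrier M" unfolding finite_basis_def restrict_to_field_simps by auto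
  then have "vs.dim V = card (h ` B)" using finite_basis_iff B h_image by (intro vs.dim_unique) auto
  then show "n = vs.dim V" using B f h_inj by (metis card_image inj_on_subset)
qed

end

section \<open>Quotients by the kernel of an additive map\<close>

text \<open>Common frame for cyclic modules, tensor products over k and the tensor product of the
  two subrings: each is a carrier modulo the kernel of a concrete additive map, so its cosets are
  the fibres of that map.\<close>

locale quotient_kernel =
  fixes F :: "('r::comm_ring_1, 'c::ab_group_add, 'm) module_scheme" and \<Phi> :: "'c \<Rightarrow> 'u::ab_group_add"
  assumes F_add: "add F = (+)" and F_zero: "0 \<in> carrier F"
    and F_closed: "\<And>c d. c \<in> carrier F \<Longrightarrow> d \<in> carrier F \<Longrightarrow> c + d \<in> carrier F"
    and F_uminus: "\<And>c. c \<in> carrier F \<Longrightarrow> - c \<in> carrier F"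
    and \<Phi>_add: "\<And>c d. \<Phi> (c + d) = \<Phi> c + \<Phi> d"
begin

lemma \<Phi>_0 [simp]: "\<Phi> 0 = 0" and \<Phi>_uminus: "\<Phi> (- c) = - \<Phi> c" and \<Phi>_diff: "\<Phi> (c - d) = \<Phi> c - \<Phi> d"
proof -
  interpret additive \<Phi> by standard (rule \<Phi>_add)
  show "\<Phi> 0 = 0" "\<Phi> (- c) = - \<Phi> c" "\<Phi> (c - d) = \<Phi> c - \<Phi> d" by (simp_all add: zero minus diff)
qed

definition cos :: "'c \<Rightarrow> 'c set" where
  "cos c = {d \<in> carrier F. \<Phi> d = \<Phi> c}"

definition ker where "ker = {c \<in> carrier F. \<Phi> c = 0}"

lemma ker_eq_cos: "ker = cos 0"
  by (simp add: ker_def cos_def)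

lemma F_diff: "c \<in> carrier F \<Longrightarrow> d \<in> carrier F \<Longrightarrow> c - d \<in> carrier F"
  using F_closed[of c "- d"] F_uminus[of d] by simp

lemma coset_eq: "c \<in> carrier F \<Longrightarrow> ker +>\<^bsub>F\<^esub> c = cos c"
proof -
  assume c: "c \<in> carrier F"
  have "ker +>\<^bsub>F\<^esub> c = {k + c | k. k \<in> ker}" unfolding a_r_coset_def r_coset_def by (auto simp: F_add)
  also have "\<dots> = cos c"
  proof (intro equalityI subsetI)
    fix d assume "d \<in> {k + c | k. k \<in> ker}"
    then show "d \<in> cos c" using c F_closed by (auto simp: ker_def cos_def \<Phi>_add)
  next
    fix d assume d: "d \<in> cos c"
    then have "d - c \<in> ker" using c F_diff by (auto simp: ker_def cos_def \<Phi>_diff)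
    then show "d \<in> {k + c | k. k \<in> ker}" by (metis (mono_tags, lifting) diff_add_cancel mem_Collect_eq)
  qed
  finally show ?thesis .
qed

lemma cos_eq_iff: "c \<in> carrier F \<Longrightarrow> d \<in> carrier F \<Longrightarrow> cos c = cos d \<longleftrightarrow> \<Phi> c = \<Phi> d"
  by (auto simp: cos_def)

lemma self_in_cos: "c \<in> carrier F \<Longrightarrow> c \<in> cos c"
  by (simp add: cos_def)

text \<open>Functions on cosets such as \<open>phi\<close> and \<open>tensor_dim\<close> are defined
  by \<open>the_elem\<close>. They can be evaluated at a representative once they are constant on
  the fibre.\<close>

lemma cos_image:
  assumes "c \<in> carrier F" "\<And>d. d \<in> carrier F \<Longrightarrow> \<Phi> d = \<Phi> c \<Longrightarrow> f d = f c"
  shows "the_elem (f ` cos c) = f c"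
proof -
  have "f d = f c" if "d \<in> cos c" for d using that assms(2)[of d] unfolding cos_def by blast
  then have "f ` cos c = {f c}" using self_in_cos[OF assms(1)] by blast
  then show ?thesis by simp
qed

lemma carrier_quotient: "carrier (quotient_module F ker) = cos ` carrier F"
proof -
  have "carrier (quotient_module F ker) = (\<lambda>c. ker +>\<^bsub>F\<^esub> c) ` carrier F"
    by (auto simp: quotient_module_def ring.extend_def module.fields_def FactRing_def A_RCOSETS_def RCOSETS_def a_r_coset_def)
  also have "\<dots> = cos ` carrier F" using coset_eq by (rule image_cong[OF refl])
  finally show ?thesis .
qed

lemma zero_quotient: "\<zero>\<^bsub>quotient_module F ker\<^esub> = cos 0"
  by (simp add: quotient_module_def ring.extend_def module.fields_def FactRing_def ker_eq_cos)

lemma add_quotient: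
  assumes "c \<in> carrier F" "d \<in> carrier F"
  shows "cos c \<oplus>\<^bsub>quotient_module F ker\<^esub> cos d = cos (c + d)"
proof -
  have "cos c \<oplus>\<^bsub>quotient_module F ker\<^esub> cos d = {x + y | x y. x \<in> cos c \<and> y \<in> cos d}"
    by (auto simp: quotient_module_def ring.extend_def module.fields_def FactRing_def set_add_def set_mult_def F_add)
  also have "\<dots> = cos (c + d)"
  proof (intro equalityI subsetI)
    fix e assume "e \<in> cos (c + d)"
    then have "e - d \<in> cos c" "d \<in> cos d" "e = (e - d) + d"
      using assms F_diff by (auto simp: cos_def \<Phi>_add \<Phi>_diff)
    then show "e \<in> {x + y | x y. x \<in> cos c \<and> y \<in> cos d}" by blast
  qed (use F_closed in \<open>auto simp: cos_def \<Phi>_add\<close>)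
  finally show ?thesis .
qed

text \<open>The scalar action on a quotient and \<open>tensor_shift\<close> are unions over all
  representatives of a coset. The union collapses to one coset when \<open>f\<close> respects
  fibres.\<close>

lemma union_cosets:
  assumes c: "c \<in> carrier F" and "\<And>d. d \<in> cos c \<Longrightarrow> f d \<in> carrier F \<and> \<Phi> (f d) = \<Phi> (f c)"
  shows "(\<Union>d\<in>cos c. ker +>\<^bsub>F\<^esub> f d) = cos (f c)"
proof -
  have "ker +>\<^bsub>F\<^esub> f d = cos (f c)" if "d \<in> cos c" for d
    using assms(2)[OF that] assms(2)[OF self_in_cos[OF c]] coset_eq cos_eq_iff by simp
  then show ?thesis using self_in_cos[OF c] by auto
qed

lemma smult_quotient:
  assumes "c \<in> carrier F" and "\<And>d. d \<in> cos c \<Longrightarrow> r \<odot>\<^bsub>F\<^esub> d \<in> carrier F \<and> \<Phi> (r \<odot>\<^bsub>F\<^esub> d) = \<Phi> (r \<odot>\<^bsub>F\<^esub> c)"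
  shows "r \<odot>\<^bsub>quotient_module F ker\<^esub> cos c = cos (r \<odot>\<^bsub>F\<^esub> c)"
  using union_cosets[of c "\<lambda>d. r \<odot>\<^bsub>F\<^esub> d"] assms
  by (simp add: quotient_module_def ring.extend_def module.fields_def)

lemma quotient_rec_iso:
  assumes act: "Modules.module act"
    and smult: "\<And>r c. c \<in> carrier F \<Longrightarrow> r \<odot>\<^bsub>F\<^esub> c \<in> carrier F \<and> \<Phi> (r \<odot>\<^bsub>F\<^esub> c) = act r (\<Phi> c)"
  shows "rec_iso act (quotient_module F ker) (\<Phi> ` carrier F) (\<lambda>C. the_elem (\<Phi> ` C))"
proof -
  interpret Modules.module act by (rule act)
  have te: "the_elem (\<Phi> ` cos c) = \<Phi> c" if "c \<in> carrier F" for c using cos_image[OF that] by simp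
  have sm: "r \<odot>\<^bsub>quotient_module F ker\<^esub> cos c = cos (r \<odot>\<^bsub>F\<^esub> c)" if "c \<in> carrier F" for r c
    by (rule smult_quotient[OF that]) (use smult that in \<open>auto simp: cos_def\<close>)
  show ?thesis
  proof
    show "subspace (\<Phi> ` carrier F)"
    proof (rule subspaceI)
      show "0 \<in> \<Phi> ` carrier F" by (rule image_eqI[of _ _ 0]) (simp_all add: F_zero)
      fix x y assume "x \<in> \<Phi> ` carrier F" "y \<in> \<Phi> ` carrier F"
      then show "x + y \<in> \<Phi> ` carrier F" by (metis (no_types, lifting) F_closed \<Phi>_add image_iff)
    next
      fix r x assume "x \<in> \<Phi> ` carrier F"
      then show "act r x \<in> \<Phi> ` carrier F" by (metis (no_types, lifting) smult image_iff)
    qed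
    show "bij_betw (\<lambda>C. the_elem (\<Phi> ` C)) (carrier (quotient_module F ker)) (\<Phi> ` carrier F)"
      unfolding carrier_quotient
    proof (rule bij_betw_imageI)
      show "inj_on (\<lambda>C. the_elem (\<Phi> ` C)) (cos ` carrier F)"
        by (rule inj_onI) (metis (no_types, lifting) cos_eq_iff imageE te)
      show "(\<lambda>C. the_elem (\<Phi> ` C)) ` cos ` carrier F = \<Phi> ` carrier F"
        unfolding image_image using te by (rule image_cong[OF refl])
    qed
  qed (use F_zero F_closed smult in \<open>auto simp: carrier_quotient zero_quotient te add_quotient sm \<Phi>_add\<close>)
qed

end


section \<open>Matrix models of finite-dimensional \<open>k[x]\<close>-modules\<close>

definition fscale :: "'k::field \<Rightarrow> ('i \<Rightarrow> 'k) \<Rightarrow> 'i \<Rightarrow> 'k" where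
  "fscale c v = (\<lambda>i. c * v i)"

text \<open>The operator of a matrix. Results are cut off outside \<open>I\<close>, so they lie in
  \<open>fsp I\<close> for every argument and the operator is linear on the whole function
  type.\<close>

definition mop :: "'i set \<Rightarrow> ('i \<Rightarrow> 'i \<Rightarrow> 'k::field) \<Rightarrow> ('i \<Rightarrow> 'k) \<Rightarrow> 'i \<Rightarrow> 'k" where
  "mop I a v = (\<lambda>i. if i \<in> I then \<Sum>j\<in>I. a i j * v j else 0)"

definition fsp :: "'i set \<Rightarrow> ('i \<Rightarrow> 'k::field) set" where
  "fsp I = {v. \<forall>i. i \<notin> I \<longrightarrow> v i = 0}"

definition mact :: "'i set \<Rightarrow> ('i \<Rightarrow> 'i \<Rightarrow> 'k::field) \<Rightarrow> 'k poly \<Rightarrow> ('i \<Rightarrow> 'k) \<Rightarrow> 'i \<Rightarrow> 'k" where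
  "mact I a = poly_act fscale (mop I a)"

definition unitv :: "'i \<Rightarrow> 'i \<Rightarrow> 'k::field" where
  "unitv i = (\<lambda>j. if j = i then 1 else 0)"

lemma fscale_apply [simp]: "fscale c v i = c * v i"
  by (simp add: fscale_def)

lemma fscale_zero [simp]: "fscale 0 v = 0" "fscale c 0 = 0"
  by (auto simp: fscale_def)

lemma fun_sum_apply: "(\<Sum>a\<in>A. f a) i = (\<Sum>a\<in>A. f a i)" for f :: "'a \<Rightarrow> 'b \<Rightarrow> 'c::comm_monoid_add"
  by (induction A rule: infinite_finite_induct) auto

lemma fscale_module: "Modules.module fscale"
  by standard (auto simp: fun_eq_iff algebra_simps)

lemma mop_endo: "module_endo fscale (mop I a)"
  unfolding module_endo_def module_endo_axioms_def using fscale_module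
  by (auto simp: mop_def fun_eq_iff algebra_simps sum.distrib sum_distrib_left)

lemma mact_0 [simp]: "mact I a 0 v = 0"
  unfolding mact_def by (rule module_endo.poly_act_0[OF mop_endo])

lemma mact_pCons [simp]: "mact I a (pCons c p) v = fscale c v + mop I a (mact I a p v)"
  unfolding mact_def by (rule module_endo.poly_act_pCons[OF mop_endo])

lemma mop_zero [simp]: "mop I a 0 = 0"
  by (auto simp: mop_def)

lemma mact_kx_space: "kx_space (mact I a)"
  unfolding kx_space_def mact_def by (rule module_endo.poly_act_module[OF mop_endo])

lemma mact_scal [simp]: "kx_space.scal (mact I a) = fscale"
  by (rule ext)+ (simp add: kx_space.scal_def[OF mact_kx_space])

lemma mact_x: "mact I a [:0, 1:] v = mop I a v"
  by (rule ext) (simp add: mop_def)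

lemma mop_in_fsp [simp]: "mop I a v \<in> fsp I"
  by (simp add: mop_def fsp_def)

lemma fsp_add: "v \<in> fsp I \<Longrightarrow> w \<in> fsp I \<Longrightarrow> v + w \<in> fsp I"
  and fsp_zero [simp]: "0 \<in> fsp I"
  and fsp_scale: "v \<in> fsp I \<Longrightarrow> fscale c v \<in> fsp I"
  by (auto simp: fsp_def)

lemma mact_in_fsp: "v \<in> fsp I \<Longrightarrow> mact I a p v \<in> fsp I"
  by (induction p) (simp_all add: fsp_add fsp_scale)

lemma fsp_subspace: "Modules.module.subspace (mact I a) (fsp I)"
  using kx_space.act_module[OF mact_kx_space[of I a]]
  by (simp add: Modules.module.subspace_def fsp_add mact_in_fsp)

lemma unitv_in_fsp [simp]: "unitv i \<in> fsp I \<longleftrightarrow> i \<in> I"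
  by (auto simp: unitv_def fsp_def)

lemma fsp_expand:
  assumes "finite I" "v \<in> fsp I"
  shows "v = (\<Sum>j\<in>I. fscale (v j) (unitv j))"
proof
  fix i
  have "(\<Sum>j\<in>I. fscale (v j) (unitv j)) i = (\<Sum>j\<in>I. if i = j then v j else 0)"
    by (simp add: fun_sum_apply unitv_def if_distrib cong: if_cong)
  also have "\<dots> = v i" using assms by (simp add: fsp_def)
  finally show "v i = (\<Sum>j\<in>I. fscale (v j) (unitv j)) i" by simp
qed

lemma fsp_fd_dim:
  fixes a :: "'i \<Rightarrow> 'i \<Rightarrow> 'k::field"
  assumes "finite I"
  shows "kx_space.fd (mact I a) (fsp I)" "vector_space.dim fscale (fsp I :: ('i \<Rightarrow> 'k) set) = card I"
proof -
  interpret kx_space "mact I a" by (rule mact_kx_space)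
  have vs: "vector_space (fscale :: 'k \<Rightarrow> ('i \<Rightarrow> 'k) \<Rightarrow> _)" using vs.vector_space_axioms by simp
  interpret f: vector_space "fscale :: 'k \<Rightarrow> ('i \<Rightarrow> 'k) \<Rightarrow> _" by (rule vs)
  have inj: "inj_on (unitv :: 'i \<Rightarrow> 'i \<Rightarrow> 'k) I" by (rule inj_onI) (metis unitv_def zero_neq_one)
  have span: "fsp I \<subseteq> f.span (unitv ` I)"
  proof
    fix v :: "'i \<Rightarrow> 'k" assume "v \<in> fsp I"
    then show "v \<in> f.span (unitv ` I)"
      by (subst fsp_expand[OF assms]) (auto intro!: f.span_sum f.span_scale intro: f.span_base)
  qed
  then show "fd (fsp I)" unfolding fd_def using assms by (intro exI[of _ "unitv ` I"]) simp
  have "f.independent (unitv ` I)"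
  proof (rule f.independent_if_scalars_zero)
    fix c :: "('i \<Rightarrow> 'k) \<Rightarrow> 'k" and x :: "'i \<Rightarrow> 'k" assume z: "(\<Sum>x\<in>unitv ` I. fscale (c x) x) = 0" and x: "x \<in> unitv ` I"
    obtain i where i: "i \<in> I" "x = unitv i" using x by blast
    have "(\<Sum>j\<in>I. fscale (c (unitv j)) (unitv j)) = 0"
      using z sum.reindex[OF inj, of "\<lambda>x. fscale (c x) x"] by (simp add: comp_def)
    then have "0 = (\<Sum>j\<in>I. fscale (c (unitv j)) (unitv j)) i" by simp
    also have "\<dots> = (\<Sum>j\<in>I. if i = j then c (unitv j) else 0)"
      by (simp add: fun_sum_apply unitv_def[abs_def] if_distrib cong: if_cong)
    also have "\<dots> = c x" using assms i by simp
    finally show "c x = 0" by simp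
  qed (use assms in simp)
  moreover have "unitv ` I \<subseteq> (fsp I :: ('i \<Rightarrow> 'k) set)" by auto
  ultimately show "f.dim (fsp I :: ('i \<Rightarrow> 'k) set) = card I" using span card_image[OF inj] by (intro f.dim_unique) auto
qed

lemma linear_on_fsp:
  fixes T :: "('i \<Rightarrow> 'k::field) \<Rightarrow> 'j \<Rightarrow> 'k"
  assumes I: "finite I" and add: "\<And>v w. v \<in> fsp I \<Longrightarrow> w \<in> fsp I \<Longrightarrow> T (v + w) = T v + T w"
    and scale: "\<And>c v. v \<in> fsp I \<Longrightarrow> T (fscale c v) = fscale c (T v)" and v: "v \<in> fsp I"
  shows "T v = (\<Sum>j\<in>I. fscale (v j) (T (unitv j)))"
proof -
  have T0: "T 0 = 0" using scale[of 0 0] by simp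
  have "T (\<Sum>j\<in>J. fscale (v j) (unitv j)) = (\<Sum>j\<in>J. fscale (v j) (T (unitv j)))
     \<and> (\<Sum>j\<in>J. fscale (v j) (unitv j)) \<in> fsp I" if "finite J" "J \<subseteq> I" for J
    using that by (induction J) (auto simp: T0 add scale fsp_add fsp_scale)
  from this[OF I subset_refl] show ?thesis using arg_cong[OF fsp_expand[OF I v], of T] by simp
qed

lemma linear_on_fsp_mop:
  assumes I: "finite I" and T: "\<And>v. v \<in> fsp I \<Longrightarrow> T v \<in> fsp I"
    "\<And>v w. v \<in> fsp I \<Longrightarrow> w \<in> fsp I \<Longrightarrow> T (v + w) = T v + T w"
    "\<And>c v. v \<in> fsp I \<Longrightarrow> T (fscale c v) = fscale c (T v)" and v: "v \<in> fsp I"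
  shows "T v = mop I (\<lambda>i j. T (unitv j) i) v"
proof
  fix i
  show "T v i = mop I (\<lambda>i j. T (unitv j) i) v i"
  proof (cases "i \<in> I")
    case True
    then show ?thesis by (subst linear_on_fsp[OF I T(2,3) v]) (simp_all add: fun_sum_apply mop_def mult.commute)
  next
    case False
    then show ?thesis using T(1)[OF v] by (simp add: mop_def fsp_def)
  qed
qed

definition model :: "'i set \<Rightarrow> ('i \<Rightarrow> 'i \<Rightarrow> 'k::field) \<Rightarrow> ('k poly, 'i \<Rightarrow> 'k) module" where
  "model I a = trec (mact I a) (fsp I)"

lemma model_kx_rec: "kx_rec (mact I a) (model I a) (fsp I) (\<lambda>x. x)"
  unfolding kx_rec_def model_def using mact_kx_space trec_rec_iso kx_space.act_module[OF mact_kx_space] fsp_subspace by blast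

text \<open>Constants and x generate the polynomial ring, so compatibility with them is
  enough.\<close>

lemma kx_recI_x:
  assumes act: "kx_space act" and V: "Modules.module.subspace act V" and M: "is_module M"
    and h: "bij_betw h (carrier M) V"
    and add: "\<And>x y. x \<in> carrier M \<Longrightarrow> y \<in> carrier M \<Longrightarrow> h (x \<oplus>\<^bsub>M\<^esub> y) = h x + h y"
    and const: "\<And>c x. x \<in> carrier M \<Longrightarrow> h ([:c:] \<odot>\<^bsub>M\<^esub> x) = act [:c:] (h x)"
    and shift: "\<And>x. x \<in> carrier M \<Longrightarrow> h ([:0, 1:] \<odot>\<^bsub>M\<^esub> x) = act [:0, 1:] (h x)"
  shows "kx_rec act M V h"
proof -
  interpret kx_space act by (rule act)
  interpret M: Module.module ring_of_type_algebra M by (rule M)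
  have sc: "r \<odot>\<^bsub>M\<^esub> x \<in> carrier M" if "x \<in> carrier M" for r x
    using M.smult_closed that by (simp add: ring_of_type_algebra_def)
  have "h (\<zero>\<^bsub>M\<^esub> \<oplus>\<^bsub>M\<^esub> \<zero>\<^bsub>M\<^esub>) = h \<zero>\<^bsub>M\<^esub> + h \<zero>\<^bsub>M\<^esub>" by (rule add) auto
  then have h0: "h \<zero>\<^bsub>M\<^esub> = 0" by simp
  have act_p: "act (pCons c p) v = act [:c:] v + act [:0, 1:] (act p v)" for c p v
  proof -
    have "pCons c p = [:c:] + [:0, 1:] * p" by simp
    then show ?thesis by (metis m.scale_left_distrib m.scale_scale)
  qed
  have sm: "h (p \<odot>\<^bsub>M\<^esub> x) = act p (h x)" if x: "x \<in> carrier M" for p x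
  proof (induction p)
    case 0
    have "(0 :: 'a poly) \<odot>\<^bsub>M\<^esub> x = \<zero>\<^bsub>M\<^esub>" using M.smult_l_null[OF x] by (simp add: ring_of_type_algebra_def)
    then show ?case by (simp add: h0)
  next
    case (pCons c p)
    have "pCons c p = [:c:] + [:0, 1:] * p" by simp
    then have "pCons c p \<odot>\<^bsub>M\<^esub> x = ([:c:] \<odot>\<^bsub>M\<^esub> x) \<oplus>\<^bsub>M\<^esub> ([:0, 1:] \<odot>\<^bsub>M\<^esub> (p \<odot>\<^bsub>M\<^esub> x))"
      using M.smult_l_distr[OF _ _ x, of "[:c:]" "[:0, 1:] * p"] M.smult_assoc1[OF _ _ x, of "[:0, 1:]" p]
      by (simp add: ring_of_type_algebra_def)
    then have "h (pCons c p \<odot>\<^bsub>M\<^esub> x) = act [:c:] (h x) + act [:0, 1:] (act p (h x))"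
      using pCons.IH x by (simp only: add sc const shift)
    then show ?case by (simp only: act_p[of c p])
  qed
  show ?thesis
    unfolding kx_rec_def rec_iso_def rec_iso_axioms_def
    using act act_module V h h0 add sc sm M.M.a_closed M.M.zero_closed by blast
qed

lemma restrict_to_field_is_module:
  assumes "is_module M"
  shows "is_module (restrict_to_field M)"
proof -
  interpret M: Module.module ring_of_type_algebra M by (rule assms)
  have sc: "r \<odot>\<^bsub>M\<^esub> x \<in> carrier M" if "x \<in> carrier M" for r x
    using M.smult_closed that by (simp add: ring_of_type_algebra_def)
  note simps = restrict_to_field_def ring.extend_def module.fields_def ring.truncate_def
  show ?thesis
  proof (rule moduleI)
    show "abelian_group (restrict_to_field M)"
    proof (rule abelian_groupI)
      fix x assume "x \<in> carrier (restrict_to_field M)"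
      then show "\<exists>y\<in>carrier (restrict_to_field M). y \<oplus>\<^bsub>restrict_to_field M\<^esub> x = \<zero>\<^bsub>restrict_to_field M\<^esub>"
        by (intro bexI[of _ "\<ominus>\<^bsub>M\<^esub> x"]) (auto simp: simps M.M.l_neg)
    qed (auto simp: simps M.M.a_ac M.M.a_closed)
  qed (use sc M.smult_l_distr[of "[:_:]" "[:_:]"] M.smult_r_distr M.smult_assoc1[of "[:_:]" "[:_:]"] M.smult_one
    in \<open>auto simp: simps ring_of_type_algebra_def one_pCons mult.commute intro: cring_from_type_algebra[unfolded ring_of_type_algebra_def]\<close>)
qed

text \<open>Coordinates with respect to a finite basis turn the action of x into a matrix.\<close>

lemma fd_module_model:
  fixes M :: "('k::field poly, 'w, 'm) module_scheme"
  assumes "fd_module M"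
  obtains n a h where "kx_rec (mact {..<n::nat} a) M (fsp {..<n}) h"
proof -
  obtain B where M: "is_module M" and fb: "finite_basis (restrict_to_field M) B"
    using assms unfolding fd_module_def by blast
  define F where "F = restrict_to_field M"
  interpret M: Module.module ring_of_type_algebra M by (rule M)
  interpret F: Module.module ring_of_type_algebra F unfolding F_def by (rule restrict_to_field_is_module[OF M])
  note simps = restrict_to_field_def ring.extend_def module.fields_def ring.truncate_def
  have F_simps: "carrier F = carrier M" "c \<odot>\<^bsub>F\<^esub> x = [:c:] \<odot>\<^bsub>M\<^esub> x" "x \<oplus>\<^bsub>F\<^esub> y = x \<oplus>\<^bsub>M\<^esub> y" for c x y
    by (simp_all add: F_def simps)
  have scF: "r \<odot>\<^bsub>F\<^esub> x \<in> carrier F" if "x \<in> carrier F" for r x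
    using F.smult_closed that by (simp add: ring_of_type_algebra_def)
  have sc: "r \<odot>\<^bsub>M\<^esub> x \<in> carrier M" if "x \<in> carrier M" for r x
    using M.smult_closed that by (simp add: ring_of_type_algebra_def)
  have B: "finite B" "B \<subseteq> carrier F"
    and ex1: "\<And>v. v \<in> carrier F \<Longrightarrow> \<exists>!a. a \<in> extensional B \<and> v = (\<Oplus>\<^bsub>F\<^esub>b\<in>B. a b \<odot>\<^bsub>F\<^esub> b)"
    using fb unfolding finite_basis_def F_def by blast+
  define n where "n = card B"
  \<comment> \<open>Numbering the basis makes coordinate vectors functions on an initial segment of
    the naturals; \<open>g\<close> sends coordinates to vectors and \<open>h\<close> is its
    inverse.\<close>
  obtain \<iota> where \<iota>: "bij_betw \<iota> B {..<n}" using ex_bij_betw_finite_nat[OF B(1)] unfolding n_def by (auto simp: atLeast0LessThan)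
  define g where "g w = (\<Oplus>\<^bsub>F\<^esub>b\<in>B. w (\<iota> b) \<odot>\<^bsub>F\<^esub> b)" for w :: "nat \<Rightarrow> 'k"
  have cl: "(\<lambda>b. w b \<odot>\<^bsub>F\<^esub> b) \<in> B \<rightarrow> carrier F" for w using B scF by blast
  have g_in: "g w \<in> carrier F" for w unfolding g_def by (rule F.M.finsum_closed[OF cl])
  have g_add: "g (v + w) = g v \<oplus>\<^bsub>F\<^esub> g w" for v w
  proof -
    have "g (v + w) = (\<Oplus>\<^bsub>F\<^esub>b\<in>B. v (\<iota> b) \<odot>\<^bsub>F\<^esub> b \<oplus>\<^bsub>F\<^esub> w (\<iota> b) \<odot>\<^bsub>F\<^esub> b)"
      unfolding g_def using B scF F.smult_l_distr by (intro F.M.finsum_cong') (auto simp: ring_of_type_algebra_def)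
    also have "\<dots> = g v \<oplus>\<^bsub>F\<^esub> g w" unfolding g_def by (rule F.M.finsum_addf[OF cl cl])
    finally show ?thesis .
  qed
  have g_scale: "g (fscale c v) = c \<odot>\<^bsub>F\<^esub> g v" for c v
  proof -
    have "c \<odot>\<^bsub>F\<^esub> g v = (\<Oplus>\<^bsub>F\<^esub>b\<in>B. c \<odot>\<^bsub>F\<^esub> (v (\<iota> b) \<odot>\<^bsub>F\<^esub> b))"
      unfolding g_def by (rule F.finsum_smult_ldistr[OF B(1) _ cl]) (simp add: ring_of_type_algebra_def)
    also have "\<dots> = g (fscale c v)"
      unfolding g_def using B scF F.smult_assoc1 by (intro F.M.finsum_cong') (auto simp: ring_of_type_algebra_def)
    finally show ?thesis by simp
  qed
  have g_restrict: "g w = (\<Oplus>\<^bsub>F\<^esub>b\<in>B. restrict (\<lambda>b. w (\<iota> b)) B b \<odot>\<^bsub>F\<^esub> b)" for w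
    unfolding g_def using B scF by (intro F.M.finsum_cong') auto
  have bij: "bij_betw g (fsp {..<n}) (carrier F)"
  proof (rule bij_betw_imageI)
    show "inj_on g (fsp {..<n})"
    proof (rule inj_onI)
      fix v w :: "nat \<Rightarrow> 'k" assume vw: "v \<in> fsp {..<n}" "w \<in> fsp {..<n}" "g v = g w"
      have "restrict (\<lambda>b. v (\<iota> b)) B = restrict (\<lambda>b. w (\<iota> b)) B"
        using ex1[OF g_in[of v]] g_restrict[of v] g_restrict[of w] vw(3) by (metis restrict_extensional)
      then have e: "v (\<iota> b) = w (\<iota> b)" if "b \<in> B" for b using that by (metis restrict_apply')
      show "v = w"
      proof
        fix i
        show "v i = w i"
        proof (cases "i < n")
          case True
          then obtain b where "b \<in> B" "i = \<iota> b" using \<iota> unfolding bij_betw_def by (metis imageE lessThan_iff)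
          then show ?thesis using e by simp
        qed (use vw in \<open>auto simp: fsp_def\<close>)
      qed
    qed
    have "x \<in> g ` fsp {..<n}" if x: "x \<in> carrier F" for x
    proof -
      obtain a where a: "x = (\<Oplus>\<^bsub>F\<^esub>b\<in>B. a b \<odot>\<^bsub>F\<^esub> b)" using ex1[OF x] by blast
      define w where "w i = (if i < n then a (inv_into B \<iota> i) else 0)" for i
      have "w (\<iota> b) = a b" if "b \<in> B" for b
        using that \<iota> unfolding w_def bij_betw_def by auto
      then have "x = g w" unfolding a g_def using B scF by (intro F.M.finsum_cong') auto
      moreover have "w \<in> fsp {..<n}" by (simp add: w_def fsp_def)
      ultimately show ?thesis by blast
    qed
    then show "g ` fsp {..<n} = carrier F" using g_in by blast
  qed
  define h where "h = inv_into (fsp {..<n}) g"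
  have h_bij: "bij_betw h (carrier M) (fsp {..<n})" using bij_betw_inv_into[OF bij] unfolding h_def F_simps .
  have gh: "g (h x) = x" if "x \<in> carrier M" for x
    using bij_betw_inv_into_right[OF bij] that unfolding h_def F_simps .
  have hg: "h (g v) = v" if "v \<in> fsp {..<n}" for v
    using bij_betw_inv_into_left[OF bij that] unfolding h_def .
  have h_in: "h x \<in> fsp {..<n}" if "x \<in> carrier M" for x using that h_bij unfolding bij_betw_def by blast
  have h_add: "h (x \<oplus>\<^bsub>M\<^esub> y) = h x + h y" if "x \<in> carrier M" "y \<in> carrier M" for x y
    using that hg[OF fsp_add[OF h_in h_in], of x y] by (simp add: g_add gh F_simps)
  have h_scale: "h ([:c:] \<odot>\<^bsub>M\<^esub> x) = fscale c (h x)" if "x \<in> carrier M" for c x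
    using that hg[OF fsp_scale[OF h_in], of x c] by (simp add: g_scale gh F_simps)
  \<comment> \<open>The action of x read in coordinates; its values on unit vectors are the columns
    of the matrix.\<close>
  define T where "T v = h ([:0, 1:] \<odot>\<^bsub>M\<^esub> g v)" for v
  have gM: "g v \<in> carrier M" for v using g_in F_simps by simp
  have T: "T v = mop {..<n} (\<lambda>i j. T (unitv j) i) v" if "v \<in> fsp {..<n}" for v
  proof (rule linear_on_fsp_mop[OF finite_lessThan _ _ _ that])
    fix v w :: "nat \<Rightarrow> 'k" and c
    show "T v \<in> fsp {..<n}" unfolding T_def by (intro h_in sc gM)
    show "T (v + w) = T v + T w" unfolding T_def g_add F_simps
      using M.smult_r_distr[OF _ gM gM, of "[:0, 1:]" v w] by (simp add: ring_of_type_algebra_def h_add sc gM)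
    show "T (fscale c v) = fscale c (T v)"
    proof -
      have "[:0, 1:] \<odot>\<^bsub>M\<^esub> ([:c:] \<odot>\<^bsub>M\<^esub> g v) = [:c:] \<odot>\<^bsub>M\<^esub> ([:0, 1:] \<odot>\<^bsub>M\<^esub> g v)"
        using M.smult_assoc1[OF _ _ gM, of "[:0, 1:]" "[:c:]" v] M.smult_assoc1[OF _ _ gM, of "[:c:]" "[:0, 1:]" v]
        by (simp add: ring_of_type_algebra_def)
      then show ?thesis unfolding T_def g_scale F_simps by (simp add: h_scale sc gM)
    qed
  qed
  have "kx_rec (mact {..<n} (\<lambda>i j. T (unitv j) i)) M (fsp {..<n}) h"
  proof (rule kx_recI_x[OF mact_kx_space fsp_subspace M h_bij h_add])
    fix x assume x: "x \<in> carrier M"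
    show "h ([:c:] \<odot>\<^bsub>M\<^esub> x) = mact {..<n} (\<lambda>i j. T (unitv j) i) [:c:] (h x)" for c
      using h_scale[OF x] by simp
    show "h ([:0, 1:] \<odot>\<^bsub>M\<^esub> x) = mact {..<n} (\<lambda>i j. T (unitv j) i) [:0, 1:] (h x)"
      unfolding mact_x T[OF h_in[OF x], symmetric] by (simp add: T_def gh x)
  qed
  then show ?thesis using that by blast
qed

text \<open>Coordinate vectors are stored as lists of length \<open>n\<close>, the carrier type over
  which isomorphism classes are formed.\<close>

lemma fd_module_list_copy:
  fixes M :: "('k::field poly, 'w, 'm) module_scheme"
  assumes "fd_module M"
  obtains N :: "('k poly, 'k list) module" where "fd_module N" "module_iso M N"
proof -
  obtain n a h where h: "kx_rec (mact {..<n::nat} a) M (fsp {..<n}) h" using fd_module_model[OF assms] .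
  define g :: "'k list \<Rightarrow> nat \<Rightarrow> 'k" where "g xs = (\<lambda>i. if i < n then xs ! i else 0)" for xs
  have "bij_betw g {xs. length xs = n} (fsp {..<n})"
  proof (rule bij_betw_byWitness[where f' = "\<lambda>v. map v [0..<n]"])
    show "\<forall>xs\<in>{xs. length xs = n}. map (g xs) [0..<n] = xs" by (auto simp: g_def intro: nth_equalityI)
    show "\<forall>v\<in>fsp {..<n}. g (map v [0..<n]) = v" by (auto simp: g_def fsp_def)
  qed (auto simp: g_def fsp_def)
  then obtain N :: "('k poly, 'k list) module" where N: "rec_iso (mact {..<n} a) N (fsp {..<n}) g"
    using rec_iso_model_exists[OF kx_space.act_module[OF mact_kx_space] fsp_subspace] by blast
  then have kN: "kx_rec (mact {..<n} a) N (fsp {..<n}) g" unfolding kx_rec_def using mact_kx_space by blast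
  have "fd_module N" using kx_rec.fd_module_iff[OF kN] fsp_fd_dim(1)[of "{..<n}" a] by simp
  moreover have "module_iso M N" using h N unfolding kx_rec_def by (blast intro: rec_iso_module_iso)
  ultimately show ?thesis using that by blast
qed

section \<open>Cyclic modules\<close>

text \<open>The map sending a polynomial \<open>g\<close> to \<open>g u\<close> has the principal
  ideal of \<open>f\<close> as its kernel.\<close>

lemma (in kx_space) cyclic_module_kx_rec:
  assumes "exact f u"
  obtains h where "kx_rec act (cyclic_module f) (cyc u) h"
proof -
  interpret q: quotient_kernel "poly_module :: ('k poly, 'k poly) module" "\<lambda>g. act g u"
    by standard (auto simp: poly_module_def ring.extend_def module.fields_def ring_of_type_algebra_def m.scale_left_distrib)
  have "PIdl\<^bsub>ring_of_type_algebra\<^esub> f = q.ker"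
    unfolding cgenideal_def q.ker_def using assms unfolding exact_def
    by (auto simp: poly_module_def ring.extend_def module.fields_def ring_of_type_algebra_def dvd_def mult.commute)
  then have c: "cyclic_module f = quotient_module poly_module q.ker" by (simp add: cyclic_module_def)
  have "rec_iso act (cyclic_module f) ((\<lambda>g. act g u) ` carrier poly_module) (\<lambda>C. the_elem ((\<lambda>g. act g u) ` C))"
    unfolding c
    by (rule q.quotient_rec_iso[OF act_module])
      (auto simp: poly_module_def ring.extend_def module.fields_def ring_of_type_algebra_def)
  moreover have "(\<lambda>g. act g u) ` carrier poly_module = cyc u"
    by (simp add: cyc_def poly_module_def ring.extend_def module.fields_def ring_of_type_algebra_def)
  ultimately show ?thesis using that kx_space_axioms unfolding kx_rec_def by metis
qed

text \<open>Column \<open>j\<close> holds the coefficients of the remainder of x^(j+1), so this is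
  multiplication by x on \<open>k[x]/f\<close> in the basis 1, x, x^2, ...\<close>

definition companion :: "'k::field poly \<Rightarrow> nat \<Rightarrow> nat \<Rightarrow> 'k" where
  "companion f i j = coeff (monom 1 (Suc j) mod f) i"

lemma mod_sum_poly: "(\<Sum>a\<in>A. p a) mod f = (\<Sum>a\<in>A. p a mod f)" for f :: "'k::field poly"
  by (induction A rule: infinite_finite_induct) (simp_all add: poly_mod_add_left)

lemma companion_mop:
  assumes f: "f \<noteq> 0"
  shows "mop {..<degree f} (companion f) (coeff (g mod f)) = coeff (([:0, 1:] * g) mod f)"
proof
  fix i
  define n where "n = degree f"
  define c where "c = coeff (g mod f)"
  have c0: "c j = 0" if "j \<ge> n" for j
    using degree_mod_less[OF f, of g] that unfolding c_def n_def by (cases "g mod f = 0") (auto intro: coeff_eq_0)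
  have gm: "g mod f = (\<Sum>j<n. monom (c j) j)"
    by (rule poly_eqI) (auto simp: sum_monom_lt c0 c_def[symmetric] not_less)
  have "([:0, 1:] * g) mod f = ([:0, 1:] * (g mod f)) mod f" by (simp only: mod_mult_right_eq)
  also have "[:0, 1:] * (g mod f) = (\<Sum>j<n. smult (c j) (monom 1 (Suc j)))"
    unfolding gm by (simp add: sum_distrib_left smult_monom monom_Suc)
  also have "\<dots> mod f = (\<Sum>j<n. smult (c j) (monom 1 (Suc j) mod f))"
    by (simp add: mod_sum_poly mod_smult_left)
  finally have e: "coeff (([:0, 1:] * g) mod f) i = (\<Sum>j<n. companion f i j * c j)"
    by (simp add: coeff_sum companion_def mult.commute)
  have "coeff (([:0, 1:] * g) mod f) i = 0" if "i \<ge> n"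
    using degree_mod_less[OF f, of "[:0, 1:] * g"] that unfolding n_def
    by (cases "([:0, 1:] * g) mod f = 0") (auto intro: coeff_eq_0)
  then show "mop {..<degree f} (companion f) (coeff (g mod f)) i = coeff (([:0, 1:] * g) mod f) i"
    unfolding mop_def n_def[symmetric] c_def[symmetric] e by auto
qed

lemma companion_mact:
  assumes f: "f \<noteq> 0"
  shows "mact {..<degree f} (companion f) p (coeff (g mod f)) = coeff ((p * g) mod f)"
proof (induction p)
  case (pCons c p)
  have "pCons c p * g = smult c g + [:0, 1:] * (p * g)" by simp
  then have "(pCons c p * g) mod f = smult c (g mod f) + ([:0, 1:] * (p * g)) mod f"
    by (simp only: poly_mod_add_left mod_smult_left)
  then show ?case unfolding mact_pCons pCons.IH companion_mop[OF f] by auto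
qed auto

text \<open>The generator is the class of 1. It is written \<open>1 mod f\<close> so that a constant
  \<open>f\<close> is covered, for which the quotient is zero.\<close>

lemma companion_exact:
  assumes f: "f \<noteq> 0"
  shows "kx_space.exact (mact {..<degree f} (companion f)) f (coeff (1 mod f))"
  unfolding kx_space.exact_def[OF mact_kx_space] companion_mact[OF f]
proof
  fix r
  have "coeff (r mod f) = 0 \<longleftrightarrow> r mod f = 0" by (simp add: poly_eq_iff fun_eq_iff)
  then show "coeff ((r * 1) mod f) = 0 \<longleftrightarrow> f dvd r" by (simp add: mod_eq_0_iff_dvd)
qed

lemma companion_cyc:
  assumes f: "f \<noteq> 0"
  shows "kx_space.cyc (mact {..<degree f} (companion f)) (coeff (1 mod f)) = fsp {..<degree f}"
proof -
  interpret kx_space "mact {..<degree f} (companion f)" by (rule mact_kx_space)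
  have "v \<in> cyc (coeff (1 mod f))" if v: "v \<in> fsp {..<degree f}" for v
  proof -
    define g where "g = (\<Sum>i<degree f. monom (v i) i)"
    have cg: "coeff g = v" using v unfolding g_def fsp_def by (auto simp: sum_monom_lt)
    have "g mod f = g"
    proof (cases "degree f = 0")
      case False
      then have "degree g < degree f" unfolding g_def by (intro degree_sum_monom_less) simp
      then show ?thesis by (rule mod_poly_less)
    qed (simp add: g_def)
    then have "v = mact {..<degree f} (companion f) g (coeff (1 mod f))" unfolding companion_mact[OF f] using cg by simp
    then show ?thesis by simp
  qed
  moreover have "coeff (1 mod f) \<in> fsp {..<degree f}"
    using degree_mod_less[OF f, of 1] unfolding fsp_def
    by (cases "1 mod f = 0") (auto intro: coeff_eq_0)
  ultimately show ?thesis using cyc_minimal[OF fsp_subspace] by blast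
qed

lemma cyclic_module_companion:
  assumes f: "f \<noteq> 0"
  obtains h where "kx_rec (mact {..<degree f} (companion f)) (cyclic_module f) (fsp {..<degree f}) h"
  using kx_space.cyclic_module_kx_rec[OF mact_kx_space companion_exact[OF f]] companion_cyc[OF f] by metis

lemma fd_cyclic_module: "f \<noteq> 0 \<Longrightarrow> fd_module (cyclic_module f)"
proof -
  assume "f \<noteq> 0"
  then obtain h where "kx_rec (mact {..<degree f} (companion f)) (cyclic_module f) (fsp {..<degree f}) h"
    using cyclic_module_companion by blast
  then show ?thesis using kx_rec.fd_module_iff fsp_fd_dim(1)[of "{..<degree f}" "companion f"] by blast
qed


section \<open>The Krull-Schmidt theorem and classes of modules\<close>

lemma (in kx_space) exact_zero: "exact f u \<Longrightarrow> act f u = 0"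
  by (simp add: exact_def)

lemma (in kx_space) fd_primary_cyc: "primary_cyc V p s \<Longrightarrow> fd V"
  unfolding primary_cyc_def using fd_cyc exact_zero by (metis irreducible_def power_not_zero)

text \<open>Both modules acquire the same coordinate model, and modules with a common model are
  isomorphic in either direction.\<close>

lemma module_iso_sym:
  assumes "is_module M" "fd_module N" "module_iso M N"
  shows "module_iso N M"
proof -
  obtain n a g where g: "kx_rec (mact {..<n::nat} a) N (fsp {..<n}) g" using fd_module_model[OF assms(2)] .
  then obtain h where "rec_iso (mact {..<n::nat} a) M (fsp {..<n}) h"
    using rec_iso_compose[OF assms(1,3)] unfolding kx_rec_def by blast
  then show ?thesis using g rec_iso_module_iso unfolding kx_rec_def by blast
qed

lemma fd_module_is_module: "fd_module M \<Longrightarrow> is_module M"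
  by (simp add: fd_module_def)

lemma iso_class_cong:
  assumes "fd_module M" "fd_module N" "module_iso M N"
  shows "iso_class M = iso_class N"
proof -
  have "module_iso N M" using module_iso_sym assms fd_module_is_module by blast
  then show ?thesis unfolding iso_class_def using assms(3) by (auto intro: module_iso_trans)
qed

lemma iso_class_nonempty:
  assumes "fd_module M"
  shows "\<exists>N. N \<in> iso_class M"
  using fd_module_list_copy[OF assms] unfolding iso_class_def by (metis (mono_tags, lifting) mem_Collect_eq)

lemma iso_class_eqD:
  assumes "fd_module M" "fd_module N" "iso_class M = iso_class N"
  shows "module_iso M N"
proof -
  obtain L where L: "L \<in> iso_class M" using iso_class_nonempty assms(1) by blast
  then have "module_iso M L" "fd_module L" unfolding iso_class_def by auto
  moreover have "module_iso N L" using L assms(3) unfolding iso_class_def by auto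
  then have "module_iso L N" using module_iso_sym assms(2) fd_module_is_module \<open>fd_module L\<close> by blast
  ultimately show ?thesis using module_iso_trans by blast
qed

lemma representative_iso_class:
  assumes "fd_module M"
  shows "fd_module (representative (iso_class M))" "module_iso M (representative (iso_class M))"
proof -
  have "representative (iso_class M) \<in> iso_class M"
    unfolding representative_def by (rule someI_ex) (rule iso_class_nonempty[OF assms])
  then show "fd_module (representative (iso_class M))" "module_iso M (representative (iso_class M))"
    unfolding iso_class_def by auto
qed

lemma (in kx_space) kills_primary_cyc_iff:
  assumes "primary_cyc V p s"
  shows "kills f V \<longleftrightarrow> p ^ s dvd f"
proof -
  obtain u where u: "V = cyc u" "exact (p ^ s) u" using assms unfolding primary_cyc_def by blast
  show ?thesis
  proof
    assume "kills f V"
    then have "act f u = 0" unfolding kills_def u(1) using self_in_cyc by blast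
    then show "p ^ s dvd f" using u(2) unfolding exact_def by blast
  next
    assume d: "p ^ s dvd f"
    show "kills f V" unfolding kills_def
    proof
      fix v assume "v \<in> V"
      then obtain r where r: "v = act r u" unfolding u(1) by (rule cycE)
      have "p ^ s dvd f * r" using d by simp
      then show "act f v = 0" unfolding r using u(2) unfolding exact_def by simp
    qed
  qed
qed

lemma (in kx_rec) kills_iff: "kills f V \<longleftrightarrow> (\<forall>x\<in>carrier M. f \<odot>\<^bsub>M\<^esub> x = \<zero>\<^bsub>M\<^esub>)"
proof -
  have "f \<odot>\<^bsub>M\<^esub> x = \<zero>\<^bsub>M\<^esub> \<longleftrightarrow> act f (h x) = 0" if "x \<in> carrier M" for x
    using M_smult[OF that, of f] M_zero h_eqD[of "f \<odot>\<^bsub>M\<^esub> x" "\<zero>\<^bsub>M\<^esub>"] by auto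
  then show ?thesis unfolding kills_def h_image[symmetric] by simp
qed

definition primary_class :: "'k::field poly \<Rightarrow> nat \<Rightarrow> 'k kx_class" where
  "primary_class p s = iso_class (cyclic_module (p ^ s))"

context kx_rec
begin

lemma fd_moduleI: "fd V \<Longrightarrow> fd_module M"
  using fd_module_iff by blast

lemma iso_class_primary:
  assumes "primary_cyc V p s"
  shows "iso_class M = primary_class p s"
proof -
  obtain u where u: "V = cyc u" "exact (p ^ s) u" and p: "irreducible p" using assms unfolding primary_cyc_def by blast
  obtain g where g: "kx_rec act (cyclic_module (p ^ s)) V g" using cyclic_module_kx_rec[OF u(2)] u(1) by metis
  have "p ^ s \<noteq> 0" using p by auto
  then have f: "fd V" unfolding u(1) using fd_cyc[OF exact_zero[OF u(2)]] by blast
  have "module_iso M (cyclic_module (p ^ s))"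
    using rec_iso_module_iso[OF rec_iso_axioms] g unfolding kx_rec_def by blast
  then show ?thesis unfolding primary_class_def
    by (rule iso_class_cong[OF fd_moduleI[OF f] fd_cyclic_module[OF \<open>p ^ s \<noteq> 0\<close>]])
qed

lemma indecomposable_primary:
  assumes "fd V" "indec V"
  obtains p s where "primary_cyc V p s" "iso_class M = primary_class p s"
  using indec_primary_cyc[OF V assms] iso_class_primary by metis

lemma decomposition_primary:
  assumes f: "fd V" and D: "indecomposable_decomposition M n U"
  obtains p s where "dsum V n (\<lambda>i. h ` U i)" "\<forall>i<n. m.subspace (h ` U i)" "\<forall>i<n. primary_cyc (h ` U i) (p i) (s i)"
    "(\<Sum>i<n. frag_of (iso_class (M\<lparr>carrier := U i\<rparr>))) = (\<Sum>i<n. frag_of (primary_class (p i) (s i)))"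
proof -
  have sub: "\<forall>i<n. is_submodule (U i) M" using D unfolding indecomposable_decomposition_def by blast
  have d: "dsum V n (\<lambda>i. h ` U i)" "\<forall>i<n. indec (h ` U i)" using D decomposition_iff[OF sub] by blast+
  have S: "\<forall>i<n. m.subspace (h ` U i)"
    using sub is_submodule_iff module.submoduleE(1)[OF is_module] by blast
  have "\<forall>i. \<exists>x. i < n \<longrightarrow> primary_cyc (h ` U i) (fst x) (snd x) \<and> iso_class (M\<lparr>carrier := U i\<rparr>) = primary_class (fst x) (snd x)"
  proof
    fix i
    show "\<exists>x. i < n \<longrightarrow> primary_cyc (h ` U i) (fst x) (snd x) \<and> iso_class (M\<lparr>carrier := U i\<rparr>) = primary_class (fst x) (snd x)"
    proof (cases "i < n")
      case True
      have "h ` U i \<subseteq> V" using dsum_piece_subset[OF d(1) _ True] S subspace_scal by blast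
      then have "fd (h ` U i)" using fd_mono[OF f] by blast
      then obtain p s where "primary_cyc (h ` U i) p s" "iso_class (M\<lparr>carrier := U i\<rparr>) = primary_class p s"
        using kx_rec.indecomposable_primary[OF submodule_kx_rec] sub d(2) True by metis
      then show ?thesis by (intro exI[of _ "(p, s)"]) simp
    qed simp
  qed
  then obtain x where x: "\<And>i. i < n \<Longrightarrow> primary_cyc (h ` U i) (fst (x i)) (snd (x i))"
    "\<And>i. i < n \<Longrightarrow> iso_class (M\<lparr>carrier := U i\<rparr>) = primary_class (fst (x i)) (snd (x i))" by metis
  show ?thesis
    by (rule that[OF d(1) S, of "\<lambda>i. fst (x i)" "\<lambda>i. snd (x i)"]) (use x in auto)
qed

text \<open>\<open>rep_class\<close> is a definite description, so it has a value only if all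
  indecomposable decompositions give the same sum. Uniqueness of the multiset of labels provides
  this, and any decomposition into primary cyclic pieces computes the value.\<close>

theorem rep_class_eq:
  assumes f: "fd V" and W: "dsum V n W" "\<forall>i<n. m.subspace (W i)" "\<forall>i<n. primary_cyc (W i) (p i) (s i)"
  shows "rep_class M = (\<Sum>i<n. frag_of (primary_class (p i) (s i)))"
proof -
  have uniq: "(\<Sum>i<n'. frag_of (iso_class (M\<lparr>carrier := U i\<rparr>))) = (\<Sum>i<n. frag_of (primary_class (p i) (s i)))"
    if D: "indecomposable_decomposition M n' U" for n' U
  proof -
    obtain p' s' where ps: "dsum V n' (\<lambda>i. h ` U i)" "\<forall>i<n'. m.subspace (h ` U i)" "\<forall>i<n'. primary_cyc (h ` U i) (p' i) (s' i)"
      "(\<Sum>i<n'. frag_of (iso_class (M\<lparr>carrier := U i\<rparr>))) = (\<Sum>i<n'. frag_of (primary_class (p' i) (s' i)))"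
      by (rule decomposition_primary[OF f D])
    \<comment> \<open>The sum depends on the multiset of labels only, which is the form in which
      uniqueness is available.\<close>
    have ms: "(\<Sum>i<n. frag_of (primary_class (p i) (s i))) =
        sum_mset (image_mset (\<lambda>(p, s). frag_of (primary_class p s)) (image_mset (\<lambda>i. (p i, s i)) (mset_set {..<n})))"
      for n and p :: "nat \<Rightarrow> 'k poly" and s
      by (simp add: sum_unfold_sum_mset image_mset.compositionality comp_def)
    show ?thesis unfolding ps(4) ms primary_decomposition_unique[OF f ps(1,2,3) W] ..
  qed
  have "\<forall>i. \<exists>U. i < n \<longrightarrow> is_submodule U M \<and> h ` U = W i"
  proof
    fix i
    show "\<exists>U. i < n \<longrightarrow> is_submodule U M \<and> h ` U = W i"
    proof (cases "i < n")
      case True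
      then have "W i \<subseteq> V" using dsum_piece_subset[OF W(1)] W(2) subspace_scal by blast
      then obtain U where "is_submodule U M" "h ` U = W i" using preimage_submodule W(2) True by metis
      then show ?thesis by blast
    qed simp
  qed
  from choice[OF this] obtain U where U: "\<forall>i<n. is_submodule (U i) M \<and> h ` U i = W i" by blast
  have "dsum V n (\<lambda>i. h ` U i)"
  proof -
    have "dsum V n W = dsum V n (\<lambda>i. h ` U i)" using U unfolding dsum_def by simp
    then show ?thesis using W(1) by simp
  qed
  then have D: "indecomposable_decomposition M n U"
    using decomposition_iff[of n U] U W(3) primary_cyc_indec by metis
  show ?thesis unfolding rep_class_def
  proof (rule the_equality)
    show "\<exists>n' U. indecomposable_decomposition M n' U \<and>
       (\<Sum>i<n. frag_of (primary_class (p i) (s i))) = (\<Sum>i<n'. frag_of (iso_class (M\<lparr>carrier := U i\<rparr>)))"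
      by (intro exI[of _ n] exI[of _ U] conjI D uniq[OF D, symmetric])
  next
    fix r assume "\<exists>n' U. indecomposable_decomposition M n' U \<and> r = (\<Sum>i<n'. frag_of (iso_class (M\<lparr>carrier := U i\<rparr>)))"
    then obtain n' U where D: "indecomposable_decomposition M n' U"
      and r: "r = (\<Sum>i<n'. frag_of (iso_class (M\<lparr>carrier := U i\<rparr>)))" by (elim exE conjE)
    show "r = (\<Sum>i<n. frag_of (primary_class (p i) (s i)))" unfolding r by (rule uniq[OF D])
  qed
qed

lemma primary_decomposition_exists:
  assumes f: "fd V"
  obtains n W p s where "dsum V n W" "\<forall>i<n. m.subspace (W i)" "\<forall>i<n. primary_cyc (W i) (p i) (s i)"
proof -
  obtain n W where W: "dsum V n W" "\<forall>i<n. m.subspace (W i) \<and> indec (W i)"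
    using indec_decomposition_exists[OF V f] by blast
  have "\<forall>i. \<exists>x. i < n \<longrightarrow> primary_cyc (W i) (fst x) (snd x)"
  proof
    fix i
    show "\<exists>x. i < n \<longrightarrow> primary_cyc (W i) (fst x) (snd x)"
    proof (cases "i < n")
      case True
      then have "W i \<subseteq> V" using dsum_piece_subset[OF W(1)] W(2) subspace_scal by blast
      then show ?thesis using indec_primary_cyc[of "W i"] W(2) True fd_mono[OF f] by (metis fst_conv snd_conv)
    qed simp
  qed
  then obtain x where "\<forall>i<n. primary_cyc (W i) (fst (x i)) (snd (x i))" by metis
  then show ?thesis using that[OF W(1), of "\<lambda>i. fst (x i)" "\<lambda>i. snd (x i)"] W(2) by blast
qed

lemma rep_class_sum:
  assumes AB: "V = ssum A B" "A \<inter> B = {0}" "fd A" "fd B"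
    and MA: "kx_rec act MA A hA" and MB: "kx_rec act MB B hB"
  shows "rep_class M = rep_class MA + rep_class MB"
proof -
  interpret A: kx_rec act MA A hA by (rule MA)
  interpret B: kx_rec act MB B hB by (rule MB)
  obtain n W p s where W: "dsum A n W" "\<forall>i<n. m.subspace (W i)" "\<forall>i<n. primary_cyc (W i) (p i) (s i)"
    using A.primary_decomposition_exists[OF AB(3)] .
  obtain n' W' p' s' where W': "dsum B n' W'" "\<forall>i<n'. m.subspace (W' i)" "\<forall>i<n'. primary_cyc (W' i) (p' i) (s' i)"
    using B.primary_decomposition_exists[OF AB(4)] .
  let ?P = "\<lambda>i. if i < n then p i else p' (i - n)" and ?S = "\<lambda>i. if i < n then s i else s' (i - n)"
  have f: "fd V" unfolding AB(1) using fd_ssum AB by blast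
  have "rep_class M = (\<Sum>i<n + n'. frag_of (primary_class (?P i) (?S i)))"
    by (rule rep_class_eq[OF f dsum_append[OF AB(1,2) A.V W(1) B.V W'(1)]]) (use W W' in auto)
  also have "\<dots> = (\<Sum>i<n. frag_of (primary_class (?P i) (?S i))) + (\<Sum>i<n'. frag_of (primary_class (?P (n + i)) (?S (n + i))))"
    by (induction n') (simp_all add: add.assoc)
  also have "\<dots> = rep_class MA + rep_class MB"
    unfolding A.rep_class_eq[OF AB(3) W] B.rep_class_eq[OF AB(4) W'] by simp
  finally show ?thesis .
qed

lemma rep_class_same:
  assumes "fd V" and N: "kx_rec act N V g"
  shows "rep_class M = rep_class N"
proof -
  obtain n W p s where W: "dsum V n W" "\<forall>i<n. m.subspace (W i)" "\<forall>i<n. primary_cyc (W i) (p i) (s i)"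
    using primary_decomposition_exists[OF assms(1)] .
  show ?thesis using rep_class_eq[OF assms(1) W] kx_rec.rep_class_eq[OF N assms(1) W] by simp
qed

lemma rep_class_zero:
  assumes "V = {0}"
  shows "rep_class M = 0"
proof -
  have "fd V" unfolding fd_def assms by (intro exI[of _ "{}"]) simp
  from rep_class_eq[OF this, of 0] show ?thesis using assms by simp
qed

lemma rep_class_primary:
  assumes "primary_cyc V p s"
  shows "rep_class M = frag_of (primary_class p s)"
proof -
  have f: "fd V" by (rule fd_primary_cyc[OF assms])
  have "dsum V 1 (\<lambda>_. V)" unfolding dsum_def by (auto intro: exI[of _ "\<lambda>_. _"])
  from rep_class_eq[OF f this, of "\<lambda>_. p" "\<lambda>_. s"] show ?thesis using assms V by simp
qed

end

lemma rep_class_cong: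
  assumes "is_module M" "fd_module N" "module_iso M N"
  shows "rep_class M = rep_class N"
proof -
  obtain n a g where g: "kx_rec (mact {..<n::nat} a) N (fsp {..<n}) g" using fd_module_model[OF assms(2)] .
  then obtain h where "rec_iso (mact {..<n::nat} a) M (fsp {..<n}) h"
    using rec_iso_compose[OF assms(1,3)] unfolding kx_rec_def by blast
  then have "kx_rec (mact {..<n::nat} a) M (fsp {..<n}) h" unfolding kx_rec_def using mact_kx_space by blast
  then show ?thesis using kx_rec.rep_class_same[OF _ _ g] kx_rec.fd_module_iff[OF g] assms(2) by blast
qed

lemma primary_class_indecomposable:
  assumes p: "irreducible p" "lead_coeff p = 1" and s: "s \<ge> 1"
  shows "primary_class p s \<in> indecomposable_classes"
    "rep_class (cyclic_module (p ^ s)) = frag_of (primary_class p s)"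
proof -
  have nz: "p ^ s \<noteq> 0" using p by auto
  define d where "d = degree (p ^ s)"
  interpret K: kx_space "mact {..<d} (companion (p ^ s))" by (rule mact_kx_space)
  obtain h where h: "kx_rec (mact {..<d} (companion (p ^ s))) (cyclic_module (p ^ s)) (fsp {..<d}) h"
    using cyclic_module_companion[OF nz] unfolding d_def by blast
  have pc: "K.primary_cyc (fsp {..<d}) p s"
    unfolding K.primary_cyc_def using companion_exact[OF nz] companion_cyc[OF nz] p s unfolding d_def by metis
  show "rep_class (cyclic_module (p ^ s)) = frag_of (primary_class p s)"
    by (rule kx_rec.rep_class_primary[OF h pc])
  have fdm: "fd_module (cyclic_module (p ^ s))" by (rule fd_cyclic_module[OF nz])
  \<comment> \<open>\<open>indecomposable_classes\<close> ranges over modules on lists, so the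
    cyclic module is replaced by an isomorphic copy of that kind.\<close>
  obtain N :: "('a poly, 'a list) module" where N: "fd_module N" "module_iso (cyclic_module (p ^ s)) N"
    using fd_module_list_copy[OF fdm] .
  have "module_iso N (cyclic_module (p ^ s))" using module_iso_sym[OF _ N] fdm fd_module_is_module by blast
  then obtain g where "rec_iso (mact {..<d} (companion (p ^ s))) N (fsp {..<d}) g"
    using rec_iso_compose h N fd_module_is_module unfolding kx_rec_def by metis
  then have "kx_rec (mact {..<d} (companion (p ^ s))) N (fsp {..<d}) g" unfolding kx_rec_def using mact_kx_space by blast
  then have "indecomposable N" using kx_rec.indecomposable_iff K.primary_cyc_indec[OF pc] by blast
  moreover have "primary_class p s = iso_class N" unfolding primary_class_def by (rule iso_class_cong[OF fdm N])
  ultimately show "primary_class p s \<in> indecomposable_classes" unfolding indecomposable_classes_def using N by blast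
qed

lemma indecomposable_classE:
  assumes "C \<in> indecomposable_classes"
  obtains p s where "irreducible p" "lead_coeff p = 1" "s \<ge> 1" "C = primary_class p s"
proof -
  obtain M :: "('a poly, 'a list) module" where M: "fd_module M" "indecomposable M" "C = iso_class M"
    using assms unfolding indecomposable_classes_def by blast
  obtain n a h where h: "kx_rec (mact {..<n::nat} a) M (fsp {..<n}) h" using fd_module_model[OF M(1)] .
  then interpret kx_rec "mact {..<n} a" M "fsp {..<n}" h .
  obtain p s where "primary_cyc (fsp {..<n}) p s" "C = primary_class p s"
    using indecomposable_primary M fd_module_iff indecomposable_iff by metis
  then show ?thesis using that unfolding primary_cyc_def by blast
qed

text \<open>Isomorphic modules are killed by the same polynomials. Hence \<open>p ^ s\<close> and
  \<open>q ^ t\<close> divide each other, and the two monic primes agree; degrees then give the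
  exponents.\<close>

lemma primary_class_inj:
  assumes p: "irreducible p" "lead_coeff p = 1" "s \<ge> 1" and q: "irreducible q" "lead_coeff q = 1" "t \<ge> 1"
    and eq: "primary_class p s = primary_class q t"
  shows "p = q \<and> s = t"
proof -
  have nz: "p ^ s \<noteq> 0" "q ^ t \<noteq> 0" using p q by auto
  have "module_iso (cyclic_module (p ^ s)) (cyclic_module (q ^ t))"
    by (rule iso_class_eqD[OF fd_cyclic_module[OF nz(1)] fd_cyclic_module[OF nz(2)] eq[unfolded primary_class_def]])
  moreover define d where "d = degree (q ^ t)"
  interpret K: kx_space "mact {..<d} (companion (q ^ t))" by (rule mact_kx_space)
  obtain h where h: "kx_rec (mact {..<d} (companion (q ^ t))) (cyclic_module (q ^ t)) (fsp {..<d}) h"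
    using cyclic_module_companion[OF nz(2)] unfolding d_def by blast
  ultimately obtain g where "rec_iso (mact {..<d} (companion (q ^ t))) (cyclic_module (p ^ s)) (fsp {..<d}) g"
    using rec_iso_compose[OF fd_module_is_module[OF fd_cyclic_module[OF nz(1)]]] unfolding kx_rec_def by metis
  then have g: "kx_rec (mact {..<d} (companion (q ^ t))) (cyclic_module (p ^ s)) (fsp {..<d}) g" unfolding kx_rec_def using mact_kx_space by blast
  have pc: "K.primary_cyc (fsp {..<d}) q t"
    unfolding K.primary_cyc_def using companion_exact[OF nz(2)] companion_cyc[OF nz(2)] q unfolding d_def by metis
  define e where "e = degree (p ^ s)"
  interpret L: kx_space "mact {..<e} (companion (p ^ s))" by (rule mact_kx_space)
  obtain h' where h': "kx_rec (mact {..<e} (companion (p ^ s))) (cyclic_module (p ^ s)) (fsp {..<e}) h'"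
    using cyclic_module_companion[OF nz(1)] unfolding e_def by blast
  have pc': "L.primary_cyc (fsp {..<e}) p s"
    unfolding L.primary_cyc_def using companion_exact[OF nz(1)] companion_cyc[OF nz(1)] p unfolding e_def by metis
  interpret G: kx_rec "mact {..<d} (companion (q ^ t))" "cyclic_module (p ^ s)" "fsp {..<d}" g by (rule g)
  interpret H: kx_rec "mact {..<e} (companion (p ^ s))" "cyclic_module (p ^ s)" "fsp {..<e}" h' by (rule h')
  have dvd_iff: "q ^ t dvd f \<longleftrightarrow> p ^ s dvd f" for f
    using G.kills_iff[of f] H.kills_iff[of f] K.kills_primary_cyc_iff[OF pc, of f] L.kills_primary_cyc_iff[OF pc', of f] by blast
  have dv: "q ^ t dvd p ^ s" "p ^ s dvd q ^ t" using dvd_iff[of "p ^ s"] dvd_iff[of "q ^ t"] by simp_all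
  have "q dvd q ^ t" using q(3) by (simp add: dvd_power)
  then have "q dvd p ^ s" using dv by (metis dvd_trans)
  then have "q dvd p" using irreducible_dvd_power_poly[OF q(1)] by blast
  then have "q = p" using monic_irreducible_dvd_eq q p by blast
  moreover have "s = t"
  proof -
    have "degree (p ^ s) = degree (q ^ t)" using dv nz dvd_imp_degree_le by (metis le_antisym)
    moreover have "p \<noteq> 0" using p(1) by auto
    ultimately show ?thesis using \<open>q = p\<close> irreducible_degree_pos[OF p(1)] by (simp add: degree_power_eq)
  qed
  ultimately show ?thesis by simp
qed

lemma rep_class_in_carrier:
  assumes "fd_module M"
  shows "Poly_Mapping.keys (rep_class M) \<subseteq> indecomposable_classes"
proof -
  obtain n a h where h: "kx_rec (mact {..<n::nat} a) M (fsp {..<n}) h" using fd_module_model[OF assms] .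
  then interpret kx_rec "mact {..<n} a" M "fsp {..<n}" h .
  have f: "fd (fsp {..<n})" using fd_module_iff assms by blast
  obtain l W p s where W: "dsum (fsp {..<n}) l W" "\<forall>i<l. m.subspace (W i)" "\<forall>i<l. primary_cyc (W i) (p i) (s i)"
    using primary_decomposition_exists[OF f] .
  have "Poly_Mapping.keys (\<Sum>i<l. frag_of (primary_class (p i) (s i))) \<subseteq> (\<Union>i<l. {primary_class (p i) (s i)})"
    by (rule order_trans[OF keys_sum]) (simp add: keys_frag_of)
  also have "\<dots> \<subseteq> indecomposable_classes"
    using W(3) primary_class_indecomposable(1) unfolding primary_cyc_def by blast
  finally show ?thesis unfolding rep_class_eq[OF f W] .
qed


section \<open>Tensor products in coordinates\<close>

definition pscale :: "'r::comm_ring_1 \<Rightarrow> ('a \<Rightarrow>\<^sub>0 'r) \<Rightarrow> 'a \<Rightarrow>\<^sub>0 'r" where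
  "pscale r = Poly_Mapping.map ((*) r)"

lemma lookup_pscale [simp]: "Poly_Mapping.lookup (pscale r c) x = r * Poly_Mapping.lookup c x"
  by (simp add: pscale_def map.rep_eq when_def)

lemma pscale_module: "Modules.module pscale"
  by standard (auto intro!: poly_mapping_eqI simp: lookup_add algebra_simps)

lemma keys_pscale: "Poly_Mapping.keys (pscale r c) \<subseteq> Poly_Mapping.keys c"
  by (auto simp: in_keys_iff)

lemma pscale_single [simp]: "pscale r (Poly_Mapping.single x s) = Poly_Mapping.single x (r * s)"
  by (rule poly_mapping_eqI) (simp add: lookup_single when_def)

text \<open>Linear extension of \<open>g\<close> to formal sums. The map from the free module to a
  tensor product, the lifted shift and \<open>rep_dim\<close> are all of this form.\<close>

definition pext :: "('r::comm_ring_1 \<Rightarrow> 'u::ab_group_add \<Rightarrow> 'u) \<Rightarrow> ('a \<Rightarrow> 'u) \<Rightarrow> ('a \<Rightarrow>\<^sub>0 'r) \<Rightarrow> 'u" where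
  "pext s g c = (\<Sum>x\<in>Poly_Mapping.keys c. s (Poly_Mapping.lookup c x) (g x))"

context Modules.module
begin

lemma pext_superset:
  assumes "finite S" "Poly_Mapping.keys c \<subseteq> S"
  shows "pext scale g c = (\<Sum>x\<in>S. scale (Poly_Mapping.lookup c x) (g x))"
  unfolding pext_def by (rule sum.mono_neutral_left) (use assms in \<open>auto simp: in_keys_iff\<close>)

lemma pext_add: "pext scale g (c + d) = pext scale g c + pext scale g d"
proof -
  let ?S = "Poly_Mapping.keys c \<union> Poly_Mapping.keys d"
  have "pext scale g (c + d) = (\<Sum>x\<in>?S. scale (Poly_Mapping.lookup (c + d) x) (g x))"
    by (rule pext_superset) (use Poly_Mapping.keys_add[of c d] in auto)
  also have "\<dots> = (\<Sum>x\<in>?S. scale (Poly_Mapping.lookup c x) (g x)) + (\<Sum>x\<in>?S. scale (Poly_Mapping.lookup d x) (g x))"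
    by (simp add: lookup_add scale_left_distrib sum.distrib)
  also have "\<dots> = pext scale g c + pext scale g d" by (subst (1 2) pext_superset[of ?S]) auto
  finally show ?thesis .
qed

lemma pext_pscale: "pext scale g (pscale r c) = scale r (pext scale g c)"
proof -
  have "pext scale g (pscale r c) = (\<Sum>x\<in>Poly_Mapping.keys c. scale (Poly_Mapping.lookup (pscale r c) x) (g x))"
    by (rule pext_superset) (auto intro: keys_pscale[THEN subsetD])
  then show ?thesis by (simp add: pext_def scale_sum_right)
qed

lemma pext_0 [simp]: "pext scale g 0 = 0"
  by (simp add: pext_def)

lemma pext_single [simp]: "pext scale g (Poly_Mapping.single x r) = scale r (g x)"
  by (subst pext_superset[of "{x}"]) auto

lemma pext_uminus: "pext scale g (- c) = - pext scale g c"
  using pext_add[of g c "- c"] by (simp add: eq_neg_iff_add_eq_0 add.commute)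

lemma pext_diff: "pext scale g (c - d) = pext scale g c - pext scale g d"
  using pext_add[of g c "- d"] by (simp add: pext_uminus)

end

lemma pext_pscale_single: "pext pscale (\<lambda>x. Poly_Mapping.single x 1) c = c"
proof (rule poly_mapping_eqI)
  fix y
  have "Poly_Mapping.lookup (pext pscale (\<lambda>x. Poly_Mapping.single x 1) c) y
      = (\<Sum>x\<in>Poly_Mapping.keys c. if x = y then Poly_Mapping.lookup c x else 0)"
    unfolding pext_def lookup_sum by (rule sum.cong) (auto simp: lookup_single when_def)
  also have "\<dots> = Poly_Mapping.lookup c y" by (simp add: in_keys_iff)
  finally show "Poly_Mapping.lookup (pext pscale (\<lambda>x. Poly_Mapping.single x 1) c) y = Poly_Mapping.lookup c y" .
qed

interpretation ps: Modules.module pscale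
  by (rule pscale_module)

text \<open>Serves as linear induction: a property that defines a submodule of formal sums need only
  be checked on single basis elements.\<close>

lemma subspace_singles:
  assumes S: "ps.subspace S" and "\<And>x. x \<in> A \<Longrightarrow> Poly_Mapping.single x 1 \<in> S" and "Poly_Mapping.keys c \<subseteq> A"
  shows "c \<in> S"
proof -
  have "pext pscale (\<lambda>x. Poly_Mapping.single x 1) c \<in> S"
    unfolding pext_def using assms by (intro ps.subspace_sum ps.subspace_scale) auto
  then show ?thesis unfolding pext_pscale_single .
qed

lemma keys_subspace: "ps.subspace {c. Poly_Mapping.keys c \<subseteq> A}"
  by (rule ps.subspaceI) (auto dest: Poly_Mapping.keys_add[THEN subsetD] keys_pscale[THEN subsetD])

lemma free_on_product_simps:
  "carrier (free_on_product V W) = {c. Poly_Mapping.keys c \<subseteq> carrier V \<times> carrier W}"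
  "\<zero>\<^bsub>free_on_product V W\<^esub> = 0" "add (free_on_product V W) = (+)" "r \<odot>\<^bsub>free_on_product V W\<^esub> c = pscale r c"
  by (simp_all add: free_on_product_def pscale_def)

lemma free_on_product_rec: "rec_iso pscale (free_on_product V W) (carrier (free_on_product V W)) (\<lambda>c. c)"
proof
  show "ps.subspace (carrier (free_on_product V W))" unfolding free_on_product_simps by (rule keys_subspace)
qed (auto simp: free_on_product_simps bij_betw_def dest: Poly_Mapping.keys_add[THEN subsetD] keys_pscale[THEN subsetD])

locale module_pair_record =
  fixes V :: "('r::comm_ring_1, 'v, 'm) module_scheme" and W :: "('r, 'w, 'n) module_scheme"
  assumes V: "is_module V" and W: "is_module W"
begin

sublocale V: Module.module ring_of_type_algebra V by (rule V)
sublocale W: Module.module ring_of_type_algebra W by (rule W)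

abbreviation "N \<equiv> tensor_kernel V W"

lemma smult_in: "x \<in> carrier V \<Longrightarrow> r \<odot>\<^bsub>V\<^esub> x \<in> carrier V" "y \<in> carrier W \<Longrightarrow> r \<odot>\<^bsub>W\<^esub> y \<in> carrier W"
  using V.smult_closed W.smult_closed by (simp_all add: ring_of_type_algebra_def)

lemma relations_in_carrier: "bilinear_relations V W \<subseteq> carrier (free_on_product V W)"
proof -
  have d: "c - d \<in> carrier (free_on_product V W)" if "c \<in> carrier (free_on_product V W)" "d \<in> carrier (free_on_product V W)" for c d
    using ps.subspace_diff[OF keys_subspace] that unfolding free_on_product_simps by blast
  have s: "Poly_Mapping.single (v, w) r \<in> carrier (free_on_product V W)" if "v \<in> carrier V" "w \<in> carrier W" for v w r
    using that unfolding free_on_product_simps by auto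
  show ?thesis unfolding bilinear_relations_def
    by (auto intro!: d s smult_in V.M.a_closed W.M.a_closed)
qed

text \<open>The relations lie in the carrier, so their linear span is already a submodule of the
  free module and therefore the hull.\<close>

lemma tensor_kernel_eq_span: "N = ps.span (bilinear_relations V W)"
proof -
  interpret F: rec_iso pscale "free_on_product V W" "carrier (free_on_product V W)" "\<lambda>c. c" by (rule free_on_product_rec)
  have sub: "is_submodule K (free_on_product V W) \<longleftrightarrow> K \<subseteq> carrier (free_on_product V W) \<and> ps.subspace K" for K
    using F.is_submodule_iff[of K] module.submoduleE(1)[OF F.is_module, of K] by auto
  have c: "ps.subspace (carrier (free_on_product V W))" unfolding free_on_product_simps by (rule keys_subspace)
  have "ps.span (bilinear_relations V W) \<subseteq> carrier (free_on_product V W)"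
    by (rule ps.span_minimal[OF relations_in_carrier c])
  then have "is_submodule (ps.span (bilinear_relations V W)) (free_on_product V W)" using sub ps.subspace_span by blast
  then show ?thesis unfolding tensor_kernel_def
    by (intro hull_unique) (auto intro: ps.span_superset[THEN subsetD] simp: sub dest: ps.span_minimal)
qed

lemma N_subspace: "ps.subspace N"
  unfolding tensor_kernel_eq_span by (rule ps.subspace_span)

lemma N_subset: "N \<subseteq> carrier (free_on_product V W)"
proof -
  have c: "ps.subspace (carrier (free_on_product V W))" unfolding free_on_product_simps by (rule keys_subspace)
  show ?thesis unfolding tensor_kernel_eq_span by (rule ps.span_minimal[OF relations_in_carrier c])
qed

lemma N_relations: "bilinear_relations V W \<subseteq> N"
  unfolding tensor_kernel_eq_span by (rule ps.span_superset)

lemma N_add1: "v \<in> carrier V \<Longrightarrow> v' \<in> carrier V \<Longrightarrow> w \<in> carrier W \<Longrightarrow>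
    Poly_Mapping.single (v \<oplus>\<^bsub>V\<^esub> v', w) 1 - Poly_Mapping.single (v, w) 1 - Poly_Mapping.single (v', w) 1 \<in> N"
  and N_add2: "v \<in> carrier V \<Longrightarrow> w \<in> carrier W \<Longrightarrow> w' \<in> carrier W \<Longrightarrow>
    Poly_Mapping.single (v, w \<oplus>\<^bsub>W\<^esub> w') 1 - Poly_Mapping.single (v, w) 1 - Poly_Mapping.single (v, w') 1 \<in> N"
  and N_smult1: "v \<in> carrier V \<Longrightarrow> w \<in> carrier W \<Longrightarrow>
    Poly_Mapping.single (r \<odot>\<^bsub>V\<^esub> v, w) 1 - Poly_Mapping.single (v, w) r \<in> N"
  and N_smult2: "v \<in> carrier V \<Longrightarrow> w \<in> carrier W \<Longrightarrow>
    Poly_Mapping.single (v, r \<odot>\<^bsub>W\<^esub> w) 1 - Poly_Mapping.single (v, w) r \<in> N"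
  by (rule subsetD[OF N_relations], unfold bilinear_relations_def, blast)+

lemma N_least:
  assumes K: "ps.subspace K"
    and "\<And>v v' w. v \<in> carrier V \<Longrightarrow> v' \<in> carrier V \<Longrightarrow> w \<in> carrier W \<Longrightarrow>
      Poly_Mapping.single (v \<oplus>\<^bsub>V\<^esub> v', w) 1 - Poly_Mapping.single (v, w) 1 - Poly_Mapping.single (v', w) 1 \<in> K"
    and "\<And>v w w'. v \<in> carrier V \<Longrightarrow> w \<in> carrier W \<Longrightarrow> w' \<in> carrier W \<Longrightarrow>
      Poly_Mapping.single (v, w \<oplus>\<^bsub>W\<^esub> w') 1 - Poly_Mapping.single (v, w) 1 - Poly_Mapping.single (v, w') 1 \<in> K"
    and "\<And>r v w. v \<in> carrier V \<Longrightarrow> w \<in> carrier W \<Longrightarrow>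
      Poly_Mapping.single (r \<odot>\<^bsub>V\<^esub> v, w) 1 - Poly_Mapping.single (v, w) r \<in> K"
    and "\<And>r v w. v \<in> carrier V \<Longrightarrow> w \<in> carrier W \<Longrightarrow>
      Poly_Mapping.single (v, r \<odot>\<^bsub>W\<^esub> w) 1 - Poly_Mapping.single (v, w) r \<in> K"
  shows "N \<subseteq> K"
  unfolding tensor_kernel_eq_span
  by (rule ps.span_minimal[OF _ K]) (use assms in \<open>auto simp: bilinear_relations_def\<close>)

definition spanned :: "'v set \<Rightarrow> 'w set \<Rightarrow> (('v \<times> 'w) \<Rightarrow>\<^sub>0 'r) set" where
  "spanned B C = {c. \<exists>d. Poly_Mapping.keys d \<subseteq> B \<times> C \<and> c - d \<in> N}"

lemma spanned_subspace: "ps.subspace (spanned B C)"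
proof (rule ps.subspaceI)
  show "0 \<in> spanned B C" unfolding spanned_def using ps.subspace_0[OF N_subspace] by (auto intro!: exI[of _ 0])
next
  fix x y assume "x \<in> spanned B C" "y \<in> spanned B C"
  then obtain d e where "Poly_Mapping.keys d \<subseteq> B \<times> C" "x - d \<in> N" "Poly_Mapping.keys e \<subseteq> B \<times> C" "y - e \<in> N"
    unfolding spanned_def by blast
  then have "Poly_Mapping.keys (d + e) \<subseteq> B \<times> C" "(x + y) - (d + e) \<in> N"
    using keys_add[of d e] ps.subspace_add[OF N_subspace, of "x - d" "y - e"] by (auto simp: algebra_simps)
  then show "x + y \<in> spanned B C" unfolding spanned_def by blast
next
  fix r x assume "x \<in> spanned B C"
  then obtain d where "Poly_Mapping.keys d \<subseteq> B \<times> C" "x - d \<in> N" unfolding spanned_def by blast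
  then have "Poly_Mapping.keys (pscale r d) \<subseteq> B \<times> C" "pscale r x - pscale r d \<in> N"
    using keys_pscale[of r d] ps.subspace_scale[OF N_subspace, of "x - d" r] by (auto simp: ps.scale_right_diff_distrib)
  then show "pscale r x \<in> spanned B C" unfolding spanned_def by blast
qed

lemma N_spanned: "c - d \<in> N \<Longrightarrow> d \<in> spanned B C \<Longrightarrow> c \<in> spanned B C"
proof -
  assume c: "c - d \<in> N" and "d \<in> spanned B C"
  then obtain e where e: "Poly_Mapping.keys e \<subseteq> B \<times> C" "d - e \<in> N" unfolding spanned_def by blast
  have "c - e \<in> N" using ps.subspace_add[OF N_subspace c e(2)] by simp
  then show ?thesis unfolding spanned_def using e by blast
qed

text \<open>Generation is stated as a closure principle because it is applied to sets of vectors
  that are not known to be submodules: to the second factor for fixed \<open>b\<close>, and then to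
  the first factor.\<close>

lemma tensor_spanned:
  assumes B: "\<And>K. \<lbrakk>B \<subseteq> K; \<zero>\<^bsub>V\<^esub> \<in> K; \<And>x y. x \<in> carrier V \<inter> K \<Longrightarrow> y \<in> carrier V \<inter> K \<Longrightarrow> x \<oplus>\<^bsub>V\<^esub> y \<in> K;
      \<And>r x. x \<in> carrier V \<inter> K \<Longrightarrow> r \<odot>\<^bsub>V\<^esub> x \<in> K\<rbrakk> \<Longrightarrow> carrier V \<subseteq> K"
    and C: "\<And>K. \<lbrakk>C \<subseteq> K; \<zero>\<^bsub>W\<^esub> \<in> K; \<And>x y. x \<in> carrier W \<inter> K \<Longrightarrow> y \<in> carrier W \<inter> K \<Longrightarrow> x \<oplus>\<^bsub>W\<^esub> y \<in> K;
      \<And>r x. x \<in> carrier W \<inter> K \<Longrightarrow> r \<odot>\<^bsub>W\<^esub> x \<in> K\<rbrakk> \<Longrightarrow> carrier W \<subseteq> K"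
    and sub: "B \<subseteq> carrier V"
    and c: "c \<in> carrier (free_on_product V W)"
  obtains d where "Poly_Mapping.keys d \<subseteq> B \<times> C" "c - d \<in> N"
proof -
  let ?S = "spanned B C"
  note S = spanned_subspace[of B C]
  have z: "0 \<in> N" by (rule ps.subspace_0[OF N_subspace])
  have "carrier W \<subseteq> {w. \<forall>b\<in>B. Poly_Mapping.single (b, w) 1 \<in> ?S}"
  proof (rule C)
    show "C \<subseteq> {w. \<forall>b\<in>B. Poly_Mapping.single (b, w) 1 \<in> ?S}"
      unfolding spanned_def using z by (auto intro!: exI[of _ "Poly_Mapping.single _ 1"])
    \<comment> \<open>The alternative \<open>r = 0\<close> gives the zero vector as 0 times itself,
      at a moment when its own tensor is not yet known to lie in the set.\<close>
    have *: "Poly_Mapping.single (b, r \<odot>\<^bsub>W\<^esub> x) 1 \<in> ?S"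
      if "b \<in> B" "x \<in> carrier W" "r = 0 \<or> Poly_Mapping.single (b, x) 1 \<in> ?S" for b r x
    proof (rule N_spanned[OF N_smult2])
      show "Poly_Mapping.single (b, x) r \<in> ?S"
        using that ps.subspace_scale[OF S, of "Poly_Mapping.single (b, x) 1" r] ps.subspace_0[OF S] by auto
    qed (use that sub in auto)
    have "0 \<odot>\<^bsub>W\<^esub> \<zero>\<^bsub>W\<^esub> = \<zero>\<^bsub>W\<^esub>" using W.smult_r_null[of 0] by (simp add: ring_of_type_algebra_def)
    then show "\<zero>\<^bsub>W\<^esub> \<in> {w. \<forall>b\<in>B. Poly_Mapping.single (b, w) 1 \<in> ?S}" using *[of _ "\<zero>\<^bsub>W\<^esub>" 0] by auto
    show "r \<odot>\<^bsub>W\<^esub> x \<in> {w. \<forall>b\<in>B. Poly_Mapping.single (b, w) 1 \<in> ?S}"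
      if "x \<in> carrier W \<inter> {w. \<forall>b\<in>B. Poly_Mapping.single (b, w) 1 \<in> ?S}" for r x using *[of _ x r] that by auto
    fix x y assume xy: "x \<in> carrier W \<inter> {w. \<forall>b\<in>B. Poly_Mapping.single (b, w) 1 \<in> ?S}"
      "y \<in> carrier W \<inter> {w. \<forall>b\<in>B. Poly_Mapping.single (b, w) 1 \<in> ?S}"
    show "x \<oplus>\<^bsub>W\<^esub> y \<in> {w. \<forall>b\<in>B. Poly_Mapping.single (b, w) 1 \<in> ?S}"
    proof safe
      fix b assume b: "b \<in> B"
      show "Poly_Mapping.single (b, x \<oplus>\<^bsub>W\<^esub> y) 1 \<in> ?S"
        using N_spanned[of "Poly_Mapping.single (b, x \<oplus>\<^bsub>W\<^esub> y) 1" "Poly_Mapping.single (b, x) 1 + Poly_Mapping.single (b, y) 1"]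
          N_add2[of b x y] ps.subspace_add[OF S] b sub xy by (auto simp: diff_diff_eq)
    qed
  qed
  then have BW: "Poly_Mapping.single (b, w) 1 \<in> ?S" if "b \<in> B" "w \<in> carrier W" for b w using that by blast
  have "carrier V \<subseteq> {v. \<forall>w\<in>carrier W. Poly_Mapping.single (v, w) 1 \<in> ?S}"
  proof (rule B)
    show "B \<subseteq> {v. \<forall>w\<in>carrier W. Poly_Mapping.single (v, w) 1 \<in> ?S}" using BW by blast
    have *: "Poly_Mapping.single (r \<odot>\<^bsub>V\<^esub> x, w) 1 \<in> ?S"
      if "w \<in> carrier W" "x \<in> carrier V" "r = 0 \<or> Poly_Mapping.single (x, w) 1 \<in> ?S" for w r x
    proof (rule N_spanned[OF N_smult1])
      show "Poly_Mapping.single (x, w) r \<in> ?S"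
        using that ps.subspace_scale[OF S, of "Poly_Mapping.single (x, w) 1" r] ps.subspace_0[OF S] by auto
    qed (use that sub in auto)
    have "0 \<odot>\<^bsub>V\<^esub> \<zero>\<^bsub>V\<^esub> = \<zero>\<^bsub>V\<^esub>" using V.smult_r_null[of 0] by (simp add: ring_of_type_algebra_def)
    then show "\<zero>\<^bsub>V\<^esub> \<in> {v. \<forall>w\<in>carrier W. Poly_Mapping.single (v, w) 1 \<in> ?S}" using *[of _ "\<zero>\<^bsub>V\<^esub>" 0] by auto
    show "r \<odot>\<^bsub>V\<^esub> x \<in> {v. \<forall>w\<in>carrier W. Poly_Mapping.single (v, w) 1 \<in> ?S}"
      if "x \<in> carrier V \<inter> {v. \<forall>w\<in>carrier W. Poly_Mapping.single (v, w) 1 \<in> ?S}" for r x using *[of _ x r] that by auto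
    fix x y assume xy: "x \<in> carrier V \<inter> {v. \<forall>w\<in>carrier W. Poly_Mapping.single (v, w) 1 \<in> ?S}"
      "y \<in> carrier V \<inter> {v. \<forall>w\<in>carrier W. Poly_Mapping.single (v, w) 1 \<in> ?S}"
    show "x \<oplus>\<^bsub>V\<^esub> y \<in> {v. \<forall>w\<in>carrier W. Poly_Mapping.single (v, w) 1 \<in> ?S}"
    proof safe
      fix w assume w: "w \<in> carrier W"
      show "Poly_Mapping.single (x \<oplus>\<^bsub>V\<^esub> y, w) 1 \<in> ?S"
        using N_spanned[of "Poly_Mapping.single (x \<oplus>\<^bsub>V\<^esub> y, w) 1" "Poly_Mapping.single (x, w) 1 + Poly_Mapping.single (y, w) 1"]
          N_add1[of x y w] ps.subspace_add[OF S] w xy by (auto simp: diff_diff_eq)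
    qed
  qed
  then have "Poly_Mapping.single p 1 \<in> ?S" if "p \<in> carrier V \<times> carrier W" for p using that by (cases p) auto
  then have "c \<in> ?S" using subspace_singles[OF S, of "carrier V \<times> carrier W" c] c unfolding free_on_product_simps by blast
  then show ?thesis using that unfolding spanned_def by blast
qed

end

section \<open>Tensor products of \<open>k[x]\<close>-modules as Kronecker products\<close>

definition otimes :: "('i \<Rightarrow> 'k::field) \<Rightarrow> ('j \<Rightarrow> 'k) \<Rightarrow> 'i \<times> 'j \<Rightarrow> 'k" where
  "otimes v w = (\<lambda>(i, j). v i * w j)"

definition kron :: "('i \<Rightarrow> 'i \<Rightarrow> 'k::field) \<Rightarrow> ('j \<Rightarrow> 'j \<Rightarrow> 'k) \<Rightarrow> 'i \<times> 'j \<Rightarrow> 'i \<times> 'j \<Rightarrow> 'k" where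
  "kron a b = (\<lambda>(i, j) (i', j'). a i i' * b j j')"

lemma otimes_simps:
  "otimes (v + v') w = otimes v w + otimes v' w" "otimes v (w + w') = otimes v w + otimes v w'"
  "otimes (fscale c v) w = fscale c (otimes v w)" "otimes v (fscale c w) = fscale c (otimes v w)"
  by (auto simp: otimes_def fun_eq_iff algebra_simps)

lemma otimes_unitv: "otimes (unitv i) (unitv j) = unitv (i, j)"
  by (auto simp: otimes_def unitv_def fun_eq_iff)

lemma otimes_in_fsp: "v \<in> fsp I \<Longrightarrow> w \<in> fsp J \<Longrightarrow> otimes v w \<in> fsp (I \<times> J)"
  by (auto simp: otimes_def fsp_def)

lemma mop_kron_otimes: "mop (I \<times> J) (kron a b) (otimes v w) = otimes (mop I a v) (mop J b w)"
  by (auto simp: mop_def kron_def otimes_def fun_eq_iff sum_product sum.cartesian_product mult_ac intro!: sum.cong)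

lemma unitv_inj: "unitv l = (unitv l' :: _ \<Rightarrow> 'k::field) \<Longrightarrow> l = l'"
  by (drule fun_cong[of _ _ l]) (auto simp: unitv_def split: if_splits)

text \<open>Coordinates expand a vector in the preimages \<open>e i\<close> of the unit vectors.
  This is generation in the form that \<open>tensor_spanned\<close> demands.\<close>

lemma fsp_generated:
  assumes rec: "rec_iso fscale M (fsp I) f" and I: "finite I"
    and e: "\<And>i. i \<in> I \<Longrightarrow> e i \<in> carrier M" "\<And>i. i \<in> I \<Longrightarrow> f (e i) = unitv i"
    and K: "e ` I \<subseteq> K" "\<zero>\<^bsub>M\<^esub> \<in> K" "\<And>x y. x \<in> carrier M \<inter> K \<Longrightarrow> y \<in> carrier M \<inter> K \<Longrightarrow> x \<oplus>\<^bsub>M\<^esub> y \<in> K"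
      "\<And>r x. x \<in> carrier M \<inter> K \<Longrightarrow> r \<odot>\<^bsub>M\<^esub> x \<in> K"
  shows "carrier M \<subseteq> K"
proof
  interpret rec_iso fscale M "fsp I" f by (rule rec)
  fix x assume x: "x \<in> carrier M"
  have "\<exists>y\<in>carrier M \<inter> K. f y = (\<Sum>i\<in>S. fscale (f x i) (unitv i))" if "finite S" "S \<subseteq> I" for S
    using that
  proof (induction S)
    case empty
    show ?case using K(2) M_zero by (intro bexI[of _ "\<zero>\<^bsub>M\<^esub>"]) auto
  next
    case (insert i S)
    then obtain y where y: "y \<in> carrier M \<inter> K" "f y = (\<Sum>i\<in>S. fscale (f x i) (unitv i))" using insert.prems by blast
    have i: "i \<in> I" using insert.prems by simp
    have "e i \<in> carrier M \<inter> K" using K(1) e(1)[OF i] i by blast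
    then have si: "f x i \<odot>\<^bsub>M\<^esub> e i \<in> carrier M \<inter> K" using K(4) M_smult(1) by blast
    have "f ((f x i \<odot>\<^bsub>M\<^esub> e i) \<oplus>\<^bsub>M\<^esub> y) = fscale (f x i) (unitv i) + f y"
      using y si e[OF i] by (simp add: M_add M_smult)
    then have "f ((f x i \<odot>\<^bsub>M\<^esub> e i) \<oplus>\<^bsub>M\<^esub> y) = (\<Sum>i\<in>insert i S. fscale (f x i) (unitv i))"
      using insert.hyps y by simp
    moreover have "(f x i \<odot>\<^bsub>M\<^esub> e i) \<oplus>\<^bsub>M\<^esub> y \<in> carrier M \<inter> K" using K(3)[OF si y(1)] si y M_add(1) by blast
    ultimately show ?case by blast
  qed
  from this[OF I subset_refl] obtain y where y: "y \<in> carrier M \<inter> K" "f y = (\<Sum>i\<in>I. fscale (f x i) (unitv i))" by blast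
  have "f y = f x" unfolding y(2) using fsp_expand[OF I h_in[OF x]] by simp
  then have "y = x" using y x h_eqD by blast
  then show "x \<in> K" using y by blast
qed

text \<open>Multiplying coordinates kills the bilinear relations. The kernel is not larger, because
  modulo the relations a formal sum involves basis tensors only, and these go to distinct unit
  vectors.\<close>

theorem kx_tensor_kx_rec:
  fixes V :: "('k::field poly, 'v, 'm) module_scheme" and W :: "('k poly, 'w, 'n) module_scheme"
  assumes I: "finite I" and J: "finite J"
    and KV: "kx_rec (mact I a) V (fsp I) f" and KW: "kx_rec (mact J b) W (fsp J) g"
  obtains h where "kx_rec (mact (I \<times> J) (kron a b)) (kx_tensor V W) (fsp (I \<times> J)) h"
proof -
  interpret V: kx_rec "mact I a" V "fsp I" f by (rule KV)
  interpret W: kx_rec "mact J b" W "fsp J" g by (rule KW)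
  define V' where "V' = restrict_to_field V"
  define W' where "W' = restrict_to_field W"
  interpret V': rec_iso fscale V' "fsp I" f unfolding V'_def using V.restrict_to_field_rec by simp
  interpret W': rec_iso fscale W' "fsp J" g unfolding W'_def using W.restrict_to_field_rec by simp
  interpret P: module_pair_record V' W'
    by (rule module_pair_record.intro) (rule V'.is_module W'.is_module)+
  interpret fs: Modules.module "fscale :: 'k \<Rightarrow> (_ \<times> _ \<Rightarrow> 'k) \<Rightarrow> _" by (rule fscale_module)
  have cV: "carrier V' = carrier V" and cW: "carrier W' = carrier W"
    unfolding V'_def W'_def by (rule V.restrict_to_field_simps W.restrict_to_field_simps)+
  define F where "F = free_on_product V' W'"
  have cF: "carrier F = {c. Poly_Mapping.keys c \<subseteq> carrier V' \<times> carrier W'}" unfolding F_def free_on_product_simps ..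
  define \<Phi> where "\<Phi> = pext fscale (\<lambda>(v, w). otimes (f v) (g w))"
  have \<Phi>_single: "\<Phi> (Poly_Mapping.single (v, w) r) = fscale r (otimes (f v) (g w))" for v w r
    unfolding \<Phi>_def by simp
  interpret Q: quotient_kernel F \<Phi>
  proof
    show "add F = (+)" "0 \<in> carrier F" unfolding F_def free_on_product_simps by auto
    show "\<And>c d. \<lbrakk>c \<in> carrier F; d \<in> carrier F\<rbrakk> \<Longrightarrow> c + d \<in> carrier F" unfolding cF by (rule ps.subspace_add[OF keys_subspace])
    show "\<And>c. c \<in> carrier F \<Longrightarrow> - c \<in> carrier F" unfolding cF by simp
    show "\<And>c d. \<Phi> (c + d) = \<Phi> c + \<Phi> d" unfolding \<Phi>_def by (rule fs.pext_add)
  qed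
  have \<Phi>_scale: "\<Phi> (pscale r c) = fscale r (\<Phi> c)" for r c unfolding \<Phi>_def by (rule fs.pext_pscale)
  have ker_sub: "ps.subspace {c. \<Phi> c = 0}"
    by (rule ps.subspaceI) (auto simp: Q.\<Phi>_add \<Phi>_scale)
  have N_ker: "P.N \<subseteq> {c. \<Phi> c = 0}"
    by (rule P.N_least[OF ker_sub])
      (simp_all add: Q.\<Phi>_diff \<Phi>_single V'.M_add W'.M_add V'.M_smult W'.M_smult otimes_simps)
  have exV: "\<exists>x. x \<in> carrier V' \<and> f x = unitv i" if "i \<in> I" for i
    using V'.h_image that by (metis imageE unitv_in_fsp)
  have exW: "\<exists>x. x \<in> carrier W' \<and> g x = unitv j" if "j \<in> J" for j
    using W'.h_image that by (metis imageE unitv_in_fsp)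
  obtain e where e: "\<And>i. i \<in> I \<Longrightarrow> e i \<in> carrier V'" "\<And>i. i \<in> I \<Longrightarrow> f (e i) = unitv i" using exV by metis
  obtain e' where e': "\<And>j. j \<in> J \<Longrightarrow> e' j \<in> carrier W'" "\<And>j. j \<in> J \<Longrightarrow> g (e' j) = unitv j" using exW by metis
  have ker_N: "Q.ker = P.N"
  proof
    show "P.N \<subseteq> Q.ker"
    proof
      fix c assume "c \<in> P.N"
      then show "c \<in> Q.ker" unfolding Q.ker_def using subsetD[OF N_ker] subsetD[OF P.N_subset] by (simp add: F_def)
    qed
    show "Q.ker \<subseteq> P.N"
    proof
      fix c assume c: "c \<in> Q.ker"
      have cc: "c \<in> carrier F" "\<Phi> c = 0" using c unfolding Q.ker_def by blast+
      have "\<exists>d. Poly_Mapping.keys d \<subseteq> e ` I \<times> e' ` J \<and> c - d \<in> P.N"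
      proof (rule P.tensor_spanned[of "e ` I" "e' ` J" c])
        show "carrier V' \<subseteq> K" if "e ` I \<subseteq> K" "\<zero>\<^bsub>V'\<^esub> \<in> K" "\<And>x y. x \<in> carrier V' \<inter> K \<Longrightarrow> y \<in> carrier V' \<inter> K \<Longrightarrow> x \<oplus>\<^bsub>V'\<^esub> y \<in> K"
          "\<And>r x. x \<in> carrier V' \<inter> K \<Longrightarrow> r \<odot>\<^bsub>V'\<^esub> x \<in> K" for K
          by (rule fsp_generated[OF V'.rec_iso_axioms I, where e = e and K = K]) (fact e that)+
        show "carrier W' \<subseteq> K" if "e' ` J \<subseteq> K" "\<zero>\<^bsub>W'\<^esub> \<in> K" "\<And>x y. x \<in> carrier W' \<inter> K \<Longrightarrow> y \<in> carrier W' \<inter> K \<Longrightarrow> x \<oplus>\<^bsub>W'\<^esub> y \<in> K"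
          "\<And>r x. x \<in> carrier W' \<inter> K \<Longrightarrow> r \<odot>\<^bsub>W'\<^esub> x \<in> K" for K
          by (rule fsp_generated[OF W'.rec_iso_axioms J, where e = e' and K = K]) (fact e' that)+
        show "e ` I \<subseteq> carrier V'" using e by blast
        show "c \<in> carrier (free_on_product V' W')" using cc unfolding F_def by blast
      qed blast
      then obtain d where d: "Poly_Mapping.keys d \<subseteq> e ` I \<times> e' ` J" "c - d \<in> P.N" by blast
      have "\<Phi> (c - d) = 0" using d(2) N_ker by blast
      then have "\<Phi> d = 0" using cc(2) by (simp add: Q.\<Phi>_diff)
      have "Poly_Mapping.lookup d (v, w) = 0" for v w
      proof (cases "(v, w) \<in> Poly_Mapping.keys d")
        case True
        then obtain i j where ij: "i \<in> I" "j \<in> J" "v = e i" "w = e' j" using d(1) by blast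
        \<comment> \<open>Evaluation at one index pair singles out one coefficient of
          \<open>d\<close>.\<close>
        have "\<Phi> d (i, j) = (\<Sum>p\<in>Poly_Mapping.keys d. if p = (v, w) then Poly_Mapping.lookup d p else 0)"
          unfolding \<Phi>_def pext_def fun_sum_apply
        proof (rule sum.cong)
          fix p assume "p \<in> Poly_Mapping.keys d"
          then obtain i' j' where p: "i' \<in> I" "j' \<in> J" "p = (e i', e' j')" using d(1) by blast
          have "e i' = e i \<longrightarrow> i' = i" using e(2)[OF p(1)] e(2)[OF ij(1)] by (auto dest: unitv_inj)
          moreover have "e' j' = e' j \<longrightarrow> j' = j" using e'(2)[OF p(2)] e'(2)[OF ij(2)] by (auto dest: unitv_inj)
          ultimately have pe: "p = (v, w) \<longleftrightarrow> (i', j') = (i, j)" using p(3) ij by auto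
          show "fscale (Poly_Mapping.lookup d p) (case p of (v, w) \<Rightarrow> otimes (f v) (g w)) (i, j)
              = (if p = (v, w) then Poly_Mapping.lookup d p else 0)"
            unfolding pe unfolding p(3) using e(2)[OF p(1)] e'(2)[OF p(2)] by (auto simp: otimes_def unitv_def)
        qed simp
        also have "\<dots> = Poly_Mapping.lookup d (v, w)" using True by simp
        finally show ?thesis using \<open>\<Phi> d = 0\<close> by simp
      qed (simp add: in_keys_iff)
      then have "d = 0" by (intro poly_mapping_eqI) auto
      then show "c \<in> P.N" using d by simp
    qed
  qed
  define T where "T = tensor_product V' W'"
  have T: "T = quotient_module F Q.ker" unfolding T_def tensor_product_def F_def[symmetric] ker_N ..
  define H where "H = (\<lambda>C. the_elem (\<Phi> ` C))"
  have img: "\<Phi> ` carrier F = fsp (I \<times> J)"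
  proof (intro equalityI subsetI)
    have sp: "fs.subspace (fsp (I \<times> J))" unfolding fs.subspace_def by (auto simp: fsp_add fsp_scale)
    fix y assume "y \<in> \<Phi> ` carrier F"
    then obtain c where c: "Poly_Mapping.keys c \<subseteq> carrier V' \<times> carrier W'" "y = \<Phi> c" unfolding cF by blast
    show "y \<in> fsp (I \<times> J)" unfolding c \<Phi>_def pext_def
      using c(1) by (intro fs.subspace_sum[OF sp] fs.subspace_scale[OF sp]) (auto intro!: otimes_in_fsp V'.h_in W'.h_in)
  next
    fix y :: "_ \<Rightarrow> 'k" assume y: "y \<in> fsp (I \<times> J)"
    define c where "c = (\<Sum>p\<in>I \<times> J. Poly_Mapping.single (e (fst p), e' (snd p)) (y p))"
    have \<Phi>_sum: "\<Phi> (sum q A) = (\<Sum>a\<in>A. \<Phi> (q a))" for q A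
      by (induction A rule: infinite_finite_induct) (auto simp: Q.\<Phi>_add)
    have "\<Phi> c = (\<Sum>p\<in>I \<times> J. fscale (y p) (unitv p))" unfolding c_def \<Phi>_sum
      by (rule sum.cong) (auto simp: \<Phi>_single e e' otimes_unitv)
    then have "\<Phi> c = y" using fsp_expand[OF finite_cartesian_product[OF I J] y] by simp
    moreover have "c \<in> carrier F" unfolding c_def cF by (rule ps.subspace_sum[OF keys_subspace]) (use e e' in auto)
    ultimately show "y \<in> \<Phi> ` carrier F" by blast
  qed
  have FT: "rec_iso fscale T (fsp (I \<times> J)) H"
    unfolding T H_def img[symmetric]
    by (rule Q.quotient_rec_iso[OF fscale_module])
      (auto simp: F_def free_on_product_simps \<Phi>_scale dest: keys_pscale[THEN subsetD])
  interpret T: rec_iso fscale T "fsp (I \<times> J)" H by (rule FT)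
  \<comment> \<open>The lift of \<open>tensor_shift\<close> to the free module: the shift of the
    coset of \<open>c\<close> is the coset of \<open>sh c\<close>.\<close>
  define sh where "sh = pext pscale (\<lambda>p. Poly_Mapping.single ([:0, 1:] \<odot>\<^bsub>V\<^esub> fst p, [:0, 1:] \<odot>\<^bsub>W\<^esub> snd p) (1::'k))"
  have sh_in: "sh c \<in> carrier F" if "c \<in> carrier F" for c
    unfolding sh_def pext_def cF
    by (intro ps.subspace_sum[OF keys_subspace] ps.subspace_scale[OF keys_subspace])
      (use that V.M_smult W.M_smult in \<open>auto simp: cF cV cW\<close>)
  have \<Phi>_sh: "\<Phi> (sh c) = mop (I \<times> J) (kron a b) (\<Phi> c)" if c: "c \<in> carrier F" for c
  proof -
    interpret me: module_endo fscale "mop (I \<times> J) (kron a b)" by (rule mop_endo)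
    have sub: "ps.subspace {c. \<Phi> (sh c) = mop (I \<times> J) (kron a b) (\<Phi> c)}"
      unfolding sh_def
      by (rule ps.subspaceI)
        (auto simp: ps.pext_add ps.pext_pscale Q.\<Phi>_add \<Phi>_scale me.T_add me.T_scale)
    have "Poly_Mapping.single p 1 \<in> {c. \<Phi> (sh c) = mop (I \<times> J) (kron a b) (\<Phi> c)}" if "p \<in> carrier V' \<times> carrier W'" for p
      using that unfolding sh_def
      by (cases p) (simp add: \<Phi>_single fs.scale_one mop_kron_otimes V.M_smult W.M_smult mact_x cV cW)
    from subspace_singles[OF sub this] c show ?thesis unfolding cF by blast
  qed
  have shift: "tensor_shift V W (Q.cos c) = Q.cos (sh c)" if c: "c \<in> carrier F" for c
  proof -
    have "tensor_shift V W (Q.cos c) = (\<Union>d\<in>Q.cos c. Q.ker +>\<^bsub>F\<^esub> sh d)"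
      unfolding tensor_shift_def V'_def[symmetric] W'_def[symmetric] F_def[symmetric] ker_N[symmetric] sh_def pext_def by simp
    also have "\<dots> = Q.cos (sh c)"
      by (rule Q.union_cosets[OF c]) (use c sh_in \<Phi>_sh in \<open>auto simp: Q.cos_def\<close>)
    finally show ?thesis .
  qed
  have carT: "carrier T = Q.cos ` carrier F" unfolding T by (rule Q.carrier_quotient)
  have H_cos: "H (Q.cos c) = \<Phi> c" if "c \<in> carrier F" for c unfolding H_def using Q.cos_image[OF that] by simp
  \<comment> \<open>A polynomial acts on \<open>kx_tensor\<close> through iterated shifts, so these
    are matched with powers of the Kronecker matrix.\<close>
  have sh_it: "(tensor_shift V W ^^ i) C \<in> carrier T \<and> H ((tensor_shift V W ^^ i) C) = (mop (I \<times> J) (kron a b) ^^ i) (H C)"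
    if C: "C \<in> carrier T" for i C
  proof (induction i)
    case (Suc i)
    then obtain c where c: "c \<in> carrier F" "(tensor_shift V W ^^ i) C = Q.cos c" unfolding carT by blast
    then show ?case using Suc shift[OF c(1)] sh_in[OF c(1)] \<Phi>_sh[OF c(1)] H_cos carT by auto
  qed (use C in simp)
  have kt: "carrier (kx_tensor V W) = carrier T" "\<zero>\<^bsub>kx_tensor V W\<^esub> = \<zero>\<^bsub>T\<^esub>" "x \<oplus>\<^bsub>kx_tensor V W\<^esub> y = x \<oplus>\<^bsub>T\<^esub> y"
    "p \<odot>\<^bsub>kx_tensor V W\<^esub> x = (\<Oplus>\<^bsub>T\<^esub>i\<in>{..degree p}. coeff p i \<odot>\<^bsub>T\<^esub> (tensor_shift V W ^^ i) x)" for x y p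
    unfolding kx_tensor_def V'_def[symmetric] W'_def[symmetric] T_def[symmetric]
    by (simp_all add: Let_def ring.extend_def module.fields_def ring.truncate_def)
  have "rec_iso (mact (I \<times> J) (kron a b)) (kx_tensor V W) (fsp (I \<times> J)) H"
    unfolding rec_iso_def rec_iso_axioms_def kt
  proof (intro conjI allI impI)
    show "Modules.module (mact (I \<times> J) (kron a b))" by (rule kx_space.act_module[OF mact_kx_space])
    show "Modules.module.subspace (mact (I \<times> J) (kron a b)) (fsp (I \<times> J))" by (rule fsp_subspace)
    show "bij_betw H (carrier T) (fsp (I \<times> J))" by (rule T.h_bij)
    show "\<zero>\<^bsub>T\<^esub> \<in> carrier T" "H \<zero>\<^bsub>T\<^esub> = 0" by (rule T.M_zero)+
    fix x y assume x: "x \<in> carrier T"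
    fix r :: "'k poly"
    have cl: "(\<lambda>i. coeff r i \<odot>\<^bsub>T\<^esub> (tensor_shift V W ^^ i) x) \<in> {..degree r} \<rightarrow> carrier T"
      using sh_it[OF x] T.M_smult by blast
    show "(\<Oplus>\<^bsub>T\<^esub>i\<in>{..degree r}. coeff r i \<odot>\<^bsub>T\<^esub> (tensor_shift V W ^^ i) x) \<in> carrier T"
      by (rule T.h_finsum(1)[OF _ cl]) simp
    show "H (\<Oplus>\<^bsub>T\<^esub>i\<in>{..degree r}. coeff r i \<odot>\<^bsub>T\<^esub> (tensor_shift V W ^^ i) x) = mact (I \<times> J) (kron a b) r (H x)"
      using T.h_finsum(2)[OF _ cl] sh_it[OF x] T.M_smult
      by (simp add: mact_def module_endo.poly_act_eq_sum[OF mop_endo order_refl])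
  next
    fix x y assume "x \<in> carrier T" "y \<in> carrier T"
    then show "x \<oplus>\<^bsub>T\<^esub> y \<in> carrier T" "H (x \<oplus>\<^bsub>T\<^esub> y) = H x + H y" by (rule T.M_add)+
  qed
  then show ?thesis using that[of H] mact_kx_space unfolding kx_rec_def by blast
qed


section \<open>The representation ring is a commutative ring\<close>

text \<open>The index type is arbitrary, so Kronecker products and block sums of matrices keep their
  natural index sets.\<close>

definition cls :: "'i set \<Rightarrow> ('i \<Rightarrow> 'i \<Rightarrow> 'k::field) \<Rightarrow> 'k kx_class \<Rightarrow>\<^sub>0 int" where
  "cls I a = rep_class (model I a)"

lemma fscale_one [simp]: "fscale 1 v = v"
  by (simp add: fscale_def)

lemma cls_eq_rep_class:
  assumes "finite I" "kx_rec (mact I a) M (fsp I) h"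
  shows "rep_class M = cls I a"
  unfolding cls_def using kx_rec.rep_class_same[OF assms(2) fsp_fd_dim(1)[OF assms(1)] model_kx_rec] .

lemma cls_intertwine:
  assumes J: "finite J" and H: "bij_betw H (fsp I) (fsp J)"
    "\<And>v w. v \<in> fsp I \<Longrightarrow> w \<in> fsp I \<Longrightarrow> H (v + w) = H v + H w"
    "\<And>c v. v \<in> fsp I \<Longrightarrow> H (fscale c v) = fscale c (H v)"
    "\<And>v. v \<in> fsp I \<Longrightarrow> H (mop I a v) = mop J b (H v)"
  shows "cls I a = cls J b"
proof -
  interpret M: kx_rec "mact I a" "model I a" "fsp I" "\<lambda>x. x" by (rule model_kx_rec)
  have "kx_rec (mact J b) (model I a) (fsp J) H"
    by (rule kx_recI_x[OF mact_kx_space fsp_subspace M.is_module]) (use H in \<open>simp_all add: model_def mact_x\<close>)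
  from cls_eq_rep_class[OF J this] show ?thesis by (simp add: cls_def)
qed

lemma cls_reindex:
  fixes I :: "'i set" and J :: "'j set" and a :: "'i \<Rightarrow> 'i \<Rightarrow> 'k::field" and b
  assumes J: "finite J" and \<sigma>: "bij_betw \<sigma> I J" and ab: "\<And>i i'. i \<in> I \<Longrightarrow> i' \<in> I \<Longrightarrow> a i i' = b (\<sigma> i) (\<sigma> i')"
  shows "cls I a = cls J b"
proof -
  define \<tau> where "\<tau> = inv_into I \<sigma>"
  have \<tau>: "\<tau> j \<in> I" "\<sigma> (\<tau> j) = j" if "j \<in> J" for j
    using that \<sigma> unfolding \<tau>_def bij_betw_def by (auto intro: inv_into_into f_inv_into_f)
  have \<tau>\<sigma>: "\<tau> (\<sigma> i) = i" "\<sigma> i \<in> J" if "i \<in> I" for i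
    using that \<sigma> unfolding \<tau>_def bij_betw_def by auto
  define H where "H v = (\<lambda>j. if j \<in> J then v (\<tau> j) else 0)" for v :: "'i \<Rightarrow> 'k"
  show ?thesis
  proof (rule cls_intertwine[OF J, of H])
    show "bij_betw H (fsp I) (fsp J)"
    proof (rule bij_betw_byWitness[where f' = "\<lambda>w i. if i \<in> I then w (\<sigma> i) else 0"])
      show "\<forall>v\<in>fsp I. (\<lambda>i. if i \<in> I then H v (\<sigma> i) else 0) = v" by (auto simp: H_def \<tau>\<sigma> fsp_def fun_eq_iff)
      show "\<forall>w\<in>fsp J. H (\<lambda>i. if i \<in> I then w (\<sigma> i) else 0) = w" by (auto simp: H_def \<tau> fsp_def fun_eq_iff)
    qed (auto simp: H_def fsp_def)
    fix v :: "'i \<Rightarrow> 'k"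
    show "H (mop I a v) = mop J b (H v)"
    proof
      fix j
      show "H (mop I a v) j = mop J b (H v) j"
      proof (cases "j \<in> J")
        case True
        have "(\<Sum>i\<in>I. a (\<tau> j) i * v i) = (\<Sum>i\<in>I. b j (\<sigma> i) * H v (\<sigma> i))"
          by (rule sum.cong) (use True in \<open>auto simp: ab \<tau> \<tau>\<sigma> H_def\<close>)
        also have "\<dots> = (\<Sum>j'\<in>J. b j j' * H v j')" using sum.reindex_bij_betw[OF \<sigma>, of "\<lambda>j'. b j j' * H v j'"] by simp
        finally have "(\<Sum>i\<in>I. a (\<tau> j) i * v i) = (\<Sum>j'\<in>J. b j j' * H v j')" .
        then have "mop I a v (\<tau> j) = mop J b (H v) j" using True \<tau> by (simp add: mop_def)
        then show ?thesis using True by (simp add: H_def)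
      qed (simp add: H_def mop_def)
    qed
  qed (auto simp: H_def fun_eq_iff)
qed

lemma mop_block:
  assumes "finite I" "finite J" "I \<inter> J = {}" "\<And>i j. i \<in> I \<Longrightarrow> j \<in> J \<Longrightarrow> a j i = 0" "v \<in> fsp I"
  shows "mop (I \<union> J) a v = mop I a v"
proof
  fix i
  have z: "(\<Sum>j\<in>J. a i j * v j) = 0" by (rule sum.neutral) (use assms in \<open>auto simp: fsp_def\<close>)
  have z': "(\<Sum>j\<in>I. a i j * v j) = 0" if "i \<in> J" by (rule sum.neutral) (use assms that in auto)
  show "mop (I \<union> J) a v i = mop I a v i"
    using assms(3) z z' by (auto simp: mop_def sum.union_disjoint[OF assms(1,2,3)])
qed

text \<open>No entry leads from \<open>I\<close> into \<open>J\<close>, so \<open>fsp I\<close> is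
  invariant under the large matrix and carries the action of the small one.\<close>

lemma block_kx_rec:
  assumes "finite I" "finite J" "I \<inter> J = {}" "\<And>i j. i \<in> I \<Longrightarrow> j \<in> J \<Longrightarrow> a j i = 0"
  shows "kx_rec (mact (I \<union> J) a) (model I a) (fsp I) (\<lambda>x. x)"
proof -
  interpret M: kx_rec "mact I a" "model I a" "fsp I" "\<lambda>x. x" by (rule model_kx_rec)
  interpret A: kx_space "mact (I \<union> J) a" by (rule mact_kx_space)
  have eq: "mact (I \<union> J) a p v = mact I a p v" if "v \<in> fsp I" for p v
  proof (induction p)
    case (pCons c p)
    have "mop (I \<union> J) a (mact I a p v) = mop I a (mact I a p v)"
      by (rule mop_block) (use assms mact_in_fsp[OF that] in auto)
    then show ?case by (simp add: pCons.IH)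
  qed simp
  have "A.m.subspace (fsp I)" unfolding A.m.subspace_def using eq by (auto simp: fsp_add mact_in_fsp)
  then show ?thesis
    by (rule kx_recI_x[OF mact_kx_space _ M.is_module])
      (use eq in \<open>simp_all add: model_def bij_betw_def del: mact_pCons\<close>)
qed

lemma cls_union:
  assumes fin: "finite I" "finite J" and disj: "I \<inter> J = {}"
    and z: "\<And>i j. i \<in> I \<Longrightarrow> j \<in> J \<Longrightarrow> a i j = 0" "\<And>i j. i \<in> I \<Longrightarrow> j \<in> J \<Longrightarrow> a j i = 0"
  shows "cls (I \<union> J) a = cls I a + cls J a"
proof -
  interpret M: kx_rec "mact (I \<union> J) a" "model (I \<union> J) a" "fsp (I \<union> J)" "\<lambda>x. x" by (rule model_kx_rec)
  have fd: "M.fd (fsp (I \<union> J))" using fsp_fd_dim(1) fin by blast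
  have s: "(fsp I :: ('a \<Rightarrow> 'b) set) \<subseteq> fsp (I \<union> J)" "(fsp J :: ('a \<Rightarrow> 'b) set) \<subseteq> fsp (I \<union> J)" by (auto simp: fsp_def)
  have mI: "kx_rec (mact (I \<union> J) a) (model I a) (fsp I) (\<lambda>x. x)"
    by (rule block_kx_rec) (use assms in auto)
  have mJ: "kx_rec (mact (I \<union> J) a) (model J a) (fsp J) (\<lambda>x. x)"
    by (subst Un_commute) (rule block_kx_rec, use assms in auto)
  have eq: "fsp (I \<union> J) = M.ssum (fsp I) (fsp J)"
  proof
    show "fsp (I \<union> J) \<subseteq> M.ssum (fsp I) (fsp J)"
    proof
      fix v :: "'a \<Rightarrow> 'b" assume v: "v \<in> fsp (I \<union> J)"
      have veq: "v = (\<lambda>i. if i \<in> I then v i else 0) + (\<lambda>i. if i \<in> I then 0 else v i)" by auto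
      have "(\<lambda>i. if i \<in> I then v i else 0) \<in> fsp I" "(\<lambda>i. if i \<in> I then 0 else v i) \<in> fsp J"
        using v by (auto simp: fsp_def)
      then show "v \<in> M.ssum (fsp I) (fsp J)" by (subst veq) (rule M.ssum_memI)
    qed
    show "M.ssum (fsp I) (fsp J) \<subseteq> fsp (I \<union> J)"
    proof
      fix z assume "z \<in> M.ssum (fsp I) (fsp J)"
      then obtain u w where uw: "z = u + w" "u \<in> fsp I" "w \<in> fsp J" unfolding M.ssum_def by blast
      show "z \<in> fsp (I \<union> J)" unfolding uw(1) by (rule fsp_add[OF subsetD[OF s(1) uw(2)] subsetD[OF s(2) uw(3)]])
    qed
  qed
  have "fsp I \<inter> fsp J = {0 :: 'a \<Rightarrow> 'b}" using disj by (auto simp: fsp_def fun_eq_iff) (metis disjoint_iff)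
  from M.rep_class_sum[OF eq this M.fd_mono[OF fd s(1)] M.fd_mono[OF fd s(2)] mI mJ] show ?thesis
    by (simp add: cls_def)
qed

lemma cls_empty: "cls {} a = 0"
  unfolding cls_def by (rule kx_rec.rep_class_zero[OF model_kx_rec]) (auto simp: fsp_def)

section \<open>Classes of tensor products and their additivity\<close>

definition tcls :: "('k::field poly, 'v, 'm) module_scheme \<Rightarrow> ('k poly, 'w, 'n) module_scheme \<Rightarrow> 'k kx_class \<Rightarrow>\<^sub>0 int" where
  "tcls M N = rep_class (kx_tensor M N)"

lemma tcls_eq:
  assumes "finite I" "finite J" "kx_rec (mact I a) M (fsp I) f" "kx_rec (mact J b) N (fsp J) g"
  shows "tcls M N = cls (I \<times> J) (kron a b)"
proof -
  obtain h where "kx_rec (mact (I \<times> J) (kron a b)) (kx_tensor M N) (fsp (I \<times> J)) h"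
    using kx_tensor_kx_rec[OF assms] by blast
  from cls_eq_rep_class[OF _ this] show ?thesis unfolding tcls_def using assms by simp
qed

lemma fd_kx_tensor:
  assumes "fd_module M" "fd_module N"
  shows "fd_module (kx_tensor M N)"
proof -
  obtain n a f where f: "kx_rec (mact {..<n::nat} a) M (fsp {..<n}) f" using fd_module_model[OF assms(1)] .
  obtain m b g where g: "kx_rec (mact {..<m::nat} b) N (fsp {..<m}) g" using fd_module_model[OF assms(2)] .
  obtain h where "kx_rec (mact ({..<n} \<times> {..<m}) (kron a b)) (kx_tensor M N) (fsp ({..<n} \<times> {..<m})) h"
    using kx_tensor_kx_rec[OF finite_lessThan finite_lessThan f g] .
  from kx_rec.fd_module_iff[OF this] show ?thesis using fsp_fd_dim(1)[of "{..<n} \<times> {..<m}" "kron a b"] by simp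
qed

lemma module_iso_model:
  assumes "fd_module M" "module_iso M M'" "kx_rec (mact I a) M' (fsp I) f'"
  obtains f where "kx_rec (mact I a) M (fsp I) f"
  using rec_iso_compose[OF fd_module_is_module[OF assms(1)] assms(2)] assms(3) mact_kx_space
  unfolding kx_rec_def by metis

lemma tcls_cong:
  assumes M: "fd_module M" "fd_module M'" "module_iso M M'" and N: "fd_module N" "fd_module N'" "module_iso N N'"
  shows "tcls M N = tcls M' N'"
proof -
  obtain n a f' where f': "kx_rec (mact {..<n::nat} a) M' (fsp {..<n}) f'" using fd_module_model[OF M(2)] .
  obtain m b g' where g': "kx_rec (mact {..<m::nat} b) N' (fsp {..<m}) g'" using fd_module_model[OF N(2)] .
  obtain f where f: "kx_rec (mact {..<n} a) M (fsp {..<n}) f" using module_iso_model[OF M(1,3) f'] .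
  obtain g where g: "kx_rec (mact {..<m} b) N (fsp {..<m}) g" using module_iso_model[OF N(1,3) g'] .
  show ?thesis
    using tcls_eq[OF finite_lessThan finite_lessThan f g] tcls_eq[OF finite_lessThan finite_lessThan f' g'] by simp
qed

lemma tcls_commute:
  assumes M: "fd_module M" and N: "fd_module N"
  shows "tcls M N = tcls N M"
proof -
  obtain n a f where f: "kx_rec (mact {..<n::nat} a) M (fsp {..<n}) f" using fd_module_model[OF M] .
  obtain m b g where g: "kx_rec (mact {..<m::nat} b) N (fsp {..<m}) g" using fd_module_model[OF N] .
  have "cls ({..<n} \<times> {..<m}) (kron a b) = cls ({..<m} \<times> {..<n}) (kron b a)"
    by (rule cls_reindex[where \<sigma> = prod.swap]) (auto simp: bij_betw_def kron_def inj_on_def mult.commute)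
  then show ?thesis
    using tcls_eq[OF finite_lessThan finite_lessThan f g] tcls_eq[OF finite_lessThan finite_lessThan g f] by simp
qed

lemma tcls_assoc:
  assumes M: "fd_module M" and N: "fd_module N" and L: "fd_module L"
  shows "tcls (kx_tensor M N) L = tcls M (kx_tensor N L)"
proof -
  obtain n a f where f: "kx_rec (mact {..<n::nat} a) M (fsp {..<n}) f" using fd_module_model[OF M] .
  obtain m b g where g: "kx_rec (mact {..<m::nat} b) N (fsp {..<m}) g" using fd_module_model[OF N] .
  obtain l c h where h: "kx_rec (mact {..<l::nat} c) L (fsp {..<l}) h" using fd_module_model[OF L] .
  obtain fg where fg: "kx_rec (mact ({..<n} \<times> {..<m}) (kron a b)) (kx_tensor M N) (fsp ({..<n} \<times> {..<m})) fg"
    using kx_tensor_kx_rec[OF finite_lessThan finite_lessThan f g] .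
  obtain gh where gh: "kx_rec (mact ({..<m} \<times> {..<l}) (kron b c)) (kx_tensor N L) (fsp ({..<m} \<times> {..<l})) gh"
    using kx_tensor_kx_rec[OF finite_lessThan finite_lessThan g h] .
  have "cls (({..<n} \<times> {..<m}) \<times> {..<l}) (kron (kron a b) c) = cls ({..<n} \<times> ({..<m} \<times> {..<l})) (kron a (kron b c))"
    by (rule cls_reindex[where \<sigma> = "\<lambda>((i, j), k). (i, (j, k))"])
      (auto simp: bij_betw_def kron_def inj_on_def mult.assoc image_iff)
  then show ?thesis
    using tcls_eq[OF _ finite_lessThan fg h] tcls_eq[OF finite_lessThan _ f gh] by simp
qed

lemma (in kx_space) trec_kx_rec: "m.subspace A \<Longrightarrow> kx_rec act (trec act A) A (\<lambda>x. x)"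
  unfolding kx_rec_def using kx_space_axioms trec_rec_iso[OF act_module] by blast

lemma (in kx_space) fd_trec: "m.subspace A \<Longrightarrow> fd A \<Longrightarrow> fd_module (trec act A)"
  using kx_rec.fd_module_iff[OF trec_kx_rec] by blast

definition case_block :: "('i \<Rightarrow> 'i \<Rightarrow> 'k::field) \<Rightarrow> ('j \<Rightarrow> 'j \<Rightarrow> 'k) \<Rightarrow> 'i + 'j \<Rightarrow> 'i + 'j \<Rightarrow> 'k" where
  "case_block a b x y = (case (x, y) of (Inl i, Inl i') \<Rightarrow> a i i' | (Inr j, Inr j') \<Rightarrow> b j j' | _ \<Rightarrow> 0)"

lemma case_block_simps [simp]:
  "case_block a b (Inl i) (Inl i') = a i i'" "case_block a b (Inr j) (Inr j') = b j j'"
  "case_block a b (Inl i) (Inr j) = 0" "case_block a b (Inr j) (Inl i) = 0"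
  by (simp_all add: case_block_def)

lemma mop_case_block:
  assumes "finite I" "finite J"
  shows "mop (I <+> J) (case_block a b) w (Inl i) = mop I a (\<lambda>i. w (Inl i)) i"
    "mop (I <+> J) (case_block a b) w (Inr j) = mop J b (\<lambda>j. w (Inr j)) j"
proof -
  have inj: "inj_on Inl I" "inj_on Inr J" by auto
  have "Inl ` I \<inter> Inr ` J = {}" by auto
  note u = sum.union_disjoint[OF finite_imageI[OF assms(1)] finite_imageI[OF assms(2)] this]
  show "mop (I <+> J) (case_block a b) w (Inl i) = mop I a (\<lambda>i. w (Inl i)) i"
    "mop (I <+> J) (case_block a b) w (Inr j) = mop J b (\<lambda>j. w (Inr j)) j"
    unfolding mop_def Plus_def u sum.reindex[OF inj(1)] sum.reindex[OF inj(2)] by (auto simp: comp_def)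
qed

lemma (in kx_space) direct_sum_model:
  assumes A: "m.subspace A" and B: "m.subspace B" and int: "A \<inter> B = {0}"
    and f: "kx_rec (mact I a) (trec act A) (fsp I) f" and g: "kx_rec (mact J b) (trec act B) (fsp J) g"
    and fin: "finite I" "finite J"
  obtains h where "kx_rec (mact (I <+> J) (case_block a b)) (trec act (ssum A B)) (fsp (I <+> J)) h"
proof -
  interpret f: kx_rec "mact I a" "trec act A" "fsp I" f by (rule f)
  interpret g: kx_rec "mact J b" "trec act B" "fsp J" g by (rule g)
  \<comment> \<open>The A-component of \<open>v\<close>, well defined because the sum is
    direct.\<close>
  define x where "x v = (THE x. x \<in> A \<and> v - x \<in> B)" for v
  have xp: "x (u + w) = u" if "u \<in> A" "w \<in> B" for u w
    unfolding x_def
  proof (rule the_equality)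
    fix y assume y: "y \<in> A \<and> u + w - y \<in> B"
    have "u - y \<in> A" using y that A by (intro m.subspace_diff) auto
    moreover have "u - y \<in> B" using m.subspace_diff[OF B, of "u + w - y" w] y that by (simp add: algebra_simps)
    ultimately have "u - y \<in> A \<inter> B" by blast
    then show "y = u" unfolding int by simp
  qed (use that in simp)
  define H where "H v = (\<lambda>s. case s of Inl i \<Rightarrow> f (x v) i | Inr j \<Rightarrow> g (v - x v) j)" for v
  have Huw: "H (u + w) = case_sum (f u) (g w)" if "u \<in> A" "w \<in> B" for u w
    unfolding H_def xp[OF that] by (auto simp: fun_eq_iff split: sum.split)
  have fA: "f (u + u') = f u + f u'" "f (act r u) = mact I a r (f u)" if "u \<in> A" "u' \<in> A" for u u' r
    using f.M_add(2)[of u u'] f.M_smult(2)[of u r] that by simp_all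
  have gB: "g (u + u') = g u + g u'" "g (act r u) = mact J b r (g u)" if "u \<in> B" "u' \<in> B" for u u' r
    using g.M_add(2)[of u u'] g.M_smult(2)[of u r] that by simp_all
  have S: "m.subspace (ssum A B)" by (rule ssum_subspace[OF A B])
  have "kx_rec (mact (I <+> J) (case_block a b)) (trec act (ssum A B)) (fsp (I <+> J)) H"
  proof (rule kx_recI_x[OF mact_kx_space fsp_subspace])
    show "is_module (trec act (ssum A B))" using kx_rec.axioms(2)[OF trec_kx_rec[OF S]] rec_iso.is_module by blast
    show "bij_betw H (carrier (trec act (ssum A B))) (fsp (I <+> J))"
    proof (rule bij_betw_imageI)
      show "inj_on H (carrier (trec act (ssum A B)))"
      proof (rule inj_onI)
        fix v v' assume "v \<in> carrier (trec act (ssum A B))" "v' \<in> carrier (trec act (ssum A B))" and e: "H v = H v'"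
        then obtain u w u' w' where uw: "v = u + w" "u \<in> A" "w \<in> B" "v' = u' + w'" "u' \<in> A" "w' \<in> B"
          unfolding ssum_def by auto
        have "case_sum (f u) (g w) = case_sum (f u') (g w')" using e Huw uw by simp
        then have "f u i = f u' i" "g w j = g w' j" for i j by (metis sum.case)+
        then have "f u = f u'" "g w = g w'" by blast+
        then have "u = u'" "w = w'" using f.h_eqD g.h_eqD uw by auto
        then show "v = v'" using uw by simp
      qed
      show "H ` carrier (trec act (ssum A B)) = fsp (I <+> J)"
      proof (intro equalityI subsetI)
        fix y assume "y \<in> H ` carrier (trec act (ssum A B))"
        then obtain u w where uw: "y = H (u + w)" "u \<in> A" "w \<in> B" unfolding ssum_def by auto
        show "y \<in> fsp (I <+> J)" unfolding uw(1) Huw[OF uw(2,3)]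
          using f.h_in[of u] g.h_in[of w] uw by (auto simp: fsp_def split: sum.split)
      next
        fix y :: "_ \<Rightarrow> 'k" assume y: "y \<in> fsp (I <+> J)"
        have "(\<lambda>i. y (Inl i)) \<in> fsp I" "(\<lambda>j. y (Inr j)) \<in> fsp J" using y by (auto simp: fsp_def)
        then have "(\<lambda>i. y (Inl i)) \<in> f ` A" "(\<lambda>j. y (Inr j)) \<in> g ` B"
          using f.h_image g.h_image by simp_all
        then obtain u w where "u \<in> A" "(\<lambda>i. y (Inl i)) = f u" "w \<in> B" "(\<lambda>j. y (Inr j)) = g w" by blast
        then have uw: "u \<in> A" "f u = (\<lambda>i. y (Inl i))" "w \<in> B" "g w = (\<lambda>j. y (Inr j))" by simp_all
        have "y = H (u + w)" unfolding Huw[OF uw(1,3)] uw by (auto simp: fun_eq_iff split: sum.split)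
        moreover have "u + w \<in> carrier (trec act (ssum A B))" using uw by (simp add: ssum_memI)
        ultimately show "y \<in> H ` carrier (trec act (ssum A B))" by blast
      qed
    qed
  next
    fix v v' assume "v \<in> carrier (trec act (ssum A B))" "v' \<in> carrier (trec act (ssum A B))"
    then obtain u w u' w' where uw: "v = u + w" "u \<in> A" "w \<in> B" "v' = u' + w'" "u' \<in> A" "w' \<in> B"
      unfolding ssum_def by auto
    have "H (v + v') = H ((u + u') + (w + w'))" unfolding uw by (simp add: algebra_simps)
    also have "\<dots> = H v + H v'" unfolding uw(1,4)
      using uw A B by (subst (1 2 3) Huw) (auto simp: m.subspace_add fA gB fun_eq_iff split: sum.split)
    finally show "H (v \<oplus>\<^bsub>trec act (ssum A B)\<^esub> v') = H v + H v'" by simp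
  next
    fix v assume "v \<in> carrier (trec act (ssum A B))"
    then obtain u w where uw: "v = u + w" "u \<in> A" "w \<in> B" unfolding ssum_def by auto
    have r: "H (act r v) = case_sum (mact I a r (f u)) (mact J b r (g w))" for r
      unfolding uw m.scale_right_distrib using uw A B by (subst Huw) (auto simp: m.subspace_scale fA gB)
    show "H ([:c:] \<odot>\<^bsub>trec act (ssum A B)\<^esub> v) = mact (I <+> J) (case_block a b) [:c:] (H v)" for c
      using Huw[OF uw(2,3)] by (auto simp: r uw(1)[symmetric] fun_eq_iff split: sum.split)
    show "H ([:0, 1:] \<odot>\<^bsub>trec act (ssum A B)\<^esub> v) = mact (I <+> J) (case_block a b) [:0, 1:] (H v)"
    proof
      fix s
      have "H v = case_sum (f u) (g w)" using Huw[OF uw(2,3)] uw(1) by simp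
      then show "H ([:0, 1:] \<odot>\<^bsub>trec act (ssum A B)\<^esub> v) s = mact (I <+> J) (case_block a b) [:0, 1:] (H v) s"
        by (cases s) (simp_all add: r mact_x mop_case_block[OF fin] del: mact_pCons)
    qed
  qed
  then show ?thesis using that by blast
qed

text \<open>The Kronecker product of a block diagonal matrix with \<open>c\<close> is again block
  diagonal, with the two Kronecker products as blocks.\<close>

lemma (in kx_space) tcls_ssum:
  assumes A: "m.subspace A" "fd A" and B: "m.subspace B" "fd B" and int: "A \<inter> B = {0}" and N: "fd_module N"
  shows "tcls (trec act (ssum A B)) N = tcls (trec act A) N + tcls (trec act B) N"
proof -
  obtain n a f where f: "kx_rec (mact {..<n::nat} a) (trec act A) (fsp {..<n}) f" using fd_module_model[OF fd_trec[OF A]] .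
  obtain m b g where g: "kx_rec (mact {..<m::nat} b) (trec act B) (fsp {..<m}) g" using fd_module_model[OF fd_trec[OF B]] .
  obtain l c h where h: "kx_rec (mact {..<l::nat} c) N (fsp {..<l}) h" using fd_module_model[OF N] .
  let ?S = "{..<n} <+> {..<m}" and ?ab = "case_block a b"
  obtain k where k: "kx_rec (mact ?S ?ab) (trec act (ssum A B)) (fsp ?S) k"
    using direct_sum_model[OF A(1) B(1) int f g finite_lessThan finite_lessThan] .
  have "tcls (trec act (ssum A B)) N = cls (?S \<times> {..<l}) (kron ?ab c)"
    by (rule tcls_eq[OF _ finite_lessThan k h]) simp
  also have "?S \<times> {..<l} = Inl ` {..<n} \<times> {..<l} \<union> Inr ` {..<m} \<times> {..<l}" by auto
  also have "cls \<dots> (kron ?ab c) = cls (Inl ` {..<n} \<times> {..<l}) (kron ?ab c) + cls (Inr ` {..<m} \<times> {..<l}) (kron ?ab c)"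
    by (rule cls_union) (auto simp: kron_def)
  also have "cls (Inl ` {..<n} \<times> {..<l}) (kron ?ab c) = cls ({..<n} \<times> {..<l}) (kron a c)"
    by (rule cls_reindex[where \<sigma> = "\<lambda>(x, y). (Inl x, y)", symmetric])
      (auto simp: kron_def bij_betw_def inj_on_def image_paired_Times[of _ "\<lambda>y. y"])
  also have "cls (Inr ` {..<m} \<times> {..<l}) (kron ?ab c) = cls ({..<m} \<times> {..<l}) (kron b c)"
    by (rule cls_reindex[where \<sigma> = "\<lambda>(x, y). (Inr x, y)", symmetric])
      (auto simp: kron_def bij_betw_def inj_on_def image_paired_Times[of _ "\<lambda>y. y"])
  finally show ?thesis
    using tcls_eq[OF finite_lessThan finite_lessThan f h] tcls_eq[OF finite_lessThan finite_lessThan g h] by simp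
qed

lemma (in kx_space) tcls_zero:
  assumes N: "fd_module N"
  shows "tcls (trec act {0}) N = 0"
proof -
  have s: "m.subspace {0}" "fd {0}" using m.subspace_single_0 unfolding fd_def by (auto intro: exI[of _ "{}"])
  have "kx_rec (mact {} (\<lambda>_ _. 0)) (trec act {0}) (fsp {} :: (nat \<Rightarrow> 'k) set) (\<lambda>_. 0)"
    by (rule kx_recI_x[OF mact_kx_space fsp_subspace rec_iso.is_module[OF kx_rec.axioms(2)[OF trec_kx_rec[OF s(1)]]]])
      (auto simp: bij_betw_def fsp_def mact_x fun_eq_iff mop_def)
  moreover obtain l c h where h: "kx_rec (mact {..<l::nat} c) N (fsp {..<l}) h" using fd_module_model[OF N] .
  ultimately have "tcls (trec act {0}) N = cls ({} \<times> {..<l}) (kron (\<lambda>(_::nat) _. 0) c)"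
    by (intro tcls_eq) auto
  then show ?thesis by (simp add: cls_empty)
qed

section \<open>The bilinear product on formal sums of classes\<close>

definition rmult :: "('k::field kx_class \<Rightarrow>\<^sub>0 int) \<Rightarrow> ('k kx_class \<Rightarrow>\<^sub>0 int) \<Rightarrow> 'k kx_class \<Rightarrow>\<^sub>0 int" where
  "rmult c d = frag_extend (\<lambda>C. frag_extend (\<lambda>D. tcls (representative C) (representative D)) d) c"

lemma rmult_add_left: "rmult (c + c') d = rmult c d + rmult c' d"
  by (simp add: rmult_def frag_extend_add)

lemma rmult_add_right: "rmult c (d + d') = rmult c d + rmult c d'"
  by (simp add: rmult_def frag_extend_add frag_extend_def[of _ c] frag_cmul_distrib2 sum.distrib)

lemma rmult_0 [simp]: "rmult 0 d = 0" "rmult c 0 = 0"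
  using rmult_add_left[of 0 0 d] rmult_add_right[of c 0 0] by simp_all

lemma rmult_diff: "rmult (c - c') d = rmult c d - rmult c' d" "rmult c (d - d') = rmult c d - rmult c d'"
  using rmult_add_left[of "c - c'" c' d] rmult_add_right[of c "d - d'" d'] by (simp_all add: eq_diff_eq)

lemma rmult_cmul: "rmult (frag_cmul n c) d = frag_cmul n (rmult c d)" "rmult c (frag_cmul n d) = frag_cmul n (rmult c d)"
  by (simp_all add: rmult_def frag_extend_cmul frag_extend_def[of _ c] frag_cmul_sum mult.commute)

lemma rep_class_indecomposable:
  assumes "fd_module M" "indecomposable M"
  shows "rep_class M = frag_of (iso_class M)"
proof -
  obtain n a h where h: "kx_rec (mact {..<n::nat} a) M (fsp {..<n}) h" using fd_module_model[OF assms(1)] .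
  then interpret kx_rec "mact {..<n} a" M "fsp {..<n}" h .
  obtain p s where "primary_cyc (fsp {..<n}) p s" "iso_class M = primary_class p s"
    using indecomposable_primary assms fd_module_iff indecomposable_iff by metis
  then show ?thesis using rep_class_primary by metis
qed

text \<open>Both sides are additive on direct sums, so agreement on indecomposable modules
  propagates by \<open>fd_induct\<close> inside a coordinate model. Using it once for each factor
  gives the product formula.\<close>

lemma additive_on_modules:
  fixes F :: "('k::field kx_class \<Rightarrow>\<^sub>0 int) \<Rightarrow> 'k kx_class \<Rightarrow>\<^sub>0 int"
  assumes F0: "F 0 = 0" and Fadd: "\<And>c d. F (c + d) = F c + F d"
    and base: "\<And>M :: ('k poly, nat \<Rightarrow> 'k) module. fd_module M \<Longrightarrow> indecomposable M \<Longrightarrow> F (frag_of (iso_class M)) = tcls M L"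
    and L: "fd_module L" and N: "fd_module N"
  shows "F (rep_class N) = tcls N L"
proof -
  obtain n a h where h: "kx_rec (mact {..<n::nat} a) N (fsp {..<n}) h" using fd_module_model[OF N] .
  then interpret N: kx_rec "mact {..<n} a" N "fsp {..<n}" h .
  have f: "N.fd (fsp {..<n})" using N N.fd_module_iff by blast
  have "F (rep_class (trec (mact {..<n} a) V)) = tcls (trec (mact {..<n} a) V) L"
    if "N.m.subspace V" "N.fd V" for V
    using that
  proof (induction rule: N.fd_induct)
    case zero
    have "rep_class (trec (mact {..<n} a) {0}) = 0"
      by (rule kx_rec.rep_class_zero[OF N.trec_kx_rec]) simp_all
    then show ?case using N.tcls_zero[OF L] F0 by simp
  next
    case (indec V)
    note k = N.trec_kx_rec[OF indec(1)] and fdV = N.fd_trec[OF indec(1,2)]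
    have "indecomposable (trec (mact {..<n} a) V)" using kx_rec.indecomposable_iff[OF k] indec(3) by blast
    then show ?case using base[OF fdV] rep_class_indecomposable[OF fdV] by simp
  next
    case (sum A B)
    have "rep_class (trec (mact {..<n} a) (N.ssum A B)) = rep_class (trec (mact {..<n} a) A) + rep_class (trec (mact {..<n} a) B)"
      by (rule kx_rec.rep_class_sum[OF N.trec_kx_rec[OF N.ssum_subspace[OF sum(1,2)]] refl sum(5,3,4) N.trec_kx_rec[OF sum(1)] N.trec_kx_rec[OF sum(2)]])
    then show ?case using Fadd sum N.tcls_ssum[OF sum(1,3,2,4,5) L] by simp
  qed
  from this[OF N.V f] have "F (rep_class (model {..<n} a)) = tcls (model {..<n} a) L" unfolding model_def .
  moreover have "fd_module (model {..<n} a)" using kx_rec.fd_module_iff[OF model_kx_rec] f by blast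
  moreover have "module_iso N (model {..<n} a)"
    using rec_iso_module_iso[OF kx_rec.axioms(2)[OF h] kx_rec.axioms(2)[OF model_kx_rec]] .
  moreover have "module_iso L L" by (rule module_isoI[of "\<lambda>x. x"]) (auto simp: bij_betw_def)
  ultimately show ?thesis
    using rep_class_cong[OF fd_module_is_module[OF N]] tcls_cong[OF N] L by metis
qed

text \<open>The product is defined bilinearly through chosen representatives of indecomposable
  classes. This formula for arbitrary modules reduces the ring axioms to isomorphisms of tensor
  products.\<close>

theorem rmult_rep_class:
  fixes M :: "('k::field poly, 'v, 'm) module_scheme" and N :: "('k poly, 'w, 'n) module_scheme"
  assumes M: "fd_module M" and N: "fd_module N"
  shows "rmult (rep_class M) (rep_class N) = tcls M N"
proof (rule additive_on_modules[OF _ _ _ N M])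
  fix K :: "('k poly, nat \<Rightarrow> 'k) module" assume K: "fd_module K" "indecomposable K"
  have "rmult (frag_of (iso_class K)) (rep_class N) = tcls N K"
  proof (rule additive_on_modules[OF _ _ _ K(1) N])
    fix L :: "('k poly, nat \<Rightarrow> 'k) module" assume L: "fd_module L" "indecomposable L"
    have "rmult (frag_of (iso_class K)) (frag_of (iso_class L)) = tcls (representative (iso_class K)) (representative (iso_class L))"
      by (simp add: rmult_def)
    also have "\<dots> = tcls K L"
      using tcls_cong[OF K(1) representative_iso_class[OF K(1)] L(1) representative_iso_class[OF L(1)]] by simp
    also have "\<dots> = tcls L K" by (rule tcls_commute[OF K(1) L(1)])
    finally show "rmult (frag_of (iso_class K)) (frag_of (iso_class L)) = tcls L K" .
  qed (simp_all add: rmult_add_right)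
  then show "rmult (frag_of (iso_class K)) (rep_class N) = tcls K N" using tcls_commute[OF K(1) N] by simp
qed (simp_all add: rmult_add_left)

lemma rep_ring_simps:
  "carrier (rep_ring (k :: 'k::field itself)) = {c. Poly_Mapping.keys c \<subseteq> indecomposable_classes}"
  "x \<otimes>\<^bsub>rep_ring k\<^esub> y = rmult x y" "\<one>\<^bsub>rep_ring k\<^esub> = rep_class (cyclic_module [:-1, 1:])"
  "\<zero>\<^bsub>rep_ring k\<^esub> = 0" "x \<oplus>\<^bsub>rep_ring k\<^esub> y = x + y" "n \<odot>\<^bsub>rep_ring k\<^esub> x = frag_cmul n x"
  by (simp_all add: rep_ring_def rmult_def tcls_def)

text \<open>Every element is built from module classes by differences, so multilinear identities
  need only be checked on modules.\<close>

lemma rep_ring_induct [consumes 1, case_names zero rep_class diff]: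
  fixes c :: "'k::field kx_class \<Rightarrow>\<^sub>0 int"
  assumes "Poly_Mapping.keys c \<subseteq> indecomposable_classes" and "P 0"
    and "\<And>M :: ('k poly, 'k list) module. fd_module M \<Longrightarrow> P (rep_class M)"
    and "\<And>c d. Poly_Mapping.keys c \<subseteq> indecomposable_classes \<Longrightarrow> Poly_Mapping.keys d \<subseteq> indecomposable_classes \<Longrightarrow>
      P c \<Longrightarrow> P d \<Longrightarrow> P (c - d)"
  shows "P c"
proof -
  have "Poly_Mapping.keys c \<subseteq> indecomposable_classes \<and> P c"
    using assms(1)
  proof (induction c rule: frag_induction)
    case (one C)
    then obtain M :: "('k poly, 'k list) module" where M: "fd_module M" "indecomposable M" "C = iso_class M"
      unfolding indecomposable_classes_def by blast
    then show ?case using assms(3)[OF M(1)] rep_class_indecomposable[OF M(1,2)] rep_class_in_carrier[OF M(1)] by simp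
  next
    case (diff a b)
    then show ?case using assms(4) keys_diff[of a b] by blast
  qed (use assms(2) in simp)
  then show ?thesis by blast
qed

lemma keys_rmult:
  assumes "Poly_Mapping.keys c \<subseteq> indecomposable_classes" "Poly_Mapping.keys d \<subseteq> indecomposable_classes"
  shows "Poly_Mapping.keys (rmult c d) \<subseteq> indecomposable_classes"
  using assms(1)
proof (induction rule: rep_ring_induct)
  case (rep_class M)
  show ?case using assms(2)
  proof (induction rule: rep_ring_induct)
    case (rep_class N)
    then show ?case using \<open>fd_module M\<close> rmult_rep_class[of M N] rep_class_in_carrier[OF fd_kx_tensor] by (simp add: tcls_def)
  next
    case (diff a b)
    then show ?case unfolding rmult_diff using keys_diff[of "rmult (rep_class M) a" "rmult (rep_class M) b"] by blast
  qed simp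
next
  case (diff a b)
  then show ?case unfolding rmult_diff using keys_diff[of "rmult a d" "rmult b d"] by blast
qed simp

lemma rmult_commute:
  assumes "Poly_Mapping.keys c \<subseteq> indecomposable_classes" "Poly_Mapping.keys d \<subseteq> indecomposable_classes"
  shows "rmult c d = rmult d c"
  using assms(1)
proof (induction rule: rep_ring_induct)
  case (rep_class M)
  show ?case using assms(2)
  proof (induction rule: rep_ring_induct)
    case (rep_class N)
    then show ?case using \<open>fd_module M\<close> rmult_rep_class[of M N] rmult_rep_class[of N M] tcls_commute[of M N] by simp
  qed (simp_all add: rmult_diff)
qed (simp_all add: rmult_diff)

lemma rmult_assoc:
  assumes "Poly_Mapping.keys c \<subseteq> indecomposable_classes" "Poly_Mapping.keys d \<subseteq> indecomposable_classes"
    "Poly_Mapping.keys e \<subseteq> indecomposable_classes"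
  shows "rmult (rmult c d) e = rmult c (rmult d e)"
  using assms(1)
proof (induction rule: rep_ring_induct)
  case (rep_class M)
  show ?case using assms(2)
  proof (induction rule: rep_ring_induct)
    case (rep_class N)
    show ?case using assms(3)
    proof (induction rule: rep_ring_induct)
      case (rep_class L)
      have "rmult (rmult (rep_class M) (rep_class N)) (rep_class L) = tcls (kx_tensor M N) L"
        using \<open>fd_module M\<close> \<open>fd_module N\<close> \<open>fd_module L\<close> by (simp add: rmult_rep_class tcls_def[of M N] fd_kx_tensor)
      moreover have "rmult (rep_class M) (rmult (rep_class N) (rep_class L)) = tcls M (kx_tensor N L)"
        using \<open>fd_module M\<close> \<open>fd_module N\<close> \<open>fd_module L\<close> by (simp add: rmult_rep_class tcls_def[of N L] fd_kx_tensor)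
      ultimately show ?case using tcls_assoc \<open>fd_module M\<close> \<open>fd_module N\<close> \<open>fd_module L\<close> by simp
    qed (simp_all add: rmult_diff)
  qed (simp_all add: rmult_diff)
qed (simp_all add: rmult_diff)

lemma x_mod_linear: "monom 1 (Suc 0) mod [:-1, 1:] = (1 :: 'k::field poly)"
proof -
  have "monom 1 (Suc 0) = 1 + [:-1, 1 :: 'k:] * 1" by (simp add: monom_Suc one_pCons)
  then have "monom 1 (Suc 0) mod [:-1, 1:] = 1 mod [:-1, 1 :: 'k:]" by (metis mod_mult_self2)
  also have "\<dots> = 1" by (rule mod_poly_less) simp
  finally show ?thesis .
qed

text \<open>On \<open>k[x]/(x - 1)\<close> the variable acts as 1, so the Kronecker product with
  this model leaves a matrix unchanged.\<close>

lemma unit_model: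
  obtains h where "kx_rec (mact {..<Suc 0} (\<lambda>_ _. 1 :: 'k::field)) (cyclic_module [:-1, 1:]) (fsp {..<Suc 0}) h"
proof -
  obtain h where h: "kx_rec (mact {..<Suc 0} (companion [:-1, 1 :: 'k:])) (cyclic_module [:-1, 1:]) (fsp {..<Suc 0}) h"
    using cyclic_module_companion[of "[:-1, 1 :: 'k:]"] by auto
  have "mop {..<Suc 0} (companion [:-1, 1 :: 'k:]) = mop {..<Suc 0} (\<lambda>_ _. 1)"
    by (rule ext)+ (auto simp: mop_def companion_def x_mod_linear)
  then have "mact {..<Suc 0} (companion [:-1, 1 :: 'k:]) = mact {..<Suc 0} (\<lambda>_ _. 1)" by (simp add: mact_def)
  then show ?thesis using h that by simp
qed

lemma rmult_one:
  assumes "Poly_Mapping.keys c \<subseteq> (indecomposable_classes :: 'k::field kx_class set)"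
  shows "rmult (rep_class (cyclic_module [:-1, 1 :: 'k:])) c = c"
  using assms
proof (induction rule: rep_ring_induct)
  case (rep_class M)
  obtain n a f where f: "kx_rec (mact {..<n::nat} a) M (fsp {..<n}) f" using fd_module_model[OF rep_class] .
  obtain h where h: "kx_rec (mact {..<Suc 0} (\<lambda>_ _. 1 :: 'k)) (cyclic_module [:-1, 1:]) (fsp {..<Suc 0}) h"
    using unit_model .
  have "rmult (rep_class (cyclic_module [:-1, 1 :: 'k:])) (rep_class M) = tcls (cyclic_module [:-1, 1 :: 'k:]) M"
    using rep_class by (intro rmult_rep_class fd_cyclic_module) simp_all
  also have "\<dots> = cls ({..<Suc 0} \<times> {..<n}) (kron (\<lambda>_ _. 1) a)" by (rule tcls_eq[OF finite_lessThan finite_lessThan h f])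
  also have "\<dots> = cls {..<n} a"
    by (rule cls_reindex[where \<sigma> = snd]) (auto simp: bij_betw_def kron_def inj_on_def image_iff)
  also have "\<dots> = rep_class M" using cls_eq_rep_class[OF finite_lessThan f] by simp
  finally show ?case .
qed (simp_all add: rmult_diff)

theorem rep_ring_cring: "cring (rep_ring (k :: 'k::field itself))"
proof (rule cringI)
  let ?R = "rep_ring k"
  show "abelian_group ?R"
  proof (rule abelian_groupI)
    fix x assume x: "x \<in> carrier ?R"
    then show "\<exists>y\<in>carrier ?R. y \<oplus>\<^bsub>?R\<^esub> x = \<zero>\<^bsub>?R\<^esub>" by (intro bexI[of _ "- x"]) (auto simp: rep_ring_simps)
  next
    fix x y assume "x \<in> carrier ?R" "y \<in> carrier ?R"
    then show "x \<oplus>\<^bsub>?R\<^esub> y \<in> carrier ?R" using Poly_Mapping.keys_add[of x y] by (auto simp: rep_ring_simps)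
  qed (auto simp: rep_ring_simps add_ac)
  have one: "\<one>\<^bsub>?R\<^esub> \<in> carrier ?R" unfolding rep_ring_simps using rep_class_in_carrier[OF fd_cyclic_module[of "[:-1, 1:]"]] by simp
  show "Group.comm_monoid ?R"
    by (rule comm_monoidI) (use one in \<open>auto simp: rep_ring_simps rmult_assoc rmult_one keys_rmult[THEN subsetD] intro: rmult_commute\<close>)
  fix x y z
  show "(x \<oplus>\<^bsub>?R\<^esub> y) \<otimes>\<^bsub>?R\<^esub> z = x \<otimes>\<^bsub>?R\<^esub> z \<oplus>\<^bsub>?R\<^esub> y \<otimes>\<^bsub>?R\<^esub> z" by (simp add: rep_ring_simps rmult_add_left)
qed


section \<open>Evaluation of polynomials in a commutative algebra\<close>

text \<open>Two instances are needed: the embedding of k into its algebraic closure, and the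
  constants inside polynomials in two variables.\<close>

locale scalar_hom =
  fixes \<iota> :: "'k::field \<Rightarrow> 's::comm_ring_1"
  assumes hom_0: "\<iota> 0 = 0" and hom_1: "\<iota> 1 = 1"
    and hom_add: "\<iota> (a + b) = \<iota> a + \<iota> b" and hom_mult: "\<iota> (a * b) = \<iota> a * \<iota> b"
begin

definition ev :: "'s \<Rightarrow> 'k poly \<Rightarrow> 's" where
  "ev e q = poly (map_poly \<iota> q) e"

lemma ev_0 [simp]: "ev e 0 = 0"
  by (simp add: ev_def)

lemma ev_pCons [simp]: "ev e (pCons c q) = \<iota> c + e * ev e q"
  by (simp add: ev_def map_poly_pCons hom_0)

lemma ev_add: "ev e (p + q) = ev e p + ev e q"
  by (induction p q rule: poly_induct2) (simp_all add: hom_add algebra_simps)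

lemma ev_smult: "ev e (smult c q) = \<iota> c * ev e q"
  by (induction q) (simp_all add: hom_mult algebra_simps)

lemma ev_mult: "ev e (p * q) = ev e p * ev e q"
  by (induction p) (simp_all add: ev_add ev_smult hom_0 algebra_simps)

lemma ev_1: "ev e 1 = 1"
  by (simp add: one_pCons hom_1)

lemma ev_x: "ev e [:0, 1:] = e"
  by (simp add: hom_0 hom_1)

lemma ev_power: "ev e (p ^ n) = ev e p ^ n"
  by (induction n) (simp_all add: ev_1 ev_mult)

text \<open>The increment is \<open>n * z\<close> because the tensor action will be
  \<open>(1 + n) * z\<close>. The remainder stays unspecified, so no factorials have to be inverted
  in positive characteristic.\<close>

lemma ev_taylor: "\<exists>R. ev (z + n * z) q = ev z q + n * (z * ev z (pderiv q)) + n ^ 2 * R"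
proof (induction q)
  case (pCons c q)
  then obtain R where R: "ev (z + n * z) q = ev z q + n * (z * ev z (pderiv q)) + n ^ 2 * R" by blast
  have "ev (z + n * z) (pCons c q) = ev z (pCons c q) + n * (z * ev z (pderiv (pCons c q)))
      + n ^ 2 * (z * (z * ev z (pderiv q)) + (z + n * z) * R)"
    by (simp add: R pderiv_pCons ev_add hom_0 power2_eq_square algebra_simps)
  then show ?case by blast
qed (auto intro: exI[of _ 0])

text \<open>\<open>F\<close> stands for a term that later vanishes on the generator. Modulo
  \<open>F\<close>, the power of \<open>n * h + n ^ 2 * R\<close> begins with
  \<open>n ^ t * h ^ t\<close>, and all further terms contain one more factor
  \<open>n\<close>.\<close>

lemma ev_power_expansion:
  assumes "ev e f = F + n * h + n ^ 2 * R"
  shows "\<exists>S U. ev e (f ^ t) = n ^ t * h ^ t + n ^ Suc t * S + F * U"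
proof (induction t)
  case 0
  show ?case by (rule exI[of _ 0], rule exI[of _ 0]) (simp add: ev_1)
next
  case (Suc t)
  then obtain S U where SU: "ev e (f ^ t) = n ^ t * h ^ t + n ^ Suc t * S + F * U" by blast
  have "ev e (f ^ Suc t) = (F + n * h + n ^ 2 * R) * (n ^ t * h ^ t + n ^ Suc t * S + F * U)"
    using assms SU by (simp add: ev_mult)
  also have "\<dots> = n ^ Suc t * h ^ Suc t + n ^ Suc (Suc t) * (h * S + R * (h ^ t + n * S))
      + F * (n ^ t * h ^ t + n ^ Suc t * S + F * U + (n * h + n ^ 2 * R) * U)"
    by (simp add: algebra_simps power2_eq_square)
  finally show ?case by blast
qed

end

text \<open>Splitting off one factor \<open>a + b\<close> lowers either exponent by one and gives an
  induction that avoids binomial coefficients. It serves to show that a sum of commuting nilpotent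
  operators is nilpotent.\<close>

lemma sum_power_ideal:
  fixes a b :: "'a::comm_ring_1"
  shows "\<exists>P Q. (a + b) ^ (s + t) = a ^ s * P + b ^ t * Q"
proof (induction "s + t" arbitrary: s t)
  case 0
  show ?case by (rule exI[of _ 1], rule exI[of _ 0]) (use 0 in simp)
next
  case (Suc n)
  show ?case
  proof (cases "s = 0 \<or> t = 0")
    case True
    then show ?thesis
    proof
      assume s0: "s = 0"
      show ?thesis unfolding s0 by (rule exI[of _ "(a + b) ^ t"], rule exI[of _ 0]) simp
    next
      assume t0: "t = 0"
      show ?thesis unfolding t0 by (rule exI[of _ 0], rule exI[of _ "(a + b) ^ s"]) simp
    qed
  next
    case False
    then obtain s' t' where st: "s = Suc s'" "t = Suc t'" by (metis not0_implies_Suc)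
    obtain P Q where 1: "(a + b) ^ (s' + t) = a ^ s' * P + b ^ t * Q" using Suc.hyps(1)[of s' t] Suc.hyps(2) st by auto
    obtain P' Q' where 2: "(a + b) ^ (s + t') = a ^ s * P' + b ^ t' * Q'" using Suc.hyps(1)[of s t'] Suc.hyps(2) st by auto
    have "(a + b) ^ (s + t) = a * (a + b) ^ (s' + t) + b * (a + b) ^ (s + t')" using st by (simp add: algebra_simps)
    also have "\<dots> = a ^ s * (P + b * P') + b ^ t * (a * Q + Q')" unfolding 1 2 by (simp add: st algebra_simps)
    finally show ?thesis by blast
  qed
qed

section \<open>Separability over perfect fields\<close>

text \<open>In characteristic 0 the leading coefficient survives differentiation. In characteristic
  p a zero derivative leaves only exponents divisible by p, and perfectness then makes
  \<open>f\<close> a p-th power.\<close>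

lemma irreducible_pderiv_nonzero:
  fixes f :: "'k::field poly"
  assumes perf: "perfect_field TYPE('k)" and f: "irreducible f"
  shows "pderiv f \<noteq> 0"
proof
  assume 0: "pderiv f = 0"
  define p where "p = CHAR('k)"
  have c0: "of_nat (Suc n) * coeff f (Suc n) = 0" for n using coeff_pderiv[of f n] 0 by simp
  have dpos: "degree f > 0" using irreducible_degree_pos f by blast
  show False
  proof (cases "p = 0")
    case True
    then have "of_nat (degree f) \<noteq> (0::'k)" using dpos of_nat_eq_0_iff_char_dvd[where 'a='k, of "degree f"] by (auto simp: p_def)
    moreover have "of_nat (degree f) * coeff f (degree f) = 0" using c0[of "degree f - 1"] dpos by simp
    ultimately have "coeff f (degree f) = 0" by simp
    then show False using dpos by auto
  next
    case False
    then have prime: "prime p" unfolding p_def using prime_CHAR_semidom[where 'a='k] by simp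
    have supp: "coeff f n = 0" if "\<not> p dvd n" for n
    proof -
      have "of_nat n \<noteq> (0::'k)" using that of_nat_eq_0_iff_char_dvd[where 'a='k, of n] by (auto simp: p_def)
      moreover have "n \<noteq> 0" using that by (metis dvd_0_right)
      then have "of_nat n * coeff f n = 0" using c0[of "n - 1"] by simp
      ultimately show ?thesis by simp
    qed
    have "surj (\<lambda>a::'k. a ^ p)" using perf False unfolding perfect_field_def p_def by simp
    then have "\<forall>x. \<exists>y::'k. y ^ p = x" by (metis surjD)
    then obtain r where r: "\<And>x::'k. r x ^ p = x" by metis
    \<comment> \<open>A p-th root of \<open>f\<close>: p-th roots of its coefficients with all
      exponents divided by p. The identity is the additivity of the p-th power.\<close>
    define g where "g = (\<Sum>j\<le>degree f. monom (r (coeff f (p * j))) j)"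
    have "g ^ p = (\<Sum>j\<le>degree f. monom (r (coeff f (p * j))) j ^ p)"
      unfolding g_def by (rule freshmans_dream_sum) (use prime in \<open>simp_all add: p_def\<close>)
    also have "\<dots> = (\<Sum>j\<le>degree f. monom (coeff f (p * j)) (p * j))"
      by (simp add: monom_power r mult.commute)
    also have "\<dots> = f"
    proof (rule poly_eqI)
      fix n
      have pp: "p > 0" using prime prime_gt_0_nat by blast
      have "coeff (\<Sum>j\<le>degree f. monom (coeff f (p * j)) (p * j)) n = (\<Sum>j\<le>degree f. if p * j = n then coeff f n else 0)"
        unfolding coeff_sum by (rule sum.cong) auto
      also have "\<dots> = coeff f n"
      proof (cases "p dvd n \<and> n \<le> degree f")
        case True
        then obtain j where j: "n = p * j" by (auto elim: dvdE)
        have "j \<le> p * j" using pp by (cases p) simp_all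
        then have "j \<le> degree f" using True unfolding j by linarith
        have "(\<Sum>i\<le>degree f. if p * i = n then coeff f n else 0) = (\<Sum>i\<le>degree f. if i = j then coeff f n else 0)"
          by (rule sum.cong) (use j pp in auto)
        then show ?thesis using \<open>j \<le> degree f\<close> by simp
      next
        case False
        then have cf: "coeff f n = 0" using supp coeff_eq_0[of f n] by auto
        show ?thesis unfolding cf by simp
      qed
      finally show "coeff (\<Sum>j\<le>degree f. monom (coeff f (p * j)) (p * j)) n = coeff f n" .
    qed
    finally have gp: "f = g * g ^ (p - 1)" using prime prime_gt_0_nat[of p] by (metis power_minus_mult mult.commute)
    \<comment> \<open>Either alternative makes \<open>g\<close> a unit, since the exponent p - 1 is
      positive; then \<open>f\<close> would be a unit.\<close>
    then have "g dvd 1 \<or> g ^ (p - 1) dvd 1" using f by (metis irreducible_def)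
    moreover have "p - 1 > 0" using prime prime_ge_2_nat[of p] by simp
    ultimately have "g dvd 1" by (metis dvd_power dvd_trans)
    then have "g ^ (p - 1) dvd 1" using dvd_power_same[of g 1 "p - 1"] by simp
    then have "f dvd 1" using mult_dvd_mono[OF \<open>g dvd 1\<close>, of "g ^ (p - 1)" 1] gp by simp
    then show False using f by (simp add: irreducible_def)
  qed
qed

text \<open>The derivative is nonzero and has smaller degree than \<open>f\<close>.\<close>

lemma irreducible_not_dvd_pderiv:
  fixes f :: "'k::field poly"
  assumes perf: "perfect_field TYPE('k)" and f: "irreducible f"
  shows "\<not> f dvd pderiv f"
proof
  assume d: "f dvd pderiv f"
  have nz: "pderiv f \<noteq> 0" by (rule irreducible_pderiv_nonzero[OF assms])
  have "degree f \<le> degree (pderiv f)" by (rule dvd_imp_degree_le[OF d nz])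
  also have "degree (pderiv f) < degree f"
  proof (rule degree_lessI)
    show "pderiv f \<noteq> 0 \<or> degree f > 0" using nz by simp
    show "\<forall>k\<ge>degree f. coeff (pderiv f) k = 0" by (simp add: coeff_pderiv coeff_eq_0)
  qed
  finally show False by simp
qed

interpretation ac: scalar_hom "to_ac :: 'k::field \<Rightarrow> 'k alg_closure"
  by standard simp_all

text \<open>Evaluating Bezout's identity for \<open>f\<close> and its derivative at a point of the
  algebraic closure excludes common roots, so all linear factors are distinct.\<close>

lemma separable_splits:
  fixes f :: "'k::field poly"
  assumes perf: "perfect_field TYPE('k)" and f: "irreducible f"
  obtains A where "finite A" "A \<noteq> {}" "map_poly to_ac f dvd (\<Prod>\<alpha>\<in>A. [:-\<alpha>, 1:])"
proof -
  define F where "F = map_poly to_ac f"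
  have f0: "f \<noteq> 0" using f by auto
  have F0: "F \<noteq> 0" unfolding F_def using f0 by (simp add: poly_eq_iff coeff_map_poly)
  have dF: "degree F = degree f" unfolding F_def by (rule degree_map_poly) simp
  obtain a b where ab: "a * f + b * pderiv f = 1"
    using irreducible_poly_bezout[OF f irreducible_not_dvd_pderiv[OF perf f]] by blast
  have pF: "pderiv F = map_poly to_ac (pderiv f)" unfolding F_def
    by (rule poly_eqI) (simp only: coeff_pderiv coeff_map_poly[of to_ac, OF to_ac_0] to_ac_mult to_ac_of_nat)
  have no_common: "\<not> (poly F \<alpha> = 0 \<and> poly (pderiv F) \<alpha> = 0)" for \<alpha>
  proof
    assume z: "poly F \<alpha> = 0 \<and> poly (pderiv F) \<alpha> = 0"
    have "ac.ev \<alpha> f = 0" "ac.ev \<alpha> (pderiv f) = 0"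
      unfolding ac.ev_def pF[symmetric] F_def[symmetric] using z by blast+
    then have "ac.ev \<alpha> (a * f + b * pderiv f) = 0" by (simp add: ac.ev_add ac.ev_mult)
    then show False unfolding ab by (simp add: ac.ev_1)
  qed
  obtain M where M: "size M = degree F" "F = smult (lead_coeff F) (\<Prod>x\<in>#M. [:-x, 1:])"
    using alg_closed_imp_factorization[OF F0] by blast
  have cnt: "count M \<alpha> \<le> 1" for \<alpha>
  proof (rule ccontr)
    assume "\<not> count M \<alpha> \<le> 1"
    then have "{#\<alpha>, \<alpha>#} \<subseteq># M" by (auto simp: subseteq_mset_def)
    then obtain M' where "M = {#\<alpha>, \<alpha>#} + M'" by (auto simp: mset_subset_eq_exists_conv)
    \<comment> \<open>A repeated linear factor would make \<open>\<alpha>\<close> a root of the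
      derivative too.\<close>
    then obtain G where G: "F = [:-\<alpha>, 1:] * ([:-\<alpha>, 1:] * G)" using M(2) by (metis (no_types, lifting) add_mset_add_single image_mset_add_mset mult_smult_right prod_mset.add_mset union_mset_add_mset_left empty_neutral(1))
    have "poly F \<alpha> = 0" "poly (pderiv F) \<alpha> = 0" unfolding G by (simp_all add: pderiv_mult pderiv_pCons del: mult_pCons_left mult_pCons_right)
    then show False using no_common by blast
  qed
  then have "M = mset_set (set_mset M)"
    by (intro multiset_eqI) (metis count_greater_eq_one_iff count_mset_set(1,3) finite_set_mset le_antisym not_in_iff)
  then have "(\<Prod>x\<in>#M. [:-x, 1:]) = (\<Prod>x\<in>set_mset M. [:-x, 1:])" by (metis prod_unfold_prod_mset)
  moreover have "F dvd (\<Prod>x\<in>#M. [:-x, 1:])" using M(2) F0 by (metis dvd_refl leading_coeff_0_iff smult_dvd_iff)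
  moreover have "set_mset M \<noteq> {}" using M(1) dF irreducible_degree_pos[OF f] by auto
  ultimately show ?thesis using that[of "set_mset M"] unfolding F_def by simp
qed

text \<open>\<open>L\<close> consists of the Lagrange basis polynomials. Their sum agrees with 1 at
  all points of \<open>A\<close> and both have degree below \<open>card A\<close>. Each is a
  projection to one eigenspace, since its multiple by the missing linear factor is divisible by the
  full product.\<close>

lemma lagrange_decomposition:
  fixes A :: "'e::field set"
  assumes A: "finite A" "A \<noteq> {}"
  obtains L where "(\<Sum>\<alpha>\<in>A. L \<alpha>) = 1" "\<And>\<alpha>. \<alpha> \<in> A \<Longrightarrow> (\<Prod>\<beta>\<in>A. [:-\<beta>, 1:]) dvd [:-\<alpha>, 1:] * L \<alpha>"
proof -
  define P where "P \<alpha> = (\<Prod>\<beta>\<in>A - {\<alpha>}. [:-\<beta>, 1:])" for \<alpha>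
  define L where "L \<alpha> = smult (inverse (\<Prod>\<beta>\<in>A - {\<alpha>}. \<alpha> - \<beta>)) (P \<alpha>)" for \<alpha>
  have val: "poly (L \<alpha>) x = (if x = \<alpha> then 1 else 0)" if "\<alpha> \<in> A" "x \<in> A" for \<alpha> x
  proof (cases "x = \<alpha>")
    case True
    have "(\<Prod>\<beta>\<in>A - {\<alpha>}. \<alpha> - \<beta>) \<noteq> 0" using A by (auto simp: prod_zero_iff)
    then show ?thesis using True by (simp add: L_def P_def poly_prod)
  next
    case False
    have "(\<Prod>\<beta>\<in>A - {\<alpha>}. x - \<beta>) = 0" using A that False by (auto simp: prod_zero_iff)
    then show ?thesis using False by (simp add: L_def P_def poly_prod)
  qed
  have degP: "degree (P \<alpha>) < card A" if "\<alpha> \<in> A" for \<alpha>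
  proof -
    have "degree (P \<alpha>) \<le> (\<Sum>\<beta>\<in>A - {\<alpha>}. degree [:-\<beta>, 1:])" unfolding P_def
      by (rule order_trans[OF degree_prod_sum_le]) (use A in \<open>auto simp: comp_def\<close>)
    also have "\<dots> = card (A - {\<alpha>})" by simp
    also have "\<dots> < card A" using A that by (metis card_Diff1_less)
    finally show ?thesis .
  qed
  have "(\<Sum>\<alpha>\<in>A. L \<alpha>) = 1"
  proof (rule poly_eqI_degree[of A])
    fix x assume x: "x \<in> A"
    have "poly (\<Sum>\<alpha>\<in>A. L \<alpha>) x = (\<Sum>\<alpha>\<in>A. if x = \<alpha> then 1 else 0)"
      unfolding poly_sum by (rule sum.cong) (use val x in auto)
    then show "poly (\<Sum>\<alpha>\<in>A. L \<alpha>) x = poly 1 x" using A x by simp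
  next
    have c: "0 < card A" using A by (simp add: card_gt_0_iff)
    show "degree (\<Sum>\<alpha>\<in>A. L \<alpha>) < card A"
    proof (rule degree_sum_less)
      show "degree (L \<alpha>) < card A" if "\<alpha> \<in> A" for \<alpha>
        using degP[OF that] degree_smult_le[of "inverse (\<Prod>\<beta>\<in>A - {\<alpha>}. \<alpha> - \<beta>)" "P \<alpha>"] unfolding L_def by linarith
    qed (rule c)
    show "degree (1 :: 'e poly) < card A" using c by simp
  qed
  moreover have "(\<Prod>\<beta>\<in>A. [:-\<beta>, 1:]) dvd [:-\<alpha>, 1:] * L \<alpha>" if "\<alpha> \<in> A" for \<alpha>
  proof -
    have "(\<Prod>\<beta>\<in>A. [:-\<beta>, 1:]) = [:-\<alpha>, 1:] * P \<alpha>" unfolding P_def using A that by (simp add: prod.remove)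
    then show ?thesis unfolding L_def by (metis dvd_refl dvd_smult mult_smult_right)
  qed
  ultimately show ?thesis using that by blast
qed

section \<open>The two commuting actions on a Kronecker product\<close>

definition actl :: "'i set \<Rightarrow> ('i \<Rightarrow> 'i \<Rightarrow> 'k::field) \<Rightarrow> 'k poly \<Rightarrow> ('i \<times> 'j \<Rightarrow> 'k) \<Rightarrow> 'i \<times> 'j \<Rightarrow> 'k" where
  "actl I a p v = (\<lambda>(i, j). mact I a p (\<lambda>i'. v (i', j)) i)"

definition actr :: "'j set \<Rightarrow> ('j \<Rightarrow> 'j \<Rightarrow> 'k::field) \<Rightarrow> 'k poly \<Rightarrow> ('i \<times> 'j \<Rightarrow> 'k) \<Rightarrow> 'i \<times> 'j \<Rightarrow> 'k" where
  "actr J b q v = (\<lambda>(i, j). mact J b q (\<lambda>j'. v (i, j')) j)"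

lemma mact_module: "Modules.module (mact I a)"
  by (rule kx_space.act_module[OF mact_kx_space])

lemma mact_add: "mact I a p (v + w) = mact I a p v + mact I a p w"
  by (rule Modules.module.scale_right_distrib[OF mact_module])

lemma mact_fscale: "mact I a p (fscale c v) = fscale c (mact I a p v)"
  using kx_space.scal_act[OF mact_kx_space, of I a c p v] by simp

lemma mact_mult: "mact I a (p * q) v = mact I a p (mact I a q v)"
  using Modules.module.scale_scale[OF mact_module] by metis

lemma mact_plus: "mact I a (p + q) v = mact I a p v + mact I a q v"
  by (rule Modules.module.scale_left_distrib[OF mact_module])

lemma mact_one: "mact I a 1 v = v"
  by (rule Modules.module.scale_one[OF mact_module])

lemma actl_module:
  fixes a :: "'i \<Rightarrow> 'i \<Rightarrow> 'k::field"
  shows "Modules.module (actl I a :: 'k poly \<Rightarrow> ('i \<times> 'j \<Rightarrow> 'k) \<Rightarrow> _)"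
proof
  fix p q :: "'k poly" and v w :: "'i \<times> 'j \<Rightarrow> 'k"
  show "actl I a p (v + w) = actl I a p v + actl I a p w"
  proof (rule ext, clarify)
    fix i j
    show "actl I a p (v + w) (i, j) = (actl I a p v + actl I a p w) (i, j)"
      using mact_add[of I a p "\<lambda>i'. v (i', j)" "\<lambda>i'. w (i', j)"] by (simp add: actl_def plus_fun_def)
  qed
  show "actl I a (p + q) v = actl I a p v + actl I a q v" by (auto simp: actl_def mact_plus)
  show "actl I a p (actl I a q v) = actl I a (p * q) v" by (auto simp: actl_def mact_mult)
  show "actl I a 1 v = v" by (auto simp: actl_def mact_one)
qed

text \<open>Matrices acting on different factors commute. This is the compatibility that lets a
  polynomial ring over the first action be formed.\<close>

lemma actl_actr_x:
  fixes a :: "'i \<Rightarrow> 'i \<Rightarrow> 'k::field"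
  shows "actr J b [:0, 1:] (actl I a p v) = actl I a p (actr J b [:0, 1:] v)"
proof (induction p)
  case (pCons c p)
  show ?case
  proof (rule ext, clarify)
    fix i j
    have ih: "(\<Sum>j'\<in>J. b j j' * mact I a p (\<lambda>i. v (i, j')) i) = mact I a p (\<lambda>i'. \<Sum>j'\<in>J. b j j' * v (i', j')) i" if "j \<in> J" for i
      using fun_cong[OF pCons.IH, of "(i, j)"] that by (simp add: actr_def actl_def mact_x mop_def)
    show "actr J b [:0, 1:] (actl I a (pCons c p) v) (i, j) = actl I a (pCons c p) (actr J b [:0, 1:] v) (i, j)"
    proof (cases "j \<in> J")
      case True
      have "(\<Sum>j'\<in>J. b j j' * mop I a (mact I a p (\<lambda>i. v (i, j'))) i) = mop I a (\<lambda>i. \<Sum>j'\<in>J. b j j' * mact I a p (\<lambda>i. v (i, j')) i) i"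
        unfolding mop_def
        by (auto simp: sum_distrib_left mult_ac intro!: sum.cong) (subst sum.swap, auto simp: sum_distrib_left mult_ac intro!: sum.cong)
      then show ?thesis using True ih
        by (simp add: actr_def actl_def mact_x mop_def[of J] distrib_left sum.distrib sum_distrib_left mult_ac)
    next
      case False
      have "mact I a q (\<lambda>i'. 0) = (\<lambda>i'. 0)" for q :: "'k poly"
        using Modules.module.scale_zero_right[OF mact_module, of I a q] by (simp add: zero_fun_def)
      then show ?thesis using False by (simp add: actr_def actl_def mact_x mop_def[of J] del: mact_pCons)
    qed
  qed
qed (auto simp: actr_def actl_def mact_x mop_def)

text \<open>Polynomials in two variables act on \<open>k\<^sup>I \<otimes> k\<^sup>J\<close>, the inner variable \<open>y\<close> through the first factor and
  the outer variable \<open>z\<close> through the second; the tensor action of \<open>x\<close> is that of \<open>y z\<close>.\<close>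

definition act2 :: "'i set \<Rightarrow> ('i \<Rightarrow> 'i \<Rightarrow> 'k::field) \<Rightarrow> 'j set \<Rightarrow> ('j \<Rightarrow> 'j \<Rightarrow> 'k) \<Rightarrow> 'k poly poly \<Rightarrow> ('i \<times> 'j \<Rightarrow> 'k) \<Rightarrow> 'i \<times> 'j \<Rightarrow> 'k" where
  "act2 I a J b = poly_act (actl I a) (actr J b [:0, 1:])"

lemma act2_endo:
  fixes a :: "'i \<Rightarrow> 'i \<Rightarrow> 'k::field" and b :: "'j \<Rightarrow> 'j \<Rightarrow> 'k"
  shows "module_endo (actl I a) (actr J b [:0, 1:])"
proof -
  have "actr J b [:0, 1:] (v + w) = actr J b [:0, 1:] v + actr J b [:0, 1:] w" for v w :: "'i \<times> 'j \<Rightarrow> 'k"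
  proof (rule ext, clarify)
    fix i j
    show "actr J b [:0, 1:] (v + w) (i, j) = (actr J b [:0, 1:] v + actr J b [:0, 1:] w) (i, j)"
      using mact_add[of J b "[:0, 1:]" "\<lambda>j'. v (i, j')" "\<lambda>j'. w (i, j')"]
      by (simp add: actr_def plus_fun_def del: mact_pCons)
  qed
  then show ?thesis unfolding module_endo_def module_endo_axioms_def using actl_module actl_actr_x by blast
qed

lemma act2_module: "Modules.module (act2 I a J b)"
  unfolding act2_def by (rule module_endo.poly_act_module[OF act2_endo])

lemma act2_simps:
  "act2 I a J b 0 v = 0" "act2 I a J b (pCons p r) v = actl I a p v + actr J b [:0, 1:] (act2 I a J b r v)"
  unfolding act2_def by (rule module_endo.poly_act_0[OF act2_endo] module_endo.poly_act_pCons[OF act2_endo])+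

lemma actr_x_0: "actr J b [:0, 1:] 0 = 0"
  using module_endo.T_zero[OF act2_endo] .

lemma act2_y: "act2 I a J b [:p:] v = actl I a p v"
  by (simp only: act2_simps actr_x_0 add_0_right)

interpretation cc: scalar_hom "\<lambda>c::'k::field. [:[:c:]:]"
  by standard (simp_all add: one_pCons)

abbreviation "yy \<equiv> [:[:0, 1:]:] :: 'k::field poly poly"
abbreviation "zz \<equiv> [:0, 1:] :: 'k::field poly poly"

lemma actl_const: "actl I a [:c:] v = fscale c v"
  by (auto simp: actl_def)

lemma act2_z_mult: "act2 I a J b (zz * r) v = actr J b [:0, 1:] (act2 I a J b r v)"
proof -
  have "zz * r = pCons 0 r" by simp
  moreover have "actl I a 0 v = 0" by (auto simp: actl_def)
  ultimately show ?thesis by (simp only: act2_simps add_0_left)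
qed

lemma act2_plus: "act2 I a J b (r + r') v = act2 I a J b r v + act2 I a J b r' v"
  by (rule Modules.module.scale_left_distrib[OF act2_module])

lemma act2_mult: "act2 I a J b (r * r') v = act2 I a J b r (act2 I a J b r' v)"
  using Modules.module.scale_scale[OF act2_module] by metis

lemma act2_zero_right: "act2 I a J b r 0 = 0"
  by (rule Modules.module.scale_zero_right[OF act2_module])

lemma act2_z: "act2 I a J b (cc.ev zz q) v = actr J b q v"
proof (induction q)
  case (pCons c q)
  show ?case unfolding cc.ev_pCons act2_plus act2_z_mult pCons.IH act2_y actl_const
    by (auto simp: actr_def mact_x)
qed (auto simp: actr_def act2_simps)

lemma mop_kron_actr_actl: "mop (I \<times> J) (kron a b) v = actr J b [:0, 1:] (actl I a [:0, 1:] v)"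
proof (rule ext, clarify)
  fix i j
  have "(\<Sum>p\<in>I \<times> J. kron a b (i, j) p * v p) = (\<Sum>i'\<in>I. \<Sum>j'\<in>J. a i i' * b j j' * v (i', j'))"
    by (simp add: sum.cartesian_product kron_def split_def)
  also have "\<dots> = (\<Sum>j'\<in>J. \<Sum>i'\<in>I. a i i' * b j j' * v (i', j'))" by (rule sum.swap)
  also have "\<dots> = (\<Sum>j'\<in>J. b j j' * (\<Sum>i'\<in>I. a i i' * v (i', j')))" by (simp add: sum_distrib_left mult_ac)
  finally show "mop (I \<times> J) (kron a b) v (i, j) = actr J b [:0, 1:] (actl I a [:0, 1:] v) (i, j)"
    by (auto simp: actr_def actl_def mact_x mop_def)
qed

lemma act2_yz_mult: "act2 I a J b (yy * zz * r) v = actr J b [:0, 1:] (actl I a [:0, 1:] (act2 I a J b r v))"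
proof -
  have "yy * zz * r = zz * (yy * r)" by (simp only: mult_ac)
  then have "act2 I a J b (yy * zz * r) v = actr J b [:0, 1:] (act2 I a J b (yy * r) v)"
    by (simp only: act2_z_mult)
  then show ?thesis by (simp only: act2_mult act2_y)
qed

lemma act2_kron: "act2 I a J b (cc.ev (yy * zz) q) v = mact (I \<times> J) (kron a b) q v"
proof (induction q)
  case (pCons c q)
  show ?case
    unfolding cc.ev_pCons act2_plus act2_y actl_const mact_pCons mop_kron_actr_actl pCons.IH[symmetric] act2_yz_mult ..
qed (simp add: act2_simps)

lemma actl_otimes: "actl I a p (otimes v w) = otimes (mact I a p v) w"
proof -
  have "(\<lambda>i'. otimes v w (i', j)) = fscale (w j) v" for j by (auto simp: otimes_def)
  then show ?thesis by (auto simp: actl_def otimes_def mact_fscale)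
qed

lemma actr_otimes: "actr J b q (otimes v w) = otimes v (mact J b q w)"
proof -
  have "(\<lambda>j'. otimes v w (i, j')) = fscale (v i) w" for i by (auto simp: otimes_def)
  then show ?thesis by (auto simp: actr_def otimes_def mact_fscale)
qed

lemma otimes_nonzero: "v \<noteq> 0 \<Longrightarrow> w \<noteq> 0 \<Longrightarrow> otimes v w \<noteq> 0"
  by (auto simp: otimes_def fun_eq_iff)

lemma actl_kills:
  assumes "\<And>w. w \<in> fsp I \<Longrightarrow> mact I a p w = 0" "v \<in> fsp (I \<times> J)"
  shows "actl I a p v = 0"
proof -
  have "(\<lambda>i'. v (i', j)) \<in> fsp I" for j using assms(2) by (auto simp: fsp_def)
  then show ?thesis using assms(1) by (auto simp: actl_def)
qed

lemma actr_kills: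
  assumes "\<And>w. w \<in> fsp J \<Longrightarrow> mact J b q w = 0" "v \<in> fsp (I \<times> J)"
  shows "actr J b q v = 0"
proof -
  have "(\<lambda>j'. v (i, j')) \<in> fsp J" for i using assms(2) by (auto simp: fsp_def)
  then show ?thesis using assms(1) by (auto simp: actr_def)
qed


section \<open>Products of classes of cyclic modules\<close>

definition cyclic_class :: "'k::field poly \<Rightarrow> 'k kx_class \<Rightarrow>\<^sub>0 int" where
  "cyclic_class f = rep_class (cyclic_module f)"

lemma cyclic_class_cls: "f \<noteq> 0 \<Longrightarrow> cyclic_class f = cls {..<degree f} (companion f)"
  unfolding cyclic_class_def by (metis cls_eq_rep_class cyclic_module_companion finite_lessThan)

lemma rmult_cyclic_class:
  assumes "f \<noteq> 0" "g \<noteq> 0"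
  shows "rmult (cyclic_class f) (cyclic_class g) = cls ({..<degree f} \<times> {..<degree g}) (kron (companion f) (companion g))"
proof -
  obtain h where h: "kx_rec (mact {..<degree f} (companion f)) (cyclic_module f) (fsp {..<degree f}) h"
    using cyclic_module_companion[OF assms(1)] .
  obtain k where k: "kx_rec (mact {..<degree g} (companion g)) (cyclic_module g) (fsp {..<degree g}) k"
    using cyclic_module_companion[OF assms(2)] .
  show ?thesis unfolding cyclic_class_def
    using rmult_rep_class[OF fd_cyclic_module[OF assms(1)] fd_cyclic_module[OF assms(2)]]
      tcls_eq[OF finite_lessThan finite_lessThan h k] by simp
qed

text \<open>The submodule generated by \<open>u\<close> has dimension \<open>degree F\<close>, which
  is the dimension of the whole space.\<close>

lemma cls_cyclic:
  fixes a :: "'i \<Rightarrow> 'i \<Rightarrow> 'k::field"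
  assumes I: "finite I" and u: "u \<in> fsp I" "kx_space.exact (mact I a) F u" and F: "F \<noteq> 0" "degree F = card I"
  shows "cls I a = cyclic_class F"
proof -
  interpret kx_space "mact I a" by (rule mact_kx_space)
  have "cyc u = fsp I"
  proof (rule subspace_eq_of_dim_le)
    show "vs.subspace (cyc u)" by (rule subspace_scal[OF cyc_subspace])
    show "cyc u \<subseteq> fsp I" by (rule cyc_minimal[OF fsp_subspace u(1)])
    show "fd (fsp I)" by (rule fsp_fd_dim(1)[OF I])
    show "vs.dim (fsp I) \<le> vs.dim (cyc u)" using dim_cyc[OF u(2) F(1)] fsp_fd_dim(2)[OF I, where 'k='k] F(2) by simp
  qed
  then obtain h where "kx_rec (mact I a) (cyclic_module F) (fsp I) h" using cyclic_module_kx_rec[OF u(2)] by metis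
  from cls_eq_rep_class[OF I this] show ?thesis by (simp add: cyclic_class_def)
qed

text \<open>Each indecomposable summand has a generator whose order is a prime power. Closure
  statements thus reduce to the question which orders single vectors can have.\<close>

lemma cls_in_span:
  assumes I: "finite I"
    and S: "\<And>p u v. irreducible p \<Longrightarrow> lead_coeff p = 1 \<Longrightarrow> u \<ge> 1 \<Longrightarrow> v \<in> fsp I \<Longrightarrow>
      kx_space.exact (mact I a) (p ^ u) v \<Longrightarrow> cyclic_class (p ^ u) \<in> ps.span S"
  shows "cls I a \<in> ps.span S"
proof -
  interpret kx_rec "mact I a" "model I a" "fsp I" "\<lambda>x. x" by (rule model_kx_rec)
  have f: "fd (fsp I)" by (rule fsp_fd_dim(1)[OF I])
  obtain n W p s where W: "dsum (fsp I) n W" "\<forall>i<n. m.subspace (W i)" "\<forall>i<n. primary_cyc (W i) (p i) (s i)"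
    using primary_decomposition_exists[OF f] .
  have "frag_of (primary_class (p i) (s i)) \<in> ps.span S" if i: "i < n" for i
  proof -
    obtain u where u: "irreducible (p i)" "lead_coeff (p i) = 1" "s i \<ge> 1" "W i = cyc u" "exact (p i ^ s i) u"
      using W(3) i unfolding primary_cyc_def by blast
    have "W i \<subseteq> fsp I" using dsum_piece_subset[OF W(1)] W(2) subspace_scal i by blast
    then have "u \<in> fsp I" using u(4) self_in_cyc by blast
    from S[OF u(1,2,3) this u(5)] show ?thesis
      using primary_class_indecomposable(2)[OF u(1,2,3)] by (simp add: cyclic_class_def)
  qed
  then have "(\<Sum>i<n. frag_of (primary_class (p i) (s i))) \<in> ps.span S" by (intro ps.span_sum) auto
  then show ?thesis unfolding cls_def rep_class_eq[OF f W] .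
qed

lemma companion_kills:
  assumes f: "f \<noteq> 0" and w: "w \<in> fsp {..<degree f}"
  shows "mact {..<degree f} (companion f) f w = 0"
proof -
  interpret kx_space "mact {..<degree f} (companion f)" by (rule mact_kx_space)
  obtain r where r: "w = mact {..<degree f} (companion f) r (coeff (1 mod f))"
    using w unfolding companion_cyc[OF f, symmetric] by (rule cycE)
  have "mact {..<degree f} (companion f) (f * r) (coeff (1 mod f)) = 0"
    using companion_exact[OF f] unfolding exact_def by simp
  then show ?thesis unfolding r mact_mult .
qed

lemma companion_generator:
  assumes "f \<noteq> 0"
  shows "coeff (1 mod f) \<in> fsp {..<degree f}"
  using companion_cyc[OF assms] kx_space.self_in_cyc[OF mact_kx_space] by metis

lemma not_dvd_x:
  assumes "irreducible (f :: 'k::field poly)" "poly f 0 \<noteq> 0"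
  shows "\<not> f dvd [:0, 1:]"
proof
  assume "f dvd [:0, 1:]"
  then obtain c where c: "[:0, 1:] = f * c" by (auto elim: dvdE)
  then have "f dvd 1 \<or> c dvd 1" using linear_poly_irreducible[of 0] by (metis irreducible_def)
  moreover have "\<not> f dvd 1" using assms by (simp add: irreducible_def)
  ultimately obtain k where k: "c = [:k:]" "k dvd 1" by (auto simp: is_unit_poly_iff)
  have "poly [:0, 1:] 0 = poly f 0 * k" unfolding c k(1) by simp
  then show False using assms(2) k(2) by auto
qed

lemma act2_const_power: "act2 I a J b ([:p:] ^ n * r) v = actl I a (p ^ n) (act2 I a J b r v)"
  by (simp only: poly_const_pow act2_mult act2_y)

text \<open>On \<open>k[x]/(x-1)\<^sup>s \<otimes> k[x]/f\<close> write the action as \<open>x = (1 + n) \<otimes> z\<close>. By Taylor expansion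
  \<open>f(x) = f(z) + n z f'(z) + n\<^sup>2 R\<close> with \<open>f(z) = 0\<close> and \<open>z f'(z)\<close> invertible, so \<open>f(x)\<close> has the same
  order of nilpotency as \<open>n\<close> and the tensor product is cyclic with annihilator \<open>f\<^sup>s\<close>.\<close>

theorem unipotent_times_simple:
  fixes f :: "'k::field poly"
  assumes perf: "perfect_field TYPE('k)" and f: "irreducible f" "poly f 0 \<noteq> 0" and s: "s \<ge> 1"
  shows "rmult (cyclic_class ([:-1, 1:] ^ s)) (cyclic_class f) = cyclic_class (f ^ s)"
proof -
  obtain t where t: "s = Suc t" using s by (cases s) auto
  define l where "l = [:-1, 1 :: 'k:]"
  have l0: "l ^ s \<noteq> 0" and f0: "f \<noteq> 0" using f by (auto simp: l_def)
  have dl: "degree (l ^ s) = s" by (simp add: l_def degree_power_eq)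
  define I where "I = {..<s}"
  define J where "J = {..<degree f}"
  define a where "a = companion (l ^ s)"
  define b where "b = companion f"
  define u0 where "u0 = coeff (1 mod (l ^ s))"
  define w0 where "w0 = coeff (1 mod f)"
  have u0: "u0 \<in> fsp I" "mact I a r u0 = 0 \<longleftrightarrow> l ^ s dvd r" for r
    using companion_generator[OF l0] companion_exact[OF l0] unfolding kx_space.exact_def[OF mact_kx_space] dl I_def a_def u0_def by auto
  have w0: "w0 \<in> fsp J" "mact J b r w0 = 0 \<longleftrightarrow> f dvd r" for r
    using companion_generator[OF f0] companion_exact[OF f0] unfolding kx_space.exact_def[OF mact_kx_space] J_def b_def w0_def by auto
  define u where "u = otimes u0 w0"
  have uI: "u \<in> fsp (I \<times> J)" unfolding u_def by (rule otimes_in_fsp[OF u0(1) w0(1)])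
  define n where "n = [:l:]"
  have "yy = 1 + n" by (simp add: n_def l_def one_pCons)
  then have yz: "yy * zz = zz + n * zz" by (simp only: distrib_right mult_1_left)
  \<comment> \<open>It acts invertibly because the irreducible \<open>f\<close> divides neither x
    nor its own derivative; the latter is separability.\<close>
  define h where "h = cc.ev zz ([:0, 1:] * pderiv f)"
  have hz: "zz * cc.ev zz (pderiv f) = h" by (simp add: h_def one_pCons[symmetric])
  obtain R where R: "cc.ev (yy * zz) f = cc.ev zz f + n * h + n ^ 2 * R"
    using cc.ev_taylor[of zz n f] unfolding yz hz by blast
  \<comment> \<open>The error terms vanish on the generator: \<open>f\<close> kills
    \<open>w0\<close> here, and \<open>l ^ s\<close> kills \<open>u0\<close> in
    \<open>z2\<close>.\<close>
  have z1: "act2 I a J b (cc.ev zz f * U) u = 0" for U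
  proof -
    have "act2 I a J b (cc.ev zz f * U) u = act2 I a J b U (actr J b f u)" by (simp only: mult.commute[of _ U] act2_mult act2_z)
    also have "actr J b f u = 0" unfolding u_def actr_otimes using w0(2)[of f] by (auto simp: otimes_def)
    finally show ?thesis by (simp only: act2_zero_right)
  qed
  have z2: "act2 I a J b (n ^ s * S) u = 0" for S
  proof -
    have "act2 I a J b (n ^ s * S) u = act2 I a J b S (actl I a (l ^ s) u)"
      unfolding n_def by (simp only: mult.commute[of _ S] act2_mult poly_const_pow act2_y)
    also have "actl I a (l ^ s) u = 0" unfolding u_def actl_otimes using u0(2)[of "l ^ s"] by (auto simp: otimes_def)
    finally show ?thesis by (simp only: act2_zero_right)
  qed
  interpret K: kx_space "mact (I \<times> J) (kron a b)" by (rule mact_kx_space)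
  have "mact (I \<times> J) (kron a b) (f ^ s) u = 0"
  proof -
    obtain S U where SU: "cc.ev (yy * zz) (f ^ s) = n ^ s * h ^ s + n ^ Suc s * S + cc.ev zz f * U"
      using cc.ev_power_expansion[OF R] by blast
    have "n ^ Suc s * S = n ^ s * (n * S)" by (simp add: mult_ac)
    then show ?thesis unfolding act2_kron[symmetric] SU act2_plus by (simp only: z1 z2 add_0_right)
  qed
  \<comment> \<open>With t = s - 1 the leading term survives as a tensor of two nonzero vectors:
    \<open>l ^ t\<close> does not kill \<open>u0\<close>, and a polynomial not divisible by
    \<open>f\<close> does not kill \<open>w0\<close>.\<close>
  moreover have "mact (I \<times> J) (kron a b) (f ^ t) u \<noteq> 0"
  proof -
    obtain S U where SU: "cc.ev (yy * zz) (f ^ t) = n ^ t * h ^ t + n ^ Suc t * S + cc.ev zz f * U"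
      using cc.ev_power_expansion[OF R] by blast
    have "h ^ t = cc.ev zz (([:0, 1:] * pderiv f) ^ t)" by (simp only: h_def cc.ev_power)
    then have "act2 I a J b (n ^ t * h ^ t) u = otimes (mact I a (l ^ t) u0) (mact J b (([:0, 1:] * pderiv f) ^ t) w0)"
      unfolding n_def by (simp only: act2_const_power act2_z u_def actr_otimes actl_otimes)
    then have e: "mact (I \<times> J) (kron a b) (f ^ t) u = otimes (mact I a (l ^ t) u0) (mact J b (([:0, 1:] * pderiv f) ^ t) w0)"
      unfolding act2_kron[symmetric] SU act2_plus using z1 z2[of S] unfolding t by (simp only: add_0_right)
    have "\<not> l ^ s dvd l ^ t"
    proof
      assume "l ^ s dvd l ^ t"
      then have "degree (l ^ s) \<le> degree (l ^ t)" by (rule dvd_imp_degree_le) (simp add: l_def)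
      then show False by (simp add: l_def degree_power_eq t del: power_Suc)
    qed
    moreover have "\<not> f dvd ([:0, 1:] * pderiv f) ^ t"
      using irreducible_dvd_power_poly[OF f(1)] irreducible_poly_dvd_mult[OF f(1)] not_dvd_x[OF f]
        irreducible_not_dvd_pderiv[OF perf f(1)] by blast
    ultimately show ?thesis unfolding e using u0(2) w0(2) by (intro otimes_nonzero) blast+
  qed
  \<comment> \<open>The order of \<open>u\<close> is thus \<open>f ^ s\<close>, whose degree
    \<open>s * degree f\<close> is the dimension of the tensor product, so \<open>u\<close>
    generates it.\<close>
  ultimately have "K.exact (f ^ s) u" unfolding t by (rule K.exact_prime_power[OF f(1)])
  moreover have "degree (f ^ s) = card (I \<times> J)" using f0 by (simp add: I_def J_def degree_power_eq card_cartesian_product)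
  moreover have "f ^ s \<noteq> 0" using f0 by simp
  ultimately have "cls (I \<times> J) (kron a b) = cyclic_class (f ^ s)" using uI by (intro cls_cyclic) (auto simp: I_def J_def)
  then show ?thesis
    unfolding l_def[symmetric] rmult_cyclic_class[OF l0 f0] dl I_def J_def a_def b_def .
qed

subsection \<open>Multiplication by nilpotent classes\<close>

lemma x_power: "[:0, 1:] ^ s = monom (1 :: 'k::field) s"
  by (induction s) (simp_all add: monom_0 monom_Suc one_pCons)

lemma companion_x_power:
  assumes "i < s" "j < s"
  shows "companion ([:0, 1 :: 'k::field:] ^ s) i j = (if i = Suc j then 1 else 0)"
proof (cases "Suc j < s")
  case True
  then have "monom (1::'k) (Suc j) mod monom 1 s = monom 1 (Suc j)" by (intro mod_poly_less) (simp add: degree_monom_eq)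
  then show ?thesis unfolding companion_def x_power by auto
next
  case False
  then have "Suc j = s" using assms by simp
  then show ?thesis unfolding companion_def x_power using assms by auto
qed

lemma shift_mop:
  assumes "i < s"
  shows "mop {..<s} (companion ([:0, 1 :: 'k::field:] ^ s)) w i = (case i of 0 \<Rightarrow> 0 | Suc i' \<Rightarrow> w i')"
proof -
  have "mop {..<s} (companion ([:0, 1 :: 'k:] ^ s)) w i = (\<Sum>j<s. if i = Suc j then w j else 0)"
    unfolding mop_def using assms by (auto simp: companion_x_power intro!: sum.cong)
  also have "\<dots> = (case i of 0 \<Rightarrow> 0 | Suc i' \<Rightarrow> w i')"
    using assms by (auto split: nat.split)
  finally show ?thesis .
qed

lemma shift_kron_mop:
  fixes b :: "'j \<Rightarrow> 'j \<Rightarrow> 'k::field"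
  shows "mop ({..<s} \<times> J) (kron (companion ([:0, 1:] ^ s)) b) v (i, j)
    = (if i < s then (case i of 0 \<Rightarrow> 0 | Suc i' \<Rightarrow> mop J b (\<lambda>j'. v (i', j')) j) else 0)"
proof -
  have "mop ({..<s} \<times> J) (kron (companion ([:0, 1:] ^ s)) b) v (i, j)
      = mop J b (\<lambda>j'. mop {..<s} (companion ([:0, 1:] ^ s)) (\<lambda>i'. v (i', j')) i) j"
    by (simp only: mop_kron_actr_actl) (simp add: actl_def actr_def mact_x)
  also have "\<dots> = (if i < s then (case i of 0 \<Rightarrow> 0 | Suc i' \<Rightarrow> mop J b (\<lambda>j'. v (i', j')) j) else 0)"
  proof (cases "i < s")
    case True
    then show ?thesis unfolding shift_mop[OF True] by (auto simp: mop_def split: nat.split)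
  qed (auto simp: mop_def)
  finally show ?thesis .
qed

text \<open>If \<open>x\<close> acts invertibly on \<open>W\<close>, then \<open>e\<^sub>i \<otimes> w \<mapsto> e\<^sub>i \<otimes> x\<^sup>-\<^sup>i w\<close> trivialises the action of \<open>x\<close> on the
  second factor of \<open>k[x]/x\<^sup>s \<otimes> W\<close>.\<close>

lemma nilpotent_twist:
  fixes b :: "'j \<Rightarrow> 'j \<Rightarrow> 'k::field"
  assumes J: "finite J" and r: "\<And>w. w \<in> fsp J \<Longrightarrow> mact J b (r * [:0, 1:]) w = w"
  shows "cls ({..<s} \<times> J) (kron (companion ([:0, 1:] ^ s)) b)
    = cls ({..<s} \<times> J) (kron (companion ([:0, 1:] ^ s)) (\<lambda>i j. if i = j then 1 else 0))"
proof -
  \<comment> \<open>\<open>H p\<close> applies the i-th power of \<open>p\<close> to the i-th slice.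
    As \<open>r\<close> inverts x on the second factor, \<open>H r\<close> and
    \<open>H [:0, 1:]\<close> are mutually inverse.\<close>
  define H where "H p v = (\<lambda>(i, j). mact J b (p ^ i) (\<lambda>j'. v (i, j')) j)" for p :: "'k poly" and v :: "nat \<times> 'j \<Rightarrow> 'k"
  have slice: "(\<lambda>j'. v (i, j')) \<in> fsp J" if "v \<in> fsp ({..<s} \<times> J)" for v :: "nat \<times> 'j \<Rightarrow> 'k" and i
    using that by (auto simp: fsp_def)
  have zero: "mact J b p (\<lambda>j'. 0) = (\<lambda>j'. 0)" for p
    using Modules.module.scale_zero_right[OF mact_module, of J b p] by (simp add: zero_fun_def)
  have inv: "mact J b (r ^ i) (mact J b ([:0, 1:] ^ i) w) = w" if "w \<in> fsp J" for i w
  proof (induction i)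
    case (Suc i)
    have "mact J b (r ^ Suc i) (mact J b ([:0, 1:] ^ Suc i) w) = mact J b (r ^ i) (mact J b ([:0, 1:] ^ i) (mact J b (r * [:0, 1:]) w))"
      unfolding mact_mult[symmetric] by (simp add: mult_ac)
    then show ?case using Suc r[OF that] by simp
  qed (simp add: mact_one)
  have inv': "mact J b ([:0, 1:] ^ i) (mact J b (r ^ i) w) = w" if "w \<in> fsp J" for i w
    using inv[OF that, of i] by (simp only: mact_mult[symmetric] mult.commute[of "r ^ i"])
  have H_in: "H p v \<in> fsp ({..<s} \<times> J)" if v: "v \<in> fsp ({..<s} \<times> J)" for p v
    unfolding fsp_def
  proof (intro CollectI allI impI)
    fix x assume x: "x \<notin> {..<s} \<times> J"
    obtain i j where ij: "x = (i, j)" by (cases x)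
    show "H p v x = 0"
    proof (cases "i < s")
      case True
      then have "j \<notin> J" using x ij by auto
      then show ?thesis using mact_in_fsp[OF slice[OF v, of i], of b "p ^ i"] by (simp add: H_def ij fsp_def)
    next
      case False
      then have "(\<lambda>j'. v (i, j')) = (\<lambda>j'. 0)" using v by (auto simp: fsp_def)
      then show ?thesis by (simp add: H_def ij zero)
    qed
  qed
  show ?thesis
  proof (rule cls_intertwine[of _ "H r"])
    show "bij_betw (H r) (fsp ({..<s} \<times> J)) (fsp ({..<s} \<times> J))"
    proof (rule bij_betw_byWitness[where f' = "H [:0, 1:]"])
      show "\<forall>v\<in>fsp ({..<s} \<times> J). H [:0, 1:] (H r v) = v" using inv'[OF slice] by (auto simp: H_def)
      show "\<forall>v\<in>fsp ({..<s} \<times> J). H r (H [:0, 1:] v) = v" using inv[OF slice] by (auto simp: H_def)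
    qed (use H_in in auto)
    fix v w :: "nat \<times> 'j \<Rightarrow> 'k" assume v: "v \<in> fsp ({..<s} \<times> J)"
    show "H r (v + w) = H r v + H r w"
    proof (rule ext, clarify)
      fix i j
      show "H r (v + w) (i, j) = (H r v + H r w) (i, j)"
        using mact_add[of J b "r ^ i" "\<lambda>j'. v (i, j')" "\<lambda>j'. w (i, j')"] by (simp add: H_def plus_fun_def)
    qed
    show "H r (fscale c v) = fscale c (H r v)" for c
    proof (rule ext, clarify)
      fix i j
      show "H r (fscale c v) (i, j) = fscale c (H r v) (i, j)"
        using mact_fscale[of J b "r ^ i" c "\<lambda>j'. v (i, j')"] by (simp add: H_def fscale_def)
    qed
    show "H r (mop ({..<s} \<times> J) (kron (companion ([:0, 1:] ^ s)) b) v)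
        = mop ({..<s} \<times> J) (kron (companion ([:0, 1:] ^ s)) (\<lambda>i j. if i = j then 1 else 0)) (H r v)"
    proof (rule ext, clarify)
      fix i j
      have id: "mop J (\<lambda>i j. if i = j then 1 else 0) w = w" if "w \<in> fsp J" for w :: "'j \<Rightarrow> 'k"
        using that J by (auto simp: mop_def fsp_def fun_eq_iff if_distrib[of "\<lambda>x. x * _"] cong: if_cong)
      show "H r (mop ({..<s} \<times> J) (kron (companion ([:0, 1:] ^ s)) b) v) (i, j)
        = mop ({..<s} \<times> J) (kron (companion ([:0, 1:] ^ s)) (\<lambda>i j. if i = j then 1 else 0)) (H r v) (i, j)"
      proof (cases "i < s")
        case False
        then show ?thesis by (simp add: H_def shift_kron_mop zero)
      next
        case True
        show ?thesis
        proof (cases i)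
          case 0
          then show ?thesis using True by (simp add: H_def shift_kron_mop zero)
        next
          case (Suc i')
          have sl: "(\<lambda>j'. v (i', j')) \<in> fsp J" by (rule slice[OF v])
          \<comment> \<open>Passing to the next slice applies x once to the second factor; one of
            the \<open>Suc i'\<close> factors \<open>r\<close> cancels it.\<close>
          have "mact J b (r ^ Suc i') (mop J b (\<lambda>j'. v (i', j'))) = mact J b (r ^ i') (\<lambda>j'. v (i', j'))"
            using r[OF sl] by (simp only: mact_x[symmetric] mact_mult[symmetric] power_Suc2 mult.assoc) (simp only: mact_mult r[OF sl])
          moreover have "(\<lambda>j'. H r v (i', j')) = mact J b (r ^ i') (\<lambda>j'. v (i', j'))" by (simp add: H_def)
          ultimately show ?thesis using True Suc id[OF mact_in_fsp[OF sl], of b "r ^ i'"]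
            by (simp add: H_def shift_kron_mop del: power_Suc)
        qed
      qed
    qed
  qed (use J in simp)
qed

text \<open>A nonzero constant term makes \<open>g\<close> prime to x, so Bezout supplies an inverse
  of x on \<open>k[x]/g\<close> and the twist applies. The Kronecker product with an identity matrix
  then splits into one block for each of its \<open>degree g\<close> indices.\<close>

theorem nilpotent_times_invertible:
  fixes g :: "'k::field poly"
  assumes g: "poly g 0 \<noteq> 0"
  shows "rmult (cyclic_class ([:0, 1:] ^ s)) (cyclic_class g) = frag_cmul (int (degree g)) (cyclic_class ([:0, 1:] ^ s))"
proof -
  have g0: "g \<noteq> 0" using g by auto
  have x0: "[:0, 1 :: 'k:] ^ s \<noteq> 0" by simp
  have dx: "degree ([:0, 1 :: 'k:] ^ s) = s" by (simp add: degree_power_eq)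
  have "\<not> [:0, 1:] dvd g"
  proof
    assume "[:0, 1:] dvd g"
    then obtain c where "g = [:0, 1:] * c" by (auto elim: dvdE)
    then show False using g by simp
  qed
  then obtain r q where rq: "r * [:0, 1:] + q * g = 1" using irreducible_poly_bezout[OF linear_poly_irreducible[of 0]] by metis
  define J where "J = {..<degree g}"
  have "mact J (companion g) (r * [:0, 1:]) w = w" if w: "w \<in> fsp J" for w
  proof -
    have "w = mact J (companion g) (r * [:0, 1:] + q * g) w" unfolding rq mact_one ..
    also have "\<dots> = mact J (companion g) (r * [:0, 1:]) w + mact J (companion g) q (mact J (companion g) g w)"
      unfolding mact_plus mact_mult ..
    also have "mact J (companion g) g w = 0" using companion_kills[OF g0] w unfolding J_def by blast
    also have "mact J (companion g) (r * [:0, 1:]) w + mact J (companion g) q 0 = mact J (companion g) (r * [:0, 1:]) w"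
      by (simp only: Modules.module.scale_zero_right[OF mact_module] add_0_right)
    finally show ?thesis by (rule sym)
  qed
  note tw = nilpotent_twist[of J "companion g" r s, OF _ this]
  define \<delta> where "\<delta> = (\<lambda>i j. if i = j then 1 else (0::'k))"
  have "cls ({..<s} \<times> {..<n}) (kron (companion ([:0, 1:] ^ s)) (\<lambda>i j::nat. if i = j then 1 else 0))
      = frag_cmul (int n) (cyclic_class ([:0, 1 :: 'k:] ^ s))" for n
  proof (induction n)
    case (Suc n)
    let ?A = "kron (companion ([:0, 1 :: 'k:] ^ s)) (\<lambda>i j::nat. if i = j then 1 else 0)"
    have e: "{..<s} \<times> {..<Suc n} = {..<s} \<times> {..<n} \<union> {..<s} \<times> {n}" by auto
    have "cls ({..<s} \<times> {..<Suc n}) ?A = cls ({..<s} \<times> {..<n}) ?A + cls ({..<s} \<times> {n}) ?A"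
      unfolding e by (rule cls_union) (auto simp: kron_def)
    also have "cls ({..<s} \<times> {n}) ?A = cls {..<s} (companion ([:0, 1 :: 'k:] ^ s))"
      by (rule cls_reindex[where \<sigma> = "\<lambda>i. (i, n)", symmetric]) (auto simp: bij_betw_def inj_on_def kron_def)
    also have "\<dots> = cyclic_class ([:0, 1 :: 'k:] ^ s)" using cyclic_class_cls[OF x0] dx by simp
    finally show ?case using Suc by (simp add: frag_cmul_distrib add.commute)
  qed (simp add: cls_empty)
  then show ?thesis
    using tw unfolding rmult_cyclic_class[OF x0 g0] dx J_def by simp
qed

subsection \<open>Closure under multiplication\<close>

lemma mact_zero_right: "mact I a p 0 = 0"
  by (rule Modules.module.scale_zero_right[OF mact_module])

lemma kron_killed_exact:
  assumes "kx_space.exact (mact I a) (p ^ u) v" "mact I a q v = 0"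
  shows "p ^ u dvd q"
  using assms unfolding kx_space.exact_def[OF mact_kx_space] by blast

lemma exact_dvd_linear_power:
  assumes "irreducible p" "lead_coeff p = 1" "u \<ge> 1" "p ^ u dvd [:c, 1:] ^ n"
  shows "p = [:c, 1 :: 'k::field:]"
proof -
  have "p dvd p ^ u" using assms(3) by (simp add: dvd_power)
  then have "p dvd [:c, 1:] ^ n" using assms(4) by (rule dvd_trans)
  then have "p dvd [:c, 1:]" by (rule irreducible_dvd_power_poly[OF assms(1)])
  then show ?thesis using monic_irreducible_dvd_eq[OF assms(1) linear_poly_irreducible assms(2)] by simp
qed

text \<open>The identity yz - 1 = (y - 1) z + (z - 1) exhibits the tensor action minus 1 as a sum of
  commuting nilpotent operators. Only the prime x - 1 can therefore occur.\<close>

theorem unipotent_closed: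
  "rmult (cyclic_class ([:-1, 1 :: 'k::field:] ^ s)) (cyclic_class ([:-1, 1:] ^ t)) \<in> ps.span {cyclic_class ([:-1, 1:] ^ u) | u. u \<ge> 1}"
proof -
  define l where "l = [:-1, 1 :: 'k:]"
  have l0: "l ^ n \<noteq> 0" and dl: "degree (l ^ n) = n" for n by (simp_all add: l_def degree_power_eq)
  let ?I = "{..<s}" and ?J = "{..<t}" and ?a = "companion (l ^ s)" and ?b = "companion (l ^ t)"
  have "cls (?I \<times> ?J) (kron ?a ?b) \<in> ps.span {cyclic_class (l ^ u) | u. u \<ge> 1}"
  proof (rule cls_in_span)
    fix p u v assume p: "irreducible p" "lead_coeff p = 1" "u \<ge> 1" and v: "v \<in> fsp (?I \<times> ?J)"
      and ex: "kx_space.exact (mact (?I \<times> ?J) (kron ?a ?b)) (p ^ u) v"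
    have e: "cc.ev (yy * zz) l = [:l:] * zz + cc.ev zz l" by (simp add: l_def)
    obtain P Q where PQ: "cc.ev (yy * zz) (l ^ (s + t)) = ([:l:] * zz) ^ s * P + cc.ev zz l ^ t * Q"
      using sum_power_ideal unfolding cc.ev_power e by blast
    have "act2 ?I ?a ?J ?b (([:l:] * zz) ^ s * P) v = act2 ?I ?a ?J ?b (zz ^ s * P) (act2 ?I ?a ?J ?b ([:l:] ^ s) v)"
      by (simp only: act2_mult[symmetric] power_mult_distrib mult_ac)
    also have "act2 ?I ?a ?J ?b ([:l:] ^ s) v = 0" unfolding poly_const_pow act2_y
      by (rule actl_kills[OF _ v]) (use companion_kills[OF l0[of s]] dl in simp)
    finally have 1: "act2 ?I ?a ?J ?b (([:l:] * zz) ^ s * P) v = 0" by (simp only: act2_zero_right)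
    have "act2 ?I ?a ?J ?b (cc.ev zz l ^ t * Q) v = act2 ?I ?a ?J ?b Q (act2 ?I ?a ?J ?b (cc.ev zz (l ^ t)) v)"
      by (simp only: act2_mult[symmetric] cc.ev_power mult_ac)
    also have "act2 ?I ?a ?J ?b (cc.ev zz (l ^ t)) v = 0" unfolding act2_z
      by (rule actr_kills[OF _ v]) (use companion_kills[OF l0[of t]] dl in simp)
    finally have 2: "act2 ?I ?a ?J ?b (cc.ev zz l ^ t * Q) v = 0" by (simp only: act2_zero_right)
    have "mact (?I \<times> ?J) (kron ?a ?b) (l ^ (s + t)) v = 0"
      unfolding act2_kron[symmetric] PQ act2_plus 1 2 by simp
    then have "p = l" using exact_dvd_linear_power[OF p] kron_killed_exact[OF ex] unfolding l_def by blast
    then show "cyclic_class (p ^ u) \<in> ps.span {cyclic_class (l ^ u) | u. u \<ge> 1}" using p(3) by (auto intro: ps.span_base)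
  qed simp
  then show ?thesis unfolding l_def[symmetric] rmult_cyclic_class[OF l0 l0] dl .
qed

text \<open>The s-th power of yz contains y^s, which is zero on the first factor, so only the prime
  x can occur.\<close>

theorem nilpotent_closed:
  "rmult (cyclic_class ([:0, 1 :: 'k::field:] ^ s)) (cyclic_class ([:0, 1:] ^ t)) \<in> ps.span {cyclic_class ([:0, 1:] ^ u) | u. u \<ge> 1}"
proof -
  define l where "l = [:0, 1 :: 'k:]"
  have l0: "l ^ n \<noteq> 0" and dl: "degree (l ^ n) = n" for n by (simp_all add: l_def degree_power_eq)
  let ?I = "{..<s}" and ?J = "{..<t}" and ?a = "companion (l ^ s)" and ?b = "companion (l ^ t)"
  have "cls (?I \<times> ?J) (kron ?a ?b) \<in> ps.span {cyclic_class (l ^ u) | u. u \<ge> 1}"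
  proof (rule cls_in_span)
    fix p u v assume p: "irreducible p" "lead_coeff p = 1" "u \<ge> 1" and v: "v \<in> fsp (?I \<times> ?J)"
      and ex: "kx_space.exact (mact (?I \<times> ?J) (kron ?a ?b)) (p ^ u) v"
    have e: "cc.ev (yy * zz) l = [:l:] * zz" by (simp add: l_def)
    have "cc.ev (yy * zz) (l ^ s) = zz ^ s * [:l:] ^ s" unfolding cc.ev_power e by (simp only: power_mult_distrib mult.commute)
    then have "mact (?I \<times> ?J) (kron ?a ?b) (l ^ s) v = act2 ?I ?a ?J ?b (zz ^ s) (actl ?I ?a (l ^ s) v)"
      by (simp only: act2_kron[symmetric] act2_mult poly_const_pow act2_y)
    also have "actl ?I ?a (l ^ s) v = 0"
      by (rule actl_kills[OF _ v]) (use companion_kills[OF l0[of s]] dl in simp)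
    finally have "mact (?I \<times> ?J) (kron ?a ?b) (l ^ s) v = 0" by (simp only: act2_zero_right)
    then have "p = l" using exact_dvd_linear_power[OF p] kron_killed_exact[OF ex] unfolding l_def by blast
    then show "cyclic_class (p ^ u) \<in> ps.span {cyclic_class (l ^ u) | u. u \<ge> 1}" using p(3) by (auto intro: ps.span_base)
  qed simp
  then show ?thesis unfolding l_def[symmetric] rmult_cyclic_class[OF l0 l0] dl .
qed

section \<open>Diagonalisation over the algebraic closure and its descent\<close>

lemma mop_fscale: "mop I a (fscale c w) = fscale c (mop I a w)"
  by (rule module_endo.T_scale[OF mop_endo])

lemma mact_eigen:
  assumes "mop I a w = fscale c w"
  shows "mact I a q w = fscale (poly q c) w"
proof (induction q)
  case (pCons x q)
  show ?case unfolding mact_pCons pCons.IH mop_fscale assms by (auto simp: algebra_simps)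
qed (auto simp: zero_fun_def)

lemma fscale_solve: "fscale (- c) w + v = 0 \<Longrightarrow> v = fscale c w"
  by (auto simp: fun_eq_iff eq_neg_iff_add_eq_0 add_eq_0_iff)

lemma actr_plus: "actr J b (p + q) v = actr J b p v + actr J b q v"
  by (auto simp: actr_def mact_plus)

lemma actr_sum: "actr J b (\<Sum>x\<in>A. p x) v = (\<Sum>x\<in>A. actr J b (p x) v)"
  by (induction A rule: infinite_finite_induct) (auto simp: actr_plus, auto simp: actr_def)

lemma actl_sum: "actl I a (\<Sum>x\<in>A. p x) v = (\<Sum>x\<in>A. actl I a (p x) v)"
  by (rule Modules.module.scale_sum_left[OF actl_module])

lemma mact_dvd_kills:
  assumes "\<And>w. w \<in> fsp I \<Longrightarrow> mact I a p w = 0" "p dvd q" "w \<in> fsp I"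
  shows "mact I a q w = 0"
proof -
  obtain c where "q = c * p" using assms(2) by (metis dvdE mult.commute)
  then show ?thesis using assms by (simp add: mact_mult mact_zero_right)
qed

text \<open>Lagrange interpolation splits \<open>v\<close> into simultaneous eigenvectors of the two commuting actions.\<close>

lemma diagonalizable_kron:
  fixes a :: "'i \<Rightarrow> 'i \<Rightarrow> 'e::field" and b :: "'j \<Rightarrow> 'j \<Rightarrow> 'e"
  assumes A: "finite A" "A \<noteq> {}" "\<And>w. w \<in> fsp I \<Longrightarrow> mact I a (\<Prod>\<alpha>\<in>A. [:-\<alpha>, 1:]) w = 0"
    and B: "finite B" "B \<noteq> {}" "\<And>w. w \<in> fsp J \<Longrightarrow> mact J b (\<Prod>\<beta>\<in>B. [:-\<beta>, 1:]) w = 0"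
    and v: "v \<in> fsp (I \<times> J)" and q: "mact (I \<times> J) (kron a b) (q * q) v = 0"
  shows "mact (I \<times> J) (kron a b) q v = 0"
proof -
  obtain L where L: "(\<Sum>\<alpha>\<in>A. L \<alpha>) = 1" "\<And>\<alpha>. \<alpha> \<in> A \<Longrightarrow> (\<Prod>\<beta>\<in>A. [:-\<beta>, 1:]) dvd [:-\<alpha>, 1:] * L \<alpha>"
    using lagrange_decomposition[OF A(1,2)] by blast
  obtain M where M: "(\<Sum>\<alpha>\<in>B. M \<alpha>) = 1" "\<And>\<alpha>. \<alpha> \<in> B \<Longrightarrow> (\<Prod>\<beta>\<in>B. [:-\<beta>, 1:]) dvd [:-\<alpha>, 1:] * M \<alpha>"
    using lagrange_decomposition[OF B(1,2)] by blast
  let ?act = "act2 I a J b"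
  \<comment> \<open>The part of \<open>v\<close> on which the first matrix acts by
    \<open>\<alpha>\<close> and the second by \<open>\<beta>\<close>, so that their Kronecker
    product acts by \<open>\<alpha> * \<beta>\<close>.\<close>
  define w where "w \<alpha> \<beta> = actr J b (M \<beta>) (actl I a (L \<alpha>) v)" for \<alpha> \<beta>
  have w2: "w \<alpha> \<beta> = ?act (cc.ev zz (M \<beta>) * [:L \<alpha>:]) v" for \<alpha> \<beta>
    unfolding w_def by (simp only: act2_mult act2_z act2_y)
  have "v = actl I a (\<Sum>\<alpha>\<in>A. L \<alpha>) v" unfolding L(1) using Modules.module.scale_one[OF actl_module] by metis
  also have "\<dots> = (\<Sum>\<alpha>\<in>A. actl I a (L \<alpha>) v)" by (rule actl_sum)
  also have "\<dots> = (\<Sum>\<alpha>\<in>A. \<Sum>\<beta>\<in>B. w \<alpha> \<beta>)"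
  proof (rule sum.cong[OF refl])
    fix \<alpha> assume "\<alpha> \<in> A"
    have "actl I a (L \<alpha>) v = actr J b (\<Sum>\<beta>\<in>B. M \<beta>) (actl I a (L \<alpha>) v)" unfolding M(1) by (auto simp: actr_def mact_one)
    then show "actl I a (L \<alpha>) v = (\<Sum>\<beta>\<in>B. w \<alpha> \<beta>)" unfolding actr_sum w_def .
  qed
  finally have v_sum: "v = (\<Sum>\<alpha>\<in>A. \<Sum>\<beta>\<in>B. w \<alpha> \<beta>)" .
  have "mact (I \<times> J) (kron a b) q (w \<alpha> \<beta>) = 0" if "\<alpha> \<in> A" "\<beta> \<in> B" for \<alpha> \<beta>
  proof -
    have "actl I a [:-\<alpha>, 1:] (w \<alpha> \<beta>) = ?act ([:[:-\<alpha>, 1:]:] * (cc.ev zz (M \<beta>) * [:L \<alpha>:])) v"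
      unfolding w2 by (simp only: act2_mult[of _ _ _ _ "[:[:-\<alpha>, 1:]:]"] act2_y)
    also have "[:[:-\<alpha>, 1:]:] * (cc.ev zz (M \<beta>) * [:L \<alpha>:]) = cc.ev zz (M \<beta>) * [:[:-\<alpha>, 1:] * L \<alpha>:]"
    proof -
      have "[:[:-\<alpha>, 1:] * L \<alpha>:] = [:[:-\<alpha>, 1:]:] * [:L \<alpha>:]" by simp
      then show ?thesis by (simp only: mult_ac)
    qed
    also have "?act \<dots> v = ?act (cc.ev zz (M \<beta>)) (actl I a ([:-\<alpha>, 1:] * L \<alpha>) v)" by (simp only: act2_mult act2_y)
    also have "actl I a ([:-\<alpha>, 1:] * L \<alpha>) v = 0"
      by (rule actl_kills[OF mact_dvd_kills[OF A(3) L(2)[OF that(1)]] v])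
    finally have "actl I a [:-\<alpha>, 1:] (w \<alpha> \<beta>) = 0" by (simp only: act2_zero_right)
    moreover have "[:-\<alpha>, 1:] = [:-\<alpha>:] + [:0, 1:]" by simp
    ultimately have "actl I a [:-\<alpha>:] (w \<alpha> \<beta>) + actl I a [:0, 1:] (w \<alpha> \<beta>) = 0"
      using Modules.module.scale_left_distrib[OF actl_module] by metis
    then have y: "actl I a [:0, 1:] (w \<alpha> \<beta>) = fscale \<alpha> (w \<alpha> \<beta>)"
      unfolding actl_const by (rule fscale_solve)
    have "actr J b [:-\<beta>, 1:] (w \<alpha> \<beta>) = ?act (cc.ev zz [:-\<beta>, 1:] * (cc.ev zz (M \<beta>) * [:L \<alpha>:])) v"
      unfolding w2 by (simp only: act2_mult[of _ _ _ _ "cc.ev zz [:-\<beta>, 1:]"] act2_z)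
    also have "cc.ev zz [:-\<beta>, 1:] * (cc.ev zz (M \<beta>) * [:L \<alpha>:]) = [:L \<alpha>:] * cc.ev zz ([:-\<beta>, 1:] * M \<beta>)"
      by (simp only: cc.ev_mult mult_ac)
    also have "?act \<dots> v = ?act [:L \<alpha>:] (actr J b ([:-\<beta>, 1:] * M \<beta>) v)" by (simp only: act2_mult act2_z)
    also have "actr J b ([:-\<beta>, 1:] * M \<beta>) v = 0"
      by (rule actr_kills[OF mact_dvd_kills[OF B(3) M(2)[OF that(2)]] v])
    finally have "actr J b [:-\<beta>, 1:] (w \<alpha> \<beta>) = 0" by (simp only: act2_zero_right)
    moreover have "[:-\<beta>, 1:] = [:-\<beta>:] + [:0, 1:]" by simp
    ultimately have "actr J b [:-\<beta>:] (w \<alpha> \<beta>) + actr J b [:0, 1:] (w \<alpha> \<beta>) = 0" using actr_plus by metis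
    moreover have "actr J b [:-\<beta>:] (w \<alpha> \<beta>) = fscale (-\<beta>) (w \<alpha> \<beta>)" by (auto simp: actr_def)
    ultimately have z: "actr J b [:0, 1:] (w \<alpha> \<beta>) = fscale \<beta> (w \<alpha> \<beta>)" by (metis fscale_solve)
    have "mop (I \<times> J) (kron a b) (w \<alpha> \<beta>) = actr J b [:0, 1:] (fscale \<alpha> (w \<alpha> \<beta>))"
      unfolding mop_kron_actr_actl y ..
    also have "\<dots> = fscale \<alpha> (actr J b [:0, 1:] (w \<alpha> \<beta>))"
      by (auto simp: actr_def mact_x mop_def sum_distrib_left mult_ac fun_eq_iff simp del: mact_pCons intro!: sum.cong)
    also have "\<dots> = fscale (\<alpha> * \<beta>) (w \<alpha> \<beta>)" unfolding z by (auto simp: mult.assoc)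
    finally have eig: "mop (I \<times> J) (kron a b) (w \<alpha> \<beta>) = fscale (\<alpha> * \<beta>) (w \<alpha> \<beta>)" .
    \<comment> \<open>Being a polynomial image of \<open>v\<close>, this eigenvector is killed by
      \<open>q * q\<close> as well. The action is a scalar square, so in a field \<open>q\<close>
      itself kills it.\<close>
    have "mact (I \<times> J) (kron a b) (q * q) (w \<alpha> \<beta>) = ?act (cc.ev zz (M \<beta>) * [:L \<alpha>:]) (mact (I \<times> J) (kron a b) (q * q) v)"
      unfolding w2 act2_kron[symmetric] by (simp only: act2_mult[symmetric] mult_ac)
    also have "\<dots> = 0" unfolding q by (rule act2_zero_right)
    finally have "fscale (poly q (\<alpha> * \<beta>) * poly q (\<alpha> * \<beta>)) (w \<alpha> \<beta>) = 0" unfolding mact_eigen[OF eig] by simp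
    then show ?thesis unfolding mact_eigen[OF eig] by (auto simp: fun_eq_iff)
  qed
  then have "(\<Sum>\<alpha>\<in>A. \<Sum>\<beta>\<in>B. mact (I \<times> J) (kron a b) q (w \<alpha> \<beta>)) = 0" by simp
  moreover have "mact (I \<times> J) (kron a b) q v = (\<Sum>\<alpha>\<in>A. \<Sum>\<beta>\<in>B. mact (I \<times> J) (kron a b) q (w \<alpha> \<beta>))"
    by (subst v_sum) (simp only: Modules.module.scale_sum_right[OF mact_module])
  ultimately show ?thesis by simp
qed

abbreviation ac_mat :: "('i \<Rightarrow> 'i \<Rightarrow> 'k::field) \<Rightarrow> 'i \<Rightarrow> 'i \<Rightarrow> 'k alg_closure" where
  "ac_mat a \<equiv> \<lambda>i j. to_ac (a i j)"

lemma mact_ac: "mact I (ac_mat a) (map_poly to_ac q) (\<lambda>i. to_ac (v i)) = (\<lambda>i. to_ac (mact I a q v i))"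
proof (induction q)
  case (pCons c q)
  have "mop I (ac_mat a) (\<lambda>i. to_ac (w i)) = (\<lambda>i. to_ac (mop I a w i))" for w
    by (auto simp: mop_def to_ac_sum)
  then show ?case unfolding map_poly_pCons[of to_ac, OF to_ac_0] mact_pCons pCons.IH by auto
qed (auto simp: zero_fun_def)

text \<open>Unit vectors have entries in the base field, where the assumption applies, and they span
  the space over the closure.\<close>

lemma mact_ac_kills:
  fixes a :: "'i \<Rightarrow> 'i \<Rightarrow> 'k::field"
  assumes I: "finite I" and k: "\<And>w. w \<in> fsp I \<Longrightarrow> mact I a f w = 0" and w: "w \<in> fsp I"
  shows "mact I (ac_mat a) (map_poly to_ac f) w = 0"
proof -
  have u: "(unitv j :: 'i \<Rightarrow> 'k alg_closure) = (\<lambda>i. to_ac (unitv j i))" for j by (auto simp: unitv_def)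
  have "mact I (ac_mat a) (map_poly to_ac f) (unitv j) = 0" if "j \<in> I" for j
    unfolding u mact_ac using k[of "unitv j"] that by (simp add: zero_fun_def)
  then show ?thesis
    by (subst linear_on_fsp[OF I, of "mact I (ac_mat a) (map_poly to_ac f)"]) (use w in \<open>auto simp: mact_add mact_fscale\<close>)
qed

text \<open>The statement concerns one vector and one polynomial over k, and both can be read over
  the algebraic closure, where separability makes the two matrices diagonalisable. Injectivity of
  the embedding brings the conclusion back.\<close>

lemma semisimple_kron:
  fixes f g :: "'k::field poly"
  assumes perf: "perfect_field TYPE('k)" and f: "irreducible f" and g: "irreducible g"
    and I: "finite I" "\<And>w. w \<in> fsp I \<Longrightarrow> mact I a f w = 0" and J: "finite J" "\<And>w. w \<in> fsp J \<Longrightarrow> mact J b g w = 0"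
    and v: "v \<in> fsp (I \<times> J)" and q: "mact (I \<times> J) (kron a b) (q * q) v = 0"
  shows "mact (I \<times> J) (kron a b) q v = 0"
proof -
  obtain A where A: "finite A" "A \<noteq> {}" "map_poly to_ac f dvd (\<Prod>\<alpha>\<in>A. [:-\<alpha>, 1:])"
    using separable_splits[OF perf f] .
  obtain B where B: "finite B" "B \<noteq> {}" "map_poly to_ac g dvd (\<Prod>\<alpha>\<in>B. [:-\<alpha>, 1:])"
    using separable_splits[OF perf g] .
  have kr: "kron (ac_mat a) (ac_mat b) = ac_mat (kron a b)" by (auto simp: kron_def fun_eq_iff)
  have m: "map_poly to_ac q * map_poly to_ac q = map_poly to_ac (q * q)"
    by (rule poly_eqI) (simp add: coeff_mult coeff_map_poly to_ac_sum)
  have "mact (I \<times> J) (kron (ac_mat a) (ac_mat b)) (map_poly to_ac q) (\<lambda>p. to_ac (v p)) = 0"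
  proof (rule diagonalizable_kron[OF A(1,2) _ B(1,2)])
    show "mact I (ac_mat a) (\<Prod>\<alpha>\<in>A. [:-\<alpha>, 1:]) w = 0" if "w \<in> fsp I" for w
      by (rule mact_dvd_kills[OF mact_ac_kills[OF I] A(3) that])
    show "mact J (ac_mat b) (\<Prod>\<alpha>\<in>B. [:-\<alpha>, 1:]) w = 0" if "w \<in> fsp J" for w
      by (rule mact_dvd_kills[OF mact_ac_kills[OF J] B(3) that])
    show "(\<lambda>p. to_ac (v p)) \<in> fsp (I \<times> J)" using v by (auto simp: fsp_def)
    show "mact (I \<times> J) (kron (ac_mat a) (ac_mat b)) (map_poly to_ac q * map_poly to_ac q) (\<lambda>p. to_ac (v p)) = 0"
      unfolding m kr mact_ac q by auto
  qed
  then show ?thesis unfolding kr mact_ac by (auto simp: fun_eq_iff)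
qed

text \<open>A vector of order \<open>p ^ u\<close> with u > 1 would contradict
  \<open>semisimple_kron\<close>, and x cannot be its order because x acts invertibly on both
  factors.\<close>

theorem simple_closed:
  fixes f g :: "'k::field poly"
  assumes perf: "perfect_field TYPE('k)" and f: "irreducible f" "poly f 0 \<noteq> 0" and g: "irreducible g" "poly g 0 \<noteq> 0"
  shows "rmult (cyclic_class f) (cyclic_class g) \<in> ps.span {cyclic_class h | h. irreducible h \<and> poly h 0 \<noteq> 0}"
proof -
  have f0: "f \<noteq> 0" and g0: "g \<noteq> 0" using f g by auto
  define I where "I = {..<degree f}"
  define J where "J = {..<degree g}"
  define a where "a = companion f"
  define b where "b = companion g"
  have kI: "mact I a f w = 0" if "w \<in> fsp I" for w using companion_kills[OF f0] that unfolding I_def a_def by blast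
  have kJ: "mact J b g w = 0" if "w \<in> fsp J" for w using companion_kills[OF g0] that unfolding J_def b_def by blast
  have fin: "finite I" "finite J" by (simp_all add: I_def J_def)
  have "cls (I \<times> J) (kron a b) \<in> ps.span {cyclic_class h | h. irreducible h \<and> poly h 0 \<noteq> 0}"
  proof (rule cls_in_span)
    fix p u v assume p: "irreducible p" "lead_coeff p = 1" "u \<ge> 1" and v: "v \<in> fsp (I \<times> J)"
      and ex: "kx_space.exact (mact (I \<times> J) (kron a b)) (p ^ u) v"
    have exd: "mact (I \<times> J) (kron a b) r v = 0 \<longleftrightarrow> p ^ u dvd r" for r
      using ex unfolding kx_space.exact_def[OF mact_kx_space] by blast
    obtain t where t: "u = Suc t" using p(3) by (cases u) auto
    have ndt: "\<not> p ^ u dvd p ^ t"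
    proof
      assume "p ^ u dvd p ^ t"
      then have "degree (p ^ u) \<le> degree (p ^ t)" using p(1) by (intro dvd_imp_degree_le) auto
      moreover have "p \<noteq> 0" using p(1) by auto
      ultimately show False using irreducible_degree_pos[OF p(1)] by (simp add: degree_power_eq t del: power_Suc)
    qed
    have "t = 0"
    proof (rule ccontr)
      assume "t \<noteq> 0"
      \<comment> \<open>With u = t + 1 and t positive, 2t is at least u: the square of
        \<open>p ^ t\<close> kills \<open>v\<close>, but \<open>p ^ t\<close> does not.\<close>
      then have "p ^ u dvd p ^ t * p ^ t" unfolding t power_add[symmetric] by (intro le_imp_power_dvd) simp
      then have "mact (I \<times> J) (kron a b) (p ^ t * p ^ t) v = 0" using exd by blast
      then have "mact (I \<times> J) (kron a b) (p ^ t) v = 0"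
        using semisimple_kron[of f g I a J b v "p ^ t"] perf f(1) g(1) fin kI kJ v by blast
      then show False using exd ndt by blast
    qed
    moreover have "poly p 0 \<noteq> 0"
    proof
      assume "poly p 0 = 0"
      then have "[:0, 1:] dvd p" by (simp add: poly_eq_0_iff_dvd)
      then have px: "p = [:0, 1:]"
        using monic_irreducible_dvd_eq[OF linear_poly_irreducible p(1) _ p(2), of 0] by simp
      obtain r1 s1 where 1: "r1 * f + s1 * [:0, 1:] = 1" using irreducible_poly_bezout[OF f(1) not_dvd_x[OF f]] by blast
      obtain r2 s2 where 2: "r2 * g + s2 * [:0, 1:] = 1" using irreducible_poly_bezout[OF g(1) not_dvd_x[OF g]] by blast
      have v0: "mact (I \<times> J) (kron a b) [:0, 1:] v = 0" using exd[of "[:0, 1:]"] \<open>t = 0\<close> unfolding t px by simp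
      have inv1: "actl I a (s1 * [:0, 1:]) w = w" if w: "w \<in> fsp (I \<times> J)" for w :: "nat \<times> nat \<Rightarrow> 'k"
      proof -
        have "w = actl I a (r1 * f + s1 * [:0, 1:]) w" unfolding 1 using Modules.module.scale_one[OF actl_module] by metis
        also have "\<dots> = actl I a (r1 * f) w + actl I a (s1 * [:0, 1:]) w" by (rule Modules.module.scale_left_distrib[OF actl_module])
        also have "actl I a (r1 * f) w = 0"
          by (rule actl_kills[OF _ w]) (simp add: mact_mult kI mact_zero_right)
        also have "0 + actl I a (s1 * [:0, 1:]) w = actl I a (s1 * [:0, 1:]) w" by (rule add_0_left)
        finally show ?thesis by (rule sym)
      qed
      have inv2: "actr J b (s2 * [:0, 1:]) w = w" if w: "w \<in> fsp (I \<times> J)" for w :: "nat \<times> nat \<Rightarrow> 'k"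
      proof -
        have "w = actr J b (r2 * g + s2 * [:0, 1:]) w" unfolding 2 by (auto simp: actr_def mact_one)
        also have "\<dots> = actr J b (r2 * g) w + actr J b (s2 * [:0, 1:]) w" by (rule actr_plus)
        also have "actr J b (r2 * g) w = 0"
          by (rule actr_kills[OF _ w]) (simp add: mact_mult kJ mact_zero_right)
        also have "0 + actr J b (s2 * [:0, 1:]) w = actr J b (s2 * [:0, 1:]) w" by (rule add_0_left)
        finally show ?thesis by (rule sym)
      qed
      \<comment> \<open>\<open>s1\<close> and \<open>s2\<close> invert x on the two factors.
        Together they undo the tensor action of x, which kills \<open>v\<close>, so \<open>v\<close>
        would be zero.\<close>
      have "v = actr J b (s2 * [:0, 1:]) (actl I a (s1 * [:0, 1:]) v)" using inv1[OF v] inv2[OF v] by simp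
      also have "\<dots> = act2 I a J b (cc.ev zz s2 * [:s1:] * cc.ev (yy * zz) [:0, 1:]) v"
      proof -
        have "cc.ev zz s2 * [:s1:] * cc.ev (yy * zz) [:0, 1:] = cc.ev zz (s2 * [:0, 1:]) * [:s1 * [:0, 1:]:]"
        proof -
          have "[:c * d:] = [:c:] * [:d:]" for c d :: "'k poly" by simp
          then show ?thesis by (simp only: cc.ev_mult cc.ev_x mult_ac)
        qed
        then show ?thesis by (simp only: act2_mult act2_z act2_y)
      qed
      also have "\<dots> = 0" by (simp only: act2_mult act2_kron v0 act2_zero_right)
      finally have "mact (I \<times> J) (kron a b) 1 v = 0" by (simp add: mact_one)
      then have "p ^ u dvd 1" using exd by blast
      then have "p dvd 1" unfolding t by (metis dvd_trans dvd_triv_left power_Suc)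
      then show False using p(1) by (simp add: irreducible_def)
    qed
    ultimately show "cyclic_class (p ^ u) \<in> ps.span {cyclic_class h | h. irreducible h \<and> poly h 0 \<noteq> 0}"
      using p(1) unfolding t by (auto intro!: ps.span_base)
  qed (use fin in simp)
  then show ?thesis unfolding rmult_cyclic_class[OF f0 g0] I_def J_def a_def b_def .
qed


section \<open>The subgroups spanned by the cyclic classes\<close>

abbreviation supp :: "'a set \<Rightarrow> ('a \<Rightarrow>\<^sub>0 int) set" where
  "supp K \<equiv> {c. Poly_Mapping.keys c \<subseteq> K}"

lemma frag_cmul_pscale: "frag_cmul = pscale"
  by (rule ext)+ (auto intro: poly_mapping_eqI)

lemma span_frag_of: "ps.span (frag_of ` K) = supp K"
proof (rule equalityI)
  show "ps.span (frag_of ` K) \<subseteq> supp K" by (rule ps.span_minimal[OF _ keys_subspace]) auto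
  show "supp K \<subseteq> ps.span (frag_of ` K)"
    using subspace_singles[OF ps.subspace_span, of K "frag_of ` K"] by (auto intro: ps.span_base)
qed

lemma keys_diff_subset: "c \<in> supp K \<Longrightarrow> d \<in> supp K \<Longrightarrow> c - d \<in> supp K"
  by (rule ps.subspace_diff[OF keys_subspace])

lemma keys_add_subset: "c \<in> supp K \<Longrightarrow> d \<in> supp K \<Longrightarrow> c + d \<in> supp K"
  by (rule ps.subspace_add[OF keys_subspace])

lemma keys_cmul_subset: "c \<in> supp K \<Longrightarrow> frag_cmul n c \<in> supp K"
  unfolding frag_cmul_pscale by (rule ps.subspace_scale[OF keys_subspace])

text \<open>The span is defined as a generated subgroup of the additive group. It is identified with
  the formal sums supported on \<open>K\<close>, where linear arguments apply.\<close>

lemma int_span_frag_of: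
  fixes k :: "'k::field itself"
  assumes K: "K \<subseteq> indecomposable_classes"
  shows "int_span k (frag_of ` K) = supp K"
proof (rule equalityI)
  \<comment> \<open>The group inverse of the record is an abstract operation and has to be
    identified with negation of formal sums.\<close>
  have inv: "inv\<^bsub>add_monoid (rep_ring k)\<^esub> x = - x" if "x \<in> frag_of ` K" for x
  proof -
    interpret cring "rep_ring k" by (rule rep_ring_cring)
    have "x \<in> carrier (rep_ring k)" "- x \<in> carrier (rep_ring k)" using that K by (auto simp: rep_ring_simps)
    then have "\<ominus>\<^bsub>rep_ring k\<^esub> x = - x" using minus_equality[of "- x" x] by (simp add: rep_ring_simps)
    then show ?thesis by (simp add: a_inv_def)
  qed
  let ?G = "generate (add_monoid (rep_ring k)) (frag_of ` K)"
  have z: "0 \<in> ?G" using generate.one[of "add_monoid (rep_ring k)"] by (simp add: rep_ring_simps)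
  have a: "x + y \<in> ?G" if "x \<in> ?G" "y \<in> ?G" for x y
    using generate.eng[OF that] by (simp add: rep_ring_simps)
  show "int_span k (frag_of ` K) \<subseteq> supp K" unfolding int_span_def
  proof
    fix x assume "x \<in> ?G"
    then show "x \<in> supp K"
    proof (induction rule: generate.induct)
      case (eng x y)
      then show ?case using keys_add_subset[of x K y] by (simp add: rep_ring_simps)
    qed (use inv in \<open>auto simp: rep_ring_simps\<close>)
  qed
  have n: "pscale (int n) x \<in> ?G" if "x \<in> ?G" for n x
  proof (induction n)
    case (Suc n)
    have "pscale (int (Suc n)) x = x + pscale (int n) x" by (simp add: ps.scale_left_distrib)
    then show ?case using a[OF that Suc] by simp
  qed (use z in simp)
  show "supp K \<subseteq> int_span k (frag_of ` K)" unfolding int_span_def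
  proof
    fix c :: "'k kx_class \<Rightarrow>\<^sub>0 int" assume "c \<in> supp K"
    have s: "pscale m (frag_of x) \<in> ?G" if "x \<in> K" for m x
    proof -
      have g: "frag_of x \<in> ?G" using that by (intro generate.incl) auto
      have "inv\<^bsub>add_monoid (rep_ring k)\<^esub> (frag_of x) \<in> ?G" using that by (intro generate.inv) auto
      then have h: "- frag_of x \<in> ?G" using inv that by simp
      show ?thesis
      proof (cases "m \<ge> 0")
        case True
        then show ?thesis using n[OF g, of "nat m"] by simp
      next
        case False
        then have "pscale m (frag_of x) = pscale (int (nat (- m))) (- frag_of x)" by (simp add: single_uminus)
        then show ?thesis using n[OF h, of "nat (- m)"] by simp
      qed
    qed
    have "(\<Sum>x\<in>T. pscale (Poly_Mapping.lookup c x) (frag_of x)) \<in> ?G" if "finite T" "T \<subseteq> K" for T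
      using that by (induction T) (use z a s in auto)
    then have "pext pscale (\<lambda>x. frag_of x) c \<in> ?G" unfolding pext_def using \<open>c \<in> supp K\<close> by simp
    then show "c \<in> ?G" unfolding pext_pscale_single .
  qed
qed

section \<open>Bases of the two subrings and of the ideal\<close>

definition unip_classes :: "'k::field kx_class set" where
  "unip_classes = {primary_class [:-1, 1:] s | s. s \<ge> 1}"

definition simple_classes :: "'k::field kx_class set" where
  "simple_classes = {primary_class f 1 | f. irreducible f \<and> lead_coeff f = 1 \<and> poly f 0 \<noteq> 0}"

text \<open>The indecomposable modules on which x acts invertibly. They will be the basis of the
  image of the tensor part.\<close>

definition inv_classes :: "'k::field kx_class set" where
  "inv_classes = {primary_class f s | f s. irreducible f \<and> lead_coeff f = 1 \<and> poly f 0 \<noteq> 0 \<and> s \<ge> 1}"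

definition nil_classes :: "'k::field kx_class set" where
  "nil_classes = {primary_class [:0, 1:] s | s. s \<ge> 1}"

lemma cyclic_class_primary:
  "irreducible p \<Longrightarrow> lead_coeff p = 1 \<Longrightarrow> s \<ge> 1 \<Longrightarrow> cyclic_class (p ^ s) = frag_of (primary_class p s)"
  unfolding cyclic_class_def by (rule primary_class_indecomposable(2))

lemma unip_subset: "unip_classes \<subseteq> inv_classes"
  and simple_subset: "simple_classes \<subseteq> inv_classes"
  and inv_subset: "inv_classes \<subseteq> indecomposable_classes"
  and nil_subset: "nil_classes \<subseteq> indecomposable_classes"
  using linear_poly_irreducible[of "-1"] linear_poly_irreducible[of 0] primary_class_indecomposable(1)
  by (force simp: unip_classes_def simple_classes_def inv_classes_def nil_classes_def)+

lemma poly_0_eq_0_iff: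
  assumes "irreducible p" "lead_coeff p = 1"
  shows "poly p 0 = 0 \<longleftrightarrow> p = [:0, 1 :: 'k::field:]"
proof
  assume "poly p 0 = 0"
  then have "[:0, 1:] dvd p" by (simp add: poly_eq_0_iff_dvd)
  then show "p = [:0, 1:]"
    using monic_irreducible_dvd_eq[OF linear_poly_irreducible assms(1) _ assms(2), of 0] by simp
qed simp

text \<open>x is the only monic irreducible polynomial that vanishes at 0, so the value at 0 decides
  between the two families.\<close>

lemma indecomposable_classes_eq: "(indecomposable_classes :: 'k::field kx_class set) = inv_classes \<union> nil_classes"
proof (rule equalityI[OF subsetI])
  fix C :: "'k::field kx_class" assume "C \<in> indecomposable_classes"
  then obtain p s where "irreducible p" "lead_coeff p = 1" "s \<ge> 1" "C = primary_class p s" by (rule indecomposable_classE)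
  then show "C \<in> inv_classes \<union> nil_classes"
    using poly_0_eq_0_iff by (cases "poly p 0 = 0") (auto simp: inv_classes_def nil_classes_def)
qed (use inv_subset nil_subset in auto)

lemma inv_nil_disjoint: "(inv_classes :: 'k::field kx_class set) \<inter> nil_classes = {}"
proof -
  have False if f: "irreducible f" "lead_coeff f = 1" "poly f 0 \<noteq> 0" "s \<ge> 1" "t \<ge> 1"
    and eq: "primary_class f s = primary_class [:0, 1:] t" for f :: "'k poly" and s t
    using primary_class_inj[OF f(1,2,4) linear_poly_irreducible _ f(5) eq] f(3) by simp
  then show ?thesis by (fastforce simp: inv_classes_def nil_classes_def)
qed

lemma unip_generators: "{cyclic_class ([:-1, 1 :: 'k::field:] ^ s) | s. s \<ge> 1} = frag_of ` unip_classes"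
proof -
  have "cyclic_class ([:-1, 1 :: 'k:] ^ s) = frag_of (primary_class [:-1, 1:] s)" if "s \<ge> 1" for s
    by (rule cyclic_class_primary[OF linear_poly_irreducible _ that]) simp
  then show ?thesis unfolding unip_classes_def setcompr_eq_image image_image by (intro image_cong refl) blast
qed

lemma nil_generators: "{cyclic_class ([:0, 1 :: 'k::field:] ^ s) | s. s \<ge> 1} = frag_of ` nil_classes"
proof -
  have "cyclic_class ([:0, 1 :: 'k:] ^ s) = frag_of (primary_class [:0, 1:] s)" if "s \<ge> 1" for s
    by (rule cyclic_class_primary[OF linear_poly_irreducible _ that]) simp
  then show ?thesis unfolding nil_classes_def setcompr_eq_image image_image by (intro image_cong refl) blast
qed

text \<open>Associated polynomials generate the same ideal. This passes from the arbitrary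
  irreducible generators of the semisimple ring to monic ones.\<close>

lemma cyclic_class_associated:
  assumes "f dvd g" "g dvd f"
  shows "cyclic_class f = cyclic_class g"
proof -
  have "PIdl\<^bsub>ring_of_type_algebra\<^esub> p = {r. p dvd r}" for p :: "'a poly"
    by (simp add: cgenideal_def ring_of_type_algebra_def dvd_def mult.commute)
  moreover have "f dvd r \<longleftrightarrow> g dvd r" for r using assms dvd_trans by blast
  ultimately have "PIdl\<^bsub>ring_of_type_algebra\<^esub> f = PIdl\<^bsub>ring_of_type_algebra\<^esub> g" by simp
  then show ?thesis by (simp add: cyclic_class_def cyclic_module_def)
qed

lemma simple_generators: "{cyclic_class f | f :: 'k::field poly. irreducible f \<and> poly f 0 \<noteq> 0} = frag_of ` simple_classes"
proof (intro equalityI subsetI)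
  fix c :: "'k kx_class \<Rightarrow>\<^sub>0 int" assume "c \<in> {cyclic_class f | f. irreducible f \<and> poly f 0 \<noteq> 0}"
  then obtain f where f: "irreducible f" "poly f 0 \<noteq> 0" "c = cyclic_class f" by blast
  obtain p where p: "irreducible p" "lead_coeff p = 1" "p dvd f" using poly_irreducible_divisor[OF irreducible_degree_pos[OF f(1)]] .
  have "f dvd p" using f(1) p(1,3) by (metis irreducibleD' irreducible_def)
  then have "c = frag_of (primary_class p 1)"
    using cyclic_class_associated[OF p(3)] cyclic_class_primary[OF p(1,2), of 1] f(3) by simp
  moreover have "poly p 0 \<noteq> 0" using p(3) f(2) by (auto elim!: dvdE)
  ultimately show "c \<in> frag_of ` simple_classes" using p by (auto simp: simple_classes_def)
next
  fix c :: "'k kx_class \<Rightarrow>\<^sub>0 int" assume "c \<in> frag_of ` simple_classes"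
  then obtain f where f: "irreducible f" "lead_coeff f = 1" "poly f 0 \<noteq> 0" "c = frag_of (primary_class f 1)"
    by (auto simp: simple_classes_def)
  then have "c = cyclic_class f" using cyclic_class_primary[OF f(1,2), of 1] by simp
  then show "c \<in> {cyclic_class f | f. irreducible f \<and> poly f 0 \<noteq> 0}" using f by blast
qed

lemma carrier_unipotent: "carrier (unipotent_ring k) = supp unip_classes"
  unfolding unipotent_ring_def cyclic_class_def[symmetric] unip_generators
  using int_span_frag_of[OF subset_trans[OF unip_subset inv_subset]] by simp

lemma carrier_semisimple: "carrier (semisimple_ring k) = supp simple_classes"
  unfolding semisimple_ring_def cyclic_class_def[symmetric] simple_generators
  using int_span_frag_of[OF subset_trans[OF simple_subset inv_subset]] by simp

lemma nilpotent_ideal_eq: "nilpotent_ideal k = supp nil_classes"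
  unfolding nilpotent_ideal_def cyclic_class_def[symmetric] nil_generators
  by (rule int_span_frag_of[OF nil_subset])

lemma subring_ops:
  "x \<otimes>\<^bsub>unipotent_ring k\<^esub> y = rmult x y" "x \<oplus>\<^bsub>unipotent_ring k\<^esub> y = x + y" "\<zero>\<^bsub>unipotent_ring k\<^esub> = 0"
  "n \<odot>\<^bsub>unipotent_ring k\<^esub> x = pscale n x" "\<one>\<^bsub>unipotent_ring k\<^esub> = cyclic_class [:-1, 1:]"
  "x \<otimes>\<^bsub>semisimple_ring k\<^esub> y = rmult x y" "x \<oplus>\<^bsub>semisimple_ring k\<^esub> y = x + y" "\<zero>\<^bsub>semisimple_ring k\<^esub> = 0"
  "n \<odot>\<^bsub>semisimple_ring k\<^esub> x = pscale n x" "\<one>\<^bsub>semisimple_ring k\<^esub> = cyclic_class [:-1, 1:]"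
  by (simp_all add: unipotent_ring_def semisimple_ring_def rep_ring_simps frag_cmul_pscale cyclic_class_def)

lemma rmult_supp:
  assumes g: "\<And>C D. C \<in> K \<Longrightarrow> D \<in> L \<Longrightarrow> rmult (frag_of C) (frag_of D) \<in> supp M" and c: "c \<in> supp K" and d: "d \<in> supp L"
  shows "rmult c d \<in> supp M"
proof -
  define S where "S = supp M"
  have S: "x + y \<in> S" if "x \<in> S" "y \<in> S" for x y using that unfolding S_def by (rule keys_add_subset)
  have S': "frag_cmul n x \<in> S" if "x \<in> S" for n x using that unfolding S_def by (rule keys_cmul_subset)
  have 0: "0 \<in> S" by (simp add: S_def)
  have "d \<in> {d. \<forall>C\<in>K. rmult (frag_of C) d \<in> S}"
  proof (rule subspace_singles[of _ L])
    show "ps.subspace {d. \<forall>C\<in>K. rmult (frag_of C) d \<in> S}"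
      by (rule ps.subspaceI) (auto simp: rmult_add_right rmult_cmul frag_cmul_pscale[symmetric] 0 S S')
  qed (use g d in \<open>auto simp: S_def\<close>)
  then have d': "rmult (frag_of C) d \<in> S" if "C \<in> K" for C using that by blast
  have "c \<in> {c. rmult c d \<in> S}"
  proof (rule subspace_singles[of _ K])
    show "ps.subspace {c. rmult c d \<in> S}"
      by (rule ps.subspaceI) (auto simp: rmult_add_left rmult_cmul frag_cmul_pscale[symmetric] 0 S S')
  qed (use d' c in auto)
  then show ?thesis by (simp add: S_def)
qed

lemma rmult_unip:
  fixes c d :: "'k::field kx_class \<Rightarrow>\<^sub>0 int"
  shows "c \<in> supp unip_classes \<Longrightarrow> d \<in> supp unip_classes \<Longrightarrow> rmult c d \<in> supp unip_classes"
proof (rule rmult_supp)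
  fix C D :: "'k kx_class" assume "C \<in> unip_classes" "D \<in> unip_classes"
  then obtain s t where "frag_of C = cyclic_class ([:-1, 1:] ^ s)" "frag_of D = cyclic_class ([:-1, 1:] ^ t)"
    using unip_generators[where 'k='k] by blast
  then show "rmult (frag_of C) (frag_of D) \<in> supp unip_classes"
    using unipotent_closed[of s t, where 'k='k] unfolding unip_generators span_frag_of by simp
qed

lemma rmult_nil:
  fixes c d :: "'k::field kx_class \<Rightarrow>\<^sub>0 int"
  shows "c \<in> supp nil_classes \<Longrightarrow> d \<in> supp nil_classes \<Longrightarrow> rmult c d \<in> supp nil_classes"
proof (rule rmult_supp)
  fix C D :: "'k kx_class" assume "C \<in> nil_classes" "D \<in> nil_classes"
  then obtain s t where "frag_of C = cyclic_class ([:0, 1:] ^ s)" "frag_of D = cyclic_class ([:0, 1:] ^ t)"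
    using nil_generators[where 'k='k] by blast
  then show "rmult (frag_of C) (frag_of D) \<in> supp nil_classes"
    using nilpotent_closed[of s t, where 'k='k] unfolding nil_generators span_frag_of by simp
qed

lemma rmult_simple:
  fixes c d :: "'k::field kx_class \<Rightarrow>\<^sub>0 int"
  assumes perf: "perfect_field TYPE('k)"
  shows "c \<in> supp simple_classes \<Longrightarrow> d \<in> supp simple_classes \<Longrightarrow> rmult c d \<in> supp simple_classes"
proof (rule rmult_supp)
  fix C D :: "'k kx_class" assume "C \<in> simple_classes" "D \<in> simple_classes"
  then obtain f g where "irreducible f" "poly f 0 \<noteq> 0" "frag_of C = cyclic_class f"
    "irreducible g" "poly g 0 \<noteq> 0" "frag_of D = cyclic_class g"
    using simple_generators[where 'k='k] by blast
  then show "rmult (frag_of C) (frag_of D) \<in> supp simple_classes"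
    using simple_closed[OF perf, of f g] unfolding simple_generators span_frag_of by simp
qed

lemma unip_times_simple:
  fixes f :: "'k::field poly"
  assumes perf: "perfect_field TYPE('k)" and f: "irreducible f" "lead_coeff f = 1" "poly f 0 \<noteq> 0" and s: "s \<ge> 1"
  shows "rmult (frag_of (primary_class [:-1, 1:] s)) (frag_of (primary_class f 1)) = frag_of (primary_class f s)"
proof -
  have "cyclic_class ([:-1, 1 :: 'k:] ^ s) = frag_of (primary_class [:-1, 1:] s)"
    by (rule cyclic_class_primary[OF linear_poly_irreducible _ s]) simp
  moreover have "cyclic_class f = frag_of (primary_class f 1)" using cyclic_class_primary[OF f(1,2), of 1] by simp
  ultimately show ?thesis using unipotent_times_simple[OF perf f(1,3) s] cyclic_class_primary[OF f(1,2) s] by simp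
qed

subsection \<open>Dimensions\<close>

lemma int_module: "Modules.module ((*) :: int \<Rightarrow> int \<Rightarrow> int)"
  by standard (simp_all add: algebra_simps)

interpretation im: Modules.module "(*) :: int \<Rightarrow> int \<Rightarrow> int"
  by (rule int_module)

lemma rep_dim_pext: "rep_dim c = pext (*) (\<lambda>C. int (dim_over_field (representative C))) c"
  by (simp add: rep_dim_def pext_def)

lemma rep_dim_linear: "rep_dim (c + d) = rep_dim c + rep_dim d" "rep_dim 0 = 0" "rep_dim (frag_cmul n c) = n * rep_dim c"
  by (simp_all add: rep_dim_pext im.pext_add im.pext_pscale frag_cmul_pscale)

lemma rep_dim_primary:
  fixes p :: "'k::field poly"
  assumes p: "irreducible p"
  shows "rep_dim (frag_of (primary_class p s)) = int (degree p * s)"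
proof -
  have "p \<noteq> 0" using p by auto
  then have p0: "p ^ s \<noteq> 0" by simp
  let ?f = "p ^ s"
  let ?R = "representative (primary_class p s)"
  obtain h where h: "kx_rec (mact {..<degree ?f} (companion ?f)) (cyclic_module ?f) (fsp {..<degree ?f}) h"
    using cyclic_module_companion[OF p0] .
  have fd: "fd_module (cyclic_module ?f)" by (rule fd_cyclic_module[OF p0])
  have R: "fd_module ?R" "module_iso (cyclic_module ?f) ?R"
    using representative_iso_class[OF fd] by (simp_all add: primary_class_def)
  have "module_iso ?R (cyclic_module ?f)" by (rule module_iso_sym[OF fd_module_is_module[OF fd] R])
  then obtain g where "rec_iso (mact {..<degree ?f} (companion ?f)) ?R (fsp {..<degree ?f}) g"
    using rec_iso_compose[OF fd_module_is_module[OF R(1)]] h unfolding kx_rec_def by blast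
  then have "kx_rec (mact {..<degree ?f} (companion ?f)) ?R (fsp {..<degree ?f}) g"
    unfolding kx_rec_def using mact_kx_space by blast
  then have "dim_over_field ?R = vector_space.dim (kx_space.scal (mact {..<degree ?f} (companion ?f))) (fsp {..<degree ?f} :: (nat \<Rightarrow> 'k) set)"
    by (rule kx_rec.dim_over_field_eq) (rule fsp_fd_dim(1), simp)
  also have "\<dots> = degree ?f" using fsp_fd_dim(2)[of "{..<degree ?f}", where 'k='k] by simp
  finally show ?thesis using \<open>p \<noteq> 0\<close> by (simp add: rep_dim_def degree_power_eq mult.commute)
qed

text \<open>On basis elements both sides equal \<open>s * degree f\<close>, since the product of the
  two classes is that of \<open>k[x]/f^s\<close>. It makes \<open>tensor_dim\<close> computable from
  the image in R.\<close>

lemma rep_dim_rmult: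
  fixes a b :: "'k::field kx_class \<Rightarrow>\<^sub>0 int"
  assumes perf: "perfect_field TYPE('k)" and a: "a \<in> supp unip_classes" and b: "b \<in> supp simple_classes"
  shows "rep_dim (rmult a b) = rep_dim a * rep_dim b"
proof -
  have "b \<in> {b. \<forall>C\<in>unip_classes. rep_dim (rmult (frag_of C) b) = rep_dim (frag_of C) * rep_dim b}"
  proof (rule subspace_singles[of _ simple_classes])
    show "ps.subspace {b. \<forall>C\<in>unip_classes. rep_dim (rmult (frag_of C) b) = rep_dim (frag_of C) * rep_dim b}"
      by (rule ps.subspaceI) (auto simp: rmult_add_right rmult_cmul frag_cmul_pscale[symmetric] rep_dim_linear distrib_left distrib_right)
    fix D :: "'k kx_class" assume "D \<in> simple_classes"
    then obtain f where f: "irreducible f" "lead_coeff f = 1" "poly f 0 \<noteq> 0" "D = primary_class f 1"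
      by (auto simp: simple_classes_def)
    have "rep_dim (rmult (frag_of (primary_class [:-1, 1:] s)) (frag_of D)) = rep_dim (frag_of (primary_class [:-1, 1:] s)) * rep_dim (frag_of D)"
      if "s \<ge> 1" for s
      unfolding f(4) unip_times_simple[OF perf f(1,2,3) that] rep_dim_primary[OF f(1)] rep_dim_primary[OF linear_poly_irreducible]
      by simp
    then show "frag_of D \<in> {b. \<forall>C\<in>unip_classes. rep_dim (rmult (frag_of C) b) = rep_dim (frag_of C) * rep_dim b}"
      by (auto simp: unip_classes_def)
  qed (use b in auto)
  then have b': "rep_dim (rmult (frag_of C) b) = rep_dim (frag_of C) * rep_dim b" if "C \<in> unip_classes" for C
    using that by blast
  have "a \<in> {a. rep_dim (rmult a b) = rep_dim a * rep_dim b}"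
  proof (rule subspace_singles[of _ unip_classes])
    show "ps.subspace {a. rep_dim (rmult a b) = rep_dim a * rep_dim b}"
      by (rule ps.subspaceI) (auto simp: rmult_add_left rmult_cmul frag_cmul_pscale[symmetric] rep_dim_linear distrib_left distrib_right)
  qed (use b' a in auto)
  then show ?thesis by blast
qed

text \<open>The rule by which the direct sum multiplies its two parts already holds in R;
  bilinearity reduces it to \<open>nilpotent_times_invertible\<close>.\<close>

lemma rmult_nil_inv:
  fixes a w :: "'k::field kx_class \<Rightarrow>\<^sub>0 int"
  assumes w: "w \<in> supp nil_classes" and a: "a \<in> supp inv_classes"
  shows "rmult w a = frag_cmul (rep_dim a) w"
proof -
  have "a \<in> {a. \<forall>C\<in>nil_classes. rmult (frag_of C) a = frag_cmul (rep_dim a) (frag_of C)}"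
  proof (rule subspace_singles[of _ inv_classes])
    show "ps.subspace {a. \<forall>C\<in>nil_classes. rmult (frag_of C) a = frag_cmul (rep_dim a) (frag_of C)}"
      by (rule ps.subspaceI) (auto simp: rmult_add_right rmult_cmul frag_cmul_pscale[symmetric] rep_dim_linear frag_cmul_distrib frag_cmul_cmul)
    fix D :: "'k kx_class" assume "D \<in> inv_classes"
    then obtain f s where f: "irreducible f" "lead_coeff f = 1" "poly f 0 \<noteq> 0" "s \<ge> 1" "D = primary_class f s"
      by (auto simp: inv_classes_def)
    have D: "frag_of D = cyclic_class (f ^ s)" unfolding f(5) cyclic_class_primary[OF f(1,2,4)] ..
    have "f \<noteq> 0" using f(1) by auto
    then have dim: "rep_dim (frag_of D) = int (degree (f ^ s))"
      unfolding f(5) rep_dim_primary[OF f(1)] by (simp add: degree_power_eq mult.commute)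
    have "poly (f ^ s) 0 \<noteq> 0" using f(3) by simp
    then have "rmult (cyclic_class ([:0, 1:] ^ t)) (frag_of D) = frag_cmul (rep_dim (frag_of D)) (cyclic_class ([:0, 1:] ^ t))" for t
      using nilpotent_times_invertible[of "f ^ s" t] unfolding dim by (simp add: D)
    moreover have "\<exists>t. frag_of C = cyclic_class ([:0, 1:] ^ t)" if "C \<in> nil_classes" for C :: "'k kx_class"
      using nil_generators[where 'k='k] that by blast
    ultimately have "rmult (frag_of C) (frag_of D) = frag_cmul (rep_dim (frag_of D)) (frag_of C)" if "C \<in> nil_classes" for C
      using that by fastforce
    then show "frag_of D \<in> {a. \<forall>C\<in>nil_classes. rmult (frag_of C) a = frag_cmul (rep_dim a) (frag_of C)}" by blast
  qed (use a in auto)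
  then have a': "rmult (frag_of C) a = frag_cmul (rep_dim a) (frag_of C)" if "C \<in> nil_classes" for C
    using that by blast
  have "w \<in> {w. rmult w a = frag_cmul (rep_dim a) w}"
  proof (rule subspace_singles[of _ nil_classes])
    show "ps.subspace {w. rmult w a = frag_cmul (rep_dim a) w}"
      by (rule ps.subspaceI) (auto simp: rmult_add_left rmult_cmul frag_cmul_pscale[symmetric] frag_cmul_distrib2 mult.commute)
  qed (use a' w in auto)
  then show ?thesis by blast
qed


section \<open>The comparison map\<close>

text \<open>A bijection compatible with the operations pulls every ring axiom back from
  \<open>R\<close>, so none has to be verified in \<open>S\<close> itself.\<close>

lemma cring_transport:
  assumes R: "cring R" and h: "bij_betw h (carrier S) (carrier R)"
    and mult: "\<And>x y. x \<in> carrier S \<Longrightarrow> y \<in> carrier S \<Longrightarrow> x \<otimes>\<^bsub>S\<^esub> y \<in> carrier S \<and> h (x \<otimes>\<^bsub>S\<^esub> y) = h x \<otimes>\<^bsub>R\<^esub> h y"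
    and add: "\<And>x y. x \<in> carrier S \<Longrightarrow> y \<in> carrier S \<Longrightarrow> x \<oplus>\<^bsub>S\<^esub> y \<in> carrier S \<and> h (x \<oplus>\<^bsub>S\<^esub> y) = h x \<oplus>\<^bsub>R\<^esub> h y"
    and one: "\<one>\<^bsub>S\<^esub> \<in> carrier S" "h \<one>\<^bsub>S\<^esub> = \<one>\<^bsub>R\<^esub>" and zero: "\<zero>\<^bsub>S\<^esub> \<in> carrier S" "h \<zero>\<^bsub>S\<^esub> = \<zero>\<^bsub>R\<^esub>"
  shows "cring S" and "h \<in> ring_iso S R"
proof -
  interpret R: cring R by (rule R)
  have hc: "h x \<in> carrier R" if "x \<in> carrier S" for x using h that by (auto simp: bij_betw_def)
  have inj: "x = y" if "h x = h y" "x \<in> carrier S" "y \<in> carrier S" for x y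
    using h that by (auto simp: bij_betw_def inj_on_def)
  show "cring S"
  proof (rule cringI)
    show "abelian_group S"
    proof (rule abelian_groupI)
      fix x assume x: "x \<in> carrier S"
      then have "\<ominus>\<^bsub>R\<^esub> h x \<in> h ` carrier S" using h hc by (auto simp: bij_betw_def)
      then obtain y where y: "y \<in> carrier S" "h y = \<ominus>\<^bsub>R\<^esub> h x" by auto
      have "y \<oplus>\<^bsub>S\<^esub> x = \<zero>\<^bsub>S\<^esub>" by (rule inj) (use add x y zero hc in \<open>auto simp: R.l_neg\<close>)
      then show "\<exists>y\<in>carrier S. y \<oplus>\<^bsub>S\<^esub> x = \<zero>\<^bsub>S\<^esub>" using y by blast
    next
      fix x y z assume "x \<in> carrier S" "y \<in> carrier S" "z \<in> carrier S"
      then show "x \<oplus>\<^bsub>S\<^esub> y \<oplus>\<^bsub>S\<^esub> z = x \<oplus>\<^bsub>S\<^esub> (y \<oplus>\<^bsub>S\<^esub> z)"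
        by (intro inj) (use add hc in \<open>auto simp: R.a_assoc\<close>)
    next
      fix x y assume "x \<in> carrier S" "y \<in> carrier S"
      then show "x \<oplus>\<^bsub>S\<^esub> y = y \<oplus>\<^bsub>S\<^esub> x" by (intro inj) (use add hc in \<open>auto simp: R.a_comm\<close>)
    next
      fix x assume "x \<in> carrier S"
      then show "\<zero>\<^bsub>S\<^esub> \<oplus>\<^bsub>S\<^esub> x = x" by (intro inj) (use add hc zero in auto)
    qed (use add zero in auto)
    show "comm_monoid S"
    proof (rule comm_monoidI)
      fix x y z assume "x \<in> carrier S" "y \<in> carrier S" "z \<in> carrier S"
      then show "x \<otimes>\<^bsub>S\<^esub> y \<otimes>\<^bsub>S\<^esub> z = x \<otimes>\<^bsub>S\<^esub> (y \<otimes>\<^bsub>S\<^esub> z)"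
        by (intro inj) (use mult hc in \<open>auto simp: R.m_assoc\<close>)
    next
      fix x y assume "x \<in> carrier S" "y \<in> carrier S"
      then show "x \<otimes>\<^bsub>S\<^esub> y = y \<otimes>\<^bsub>S\<^esub> x" by (intro inj) (use mult hc in \<open>auto simp: R.m_comm\<close>)
    next
      fix x assume "x \<in> carrier S"
      then show "\<one>\<^bsub>S\<^esub> \<otimes>\<^bsub>S\<^esub> x = x" by (intro inj) (use mult hc one in auto)
    qed (use mult one in auto)
    fix x y z assume "x \<in> carrier S" "y \<in> carrier S" "z \<in> carrier S"
    then show "(x \<oplus>\<^bsub>S\<^esub> y) \<otimes>\<^bsub>S\<^esub> z = x \<otimes>\<^bsub>S\<^esub> z \<oplus>\<^bsub>S\<^esub> y \<otimes>\<^bsub>S\<^esub> z"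
      by (intro inj) (use mult add hc in \<open>auto simp: R.l_distr\<close>)
  qed
  show "h \<in> ring_iso S R"
    unfolding ring_iso_def ring_hom_def using h hc mult add one by auto
qed

text \<open>Cosets are multiplied by a union over all pairs of representatives, which collapses when
  the product respects fibres in both arguments.\<close>

lemma (in quotient_kernel) mult_quotient:
  assumes c: "c \<in> carrier F" and d: "d \<in> carrier F"
    and m: "\<And>c' d'. c' \<in> carrier F \<Longrightarrow> d' \<in> carrier F \<Longrightarrow> \<Phi> c' = \<Phi> c \<Longrightarrow> \<Phi> d' = \<Phi> d \<Longrightarrow>
      c' \<otimes>\<^bsub>F\<^esub> d' \<in> carrier F \<and> \<Phi> (c' \<otimes>\<^bsub>F\<^esub> d') = \<Phi> (c \<otimes>\<^bsub>F\<^esub> d)"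
  shows "cos c \<otimes>\<^bsub>quotient_module F ker\<^esub> cos d = cos (c \<otimes>\<^bsub>F\<^esub> d)"
proof -
  have "ker +>\<^bsub>F\<^esub> (c' \<otimes>\<^bsub>F\<^esub> d') = cos (c \<otimes>\<^bsub>F\<^esub> d)" if "c' \<in> cos c" "d' \<in> cos d" for c' d'
  proof -
    have 1: "c' \<otimes>\<^bsub>F\<^esub> d' \<in> carrier F \<and> \<Phi> (c' \<otimes>\<^bsub>F\<^esub> d') = \<Phi> (c \<otimes>\<^bsub>F\<^esub> d)"
      by (rule m) (use that in \<open>auto simp: cos_def\<close>)
    then have "ker +>\<^bsub>F\<^esub> (c' \<otimes>\<^bsub>F\<^esub> d') = cos (c' \<otimes>\<^bsub>F\<^esub> d')" by (intro coset_eq) blast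
    also have "\<dots> = cos (c \<otimes>\<^bsub>F\<^esub> d)" using 1 by (simp add: cos_def)
    finally show ?thesis .
  qed
  then have "(\<Union>c'\<in>cos c. \<Union>d'\<in>cos d. ker +>\<^bsub>F\<^esub> (c' \<otimes>\<^bsub>F\<^esub> d')) = cos (c \<otimes>\<^bsub>F\<^esub> d)"
    using self_in_cos[OF c] self_in_cos[OF d] by auto
  then show ?thesis
    by (simp add: quotient_module_def ring.extend_def module.fields_def FactRing_def rcoset_mult_def)
qed

lemma (in quotient_kernel) one_quotient:
  "\<one>\<^bsub>F\<^esub> \<in> carrier F \<Longrightarrow> \<one>\<^bsub>quotient_module F ker\<^esub> = cos \<one>\<^bsub>F\<^esub>"
  using coset_eq by (simp add: quotient_module_def ring.extend_def module.fields_def FactRing_def)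

lemma rmult_sum: "rmult (\<Sum>x\<in>A. f x) d = (\<Sum>x\<in>A. rmult (f x) d)" "rmult d (\<Sum>x\<in>A. f x) = (\<Sum>x\<in>A. rmult d (f x))"
  by (induction A rule: infinite_finite_induct) (simp_all add: rmult_add_left rmult_add_right)

lemma (in Modules.module) pext_sum: "pext scale g (\<Sum>x\<in>A. f x) = (\<Sum>x\<in>A. pext scale g (f x))"
  by (induction A rule: infinite_finite_induct) (simp_all add: pext_add)

text \<open>Distinct basis elements go to distinct basis elements, so every coefficient of
  \<open>d\<close> reappears as a coefficient of its image.\<close>

lemma pext_frag_of_inj:
  assumes g: "inj_on g A" "\<And>x. x \<in> A \<Longrightarrow> \<exists>y. g x = frag_of y" and d: "Poly_Mapping.keys d \<subseteq> A" "pext pscale g d = 0"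
  shows "d = 0"
proof (rule poly_mapping_eqI)
  fix x
  obtain y where y: "\<And>x. x \<in> A \<Longrightarrow> g x = frag_of (y x)" using g(2) by metis
  show "Poly_Mapping.lookup d x = Poly_Mapping.lookup 0 x"
  proof (cases "x \<in> Poly_Mapping.keys d")
    case True
    have "Poly_Mapping.lookup (pext pscale g d) (y x) = (\<Sum>z\<in>Poly_Mapping.keys d. if z = x then Poly_Mapping.lookup d z else 0)"
      unfolding pext_def lookup_sum
    proof (rule sum.cong[OF refl])
      fix z assume "z \<in> Poly_Mapping.keys d"
      then have z: "z \<in> A" and x: "x \<in> A" using d True by auto
      have "y z = y x \<longleftrightarrow> z = x" using y[OF z] y[OF x] g(1) z x by (metis inj_onD)
      then show "Poly_Mapping.lookup (pscale (Poly_Mapping.lookup d z) (g z)) (y x) = (if z = x then Poly_Mapping.lookup d z else 0)"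
        unfolding y[OF z] by (simp add: lookup_single when_def)
    qed
    also have "\<dots> = Poly_Mapping.lookup d x" using True by simp
    finally show ?thesis using d by simp
  qed (simp add: in_keys_iff)
qed

lemma supp_Un:
  assumes "c \<in> supp (K \<union> L)"
  obtains a b where "a \<in> supp K" "b \<in> supp L" "c = a + b"
  using assms that unfolding span_frag_of[symmetric] image_Un ps.span_Un by blast

lemma unipotent_module: "is_module (unipotent_ring k)"
proof -
  interpret rec_iso pscale "unipotent_ring k" "supp unip_classes" "\<lambda>c. c"
    by unfold_locales (auto simp: carrier_unipotent subring_ops keys_subspace bij_betw_def
      dest: Poly_Mapping.keys_add[THEN subsetD] keys_pscale[THEN subsetD])
  show ?thesis by (rule is_module)
qed

lemma semisimple_module: "is_module (semisimple_ring k)"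
proof -
  interpret rec_iso pscale "semisimple_ring k" "supp simple_classes" "\<lambda>c. c"
    by unfold_locales (auto simp: carrier_semisimple subring_ops keys_subspace bij_betw_def
      dest: Poly_Mapping.keys_add[THEN subsetD] keys_pscale[THEN subsetD])
  show ?thesis by (rule is_module)
qed

text \<open>Expresses that sending a pair to its product is multiplicative on pairs, which uses
  commutativity.\<close>

lemma rmult_medial:
  fixes a b c d :: "'k::field kx_class \<Rightarrow>\<^sub>0 int"
  assumes "a \<in> supp indecomposable_classes" "b \<in> supp indecomposable_classes"
    "c \<in> supp indecomposable_classes" "d \<in> supp indecomposable_classes"
  shows "rmult (rmult a c) (rmult b d) = rmult (rmult a b) (rmult c d)"
proof -
  interpret cring "rep_ring TYPE('k)" by (rule rep_ring_cring)
  have "a \<in> carrier (rep_ring TYPE('k))" "b \<in> carrier (rep_ring TYPE('k))"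
    "c \<in> carrier (rep_ring TYPE('k))" "d \<in> carrier (rep_ring TYPE('k))" using assms by (simp_all add: rep_ring_simps)
  then have "(a \<otimes>\<^bsub>rep_ring TYPE('k)\<^esub> c) \<otimes>\<^bsub>rep_ring TYPE('k)\<^esub> (b \<otimes>\<^bsub>rep_ring TYPE('k)\<^esub> d)
      = (a \<otimes>\<^bsub>rep_ring TYPE('k)\<^esub> b) \<otimes>\<^bsub>rep_ring TYPE('k)\<^esub> (c \<otimes>\<^bsub>rep_ring TYPE('k)\<^esub> d)"
    by (simp add: m_ac)
  then show ?thesis by (simp add: rep_ring_simps)
qed

section \<open>The isomorphism over a perfect field\<close>

locale perfect_comparison =
  fixes k :: "'k::field itself"
  assumes perf: "perfect_field TYPE('k)"
begin

abbreviation "F \<equiv> free_on_product (unipotent_ring k) (semisimple_ring k)"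

abbreviation \<Phi> :: "((('k kx_class \<Rightarrow>\<^sub>0 int) \<times> ('k kx_class \<Rightarrow>\<^sub>0 int)) \<Rightarrow>\<^sub>0 int) \<Rightarrow> 'k kx_class \<Rightarrow>\<^sub>0 int" where
  "\<Phi> \<equiv> pext pscale (\<lambda>(a, b). rmult a b)"

sublocale P: module_pair_record "unipotent_ring k" "semisimple_ring k"
  by (rule module_pair_record.intro[OF unipotent_module semisimple_module])

lemma carrier_F: "carrier F = {c. Poly_Mapping.keys c \<subseteq> supp unip_classes \<times> supp simple_classes}"
  by (simp add: free_on_product_simps carrier_unipotent carrier_semisimple)

lemma keys_F: "c \<in> carrier F \<Longrightarrow> p \<in> Poly_Mapping.keys c \<Longrightarrow> fst p \<in> supp unip_classes \<and> snd p \<in> supp simple_classes"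
  unfolding carrier_F mem_Times_iff[symmetric] by blast

lemma F_subspace: "ps.subspace (carrier F)"
  unfolding carrier_F by (rule keys_subspace)

sublocale Q: quotient_kernel F \<Phi>
  by unfold_locales (simp_all add: free_on_product_simps(3) ps.pext_add
    ps.subspace_0[OF F_subspace] ps.subspace_add[OF F_subspace] ps.subspace_neg[OF F_subspace])

lemma unip_simple_frag:
  fixes p :: "('k kx_class \<Rightarrow>\<^sub>0 int) \<times> ('k kx_class \<Rightarrow>\<^sub>0 int)"
  assumes "p \<in> frag_of ` unip_classes \<times> frag_of ` simple_classes"
  obtains f s where "irreducible f" "lead_coeff f = 1" "poly f 0 \<noteq> 0" "s \<ge> 1"
    "p = (frag_of (primary_class [:-1, 1:] s), frag_of (primary_class f 1))"
    "(\<lambda>(a, b). rmult a b) p = frag_of (primary_class f s)"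
proof -
  obtain f s where "irreducible f" "lead_coeff f = 1" "poly f 0 \<noteq> 0" "s \<ge> 1"
    "p = (frag_of (primary_class [:-1, 1:] s), frag_of (primary_class f 1))"
    using assms by (auto simp: unip_classes_def simple_classes_def)
  with unip_times_simple[OF perf this(1-4)] that show ?thesis by auto
qed

lemma rmult_inv:
  fixes a b :: "'k kx_class \<Rightarrow>\<^sub>0 int"
  assumes "a \<in> supp unip_classes" "b \<in> supp simple_classes"
  shows "rmult a b \<in> supp inv_classes"
proof (rule rmult_supp[OF _ assms])
  fix C D :: "'k kx_class" assume "C \<in> unip_classes" "D \<in> simple_classes"
  then have "(frag_of C, frag_of D) \<in> frag_of ` unip_classes \<times> frag_of ` simple_classes" by auto
  then show "rmult (frag_of C) (frag_of D) \<in> supp inv_classes"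
    by (rule unip_simple_frag) (auto simp: inv_classes_def)
qed

text \<open>Modulo the bilinear relations a formal sum reduces to pairs of basis elements, and their
  products are the classes of \<open>k[x]/f^s\<close>, pairwise distinct. Hence nothing beyond the
  relations is killed.\<close>

lemma tensor_kernel_eq: "tensor_kernel (unipotent_ring k) (semisimple_ring k) = Q.ker"
proof (rule equalityI)
  have sub: "ps.subspace {c. \<Phi> c = 0}"
    by (rule ps.subspaceI) (simp_all add: ps.pext_add ps.pext_pscale)
  have "P.N \<subseteq> {c. \<Phi> c = 0}"
    by (rule P.N_least[OF sub])
      (simp_all add: ps.pext_diff subring_ops rmult_add_left rmult_add_right rmult_cmul[unfolded frag_cmul_pscale])
  then show 1: "P.N \<subseteq> Q.ker" using P.N_subset by (auto simp: Q.ker_def)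
  show "Q.ker \<subseteq> P.N"
  proof
    fix c assume "c \<in> Q.ker"
    then have c: "c \<in> carrier F" "\<Phi> c = 0" by (auto simp: Q.ker_def)
    obtain d where d: "Poly_Mapping.keys d \<subseteq> frag_of ` unip_classes \<times> frag_of ` simple_classes" "c - d \<in> P.N"
    proof (rule P.tensor_spanned[OF _ _ _ c(1)])
      have gen: "supp A \<subseteq> K" if K: "frag_of ` A \<subseteq> K" "0 \<in> K" "\<And>x y. x \<in> supp A \<inter> K \<Longrightarrow> y \<in> supp A \<inter> K \<Longrightarrow> x + y \<in> K"
          "\<And>r x. x \<in> supp A \<inter> K \<Longrightarrow> pscale r x \<in> K" for A and K :: "('k kx_class \<Rightarrow>\<^sub>0 int) set"
      proof -
        have S: "ps.subspace (supp A \<inter> K)"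
        proof (rule ps.subspaceI)
          show "0 \<in> supp A \<inter> K" using K(2) by auto
          show "x + y \<in> supp A \<inter> K" if "x \<in> supp A \<inter> K" "y \<in> supp A \<inter> K" for x y
            using K(3)[OF that] that ps.subspace_add[OF keys_subspace] by blast
          show "pscale r x \<in> supp A \<inter> K" if "x \<in> supp A \<inter> K" for r x
            using K(4)[OF that] that ps.subspace_scale[OF keys_subspace] by blast
        qed
        show ?thesis using subspace_singles[OF S, of A] K(1) by auto
      qed
      show "carrier (unipotent_ring k) \<subseteq> K" if "frag_of ` unip_classes \<subseteq> K" "\<zero>\<^bsub>unipotent_ring k\<^esub> \<in> K"
        "\<And>x y. x \<in> carrier (unipotent_ring k) \<inter> K \<Longrightarrow> y \<in> carrier (unipotent_ring k) \<inter> K \<Longrightarrow> x \<oplus>\<^bsub>unipotent_ring k\<^esub> y \<in> K"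
        "\<And>r x. x \<in> carrier (unipotent_ring k) \<inter> K \<Longrightarrow> r \<odot>\<^bsub>unipotent_ring k\<^esub> x \<in> K" for K
        using gen[of unip_classes K] that unfolding carrier_unipotent subring_ops by blast
      show "carrier (semisimple_ring k) \<subseteq> K" if "frag_of ` simple_classes \<subseteq> K" "\<zero>\<^bsub>semisimple_ring k\<^esub> \<in> K"
        "\<And>x y. x \<in> carrier (semisimple_ring k) \<inter> K \<Longrightarrow> y \<in> carrier (semisimple_ring k) \<inter> K \<Longrightarrow> x \<oplus>\<^bsub>semisimple_ring k\<^esub> y \<in> K"
        "\<And>r x. x \<in> carrier (semisimple_ring k) \<inter> K \<Longrightarrow> r \<odot>\<^bsub>semisimple_ring k\<^esub> x \<in> K" for K
        using gen[of simple_classes K] that unfolding carrier_semisimple subring_ops by blast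
    qed (auto simp: carrier_unipotent)
    have "\<Phi> (c - d) = 0" using d(2) 1 by (auto simp: Q.ker_def)
    then have "\<Phi> d = 0" using c(2) by (simp add: ps.pext_diff)
    have "d = 0"
    proof (rule pext_frag_of_inj[OF _ _ d(1) \<open>\<Phi> d = 0\<close>])
      show "inj_on (\<lambda>(a, b). rmult a b) (frag_of ` unip_classes \<times> frag_of ` simple_classes :: (('k kx_class \<Rightarrow>\<^sub>0 int) \<times> _) set)"
      proof (rule inj_onI)
        fix p q :: "('k kx_class \<Rightarrow>\<^sub>0 int) \<times> ('k kx_class \<Rightarrow>\<^sub>0 int)"
        assume p: "p \<in> frag_of ` unip_classes \<times> frag_of ` simple_classes" and q: "q \<in> frag_of ` unip_classes \<times> frag_of ` simple_classes"
          and eq: "(\<lambda>(a, b). rmult a b) p = (\<lambda>(a, b). rmult a b) q"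
        obtain f s where f: "irreducible f" "lead_coeff f = 1" "poly f 0 \<noteq> 0" "s \<ge> 1"
          "p = (frag_of (primary_class [:-1, 1:] s), frag_of (primary_class f 1))"
          "(\<lambda>(a, b). rmult a b) p = frag_of (primary_class f s)" using unip_simple_frag[OF p] .
        obtain g t where g: "irreducible g" "lead_coeff g = 1" "poly g 0 \<noteq> 0" "t \<ge> 1"
          "q = (frag_of (primary_class [:-1, 1:] t), frag_of (primary_class g 1))"
          "(\<lambda>(a, b). rmult a b) q = frag_of (primary_class g t)" using unip_simple_frag[OF q] .
        have "frag_of (primary_class f s) = frag_of (primary_class g t)" using eq f(6) g(6) by simp
        then have "primary_class f s = primary_class g t" by (metis lookup_frag_of zero_neq_one)
        then have "f = g \<and> s = t" using primary_class_inj f(1,2,4) g(1,2,4) by blast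
        then show "p = q" using f(5) g(5) by simp
      qed
      show "\<exists>y. (\<lambda>(a, b). rmult a b) p = frag_of y" if "p \<in> frag_of ` unip_classes \<times> frag_of ` simple_classes"
        for p :: "('k kx_class \<Rightarrow>\<^sub>0 int) \<times> ('k kx_class \<Rightarrow>\<^sub>0 int)"
        using unip_simple_frag[OF that] by metis
    qed
    then show "c \<in> P.N" using d(2) by simp
  qed
qed

lemma unip_ss_tensor_eq: "unip_ss_tensor k = quotient_module F Q.ker"
  by (simp add: tensor_product_def tensor_kernel_eq)

lemma \<Phi>_in_supp:
  assumes "c \<in> carrier F"
  shows "\<Phi> c \<in> supp inv_classes"
  unfolding pext_def
proof (rule ps.subspace_sum[OF keys_subspace])
  fix p assume "p \<in> Poly_Mapping.keys c"
  then have "p \<in> supp unip_classes \<times> supp simple_classes" using assms unfolding carrier_F by blast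
  then have "(\<lambda>(a, b). rmult a b) p \<in> supp inv_classes" using rmult_inv by auto
  then show "pscale (Poly_Mapping.lookup c p) ((\<lambda>(a, b). rmult a b) p) \<in> supp inv_classes"
    by (rule ps.subspace_scale[OF keys_subspace])
qed

lemma single_in_F: "a \<in> supp unip_classes \<Longrightarrow> b \<in> supp simple_classes \<Longrightarrow> Poly_Mapping.single (a, b) n \<in> carrier F"
  unfolding carrier_F by simp

lemma \<Phi>_surj: "supp inv_classes \<subseteq> \<Phi> ` carrier F"
proof
  fix c :: "'k kx_class \<Rightarrow>\<^sub>0 int" assume c: "c \<in> supp inv_classes"
  show "c \<in> \<Phi> ` carrier F"
  proof (rule subspace_singles[of _ inv_classes])
    show "ps.subspace (\<Phi> ` carrier F)"
    proof (rule ps.subspaceI)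
      show "0 \<in> \<Phi> ` carrier F" by (rule image_eqI[of _ _ 0]) (simp_all add: Q.F_zero)
      show "x + y \<in> \<Phi> ` carrier F" if "x \<in> \<Phi> ` carrier F" "y \<in> \<Phi> ` carrier F" for x y
      proof -
        obtain c d where "c \<in> carrier F" "d \<in> carrier F" "x = \<Phi> c" "y = \<Phi> d" using \<open>x \<in> _\<close> \<open>y \<in> _\<close> by blast
        then show ?thesis by (intro image_eqI[of _ _ "c + d"] Q.F_closed) (simp_all add: ps.pext_add)
      qed
      show "pscale r x \<in> \<Phi> ` carrier F" if "x \<in> \<Phi> ` carrier F" for r x
      proof -
        obtain c where "c \<in> carrier F" "x = \<Phi> c" using \<open>x \<in> _\<close> by blast
        then show ?thesis by (intro image_eqI[of _ _ "pscale r c"] ps.subspace_scale[OF F_subspace]) (simp_all add: ps.pext_pscale)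
      qed
    qed
    fix C :: "'k kx_class" assume "C \<in> inv_classes"
    then obtain f s where f: "irreducible f" "lead_coeff f = 1" "poly f 0 \<noteq> 0" "s \<ge> 1" "C = primary_class f s"
      by (auto simp: inv_classes_def)
    \<comment> \<open>The class of \<open>k[x]/f^s\<close> is the product of the classes of
      \<open>k[x]/(x-1)^s\<close> and \<open>k[x]/f\<close>.\<close>
    let ?c = "Poly_Mapping.single (frag_of (primary_class [:-1, 1:] s), frag_of (primary_class f 1)) (1 :: int)"
    have "?c \<in> carrier F" by (rule single_in_F) (use f in \<open>auto simp: unip_classes_def simple_classes_def\<close>)
    moreover have "\<Phi> ?c = frag_of C" using unip_times_simple[OF perf f(1-4)] f(5) by simp
    ultimately show "frag_of C \<in> \<Phi> ` carrier F" by (metis imageI)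
  qed (use c in simp)
qed

lemma supp_indecomposable: "supp unip_classes \<subseteq> supp indecomposable_classes" "supp simple_classes \<subseteq> supp indecomposable_classes"
  using unip_subset simple_subset inv_subset by blast+

lemma mult_F:
  assumes c: "c \<in> carrier F" and d: "d \<in> carrier F"
  shows "c \<otimes>\<^bsub>F\<^esub> d \<in> carrier F" "\<Phi> (c \<otimes>\<^bsub>F\<^esub> d) = rmult (\<Phi> c) (\<Phi> d)"
proof -
  let ?t = "\<lambda>p q. Poly_Mapping.single (rmult (fst p) (fst q), rmult (snd p) (snd q)) (Poly_Mapping.lookup c p * Poly_Mapping.lookup d q)"
  have m: "c \<otimes>\<^bsub>F\<^esub> d = (\<Sum>p\<in>Poly_Mapping.keys c. \<Sum>q\<in>Poly_Mapping.keys d. ?t p q)"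
    by (simp add: free_on_product_def subring_ops)
  have kc: "fst p \<in> supp unip_classes" "snd p \<in> supp simple_classes" if "p \<in> Poly_Mapping.keys c" for p
    using keys_F[OF c that] by (rule conjunct1, rule conjunct2)
  have kd: "fst p \<in> supp unip_classes" "snd p \<in> supp simple_classes" if "p \<in> Poly_Mapping.keys d" for p
    using keys_F[OF d that] by (rule conjunct1, rule conjunct2)
  show "c \<otimes>\<^bsub>F\<^esub> d \<in> carrier F" unfolding m
    by (intro ps.subspace_sum[OF F_subspace] single_in_F rmult_unip rmult_simple[OF perf] kc kd)
  have "\<Phi> (c \<otimes>\<^bsub>F\<^esub> d) = (\<Sum>p\<in>Poly_Mapping.keys c. \<Sum>q\<in>Poly_Mapping.keys d.
      rmult (pscale (Poly_Mapping.lookup c p) (rmult (fst p) (snd p))) (pscale (Poly_Mapping.lookup d q) (rmult (fst q) (snd q))))"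
    unfolding m ps.pext_sum
  proof (intro sum.cong refl)
    fix p q assume p: "p \<in> Poly_Mapping.keys c" and q: "q \<in> Poly_Mapping.keys d"
    have "rmult (rmult (fst p) (fst q)) (rmult (snd p) (snd q)) = rmult (rmult (fst p) (snd p)) (rmult (fst q) (snd q))"
      by (rule rmult_medial) (use kc[OF p] kd[OF q] supp_indecomposable in blast)+
    then show "\<Phi> (?t p q) = rmult (pscale (Poly_Mapping.lookup c p) (rmult (fst p) (snd p))) (pscale (Poly_Mapping.lookup d q) (rmult (fst q) (snd q)))"
      by (simp add: rmult_cmul[unfolded frag_cmul_pscale] mult.commute)
  qed
  also have "\<dots> = rmult (\<Phi> c) (\<Phi> d)"
    by (simp add: pext_def rmult_sum case_prod_beta) (rule sum.swap)
  finally show "\<Phi> (c \<otimes>\<^bsub>F\<^esub> d) = rmult (\<Phi> c) (\<Phi> d)" .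
qed

text \<open>The class of \<open>k[x]/(x-1)\<close> lies in both subrings: it is unipotent, and x - 1
  is irreducible with nonzero value at 0.\<close>

lemma one_F: "\<one>\<^bsub>F\<^esub> \<in> carrier F" "\<Phi> \<one>\<^bsub>F\<^esub> = \<one>\<^bsub>rep_ring k\<^esub>"
proof -
  let ?l = "[:-1, 1 :: 'k:]"
  have l: "cyclic_class ?l = frag_of (primary_class ?l 1)" using cyclic_class_primary[OF linear_poly_irreducible, of "-1" 1] by simp
  have c: "primary_class ?l 1 \<in> unip_classes" "primary_class ?l 1 \<in> simple_classes"
    using linear_poly_irreducible[of "-1 :: 'k"] by (auto simp: unip_classes_def simple_classes_def)
  have one: "\<one>\<^bsub>F\<^esub> = Poly_Mapping.single (cyclic_class ?l, cyclic_class ?l) 1" by (simp add: free_on_product_def subring_ops)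
  show "\<one>\<^bsub>F\<^esub> \<in> carrier F" unfolding one l by (rule single_in_F) (use c in auto)
  have "Poly_Mapping.keys (cyclic_class ?l) \<subseteq> indecomposable_classes" unfolding l using c supp_indecomposable unip_subset inv_subset by auto
  then have "rmult (cyclic_class ?l) (cyclic_class ?l) = cyclic_class ?l" using rmult_one unfolding cyclic_class_def by blast
  then show "\<Phi> \<one>\<^bsub>F\<^esub> = \<one>\<^bsub>rep_ring k\<^esub>" unfolding one by (simp add: rep_ring_simps cyclic_class_def)
qed

lemma phi_cos: "c \<in> carrier F \<Longrightarrow> phi k (Q.cos c, w) = \<Phi> c + w"
proof -
  assume c: "c \<in> carrier F"
  have "frag_extend (\<lambda>(a, b). a \<otimes>\<^bsub>rep_ring k\<^esub> b) = \<Phi>"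
    by (rule ext) (simp add: frag_extend_def pext_def rep_ring_simps frag_cmul_pscale)
  then show ?thesis using Q.cos_image[OF c, of \<Phi>] by (simp add: phi_def)
qed

text \<open>The product of dimensions is the dimension of the product, so the value factors through
  \<open>\<Phi>\<close> and is constant on the coset.\<close>

lemma tensor_dim_cos:
  assumes c: "c \<in> carrier F"
  shows "tensor_dim (Q.cos c) = rep_dim (\<Phi> c)"
proof -
  have e: "(\<Sum>p\<in>Poly_Mapping.keys d. Poly_Mapping.lookup d p * (rep_dim (fst p) * rep_dim (snd p))) = rep_dim (\<Phi> d)"
    if d: "d \<in> carrier F" for d
  proof -
    have s: "rep_dim (\<Sum>x\<in>A. f x) = (\<Sum>x\<in>A. rep_dim (f x))" for A and f :: "_ \<Rightarrow> 'k kx_class \<Rightarrow>\<^sub>0 int"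
      by (induction A rule: infinite_finite_induct) (simp_all add: rep_dim_linear)
    show ?thesis unfolding pext_def s
    proof (rule sum.cong[OF refl])
      fix p assume "p \<in> Poly_Mapping.keys d"
      then have "fst p \<in> supp unip_classes" "snd p \<in> supp simple_classes" using keys_F[OF d] by (blast, blast)
      then show "Poly_Mapping.lookup d p * (rep_dim (fst p) * rep_dim (snd p)) = rep_dim (pscale (Poly_Mapping.lookup d p) ((\<lambda>(a, b). rmult a b) p))"
        by (simp add: frag_cmul_pscale[symmetric] rep_dim_linear rep_dim_rmult[OF perf] case_prod_beta)
    qed
  qed
  show ?thesis unfolding tensor_dim_def e[OF c, symmetric]
    by (rule Q.cos_image[OF c]) (simp only: e c)
qed

text \<open>Additively, \<open>\<Phi>\<close> identifies the tensor part with the sums over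
  \<open>inv_classes\<close>, and R is the direct sum of these and the sums over
  \<open>nil_classes\<close>. Multiplicativity on mixed products is
  \<open>rmult_nil_inv\<close>.\<close>

lemma phi_ring_iso: "cring (split_ring k)" "phi k \<in> ring_iso (split_ring k) (rep_ring k)"
proof -
  let ?S = "split_ring k" and ?R = "rep_ring k"
  have carrier_S: "carrier ?S = Q.cos ` carrier F \<times> supp nil_classes"
    by (simp add: split_ring_def unip_ss_tensor_eq Q.carrier_quotient nilpotent_ideal_eq)
  have inv_ind: "supp inv_classes \<subseteq> supp indecomposable_classes" and nil_ind: "supp nil_classes \<subseteq> supp indecomposable_classes"
    using inv_subset nil_subset by blast+
  have bij: "bij_betw (phi k) (carrier ?S) (carrier ?R)"
  proof (rule bij_betw_imageI)
    show "inj_on (phi k) (carrier ?S)"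
    proof (rule inj_onI)
      fix x y assume "x \<in> carrier ?S" "y \<in> carrier ?S" and eq: "phi k x = phi k y"
      then obtain c w d v where x: "c \<in> carrier F" "w \<in> supp nil_classes" "x = (Q.cos c, w)"
        and y: "d \<in> carrier F" "v \<in> supp nil_classes" "y = (Q.cos d, v)" unfolding carrier_S by blast
      have "\<Phi> c - \<Phi> d = v - w" using eq by (simp add: x y phi_cos algebra_simps)
      moreover have "\<Phi> c - \<Phi> d \<in> supp inv_classes" by (rule keys_diff_subset[OF \<Phi>_in_supp[OF x(1)] \<Phi>_in_supp[OF y(1)]])
      moreover have "v - w \<in> supp nil_classes" by (rule keys_diff_subset[OF y(2) x(2)])
      \<comment> \<open>The difference is supported on both families of basis classes, which are
        disjoint, so the two components agree separately.\<close>
      ultimately have "Poly_Mapping.keys (v - w) \<subseteq> inv_classes \<inter> nil_classes" by auto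
      then have "v - w = 0" unfolding inv_nil_disjoint by simp
      with \<open>\<Phi> c - \<Phi> d = v - w\<close> have "\<Phi> c = \<Phi> d" "v = w" by simp_all
      then show "x = y" using x y Q.cos_eq_iff by simp
    qed
    show "phi k ` carrier ?S = carrier ?R"
    proof (intro equalityI subsetI)
      fix r assume "r \<in> phi k ` carrier ?S"
      then obtain c w where c: "c \<in> carrier F" "w \<in> supp nil_classes" "r = phi k (Q.cos c, w)" unfolding carrier_S by blast
      have "r \<in> supp indecomposable_classes" unfolding c(3) phi_cos[OF c(1)]
        by (rule keys_add_subset[OF subsetD[OF inv_ind \<Phi>_in_supp[OF c(1)]] subsetD[OF nil_ind c(2)]])
      then show "r \<in> carrier ?R" by (simp add: rep_ring_simps)
    next
      fix r assume "r \<in> carrier ?R"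
      then have "r \<in> supp (inv_classes \<union> nil_classes)" by (simp add: rep_ring_simps indecomposable_classes_eq)
      then obtain a w where r: "a \<in> supp inv_classes" "w \<in> supp nil_classes" "r = a + w" by (rule supp_Un)
      then obtain c where c: "c \<in> carrier F" "a = \<Phi> c" using \<Phi>_surj by blast
      have "r = phi k (Q.cos c, w)" using phi_cos[OF c(1)] r(3) c(2) by simp
      then show "r \<in> phi k ` carrier ?S" unfolding carrier_S using c(1) r(2) by blast
    qed
  qed
  have mult: "x \<otimes>\<^bsub>?S\<^esub> y \<in> carrier ?S \<and> phi k (x \<otimes>\<^bsub>?S\<^esub> y) = phi k x \<otimes>\<^bsub>?R\<^esub> phi k y"
    and add: "x \<oplus>\<^bsub>?S\<^esub> y \<in> carrier ?S \<and> phi k (x \<oplus>\<^bsub>?S\<^esub> y) = phi k x \<oplus>\<^bsub>?R\<^esub> phi k y"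
    if xS: "x \<in> carrier ?S" and yS: "y \<in> carrier ?S" for x y
  proof -
    obtain c w where x: "c \<in> carrier F" "w \<in> supp nil_classes" "x = (Q.cos c, w)" using xS unfolding carrier_S by blast
    obtain d v where y: "d \<in> carrier F" "v \<in> supp nil_classes" "y = (Q.cos d, v)" using yS unfolding carrier_S by blast
    have q: "Q.cos c \<otimes>\<^bsub>unip_ss_tensor k\<^esub> Q.cos d = Q.cos (c \<otimes>\<^bsub>F\<^esub> d)"
      unfolding unip_ss_tensor_eq by (rule Q.mult_quotient[OF x(1) y(1)]) (simp add: mult_F x(1) y(1))
    \<comment> \<open>The ideal component of the product, with \<open>tensor_dim\<close> already
      expressed by the dimension of the image in R.\<close>
    let ?w = "frag_cmul (rep_dim (\<Phi> c)) v + frag_cmul (rep_dim (\<Phi> d)) w + rmult w v"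
    have xy: "x \<otimes>\<^bsub>?S\<^esub> y = (Q.cos (c \<otimes>\<^bsub>F\<^esub> d), ?w)"
      unfolding x(3) y(3) by (simp add: split_ring_def q tensor_dim_cos x(1) y(1) rep_ring_simps)
    have "?w \<in> supp nil_classes" by (intro keys_add_subset keys_cmul_subset rmult_nil x(2) y(2))
    then have 1: "x \<otimes>\<^bsub>?S\<^esub> y \<in> carrier ?S" unfolding xy carrier_S using mult_F(1)[OF x(1) y(1)] by blast
    have w: "rmult w (\<Phi> d) = frag_cmul (rep_dim (\<Phi> d)) w" by (rule rmult_nil_inv[OF x(2) \<Phi>_in_supp[OF y(1)]])
    have "rmult (\<Phi> c) v = rmult v (\<Phi> c)"
      by (rule rmult_commute) (use subsetD[OF inv_ind \<Phi>_in_supp[OF x(1)]] subsetD[OF nil_ind y(2)] in simp_all)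
    also have "\<dots> = frag_cmul (rep_dim (\<Phi> c)) v" by (rule rmult_nil_inv[OF y(2) \<Phi>_in_supp[OF x(1)]])
    finally have v: "rmult (\<Phi> c) v = frag_cmul (rep_dim (\<Phi> c)) v" .
    have 2: "phi k (x \<otimes>\<^bsub>?S\<^esub> y) = phi k x \<otimes>\<^bsub>?R\<^esub> phi k y"
      unfolding xy phi_cos[OF mult_F(1)[OF x(1) y(1)]] mult_F(2)[OF x(1) y(1)]
      by (simp add: x(3) y(3) phi_cos[OF x(1)] phi_cos[OF y(1)] rep_ring_simps rmult_add_left rmult_add_right v w)
    show "x \<otimes>\<^bsub>?S\<^esub> y \<in> carrier ?S \<and> phi k (x \<otimes>\<^bsub>?S\<^esub> y) = phi k x \<otimes>\<^bsub>?R\<^esub> phi k y" using 1 2 by blast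
    have a: "x \<oplus>\<^bsub>?S\<^esub> y = (Q.cos (c + d), w + v)"
      unfolding x(3) y(3) using Q.add_quotient[OF x(1) y(1)] by (simp add: split_ring_def unip_ss_tensor_eq)
    have cd: "c + d \<in> carrier F" by (rule Q.F_closed[OF x(1) y(1)])
    have "w + v \<in> supp nil_classes" by (rule keys_add_subset[OF x(2) y(2)])
    then have "x \<oplus>\<^bsub>?S\<^esub> y \<in> carrier ?S" unfolding a carrier_S using cd by blast
    moreover have "phi k (x \<oplus>\<^bsub>?S\<^esub> y) = phi k x \<oplus>\<^bsub>?R\<^esub> phi k y"
      unfolding a phi_cos[OF cd]
      by (simp add: x(3) y(3) phi_cos[OF x(1)] phi_cos[OF y(1)] rep_ring_simps ps.pext_add)
    ultimately show "x \<oplus>\<^bsub>?S\<^esub> y \<in> carrier ?S \<and> phi k (x \<oplus>\<^bsub>?S\<^esub> y) = phi k x \<oplus>\<^bsub>?R\<^esub> phi k y" by blast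
  qed
  have one: "\<one>\<^bsub>?S\<^esub> = (Q.cos \<one>\<^bsub>F\<^esub>, 0)" by (simp add: split_ring_def unip_ss_tensor_eq Q.one_quotient one_F(1))
  have zero: "\<zero>\<^bsub>?S\<^esub> = (Q.cos 0, 0)" by (simp add: split_ring_def unip_ss_tensor_eq Q.zero_quotient)
  have 1: "\<one>\<^bsub>?S\<^esub> \<in> carrier ?S" "phi k \<one>\<^bsub>?S\<^esub> = \<one>\<^bsub>?R\<^esub>"
    unfolding one phi_cos[OF one_F(1)] carrier_S using one_F by auto
  have 0: "\<zero>\<^bsub>?S\<^esub> \<in> carrier ?S" "phi k \<zero>\<^bsub>?S\<^esub> = \<zero>\<^bsub>?R\<^esub>"
    unfolding zero phi_cos[OF Q.F_zero] carrier_S using Q.F_zero by (auto simp: rep_ring_simps)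
  show "cring ?S" by (rule cring_transport(1)[OF rep_ring_cring bij mult add 1 0])
  show "phi k \<in> ring_iso ?S ?R" by (rule cring_transport(2)[OF rep_ring_cring bij mult add 1 0])
qed

lemma phi_pure_tensor:
  assumes a: "a \<in> carrier (unipotent_ring k)" and b: "b \<in> carrier (semisimple_ring k)"
  shows "phi k (pure_tensor (unipotent_ring k) (semisimple_ring k) a b, w) = a \<otimes>\<^bsub>rep_ring k\<^esub> b \<oplus>\<^bsub>rep_ring k\<^esub> w"
proof -
  have c: "Poly_Mapping.single (a, b) 1 \<in> carrier F" using a b by (intro single_in_F) (simp_all only: carrier_unipotent carrier_semisimple)
  have "pure_tensor (unipotent_ring k) (semisimple_ring k) a b = Q.cos (Poly_Mapping.single (a, b) 1)"
    unfolding pure_tensor_def tensor_kernel_eq by (rule Q.coset_eq[OF c])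
  then show ?thesis by (simp add: phi_cos[OF c] rep_ring_simps)
qed

end

theorem theorem3:
  assumes "perfect_field TYPE('k::field)"
  shows "cring (split_ring TYPE('k)) \<and> cring (rep_ring TYPE('k)) \<and>
    (\<forall>a \<in> carrier (unipotent_ring TYPE('k)). \<forall>b \<in> carrier (semisimple_ring TYPE('k)).
       \<forall>w \<in> nilpotent_ideal TYPE('k).
         phi TYPE('k) (pure_tensor (unipotent_ring TYPE('k)) (semisimple_ring TYPE('k)) a b, w)
           = a \<otimes>\<^bsub>rep_ring TYPE('k)\<^esub> b \<oplus>\<^bsub>rep_ring TYPE('k)\<^esub> w) \<and>
    phi TYPE('k) \<in> ring_iso (split_ring TYPE('k)) (rep_ring TYPE('k))"
proof -
  interpret perfect_comparison "TYPE('k)" by standard (rule assms)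
  show ?thesis using phi_ring_iso rep_ring_cring phi_pure_tensor by blast
qed

end
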